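(* Let $M$ be an $\mathbb{N}$-valued random variable with $\mathbb{E}[M^p]<\infty$ for some $p>1$ and let $\delta>-\inf\operatorname{supp}(M)$. Then each of the preferential attachment models (A), (B) and (D) with out-degree law $M$ and parameter $\delta$ converges vertex-marked locally in probability, as $n\to\infty$, to the random Pólya point tree $\mathrm{RPPT}(M,\delta)$. Here vertex $v$ of the graph with $n$ vertices carries the mark $v/n$, and each node of $\mathrm{RPPT}(M,\delta)$ carries its age as mark.
   Context: **Preferential attachment models.** $\mathbb{N}=\{1,2,\dots\}$. Let $(m_i)_{i\ge3}$ be i.i.d. copies of $M$, $m_1=m_2=1$, $\boldsymbol m=(m_1,m_2,\dots)$, $m_{[l]}=\sum_{i\le l}m_i$, and let $\mathbb{P}_m$ denote conditional law given $\boldsymbol m$. Start with a fixed multigraph $G_0$ on $\{1,2\}$ with degrees $a_1,a_2$, where $a_i+\delta>0$, and let $a_{[2]}=a_1+a_2$. A self-loop contributes $2$ to the degree. Vertices $v=3,4,\dots$ arrive successively, vertex $v$ with $m_v$ edges, attached one at a time. $v\overset{j}{\rightsquigarrow}u$ means that the $j$-th edge of $v$ connects to $u$, and $d_u(v,j-1)$ is the degree of $u$ after the first $j-1$ edges of $v$ have been attached. Given $\boldsymbol m$ and the current graph, the conditional probability of $v\overset{j}{\rightsquigarrow}u$ is: - Model (A): $\frac{d_u(v,j-1)+\delta}{c_{v,j}}$ for $u<v$, and $\frac{d_v(v,j-1)+1+\frac{j}{m_v}\delta}{c_{v,j}}$ for $u=v$, with $c_{v,j}=a_{[2]}+2(m_{[v-1]}+j-2)-1+(v-1)\delta+\frac{j}{m_v}\delta$.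 - Model (B): $\frac{d_u(v,j-1)+\delta}{c_{v,j}}$ for $u<v$, and $\frac{d_v(v,j-1)+\frac{j-1}{m_v}\delta}{c_{v,j}}$ for $u=v$, with $c_{v,j}=a_{[2]}+2(m_{[v-1]}+j-3)+(v-1)\delta+\frac{j-1}{m_v}\delta$. - Model (D): $\frac{d_u(v,j-1)+\delta}{c_{v,j}}$ for $u<v$ (no self-loops), with $c_{v,j}=a_{[2]}+2(m_{[v-1]}-2)+(j-1)+(v-1)\delta$. $G_n$ denotes the graph once all edges of vertex $n$ have been attached. **Random Pólya point tree $\mathrm{RPPT}(M,\delta)$.** Put $\chi=\frac{\mathbb{E}[M]+\delta}{2\mathbb{E}[M]+\delta}$. Let $M^{(\delta)}$ have law $\mathbb{P}(M^{(\delta)}=k)=\frac{k+\delta}{\mathbb{E}[M]+\delta}\mathbb{P}(M=k)$, and let $M^{(0)}$ be the size-biased version of $M$. Every node $\omega$ has an age $A_\omega\in[0,1]$, a strength $\Gamma_\omega>0$ and a number $m_-(\omega)$; every non-root node also has a label O (older than its parent) or Y (younger than its parent). For the root $\varnothing$: $A_\varnothing$ is uniform on $[0,1]$, $m_-(\varnothing)\sim M$, and given $m_-(\varnothing)$, $\Gamma_\varnothing\sim\mathrm{Gamma}(m_-(\varnothing)+\delta,1)$. If $\omega$ has label O then $m_-(\omega)\sim M^{(\delta)}$; if it has label Y then $m_-(\omega)\sim M^{(0)}-1$; in both cases, given $m_-(\omega)$, $\Gamma_\omega\sim \mathrm{Gamma}(m_-(\omega)+1+\delta,1)$. Given $A_\omega=a$,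 $m_-(\omega)$ and $\Gamma_\omega$, node $\omega$ has $m_-(\omega)$ children labelled O with ages $U^{1/\chi}a$ ($U$ i.i.d. uniform on $[0,1]$), and children labelled Y whose ages are the points of a Poisson process on $[a,1]$ with intensity $(1-\chi)\Gamma_\omega x^{-\chi}/a^{1-\chi}$. All of these are conditionally independent between and within nodes. **Vertex-marked local convergence in probability.** For locally finite rooted graphs with $[0,1]$-valued vertex marks, let $B_r^{(G)}(o)$ be the subgraph induced by vertices at graph distance at most $r$ from $o$, rooted at $o$ and with the marks of its vertices. Let $d_{\mathcal G_\star}\big((G_1,o_1),(G_2,o_2)\big)=\frac1{1+R^\star}$, where $R^\star$ is the supremum of the $r\ge0$ such that there is a rooted isomorphism $\phi:B_r^{(G_1)}(o_1)\to B_r^{(G_2)}(o_2)$ for which the marks of $u$ and $\phi(u)$ differ by at most $1/r$ for all $u$. $(G_n)$ converges vertex-marked locally in probability to a random marked rooted graph $(G,o)$ with law $\mu_\star$ if, for every $r>0$ and every marked rooted graph $H_\star$ (at continuity points of $\mu_\star$), $$\frac1n\sum_{\omega\in[n]}\mathbf 1\Big\{d_{\mathcal G_\star}\big(B_r^{(G_n)}(\omega),H_\star\big)\le\tfrac1{1+r}\Big\}\ \overset{\mathbb P}{\to}\ \mu_\star\Big(d_{\mathcal G_\star}\big(B_r^{(G)}(o),H_\star\big)\le\tfrac1{1+r}\Big).$$ *)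

theory Defs
  imports "HOL-Probability.Probability"
begin

section \<open>Marked multigraphs and vertex-marked local convergence\<close>

text \<open>
  \<open>mult G u v\<close> is the number of edges between \<open>u\<close> and \<open>v\<close> (the number of self-loops
  if \<open>u = v\<close>).  Everything below only looks at \<open>mult\<close> and \<open>mark\<close> on \<open>verts\<close>, so that an induced
  subgraph is obtained by shrinking \<open>verts\<close>.  A rooted graph is a pair of a graph and a vertex.
\<close>

record 'a mgraph =
  verts :: "'a set"
  mult :: "'a \<Rightarrow> 'a \<Rightarrow> nat"
  mark :: "'a \<Rightarrow> real"

type_synonym 'a rooted = "'a mgraph \<times> 'a"

definition marked_rooted_graph :: "'a rooted \<Rightarrow> bool" where
  "marked_rooted_graph = (\<lambda>(G, x).
     x \<in> verts G \<and>
     (\<forall>u\<in>verts G. \<forall>v\<in>verts G. mult G u v = mult G v u) \<and>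
     (\<forall>u\<in>verts G. finite {v \<in> verts G. mult G u v > 0}) \<and>
     (\<forall>u\<in>verts G. mark G u \<in> {0..1}))"

definition adj :: "'a mgraph \<Rightarrow> ('a \<times> 'a) set" where
  "adj G = {(u, v). u \<in> verts G \<and> v \<in> verts G \<and> mult G u v > 0}"

definition gdist :: "'a mgraph \<Rightarrow> 'a \<Rightarrow> 'a \<Rightarrow> ereal" where
  "gdist G u v = (INF k\<in>{k. (u, v) \<in> adj G ^^ k}. ereal (real k))"

definition nbhd :: "real \<Rightarrow> 'a rooted \<Rightarrow> 'a rooted" where
  "nbhd r = (\<lambda>(G, x). (G\<lparr>verts := {v \<in> verts G. gdist G x v \<le> ereal r}\<rparr>, x))"

text \<open>
  Isomorphisms preserve edge multiplicities.  For \<open>r = 0\<close> the bound \<open>1 / r\<close> is read as infinity.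
\<close>

definition close_iso :: "real \<Rightarrow> ('a \<Rightarrow> 'b) \<Rightarrow> 'a rooted \<Rightarrow> 'b rooted \<Rightarrow> bool" where
  "close_iso r \<phi> = (\<lambda>(G, x) (H, y).
     bij_betw \<phi> (verts G) (verts H) \<and> \<phi> x = y \<and>
     (\<forall>u\<in>verts G. \<forall>v\<in>verts G. mult G u v = mult H (\<phi> u) (\<phi> v)) \<and>
     (\<forall>u\<in>verts G. r > 0 \<longrightarrow> \<bar>mark G u - mark H (\<phi> u)\<bar> \<le> 1 / r))"

definition Rstar :: "'a rooted \<Rightarrow> 'b rooted \<Rightarrow> ennreal" where
  "Rstar g h = Sup {ennreal r | r. r \<ge> 0 \<and> (\<exists>\<phi>. close_iso r \<phi> (nbhd r g) (nbhd r h))}"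

definition dist_rooted :: "'a rooted \<Rightarrow> 'b rooted \<Rightarrow> real" where
  "dist_rooted g h = enn2real (1 / (1 + Rstar g h))"

definition looks_like :: "real \<Rightarrow> 'a rooted \<Rightarrow> 'b rooted \<Rightarrow> bool" where
  "looks_like r g h \<longleftrightarrow> dist_rooted (nbhd r g) h \<le> 1 / (1 + r)"

text \<open>
  In the next two definitions the limiting random rooted graph is the random element \<open>T\<close> on the
  probability space \<open>P\<close>.  \<open>continuity_point P T r h\<close> says that the law of \<open>T\<close> gives mass \<open>0\<close> to
  the boundary of the set of all \<open>g\<close> with \<open>looks_like r g h\<close>.  Locally finite rooted graphs have
  countable components, so graphs with vertices in \<open>nat\<close> are fully general here.
\<close>

definition continuity_point ::
    "'w measure \<Rightarrow> ('w \<Rightarrow> 'b rooted) \<Rightarrow> real \<Rightarrow> nat rooted \<Rightarrow> bool" where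
  "continuity_point P T r h \<longleftrightarrow>
     (AE w in P. \<exists>\<epsilon>>0. \<forall>g :: nat rooted. marked_rooted_graph g \<and> dist_rooted (T w) g < \<epsilon> \<longrightarrow>
        (looks_like r g h \<longleftrightarrow> looks_like r (T w) h))"

text \<open>
  \<open>L n\<close> is the law of a random marked graph with vertex set \<open>{1..n}\<close>.  Convergence in probability
  to a constant only involves these laws, not a coupling for different \<open>n\<close>.
\<close>

definition marked_local_conv_prob ::
    "(nat \<Rightarrow> nat mgraph pmf) \<Rightarrow> 'w measure \<Rightarrow> ('w \<Rightarrow> 'b rooted) \<Rightarrow> bool" where
  "marked_local_conv_prob L P T \<longleftrightarrow>
     (\<forall>r>0. \<forall>h :: nat rooted. marked_rooted_graph h \<and> continuity_point P T r h \<longrightarrow>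
       (\<forall>\<epsilon>>0. (\<lambda>n. measure_pmf.prob (L n)
           {G. \<bar>(\<Sum>v\<in>{1..n}. of_bool (looks_like r (G, v) h)) / real n
                 - measure P {w \<in> space P. looks_like r (T w) h}\<bar> > \<epsilon>})
         \<longlonglongrightarrow> 0))"


section \<open>Preferential attachment models\<close>

text \<open>
  A multigraph on the positive integers is a multiset of edges; \<open>(v, u)\<close> stands for the undirected
  edge between \<open>v\<close> and \<open>u\<close>.
\<close>

type_synonym edges = "(nat \<times> nat) multiset"

definition deg :: "edges \<Rightarrow> nat \<Rightarrow> nat" where
  "deg E u = size {#e \<in># E. fst e = u#} + size {#e \<in># E. snd e = u#}"

definition edge_mult :: "edges \<Rightarrow> nat \<Rightarrow> nat \<Rightarrow> nat" where
  "edge_mult E u v = (if u = v then count E (u, u) else count E (u, v) + count E (v, u))"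

datatype pa_model = Model_A | Model_B | Model_D

text \<open>
  In the following, \<open>a2\<close> is the total degree of the initial graph, \<open>m\<close> the sequence of out-degrees,
  and \<open>E\<close> the graph after the first \<open>j - 1\<close> edges of \<open>v\<close> have been attached.
\<close>

fun normalisation :: "pa_model \<Rightarrow> real \<Rightarrow> nat \<Rightarrow> (nat \<Rightarrow> nat) \<Rightarrow> nat \<Rightarrow> nat \<Rightarrow> real" where
  "normalisation Model_A \<delta> a2 m v j =
     real a2 + 2 * (real (\<Sum>i\<in>{1..v-1}. m i) + real j - 2) - 1 + (real v - 1) * \<delta>
       + real j / real (m v) * \<delta>"
| "normalisation Model_B \<delta> a2 m v j =
     real a2 + 2 * (real (\<Sum>i\<in>{1..v-1}. m i) + real j - 3) + (real v - 1) * \<delta>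
       + (real j - 1) / real (m v) * \<delta>"
| "normalisation Model_D \<delta> a2 m v j =
     real a2 + 2 * (real (\<Sum>i\<in>{1..v-1}. m i) - 2) + (real j - 1) + (real v - 1) * \<delta>"

fun loop_weight :: "pa_model \<Rightarrow> real \<Rightarrow> (nat \<Rightarrow> nat) \<Rightarrow> nat \<Rightarrow> nat \<Rightarrow> edges \<Rightarrow> real" where
  "loop_weight Model_A \<delta> m v j E = real (deg E v) + 1 + real j / real (m v) * \<delta>"
| "loop_weight Model_B \<delta> m v j E = real (deg E v) + (real j - 1) / real (m v) * \<delta>"
| "loop_weight Model_D \<delta> m v j E = 0"

definition attach_prob ::
    "pa_model \<Rightarrow> real \<Rightarrow> nat \<Rightarrow> (nat \<Rightarrow> nat) \<Rightarrow> nat \<Rightarrow> nat \<Rightarrow> edges \<Rightarrow> nat \<Rightarrow> real" where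
  "attach_prob md \<delta> a2 m v j E u =
     (if 1 \<le> u \<and> u < v then (real (deg E u) + \<delta>) / normalisation md \<delta> a2 m v j
      else if u = v then loop_weight md \<delta> m v j E / normalisation md \<delta> a2 m v j
      else 0)"

primrec attach_edges ::
    "pa_model \<Rightarrow> real \<Rightarrow> nat \<Rightarrow> (nat \<Rightarrow> nat) \<Rightarrow> nat \<Rightarrow> nat \<Rightarrow> edges \<Rightarrow> edges pmf" where
  "attach_edges md \<delta> a2 m v 0 E = return_pmf E"
| "attach_edges md \<delta> a2 m v (Suc j) E =
     bind_pmf (attach_edges md \<delta> a2 m v j E) (\<lambda>E'.
       map_pmf (\<lambda>u. add_mset (v, u) E') (embed_pmf (attach_prob md \<delta> a2 m v (Suc j) E')))"

text \<open>The law of the graph on \<open>{1..n}\<close> (for \<open>n \<ge> 2\<close>) given the out-degrees \<open>m\<close>.\<close>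

primrec pa_given :: "pa_model \<Rightarrow> real \<Rightarrow> edges \<Rightarrow> (nat \<Rightarrow> nat) \<Rightarrow> nat \<Rightarrow> edges pmf" where
  "pa_given md \<delta> G0 m 0 = return_pmf G0"
| "pa_given md \<delta> G0 m (Suc n) =
     (if Suc n \<le> 2 then return_pmf G0
      else bind_pmf (pa_given md \<delta> G0 m n)
             (attach_edges md \<delta> (deg G0 1 + deg G0 2) m (Suc n) (m (Suc n))))"

text \<open>
  The out-degrees of \<open>3, \<dots>, n\<close> are i.i.d. with law \<open>M\<close>; the default value \<open>1\<close> of the product
  gives \<open>m 1 = m 2 = 1\<close>.
\<close>

definition pa_law :: "pa_model \<Rightarrow> nat pmf \<Rightarrow> real \<Rightarrow> edges \<Rightarrow> nat \<Rightarrow> edges pmf" where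
  "pa_law md M \<delta> G0 n = bind_pmf (Pi_pmf {3..n} 1 (\<lambda>_. M)) (\<lambda>m. pa_given md \<delta> G0 m n)"

definition marked_graph :: "nat \<Rightarrow> edges \<Rightarrow> nat mgraph" where
  "marked_graph n E = \<lparr>verts = {1..n}, mult = edge_mult E, mark = (\<lambda>v. real v / real n)\<rparr>"

definition pa_marked_graph :: "pa_model \<Rightarrow> nat pmf \<Rightarrow> real \<Rightarrow> edges \<Rightarrow> nat \<Rightarrow> nat mgraph pmf" where
  "pa_marked_graph md M \<delta> G0 n = map_pmf (marked_graph n) (pa_law md M \<delta> G0 n)"


section \<open>Poisson processes\<close>

text \<open>
  A Poisson process whose intensity measure \<open>I\<close> is finite and without atoms (as all those below
  are) has almost surely finitely many points, all distinct, so it is modelled as a random finite set.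
\<close>

definition poisson_process :: "'w measure \<Rightarrow> 'a measure \<Rightarrow> ('w \<Rightarrow> 'a set) \<Rightarrow> bool" where
  "poisson_process P I X \<longleftrightarrow>
     prob_space P \<and>
     (\<forall>w\<in>space P. finite (X w) \<and> X w \<subseteq> space I) \<and>
     (\<forall>B\<in>sets I. (\<lambda>w. card (X w \<inter> B)) \<in> measurable P (count_space UNIV)) \<and>
     (\<forall>B\<in>sets I. \<forall>k. measure P {w \<in> space P. card (X w \<inter> B) = k}
                     = measure I B ^ k / fact k * exp (- measure I B)) \<and>
     (\<forall>(B :: nat \<Rightarrow> 'a set) N. (\<forall>i<N. B i \<in> sets I) \<and> disjoint_family_on B {..<N} \<longrightarrow>
        prob_space.indep_vars P (\<lambda>_. count_space UNIV) (\<lambda>i w. card (X w \<inter> B i)) {..<N})"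


section \<open>The random Polya point tree\<close>

definition chi :: "nat pmf \<Rightarrow> real \<Rightarrow> real" where
  "chi M \<delta> = (measure_pmf.expectation M real + \<delta>) / (2 * measure_pmf.expectation M real + \<delta>)"

text \<open>From here on \<open>\<kappa>\<close> stands for the value \<open>chi M \<delta>\<close>.\<close>

definition younger_intensity :: "real \<Rightarrow> real \<Rightarrow> real \<Rightarrow> real measure" where
  "younger_intensity \<kappa> a \<gamma> =
     density (restrict_space lborel {a..1})
       (\<lambda>x. ennreal ((1 - \<kappa>) * \<gamma> * x powr (- \<kappa>) / a powr (1 - \<kappa>)))"

text \<open>
  \<open>younger_family \<kappa> Q F\<close>: under the probability measure \<open>Q\<close>, \<open>F _ a \<gamma>\<close> is a Poisson process with the
  intensity prescribed for a node of age \<open>a\<close> and strength \<open>\<gamma>\<close>.  If \<open>\<xi>\<close> has law \<open>Q\<close> and is independent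
  of the (random) age and strength of a node, then, by the joint measurability, \<open>F \<xi>\<close> evaluated at
  the age and strength is a Poisson process with that intensity conditionally on them.  No
  relation is imposed between \<open>F _ a \<gamma>\<close> for different \<open>(a, \<gamma>)\<close>.
\<close>

definition younger_family :: "real \<Rightarrow> 'v measure \<Rightarrow> ('v \<Rightarrow> real \<Rightarrow> real \<Rightarrow> real set) \<Rightarrow> bool" where
  "younger_family \<kappa> Q F \<longleftrightarrow>
     prob_space Q \<and>
     (\<forall>\<xi>\<in>space Q. \<forall>a \<gamma>. finite (F \<xi> a \<gamma>)) \<and>
     (\<forall>B\<in>sets borel. (\<lambda>(\<xi>, a, \<gamma>). card (F \<xi> a \<gamma> \<inter> B))
        \<in> measurable (Q \<Otimes>\<^sub>M borel \<Otimes>\<^sub>M borel) (count_space UNIV)) \<and>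
     (\<forall>a \<gamma>. 0 < a \<and> a \<le> 1 \<and> 0 < \<gamma> \<longrightarrow>
        poisson_process Q (younger_intensity \<kappa> a \<gamma>) (\<lambda>\<xi>. F \<xi> a \<gamma>))"

text \<open>The law of \<open>M\<^sup>(\<^sup>\<delta>\<^sup>)\<close>; for \<open>\<delta> = 0\<close> this is the size-biased law.\<close>

definition tilted :: "nat pmf \<Rightarrow> real \<Rightarrow> nat pmf" where
  "tilted M \<delta> = embed_pmf (\<lambda>k. (real k + \<delta>) / (measure_pmf.expectation M real + \<delta>) * pmf M k)"

datatype label = Old | Young

text \<open>
  Nodes have Ulam-Harris names: \<open>[]\<close> is the root and \<open>(l, i) # \<omega>\<close> is the \<open>i\<close>-th child of \<open>\<omega>\<close> with
  label \<open>l\<close>, counting from \<open>0\<close>.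
\<close>

type_synonym node = "(label \<times> nat) list"

fun m_law :: "nat pmf \<Rightarrow> real \<Rightarrow> node \<Rightarrow> nat pmf" where
  "m_law M \<delta> [] = M"
| "m_law M \<delta> ((Old, i) # \<omega>) = tilted M \<delta>"
| "m_law M \<delta> ((Young, i) # \<omega>) = map_pmf (\<lambda>k. k - 1) (tilted M 0)"

definition gamma_density :: "real \<Rightarrow> real \<Rightarrow> real" where
  "gamma_density s x = (if x > 0 then x powr (s - 1) * exp (- x) / Gamma s else 0)"

text \<open>The joint law of the number \<open>m\<^sub>-(\<omega>)\<close> of older children and the strength of \<open>\<omega>\<close>.\<close>

definition m_strength_law :: "nat pmf \<Rightarrow> real \<Rightarrow> node \<Rightarrow> (nat \<times> real) measure" where
  "m_strength_law M \<delta> \<omega> =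
     density (count_space UNIV \<Otimes>\<^sub>M lborel)
       (\<lambda>(k, x). ennreal (pmf (m_law M \<delta> \<omega>) k *
          gamma_density (real k + \<delta> + (if \<omega> = [] then 0 else 1)) x))"

text \<open>
  The sample space carries, independently for all names \<open>\<omega>\<close> (whether or not they end up in the
  tree): a uniform variable, which determines the age of \<open>\<omega>\<close> if \<open>\<omega>\<close> is the root or has label
  \<open>Old\<close>; the pair of \<open>m\<^sub>-(\<omega>)\<close> and the strength; and the randomness \<open>\<xi>\<close> of the Poisson process
  of younger children of \<open>\<omega>\<close>.
\<close>

type_synonym 'v sample = "node \<Rightarrow> real \<times> (nat \<times> real) \<times> 'v"

definition rppt_space :: "nat pmf \<Rightarrow> real \<Rightarrow> 'v measure \<Rightarrow> 'v sample measure" where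
  "rppt_space M \<delta> Q =
     PiM UNIV (\<lambda>\<omega>. uniform_measure lborel {0..1} \<Otimes>\<^sub>M m_strength_law M \<delta> \<omega> \<Otimes>\<^sub>M Q)"

definition unif :: "'v sample \<Rightarrow> node \<Rightarrow> real" where
  "unif w \<omega> = fst (w \<omega>)"

definition m_minus :: "'v sample \<Rightarrow> node \<Rightarrow> nat" where
  "m_minus w \<omega> = fst (fst (snd (w \<omega>)))"

definition strength :: "'v sample \<Rightarrow> node \<Rightarrow> real" where
  "strength w \<omega> = snd (fst (snd (w \<omega>)))"

definition noise :: "'v sample \<Rightarrow> node \<Rightarrow> 'v" where
  "noise w \<omega> = snd (snd (w \<omega>))"

text \<open>Children with label \<open>Young\<close> are numbered in increasing order of their ages.\<close>

fun age :: "real \<Rightarrow> ('v \<Rightarrow> real \<Rightarrow> real \<Rightarrow> real set) \<Rightarrow> 'v sample \<Rightarrow> node \<Rightarrow> real" where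
  "age \<kappa> F w [] = unif w []"
| "age \<kappa> F w ((Old, i) # \<omega>) = unif w ((Old, i) # \<omega>) powr (1 / \<kappa>) * age \<kappa> F w \<omega>"
| "age \<kappa> F w ((Young, i) # \<omega>) =
     sorted_list_of_set (F (noise w \<omega>) (age \<kappa> F w \<omega>) (strength w \<omega>)) ! i"

fun in_tree :: "real \<Rightarrow> ('v \<Rightarrow> real \<Rightarrow> real \<Rightarrow> real set) \<Rightarrow> 'v sample \<Rightarrow> node \<Rightarrow> bool" where
  "in_tree \<kappa> F w [] \<longleftrightarrow> True"
| "in_tree \<kappa> F w ((Old, i) # \<omega>) \<longleftrightarrow> in_tree \<kappa> F w \<omega> \<and> i < m_minus w \<omega>"
| "in_tree \<kappa> F w ((Young, i) # \<omega>) \<longleftrightarrow>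
     in_tree \<kappa> F w \<omega> \<and> i < card (F (noise w \<omega>) (age \<kappa> F w \<omega>) (strength w \<omega>))"

definition rppt :: "real \<Rightarrow> ('v \<Rightarrow> real \<Rightarrow> real \<Rightarrow> real set) \<Rightarrow> 'v sample \<Rightarrow> node rooted" where
  "rppt \<kappa> F w =
     (\<lparr>verts = {\<omega>. in_tree \<kappa> F w \<omega>},
       mult = (\<lambda>\<omega> \<omega>'. of_bool (\<exists>c. \<omega> = c # \<omega>' \<or> \<omega>' = c # \<omega>)),
       mark = age \<kappa> F w\<rparr>, [])"

end

theory Submission
  imports Defs
begin

text \<open>
  Only lower bounds are needed.  Let \<open>X\<^sub>b\<close> be the number of vertices of the \<open>n\<close>-th graph whose
  neighbourhood looks like \<open>h\<close> (\<open>b = True\<close>) or does not (\<open>b = False\<close>), and \<open>P\<^sub>b\<close> the corresponding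
  probability for the tree.  As \<open>X\<^sub>b\<close> sum up to \<open>n\<close> and \<open>P\<^sub>b\<close> to \<open>1\<close>, the four bounds
  \<open>liminf E(X\<^sub>b X\<^sub>c) / n\<^sup>2 \<ge> P\<^sub>b P\<^sub>c\<close> force equality in the limit, so that the variance of \<open>X\<^sub>b / n\<close>
  tends to \<open>0\<close> and its mean to \<open>P\<^sub>b\<close>.

  For the bounds, count pairs of embedded trees: finitely many structures (numbers of children with
  either label up to the relevant depth), the vertices that represent the nodes, and for each younger
  child the index of the edge to its parent.  A vertex is the root of at most one such tree.  If all edges into
  the vertices of a pattern are prescribed, then the degrees of these vertices are deterministic,
  and the probability given the out-degrees is an explicit product.  Averaging over the
  out-degrees (Jensen's inequality and a weak law of large numbers) gives a pointwise lower bound for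
  its limit, and Fatou's lemma turns the sum over positions into an integral over ages.  Integrating out the
  strengths shows that the integrand is, node by node, the density of the ages in the tree.
\<close>

section \<open>Balls in marked rooted graphs\<close>

text \<open>Attachment probabilities involve random degrees and random normalisations, and the
  limiting densities may blow up near age 0, which makes upper bounds delicate; lower bounds only
  need fixed ages away from 0. Two mechanisms make the two sides agree. In the graph, an edge of
  \<open>w\<close> avoids the pattern with probability about 1 - D / (\<mu> w), where D is the
  weight of the pattern at that time. Out-degrees average to \<open>EM\<close>, and sums of 1 / w
  give logarithms, so a unit of weight present from age x on contributes x to the power
  \<open>EM\<close> / \<mu> = 1 - \<kappa>. In the tree, the same powers, and the rising factorials
  of successive attachment weights, arise when Poisson counts are mixed over a gamma strength. The
  biased laws of the labels come from the edge to the parent: an older child is hit with weight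
  proportional to its degree plus \<delta>, and a younger one can use any of its own edges, which
  yields size-biasing. Neighbourhoods decorrelate because two disjoint patterns form one pattern
  whose density is a product.\<close>

lemma gdist_le_iff:
  "gdist G x v \<le> ereal r \<longleftrightarrow> (\<exists>i. (x, v) \<in> adj G ^^ i \<and> real i \<le> r)"
proof
  assume le: "gdist G x v \<le> ereal r"
  define S where "S = {k. (x, v) \<in> adj G ^^ k}"
  have "S \<noteq> {}"
  proof
    assume "S = {}"
    then have "gdist G x v = \<infinity>"
      by (simp add: gdist_def S_def[symmetric] top_ereal_def)
    with le show False by simp
  qed
  \<comment> \<open>A nonempty set of naturals contains its infimum, so the \<open>INF\<close> is
    attained by a walk.\<close>
  then have k: "(LEAST k. k \<in> S) \<in> S"
    by (metis LeastI_ex ex_in_conv)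
  have "ereal (real (LEAST k. k \<in> S)) \<le> gdist G x v"
    unfolding gdist_def S_def[symmetric] by (intro INF_greatest) (simp add: Least_le)
  with le have "real (LEAST k. k \<in> S) \<le> r"
    by (metis ereal_less_eq(3) order_trans)
  with k show "\<exists>i. (x, v) \<in> adj G ^^ i \<and> real i \<le> r"
    unfolding S_def by blast
next
  assume "\<exists>i. (x, v) \<in> adj G ^^ i \<and> real i \<le> r"
  then show "gdist G x v \<le> ereal r"
    unfolding gdist_def by (auto intro: INF_lower2)
qed

definition ball_verts :: "real \<Rightarrow> 'a rooted \<Rightarrow> 'a set" where
  "ball_verts s g = {v \<in> verts (fst g). \<exists>i. (snd g, v) \<in> adj (fst g) ^^ i \<and> real i \<le> s}"

lemma nbhd_eq: "nbhd s g = ((fst g)\<lparr>verts := ball_verts s g\<rparr>, snd g)"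
  by (cases g) (simp add: nbhd_def gdist_le_iff ball_verts_def)

lemma adj_update_verts: "B \<subseteq> verts G \<Longrightarrow> adj (G\<lparr>verts := B\<rparr>) = adj G \<inter> B \<times> B"
  by (auto simp: adj_def)

lemma ball_verts_subset: "ball_verts s g \<subseteq> verts (fst g)"
  by (auto simp: ball_verts_def)

text \<open>Initial segments of a walk of length at most \<open>s\<close> are no longer than the
  walk, so all its vertices lie in the ball and the walk survives in the induced subgraph.\<close>

lemma adj_path_in_ball:
  assumes "x \<in> verts G" "(x, v) \<in> adj G ^^ i" "real i \<le> s"
  shows "(x, v) \<in> adj (G\<lparr>verts := ball_verts s (G, x)\<rparr>) ^^ i \<and> v \<in> ball_verts s (G, x)"
  using assms(2,3)
proof (induction i arbitrary: v)
  case 0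
  then show ?case using assms(1) by (auto simp: ball_verts_def intro!: exI[of _ "0::nat"])
next
  case (Suc i)
  then obtain w where w: "(x, w) \<in> adj G ^^ i" "(w, v) \<in> adj G" by auto
  have "v \<in> ball_verts s (G, x)"
    using Suc.prems w(2) unfolding ball_verts_def
    by (intro CollectI conjI exI[of _ "Suc i"]) (auto simp: adj_def[of G])
  moreover have "(x, w) \<in> adj (G\<lparr>verts := ball_verts s (G, x)\<rparr>) ^^ i \<and> w \<in> ball_verts s (G, x)"
    using Suc w by auto
  ultimately show ?case
    using w(2) by (auto simp: adj_update_verts[OF ball_verts_subset[of _ "(G, x)", simplified]])
qed

lemma relpow_mono_set:
  fixes R S :: "('a \<times> 'a) set"
  shows "R \<subseteq> S \<Longrightarrow> R ^^ i \<subseteq> S ^^ i"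
  by (induction i) (simp_all add: relcomp_mono)

text \<open>Walks that witness membership in the smaller ball never leave the larger one.
  \<open>looks_like\<close> cuts the graph at \<open>r\<close> before \<open>Rstar\<close> cuts it
  again, and this removes the double truncation.\<close>

lemma nbhd_nbhd:
  assumes "snd g \<in> verts (fst g)" "s \<le> r"
  shows "nbhd s (nbhd r g) = nbhd s g"
proof -
  obtain G x where g: "g = (G, x)" by (cases g)
  let ?B = "ball_verts r (G, x)"
  have sub: "adj (G\<lparr>verts := ?B\<rparr>) ^^ i \<subseteq> adj G ^^ i" for i
    by (intro relpow_mono_set) (auto simp: adj_update_verts[OF ball_verts_subset[of _ "(G, x)", simplified]])
  have "ball_verts s (G\<lparr>verts := ?B\<rparr>, x) = ball_verts s (G, x)"
  proof (intro set_eqI iffI)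
    fix v assume "v \<in> ball_verts s (G\<lparr>verts := ?B\<rparr>, x)"
    then show "v \<in> ball_verts s (G, x)"
      using sub by (fastforce simp: ball_verts_def)
  next
    fix v assume "v \<in> ball_verts s (G, x)"
    then obtain i where "(x, v) \<in> adj G ^^ i" "real i \<le> s" by (auto simp: ball_verts_def)
    then show "v \<in> ball_verts s (G\<lparr>verts := ?B\<rparr>, x)"
      using adj_path_in_ball[of x G v i r] assms by (auto simp: ball_verts_def g)
  qed
  then show ?thesis by (simp add: nbhd_eq g)
qed

text \<open>An isomorphism transports walks from the root step by step. The second part goes
  backwards, through surjectivity, so that distances from the root agree exactly.\<close>

lemma close_iso_relpow:
  assumes iso: "close_iso s \<phi> (G, x) (H, y)" and x: "x \<in> verts G"
  shows "(x, v) \<in> adj G ^^ i \<Longrightarrow> (y, \<phi> v) \<in> adj H ^^ i"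
    and "(y, w) \<in> adj H ^^ i \<Longrightarrow> \<exists>v\<in>verts G. \<phi> v = w \<and> (x, v) \<in> adj G ^^ i"
proof -
  have bij: "bij_betw \<phi> (verts G) (verts H)" and root: "\<phi> x = y"
    and mult: "\<And>u v. u \<in> verts G \<Longrightarrow> v \<in> verts G \<Longrightarrow> mult G u v = mult H (\<phi> u) (\<phi> v)"
    using iso by (auto simp: close_iso_def)
  show "(x, v) \<in> adj G ^^ i \<Longrightarrow> (y, \<phi> v) \<in> adj H ^^ i"
  proof (induction i arbitrary: v)
    case (Suc i)
    then obtain w where w: "(x, w) \<in> adj G ^^ i" "(w, v) \<in> adj G" by auto
    then have "(\<phi> w, \<phi> v) \<in> adj H"
      using mult bij by (auto simp: adj_def bij_betw_def)
    with Suc.IH[OF w(1)] show ?case by auto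
  qed (simp add: root)
  show "(y, w) \<in> adj H ^^ i \<Longrightarrow> \<exists>v\<in>verts G. \<phi> v = w \<and> (x, v) \<in> adj G ^^ i"
  proof (induction i arbitrary: w)
    case 0
    then show ?case using x root by auto
  next
    case (Suc i)
    then obtain w' where w': "(y, w') \<in> adj H ^^ i" "(w', w) \<in> adj H" by auto
    from Suc.IH[OF w'(1)] obtain v' where v': "v' \<in> verts G" "\<phi> v' = w'" "(x, v') \<in> adj G ^^ i"
      by auto
    have "w \<in> verts H" using w'(2) by (auto simp: adj_def)
    then obtain v where v: "v \<in> verts G" "\<phi> v = w" using bij by (metis bij_betw_imp_surj_on imageE)
    then have "(v', v) \<in> adj G" using w'(2) v' mult by (auto simp: adj_def)
    with v' v show ?case by auto
  qed
qed

text \<open>Since distances from the root agree, the same map restricts to smaller balls; lowering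
  the scale to \<open>s'\<close> also relaxes the tolerance for marks, because
  \<open>1 / s \<le> 1 / s'\<close>.\<close>

lemma close_iso_nbhd:
  assumes iso: "close_iso s \<phi> g h" and x: "snd g \<in> verts (fst g)" and s: "0 \<le> s'" "s' \<le> s"
  shows "close_iso s' \<phi> (nbhd t g) (nbhd t h)"
proof -
  obtain G x H y where g: "g = (G, x)" and h: "h = (H, y)" by (cases g, cases h) auto
  note rp = close_iso_relpow[OF iso[unfolded g h] x[unfolded g, simplified]]
  have bij: "bij_betw \<phi> (verts G) (verts H)" and root: "\<phi> x = y"
    and mult: "\<And>u v. u \<in> verts G \<Longrightarrow> v \<in> verts G \<Longrightarrow> mult G u v = mult H (\<phi> u) (\<phi> v)"
    and mark: "\<And>u. u \<in> verts G \<Longrightarrow> s > 0 \<Longrightarrow> \<bar>mark G u - mark H (\<phi> u)\<bar> \<le> 1 / s"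
    using iso by (auto simp: close_iso_def g h)
  have im: "\<phi> ` ball_verts t (G, x) = ball_verts t (H, y)"
  proof (intro set_eqI iffI)
    fix w assume "w \<in> \<phi> ` ball_verts t (G, x)"
    then show "w \<in> ball_verts t (H, y)"
      using rp(1) bij by (fastforce simp: ball_verts_def bij_betw_def)
  next
    fix w assume "w \<in> ball_verts t (H, y)"
    then show "w \<in> \<phi> ` ball_verts t (G, x)"
      using rp(2) by (fastforce simp: ball_verts_def)
  qed
  have sub: "ball_verts t (G, x) \<subseteq> verts G"
    by (auto simp: ball_verts_def)
  have "bij_betw \<phi> (ball_verts t (G, x)) (ball_verts t (H, y))"
    using im bij sub by (auto simp: bij_betw_def intro: inj_on_subset)
  moreover have "\<bar>mark G u - mark H (\<phi> u)\<bar> \<le> 1 / s'" if "u \<in> ball_verts t (G, x)" "s' > 0" for u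
  proof -
    have "\<bar>mark G u - mark H (\<phi> u)\<bar> \<le> 1 / s" using mark sub that s by auto
    also have "\<dots> \<le> 1 / s'" using that s by (intro divide_left_mono) auto
    finally show ?thesis .
  qed
  ultimately show ?thesis
    using mult root sub by (auto simp: close_iso_def nbhd_eq g h)
qed

text \<open>The largest integer below \<open>r\<close>: closeness at all scales below \<open>r\<close> only concerns this ball.\<close>

definition inner_radius :: "real \<Rightarrow> nat" where
  "inner_radius r = nat (\<lceil>r\<rceil> - 1)"

lemma inner_radius:
  assumes "r > 0"
  shows "real (inner_radius r) < r" "r \<le> real (inner_radius r) + 1"
  using assms unfolding inner_radius_def by linarith+

text \<open>Graph distances are integers and no integer lies strictly between
  \<open>inner_radius r\<close> and \<open>r\<close>, so all radii in this range give the same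
  ball.\<close>

lemma nbhd_inner_radius:
  assumes "r > 0" "real (inner_radius r) \<le> s" "s < r"
  shows "nbhd s g = nbhd (inner_radius r) g"
proof -
  have "real i \<le> s \<longleftrightarrow> real i \<le> real (inner_radius r)" for i
    using inner_radius[OF assms(1)] assms(2,3)
    by (smt (verit) Suc_leI linorder_not_le of_nat_Suc of_nat_le_iff of_nat_less_iff)
  then show ?thesis by (simp add: nbhd_eq ball_verts_def)
qed

lemma dist_rooted_le_iff:
  assumes "r > 0"
  shows "dist_rooted g h \<le> 1 / (1 + r) \<longleftrightarrow> ennreal r \<le> Rstar g h"
proof (cases "Rstar g h")
  case (real R)
  then have "1 / (1 + Rstar g h) = ennreal (1 / (1 + R))"
    by (metis add_nonneg_pos divide_ennreal ennreal_1 ennreal_plus zero_le_one zero_less_one add.commute)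
  then have "dist_rooted g h = 1 / (1 + R)"
    using real unfolding dist_rooted_def by simp
  then show ?thesis
    using real assms inverse_le_iff_le[of "1 + R" "1 + r"] by (simp add: inverse_eq_divide)
next
  case top
  then show ?thesis
    using assms by (simp add: dist_rooted_def)
qed

text \<open>The supremum in \<open>Rstar\<close> asks for closeness at every scale
  \<open>s < r\<close>, with a map that may depend on \<open>s\<close>. A finite ball admits only
  finitely many maps, so one of them works for all \<open>s\<close>, hence at tolerance
  \<open>1 / r\<close> itself. This replaces the supremum by a closed condition on the
  marks.\<close>

lemma looks_like_iff:
  assumes r: "r > 0" and x: "snd g \<in> verts (fst g)"
    and fin: "finite (ball_verts (inner_radius r) g)" and y: "snd h \<in> verts (fst h)"
  shows "looks_like r g h \<longleftrightarrow>
    (\<exists>\<phi>. close_iso r \<phi> (nbhd (inner_radius r) g) (nbhd (inner_radius r) h))"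
proof -
  let ?k = "real (inner_radius r)"
  define S where "S = {s. s \<ge> 0 \<and> (\<exists>\<phi>. close_iso s \<phi> (nbhd s (nbhd r g)) (nbhd s h))}"
  have k: "?k < r" "r \<le> ?k + 1" "?k \<ge> 0" using inner_radius[OF r] by auto
  have x0: "snd (nbhd s g) \<in> verts (fst (nbhd s g))" if "s \<ge> 0" for s
    using x that by (auto simp: nbhd_eq ball_verts_def intro!: exI[of _ "0::nat"])
  have S_iff: "s \<in> S \<longleftrightarrow> (\<exists>\<phi>. close_iso s \<phi> (nbhd ?k g) (nbhd ?k h))" if "?k \<le> s" "s < r" for s
  proof -
    have "0 \<le> s" using that k by linarith
    then show ?thesis
      using that nbhd_nbhd[OF x, of s r] unfolding S_def by (simp add: nbhd_inner_radius[OF r that])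
  qed
  \<comment> \<open>Closeness passes to smaller scales with the same map, so only scales just below
    \<open>r\<close> matter.\<close>
  have down: "s' \<in> S" if "s \<in> S" "0 \<le> s'" "s' \<le> s" "s' < r" for s s'
  proof -
    from that obtain \<phi> where \<phi>: "close_iso s \<phi> (nbhd s (nbhd r g)) (nbhd s h)" by (auto simp: S_def)
    have xx: "snd (nbhd r g) \<in> verts (fst (nbhd r g))" using x0 r by auto
    have "snd (nbhd s (nbhd r g)) \<in> verts (fst (nbhd s (nbhd r g)))"
      using that xx by (auto simp: nbhd_eq[of s] ball_verts_def intro!: exI[of _ "0::nat"])
    from close_iso_nbhd[OF \<phi> this that(2,3), of s']
    show ?thesis using that xx y by (auto simp: S_def nbhd_nbhd)
  qed
  have Sup: "ennreal r \<le> Rstar (nbhd r g) h \<longleftrightarrow> (\<forall>s. 0 \<le> s \<longrightarrow> s < r \<longrightarrow> s \<in> S)"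
  proof
    assume le: "ennreal r \<le> Rstar (nbhd r g) h"
    show "\<forall>s. 0 \<le> s \<longrightarrow> s < r \<longrightarrow> s \<in> S"
    proof (intro allI impI)
      fix s :: real assume s: "0 \<le> s" "s < r"
      have "ennreal s < Rstar (nbhd r g) h"
        using s le by (metis ennreal_less_iff order_less_le_trans)
      then obtain s' where "s' \<in> S" "ennreal s < ennreal s'"
        unfolding Rstar_def less_Sup_iff S_def by auto
      then show "s \<in> S" using down[of s' s] s by (simp add: ennreal_less_iff)
    qed
  next
    assume all: "\<forall>s. 0 \<le> s \<longrightarrow> s < r \<longrightarrow> s \<in> S"
    show "ennreal r \<le> Rstar (nbhd r g) h"
    proof (rule dense_le)
      fix z assume z: "z < ennreal r"
      then obtain s where s: "z = ennreal s" "0 \<le> s" by (cases z) auto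
      with z have "s \<in> S" using all by (auto simp: ennreal_less_iff)
      then show "z \<le> Rstar (nbhd r g) h"
        unfolding Rstar_def S_def s(1) by (intro Sup_upper) auto
    qed
  qed
  have "(\<forall>s. 0 \<le> s \<longrightarrow> s < r \<longrightarrow> s \<in> S) \<longleftrightarrow> (\<exists>\<phi>. close_iso r \<phi> (nbhd ?k g) (nbhd ?k h))" (is "?L \<longleftrightarrow> ?R")
  proof
    assume ?R
    then obtain \<phi> where \<phi>: "close_iso r \<phi> (nbhd ?k g) (nbhd ?k h)" by auto
    have "s \<in> S" if s: "0 \<le> s" "s < r" for s
    proof -
      have "nbhd ?k g = nbhd ?k (nbhd ?k g)" "nbhd ?k h = nbhd ?k (nbhd ?k h)"
        using x y by (simp_all add: nbhd_nbhd)
      then have *: "close_iso (max s ?k) \<phi> (nbhd ?k g) (nbhd ?k h)"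
        using close_iso_nbhd[OF \<phi> x0, of "max s ?k" ?k] s k by auto
      have "max s ?k \<in> S" using S_iff[of "max s ?k"] * s k by auto
      then show ?thesis using down[of "max s ?k" s] s by auto
    qed
    then show ?L by auto
  next
    assume L: ?L
    show ?R
    proof (rule ccontr)
      assume nR: "\<not> ?R"
      obtain G x where g: "g = (G, x)" by (cases g)
      obtain H y where h: "h = (H, y)" by (cases h)
      let ?B = "ball_verts ?k g" and ?C = "ball_verts ?k h"
      define iso where "iso \<phi> \<longleftrightarrow> bij_betw \<phi> ?B ?C \<and> \<phi> x = y \<and>
        (\<forall>u\<in>?B. \<forall>v\<in>?B. mult G u v = mult H (\<phi> u) (\<phi> v))" for \<phi>
      have ci: "close_iso s \<phi> (nbhd ?k g) (nbhd ?k h) \<longleftrightarrow>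
          iso \<phi> \<and> (\<forall>u\<in>?B. \<bar>mark G u - mark H (\<phi> u)\<bar> \<le> 1 / s)" if "s > 0" for s \<phi>
        using that by (auto simp: close_iso_def nbhd_eq iso_def g h)
      have xB: "x \<in> ?B" using x0[of ?k] by (simp add: nbhd_eq g)
      have "\<exists>\<phi>. iso \<phi>"
      proof -
        obtain s where s: "?k < s" "0 < s" "s < r" using dense[of "?k" r] k by auto
        then show ?thesis using L[rule_format, of s] S_iff[of s] ci[of s] by auto
      qed
      then obtain \<phi>0 where "iso \<phi>0" by auto
      then have finC: "finite ?C" using fin bij_betw_finite by (auto simp: iso_def)
      \<comment> \<open>Maps are restricted to the ball to make them finitely many; outside the ball
        a map is arbitrary.\<close>
      define \<Phi> where "\<Phi> = {\<phi> \<in> ?B \<rightarrow>\<^sub>E ?C. iso \<phi>}"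
      have fin\<Phi>: "finite \<Phi>" unfolding \<Phi>_def using fin finC by (simp add: finite_PiE)
      have restr: "restrict \<phi> ?B \<in> \<Phi>" if "iso \<phi>" for \<phi>
      proof -
        have "bij_betw (restrict \<phi> ?B) ?B ?C"
          using that by (subst bij_betw_cong[of _ _ \<phi>]) (auto simp: iso_def)
        then show ?thesis
          using that xB unfolding \<Phi>_def iso_def by (auto simp: bij_betw_def)
      qed
      have ex: "\<exists>u\<in>?B. \<bar>mark G u - mark H (\<phi> u)\<bar> > 1 / r" if "\<phi> \<in> \<Phi>" for \<phi>
        using nR that ci[OF r, of \<phi>] by (auto simp: \<Phi>_def not_le)
      define e where "e \<phi> = Max ((\<lambda>u. \<bar>mark G u - mark H (\<phi> u)\<bar>) ` ?B)" for \<phi>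
      have e: "e \<phi> > 1 / r" if "\<phi> \<in> \<Phi>" for \<phi>
        using ex[OF that] fin xB unfolding e_def by (subst Max_gr_iff) auto
      \<comment> \<open>The smallest worst mark error over all isomorphisms. If none meets the
        tolerance \<open>1 / r\<close>, then \<open>d > 1 / r\<close>, and a scale \<open>s\<close>
        between \<open>1 / d\<close> and \<open>r\<close> already excludes all of them.\<close>
      define d where "d = Min (e ` \<Phi>)"
      have ne: "\<Phi> \<noteq> {}" using restr[OF \<open>iso \<phi>0\<close>] by auto
      have d: "d > 1 / r" unfolding d_def using e fin\<Phi> ne by (subst Min_gr_iff) auto
      then have d0: "d > 0" using r by (smt (verit) zero_less_divide_1_iff)
      have "1 / d < r" using d d0 r by (simp add: field_simps)
      then obtain s where s: "1 / d < s" "?k < s" "r/2 < s" "s < r"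
        using dense[of "max (1/d) (max ?k (r/2))" r] k r by auto
      then have s0: "s > 0" using r by auto
      from L s s0 S_iff[of s] ci[OF s0] obtain \<phi> where
        \<phi>: "iso \<phi>" "\<And>u. u \<in> ?B \<Longrightarrow> \<bar>mark G u - mark H (\<phi> u)\<bar> \<le> 1 / s" by auto
      have "e (restrict \<phi> ?B) \<le> 1 / s"
        unfolding e_def using fin xB \<phi>(2) by (subst Max_le_iff) auto
      moreover have "d \<le> e (restrict \<phi> ?B)"
        unfolding d_def using restr[OF \<phi>(1)] fin\<Phi> by (intro Min_le) auto
      moreover have "1 / s < d" using s s0 d0 by (simp add: field_simps)
      ultimately show False by linarith
    qed
  qed
  with Sup show ?thesis
    unfolding looks_like_def using dist_rooted_le_iff[OF r, of "nbhd r g" h] by simp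
qed

section \<open>Tree-shaped balls\<close>

definition nb :: "'b list \<Rightarrow> 'b list \<Rightarrow> bool" where
  "nb \<nu> \<nu>' \<longleftrightarrow> (\<exists>c. \<nu> = c # \<nu>' \<or> \<nu>' = c # \<nu>)"

text \<open>The relation \<open>looks_like\<close> for a ball that is a tree with known node set
  \<open>I\<close> and marks \<open>x\<close>. It mentions neither the graph nor the random tree, so
  both sides of the convergence are tested by the same predicate.\<close>

definition tree_looks_like :: "real \<Rightarrow> nat rooted \<Rightarrow> 'b list set \<Rightarrow> ('b list \<Rightarrow> real) \<Rightarrow> bool" where
  "tree_looks_like r h I x \<longleftrightarrow> (\<exists>\<psi>. bij_betw \<psi> I (ball_verts (inner_radius r) h) \<and> \<psi> [] = snd h \<and>
     (\<forall>a\<in>I. \<forall>b\<in>I. of_bool (nb a b) = mult (fst h) (\<psi> a) (\<psi> b)) \<and>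
     (\<forall>a\<in>I. \<bar>x a - mark (fst h) (\<psi> a)\<bar> \<le> 1 / r))"

text \<open>A walk from the root gains at most one level per step, so a walk of at most
  \<open>k\<close> steps never takes a step from a node of depth \<open>k\<close>. Hence
  \<open>nbrs\<close> only controls nodes of smaller depth; what is attached at depth
  \<open>k\<close> lies outside the ball.\<close>

lemma ball_verts_tree:
  assumes root: "[] \<in> I" and pre: "\<And>c \<nu>. c # \<nu> \<in> I \<Longrightarrow> \<nu> \<in> I"
    and len: "\<And>\<nu>. \<nu> \<in> I \<Longrightarrow> length \<nu> \<le> k"
    and verts: "\<phi> ` I \<subseteq> verts G"
    and mult: "\<And>a b. a \<in> I \<Longrightarrow> b \<in> I \<Longrightarrow> mult G (\<phi> a) (\<phi> b) = of_bool (nb a b)"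
    and nbrs: "\<And>a u. a \<in> I \<Longrightarrow> length a < k \<Longrightarrow> u \<in> verts G \<Longrightarrow> mult G (\<phi> a) u > 0 \<Longrightarrow>
       \<exists>b\<in>I. u = \<phi> b \<and> nb a b"
  shows "ball_verts k (G, \<phi> []) = \<phi> ` I"
proof (intro set_eqI iffI)
  fix u assume "u \<in> \<phi> ` I"
  then obtain a where a: "a \<in> I" "u = \<phi> a" by auto
  have "(\<phi> [], \<phi> a) \<in> adj G ^^ length a" using a(1)
  proof (induction a)
    case (Cons c a)
    have "mult G (\<phi> a) (\<phi> (c # a)) = 1"
      using mult[OF pre[OF Cons.prems] Cons.prems] by (auto simp: nb_def)
    then have "(\<phi> a, \<phi> (c # a)) \<in> adj G" using verts Cons.prems pre[OF Cons.prems]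
      by (auto simp: adj_def)
    then show ?case using Cons.IH[OF pre[OF Cons.prems]] by auto
  qed simp
  then show "u \<in> ball_verts k (G, \<phi> [])"
    using a verts len by (auto simp: ball_verts_def)
next
  fix u assume "u \<in> ball_verts k (G, \<phi> [])"
  then obtain i where i: "(\<phi> [], u) \<in> adj G ^^ i" "i \<le> k"
    by (auto simp: ball_verts_def)
  have "\<exists>a\<in>I. length a \<le> i \<and> u = \<phi> a" using i
  proof (induction i arbitrary: u)
    case 0
    then show ?case using root by auto
  next
    case (Suc i)
    then obtain w where w: "(\<phi> [], w) \<in> adj G ^^ i" "(w, u) \<in> adj G" by auto
    with Suc obtain a where a: "a \<in> I" "length a \<le> i" "w = \<phi> a" by fastforce
    with nbrs[of a u] w(2) Suc.prems(2) obtain b where b: "b \<in> I" "u = \<phi> b" "nb a b"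
      by (auto simp: adj_def)
    from b(3) have "length b \<le> Suc (length a)" by (auto simp: nb_def)
    with a have "length b \<le> Suc i" by simp
    with b show ?case by blast
  qed
  then show "u \<in> \<phi> ` I" by auto
qed

text \<open>Composing with the embedding \<open>\<phi>\<close> or with its inverse turns
  isomorphisms of the ball into labellings of \<open>I\<close> and back; after that the graph enters
  only through the marks of \<open>\<phi> a\<close>.\<close>

lemma looks_like_iff_tree_looks_like:
  assumes r: "r > 0" and fin: "finite I" and root: "[] \<in> I" and inj: "inj_on \<phi> I"
    and ball: "ball_verts (inner_radius r) (G, \<phi> []) = \<phi> ` I"
    and mult: "\<And>a b. a \<in> I \<Longrightarrow> b \<in> I \<Longrightarrow> mult G (\<phi> a) (\<phi> b) = of_bool (nb a b)"
    and h: "snd h \<in> verts (fst h)"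
  shows "looks_like r (G, \<phi> []) h \<longleftrightarrow> tree_looks_like r h I (\<lambda>a. mark G (\<phi> a))"
proof -
  let ?k = "real (inner_radius r)" and ?C = "ball_verts (real (inner_radius r)) h"
  have "\<phi> [] \<in> verts G"
    using root ball by (auto simp: ball_verts_def)
  then have "looks_like r (G, \<phi> []) h \<longleftrightarrow>
     (\<exists>\<psi>. close_iso r \<psi> (nbhd ?k (G, \<phi> [])) (nbhd ?k h))"
    using r fin ball h by (intro looks_like_iff) auto
  also have "\<dots> \<longleftrightarrow> (\<exists>\<psi>. bij_betw \<psi> (\<phi> ` I) ?C \<and> \<psi> (\<phi> []) = snd h \<and>
     (\<forall>a\<in>I. \<forall>b\<in>I. of_bool (nb a b) = mult (fst h) (\<psi> (\<phi> a)) (\<psi> (\<phi> b))) \<and>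
     (\<forall>a\<in>I. \<bar>mark G (\<phi> a) - mark (fst h) (\<psi> (\<phi> a))\<bar> \<le> 1 / r))"
    using r by (auto simp: close_iso_def nbhd_eq ball mult split_beta)
  also have "\<dots> \<longleftrightarrow> tree_looks_like r h I (\<lambda>a. mark G (\<phi> a))"
  proof
    assume "\<exists>\<psi>. bij_betw \<psi> (\<phi> ` I) ?C \<and> \<psi> (\<phi> []) = snd h \<and>
     (\<forall>a\<in>I. \<forall>b\<in>I. of_bool (nb a b) = mult (fst h) (\<psi> (\<phi> a)) (\<psi> (\<phi> b))) \<and>
     (\<forall>a\<in>I. \<bar>mark G (\<phi> a) - mark (fst h) (\<psi> (\<phi> a))\<bar> \<le> 1 / r)"
    then obtain \<psi> where \<psi>: "bij_betw \<psi> (\<phi> ` I) ?C" "\<psi> (\<phi> []) = snd h"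
     "(\<forall>a\<in>I. \<forall>b\<in>I. of_bool (nb a b) = mult (fst h) (\<psi> (\<phi> a)) (\<psi> (\<phi> b)))"
     "(\<forall>a\<in>I. \<bar>mark G (\<phi> a) - mark (fst h) (\<psi> (\<phi> a))\<bar> \<le> 1 / r)" by blast
    have "bij_betw (\<psi> \<circ> \<phi>) I ?C"
      using inj by (intro bij_betw_trans[OF _ \<psi>(1)]) (auto simp: bij_betw_def)
    then show "tree_looks_like r h I (\<lambda>a. mark G (\<phi> a))"
      unfolding tree_looks_like_def using \<psi> by (intro exI[of _ "\<psi> \<circ> \<phi>"]) simp
  next
    assume "tree_looks_like r h I (\<lambda>a. mark G (\<phi> a))"
    then obtain \<psi> where \<psi>: "bij_betw \<psi> I ?C" "\<psi> [] = snd h"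
      "(\<forall>a\<in>I. \<forall>b\<in>I. of_bool (nb a b) = mult (fst h) (\<psi> a) (\<psi> b))"
      "(\<forall>a\<in>I. \<bar>mark G (\<phi> a) - mark (fst h) (\<psi> a)\<bar> \<le> 1 / r)"
      unfolding tree_looks_like_def by auto
    let ?\<psi> = "\<psi> \<circ> inv_into I \<phi>"
    have inv: "inv_into I \<phi> (\<phi> a) = a" if "a \<in> I" for a using inj that by simp
    have "bij_betw (inv_into I \<phi>) (\<phi> ` I) I"
      using inj by (intro bij_betw_inv_into) (auto simp: bij_betw_def)
    then have "bij_betw ?\<psi> (\<phi> ` I) ?C" using \<psi>(1) by (rule bij_betw_trans)
    then show "\<exists>\<psi>. bij_betw \<psi> (\<phi> ` I) ?C \<and> \<psi> (\<phi> []) = snd h \<and>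
     (\<forall>a\<in>I. \<forall>b\<in>I. of_bool (nb a b) = mult (fst h) (\<psi> (\<phi> a)) (\<psi> (\<phi> b))) \<and>
     (\<forall>a\<in>I. \<bar>mark G (\<phi> a) - mark (fst h) (\<psi> (\<phi> a))\<bar> \<le> 1 / r)"
      using \<psi> inv root by (intro exI[of _ ?\<psi>]) simp
  qed
  finally show ?thesis .
qed

section \<open>Poisson processes and their ordered points\<close>

text \<open>Access beyond the end of a list yields an unspecified value, but one that depends only
  on the excess. Order statistics are therefore measurable even where the set has too few
  points.\<close>

lemma nth_beyond_length: "length xs \<le> i \<Longrightarrow> xs ! i = [] ! (i - length xs)"
proof (induction xs arbitrary: i)
  case (Cons x xs)
  then show ?case by (cases i) auto
qed simp

text \<open>Expresses order statistics through counts of points, in terms of which both the law and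
  the measurability of the random sets are given.\<close>

lemma nth_sorted_list_of_set_le_iff:
  fixes X :: "real set"
  assumes X: "finite X" and i: "i < card X"
  shows "sorted_list_of_set X ! i \<le> t \<longleftrightarrow> i < card (X \<inter> {..t})"
proof -
  let ?s = "sorted_list_of_set X"
  have set: "set ?s = X" and len: "length ?s = card X" using X by auto
  have sorted: "?s ! j \<le> ?s ! l" if "j \<le> l" "l < card X" for j l
    using that len by (intro sorted_nth_mono) auto
  have inj: "inj_on ((!) ?s) {..<card X}"
    using len by (intro inj_on_nth) auto
  have img: "((!) ?s) ` {..<card X} = X"
    using len set by (auto simp: set_conv_nth image_def)
  show ?thesis
  proof
    assume le: "?s ! i \<le> t"
    have "((!) ?s) ` {..i} \<subseteq> X \<inter> {..t}"
    proof
      fix y assume "y \<in> ((!) ?s) ` {..i}"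
      then obtain j where j: "j \<le> i" "y = ?s ! j" by auto
      with sorted[of j i] i le img show "y \<in> X \<inter> {..t}" by auto
    qed
    then have "card (((!) ?s) ` {..i}) \<le> card (X \<inter> {..t})"
      using X by (intro card_mono) auto
    moreover have "card (((!) ?s) ` {..i}) = Suc i"
      using i by (subst card_image) (auto intro: inj_on_subset[OF inj])
    ultimately show "i < card (X \<inter> {..t})" by simp
  next
    assume lt: "i < card (X \<inter> {..t})"
    show "?s ! i \<le> t"
    proof (rule ccontr)
      assume "\<not> ?s ! i \<le> t"
      have "X \<inter> {..t} \<subseteq> ((!) ?s) ` {..<i}"
      proof
        fix y assume y: "y \<in> X \<inter> {..t}"
        then obtain j where j: "j < card X" "y = ?s ! j" using img by auto
        have "j < i"
        proof (rule ccontr)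
          assume "\<not> j < i"
          with sorted[of i j] j y \<open>\<not> ?s ! i \<le> t\<close> show False by auto
        qed
        with j show "y \<in> ((!) ?s) ` {..<i}" by auto
      qed
      then have "card (X \<inter> {..t}) \<le> card (((!) ?s) ` {..<i})" by (intro card_mono) auto
      also have "\<dots> \<le> i" using card_image_le[of "{..<i}" "(!) ?s"] by simp
      finally show False using lt by simp
    qed
  qed
qed

lemma borel_measurable_nth_sorted_list_of_set:
  fixes X :: "'a \<Rightarrow> real set"
  assumes fin: "\<And>z. z \<in> space N \<Longrightarrow> finite (X z)"
    and meas: "\<And>B. B \<in> sets borel \<Longrightarrow> (\<lambda>z. card (X z \<inter> B)) \<in> measurable N (count_space UNIV)"
  shows "(\<lambda>z. sorted_list_of_set (X z) ! i) \<in> borel_measurable N"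
proof (rule borel_measurableI_le)
  fix t :: real
  note [measurable] = meas
  have c: "(\<lambda>z. card (X z)) \<in> measurable N (count_space UNIV)"
    using meas[of UNIV] by simp
  note [measurable] = c
  \<comment> \<open>Where the set is too small, the entry is a fixed function of the number of
    points.\<close>
  have "{z \<in> space N. sorted_list_of_set (X z) ! i \<le> t} =
    {z \<in> space N. if i < card (X z) then i < card (X z \<inter> {..t}) else [] ! (i - card (X z)) \<le> t}"
  proof (intro Collect_cong conj_cong refl)
    fix z assume "z \<in> space N"
    then show "(sorted_list_of_set (X z) ! i \<le> t) =
        (if i < card (X z) then i < card (X z \<inter> {..t}) else [] ! (i - card (X z)) \<le> t)"
      using nth_sorted_list_of_set_le_iff[OF fin, of z i t] nth_beyond_length[of "sorted_list_of_set (X z)" i]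
      by (simp add: not_less)
  qed
  also have "\<dots> \<in> sets N"
    by measurable
  finally show "{z \<in> space N. sorted_list_of_set (X z) ! i \<le> t} \<in> sets N" .
qed

lemma sorted_list_of_set_image_strict_mono:
  fixes z :: "nat \<Rightarrow> real"
  assumes "strict_mono_on {..<q} z"
  shows "sorted_list_of_set (z ` {..<q}) = map z [0..<q]"
proof -
  have "sorted_wrt (<) (map z [0..<q])"
    using assms by (auto simp: sorted_wrt_iff_nth_less strict_mono_on_def)
  moreover have "set (map z [0..<q]) = z ` {..<q}" by (auto simp: atLeast0LessThan)
  ultimately show ?thesis
    by (metis finite_imageI finite_lessThan sorted_list_of_set.idem_if_sorted_distinct
        strict_sorted_iff)
qed

section \<open>The uniform law and the intensity of younger children\<close>

abbreviation U01 :: "real measure" where "U01 \<equiv> uniform_measure lborel {0..1}"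

lemma prob_space_U01: "prob_space U01"
  by (intro prob_space_uniform_measure) auto

lemma sets_U01 [simp, measurable_cong]: "sets U01 = sets borel" by simp
lemma space_U01 [simp]: "space U01 = UNIV" by simp

lemma nn_integral_U01:
  assumes [measurable]: "f \<in> borel_measurable borel"
  shows "(\<integral>\<^sup>+x. f x \<partial>U01) = (\<integral>\<^sup>+x. f x * indicator {0..1} x \<partial>lborel)"
  by (subst nn_integral_uniform_measure) (auto simp: divide_ennreal_def)

lemma AE_U01: "AE x in U01. 0 < x \<and> x < 1"
proof -
  have "AE x in lborel. x \<noteq> (0::real)" "AE x in lborel. x \<noteq> (1::real)"
    by (rule AE_lborel_singleton)+
  then have "AE x in lborel. x \<in> {0..1::real} \<longrightarrow> 0 < x \<and> x < 1" by eventually_elim auto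
  then show ?thesis by (intro AE_uniform_measureI) auto
qed

lemma AE_U01_neq: "AE x in U01. x \<noteq> c"
proof -
  have "AE x in lborel. x \<in> {0..1::real} \<longrightarrow> x \<noteq> c"
    using AE_lborel_singleton[of c] by eventually_elim auto
  then show ?thesis by (intro AE_uniform_measureI) auto
qed

definition younger_rate :: "real \<Rightarrow> real \<Rightarrow> real \<Rightarrow> real \<Rightarrow> real" where
  "younger_rate \<kappa> a \<gamma> x = (1 - \<kappa>) * \<gamma> * x powr (- \<kappa>) / a powr (1 - \<kappa>)"

text \<open>The mass of the intensity on \<open>[a, 1]\<close>: integrating
  \<open>(1 - \<kappa>) * x powr (- \<kappa>)\<close> gives
  \<open>1 - a powr (1 - \<kappa>)\<close>, which is multiplied by \<open>\<gamma>\<close> and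
  divided by \<open>a powr (1 - \<kappa>)\<close>.\<close>

definition younger_total :: "real \<Rightarrow> real \<Rightarrow> real \<Rightarrow> real" where
  "younger_total \<kappa> a \<gamma> = \<gamma> * (a powr (\<kappa> - 1) - 1)"

lemma borel_measurable_younger_rate [measurable]: "younger_rate \<kappa> a \<gamma> \<in> borel_measurable borel"
  unfolding younger_rate_def[abs_def] by measurable

lemma sets_younger_intensity: "sets (younger_intensity \<kappa> a \<gamma>) = sets (restrict_space borel {a..1})"
  by (simp add: younger_intensity_def cong: sets_restrict_space_cong)

lemma younger_intensity_Icc: "A \<in> sets borel \<Longrightarrow> A \<inter> {a..1} \<in> sets (younger_intensity \<kappa> a \<gamma>)"
  unfolding sets_younger_intensity by (auto simp: sets_restrict_space)

text \<open>All ages are later compared with independent uniform variables, so the intensity is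
  rewritten with \<open>U01\<close> as reference measure; both integrals run over a subset of
  \<open>[a, 1]\<close>.\<close>

lemma emeasure_younger_intensity:
  assumes "0 < a" "A \<in> sets borel"
  shows "emeasure (younger_intensity \<kappa> a \<gamma>) (A \<inter> {a..1}) =
    (\<integral>\<^sup>+x. ennreal (younger_rate \<kappa> a \<gamma> x) * indicator (A \<inter> {a..1}) x \<partial>U01)"
proof -
  have [measurable]: "A \<in> sets borel" by fact
  have "emeasure (younger_intensity \<kappa> a \<gamma>) (A \<inter> {a..1}) =
    (\<integral>\<^sup>+x. ennreal (younger_rate \<kappa> a \<gamma> x) * indicator (A \<inter> {a..1}) x \<partial>restrict_space lborel {a..1})"
    unfolding younger_intensity_def younger_rate_def
  proof (rule emeasure_density)
    show "(\<lambda>x. ennreal ((1 - \<kappa>) * \<gamma> * x powr - \<kappa> / a powr (1 - \<kappa>))) \<in> borel_measurable (restrict_space lborel {a..1})"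
      by (intro measurable_restrict_space1) measurable
    show "A \<inter> {a..1} \<in> sets (restrict_space lborel {a..1})"
      unfolding sets_restrict_space using assms by (intro image_eqI[of _ _ A]) auto
  qed
  also have "\<dots> = (\<integral>\<^sup>+x. ennreal (younger_rate \<kappa> a \<gamma> x) * indicator (A \<inter> {a..1}) x * indicator {a..1} x \<partial>lborel)"
    by (subst nn_integral_restrict_space) auto
  also have "\<dots> = (\<integral>\<^sup>+x. ennreal (younger_rate \<kappa> a \<gamma> x) * indicator (A \<inter> {a..1}) x \<partial>U01)"
    using assms(1) by (subst nn_integral_U01) (auto intro!: nn_integral_cong split: split_indicator)
  finally show ?thesis .
qed

lemma emeasure_younger_intensity_total:
  assumes "0 < a" "a < 1" "0 < \<gamma>" "0 < \<kappa>" "\<kappa> < 1"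
  shows "emeasure (younger_intensity \<kappa> a \<gamma>) {a..1} = ennreal (younger_total \<kappa> a \<gamma>)"
proof -
  have "emeasure (younger_intensity \<kappa> a \<gamma>) {a..1} =
    (\<integral>\<^sup>+x. ennreal (younger_rate \<kappa> a \<gamma> x) * indicator {a..1} x \<partial>lborel)"
    using assms by (subst emeasure_younger_intensity[of a UNIV, simplified], simp, subst nn_integral_U01)
      (auto intro!: nn_integral_cong split: split_indicator)
  also have "\<dots> = ennreal (\<gamma> * 1 powr (1 - \<kappa>) / a powr (1 - \<kappa>) - \<gamma> * a powr (1 - \<kappa>) / a powr (1 - \<kappa>))"
  proof (rule nn_integral_FTC_Icc)
    fix x assume "x \<in> {a..1}"
    then have x: "a \<le> x" "x \<le> 1" by auto
    then show "0 \<le> younger_rate \<kappa> a \<gamma> x" using assms by (auto simp: younger_rate_def)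
    have "((\<lambda>x. x powr (1 - \<kappa>)) has_real_derivative (1 - \<kappa>) * x powr (1 - \<kappa> - 1)) (at x)"
      using x assms by (intro has_real_derivative_powr) auto
    then have "((\<lambda>x. \<gamma> * x powr (1 - \<kappa>) / a powr (1 - \<kappa>)) has_real_derivative
        \<gamma> * ((1 - \<kappa>) * x powr (1 - \<kappa> - 1)) / a powr (1 - \<kappa>)) (at x)"
      by (intro DERIV_cdivide DERIV_cmult)
    then show "((\<lambda>x. \<gamma> * x powr (1 - \<kappa>) / a powr (1 - \<kappa>)) has_real_derivative younger_rate \<kappa> a \<gamma> x) (at x)"
      by (simp add: younger_rate_def mult_ac)
  qed (use assms in auto)
  also have "\<gamma> * 1 powr (1 - \<kappa>) / a powr (1 - \<kappa>) - \<gamma> * a powr (1 - \<kappa>) / a powr (1 - \<kappa>) = younger_total \<kappa> a \<gamma>"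
    using assms by (simp add: younger_total_def algebra_simps powr_diff powr_minus divide_simps)
  finally show ?thesis .
qed

text \<open>Because the boxes follow one another, points in different boxes are automatically in the
  right order. Statements about order statistics thus become statements about counts in disjoint
  sets, which are independent for a Poisson process.\<close>

lemma sorted_nth_mem_boxes_iff:
  fixes X :: "real set" and B :: "nat \<Rightarrow> real set"
  assumes fin: "finite X" and incr: "\<And>i j x y. i < j \<Longrightarrow> j < q \<Longrightarrow> x \<in> B i \<Longrightarrow> y \<in> B j \<Longrightarrow> x < y"
  shows "(card X = q \<and> (\<forall>i<q. sorted_list_of_set X ! i \<in> B i)) \<longleftrightarrow>
    (\<forall>i<q. card (X \<inter> B i) = 1) \<and> card (X \<inter> - (\<Union>i<q. B i)) = 0" (is "?L \<longleftrightarrow> ?R")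
proof
  assume L: ?L
  let ?s = "sorted_list_of_set X"
  have img: "((!) ?s) ` {..<q} = X"
  proof -
    have "set ?s = X" "length ?s = q" using L fin by auto
    then show ?thesis by (auto simp: set_conv_nth image_def)
  qed
  have "X \<inter> B i = {?s ! i}" if i: "i < q" for i
  proof -
    have "j = i" if "j < q" "?s ! j \<in> B i" for j
    proof (rule ccontr)
      assume "j \<noteq> i"
      with L i that incr[of i j "?s ! j" "?s ! j"] incr[of j i "?s ! j" "?s ! j"]
      show False by (meson linorder_neqE_nat less_irrefl)
    qed
    moreover have "\<exists>j<q. x = ?s ! j" if "x \<in> X" for x using that img by blast
    moreover have "?s ! i \<in> X" using img i by blast
    ultimately show ?thesis using L i by blast
  qed
  moreover have "X \<subseteq> (\<Union>i<q. B i)"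
  proof
    fix x assume "x \<in> X"
    then have "x \<in> ((!) ?s) ` {..<q}" using img by simp
    then obtain j where "j < q" "x = ?s ! j" by auto
    with L show "x \<in> (\<Union>i<q. B i)" by auto
  qed
  then have "X \<inter> - (\<Union>i<q. B i) = {}" by auto
  ultimately show ?R by auto
next
  assume R: ?R
  then have "\<forall>i<q. \<exists>z. X \<inter> B i = {z}" by (simp add: card_1_singleton_iff)
  then obtain z where z: "\<And>i. i < q \<Longrightarrow> X \<inter> B i = {z i}" by metis
  have "X \<inter> - (\<Union>i<q. B i) = {}" using R fin by auto
  then have X: "X = z ` {..<q}" using z by (fastforce simp: set_eq_iff)
  have "strict_mono_on {..<q} z"
  proof (rule strict_mono_onI)
    fix i j assume ij: "i \<in> {..<q}" "j \<in> {..<q}" "i < j"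
    then have "z i \<in> B i" "z j \<in> B j" using z[of i] z[of j] by auto
    then show "z i < z j" using incr ij by auto
  qed
  then have s: "sorted_list_of_set X = map z [0..<q]" and "inj_on z {..<q}"
    by (auto simp: X sorted_list_of_set_image_strict_mono strict_mono_on_imp_inj_on)
  then have "card X = q" by (simp add: X card_image)
  then show ?L using z by (auto simp: s)
qed

text \<open>Disjointing the cover cuts \<open>A\<close> into countably many pieces that each lie in
  some \<open>B n\<close>. It is used with boxes that separate the points of an ordered tuple by
  rational numbers.\<close>

lemma measure_eq_countable_cover:
  assumes [simp]: "sets M = sets N" and A: "A \<in> sets N" and sub: "A \<subseteq> (\<Union>n::nat. B n)"
    and B: "\<And>n. B n \<in> sets N"
    and eq: "\<And>n C. C \<in> sets N \<Longrightarrow> C \<subseteq> B n \<Longrightarrow> emeasure M C = emeasure N C"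
  shows "emeasure M A = emeasure N A"
proof -
  have D: "disjointed B n \<in> sets N" for n
    using B sets.range_disjointed_sets[of B N] by auto
  have un: "A \<inter> (\<Union>n. disjointed B n) = A"
    using sub by (auto simp: UN_disjointed_eq)
  have dis: "disjoint_family (\<lambda>n. A \<inter> disjointed B n)"
    using disjoint_family_disjointed[of B] by (auto simp: disjoint_family_on_def)
  have "emeasure M A = (\<Sum>n. emeasure M (A \<inter> disjointed B n))"
    using A D dis by (subst suminf_emeasure) (auto simp: un)
  also have "\<dots> = (\<Sum>n. emeasure N (A \<inter> disjointed B n))"
    using A D disjointed_subset[of B] by (intro suminf_cong eq) auto
  also have "\<dots> = emeasure N A"
    using A D dis by (subst suminf_emeasure) (auto simp: un)
  finally show ?thesis .
qed

section \<open>The joint density of the ordered points of a Poisson process\<close>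

definition ordered_above :: "real \<Rightarrow> nat \<Rightarrow> (nat \<Rightarrow> real) \<Rightarrow> bool" where
  "ordered_above a q y \<longleftrightarrow> (\<forall>i<q. a < y i \<and> y i \<le> 1) \<and> (\<forall>i j. i < j \<longrightarrow> j < q \<longrightarrow> y i < y j)"

locale younger_points =
  fixes \<kappa> a \<gamma> :: real and Q :: "'v measure" and X :: "'v \<Rightarrow> real set"
  assumes kappa: "0 < \<kappa>" "\<kappa> < 1" and a: "0 < a" "a < 1" and gamma: "0 < \<gamma>"
    and poisson: "poisson_process Q (younger_intensity \<kappa> a \<gamma>) X"
begin

abbreviation "I \<equiv> younger_intensity \<kappa> a \<gamma>"
abbreviation "rate \<equiv> younger_rate \<kappa> a \<gamma>"
abbreviation "tot \<equiv> younger_total \<kappa> a \<gamma>"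
abbreviation "PU q \<equiv> (\<Pi>\<^sub>M i\<in>{..<q::nat}. U01)"

sublocale prob_space Q using poisson by (simp add: poisson_process_def)

lemma space_I: "space I = {a..1}"
  by (simp add: younger_intensity_def)

lemma X: "\<xi> \<in> space Q \<Longrightarrow> finite (X \<xi>)" "\<xi> \<in> space Q \<Longrightarrow> X \<xi> \<subseteq> {a..1}"
  using poisson space_I by (auto simp: poisson_process_def)

lemma total_pos: "tot > 0"
proof -
  have "1 powr (\<kappa> - 1) < a powr (\<kappa> - 1)" using kappa a by (intro powr_less_mono2_neg) auto
  then show ?thesis using gamma by (simp add: younger_total_def)
qed

lemma card_measurable [measurable]:
  assumes "B \<in> sets borel" shows "(\<lambda>\<xi>. card (X \<xi> \<inter> B)) \<in> measurable Q (count_space UNIV)"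
proof -
  have "(\<lambda>\<xi>. card (X \<xi> \<inter> (B \<inter> {a..1}))) \<in> measurable Q (count_space UNIV)"
    using poisson younger_intensity_Icc[OF assms] by (auto simp: poisson_process_def)
  also have "?this \<longleftrightarrow> ?thesis"
    using X(2) by (intro measurable_cong arg_cong[of _ _ card]) auto
  finally show ?thesis .
qed

lemma card_measurable' [measurable]: "(\<lambda>\<xi>. card (X \<xi>)) \<in> measurable Q (count_space UNIV)"
  using card_measurable[of UNIV] by simp

lemma nth_measurable [measurable]: "(\<lambda>\<xi>. sorted_list_of_set (X \<xi>) ! i) \<in> borel_measurable Q"
  using X by (intro borel_measurable_nth_sorted_list_of_set) auto

definition pts :: "nat \<Rightarrow> 'v \<Rightarrow> nat \<Rightarrow> real" where
  "pts q \<xi> = (\<lambda>i\<in>{..<q}. sorted_list_of_set (X \<xi>) ! i)"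

lemma pts_measurable [measurable]: "pts q \<in> measurable Q (PU q)"
  unfolding pts_def[abs_def] by (intro measurable_restrict) simp

text \<open>One point in each box and none elsewhere: the counts are independent, each box
  contributes its mass times an exponential, and all exponentials multiply to the probability
  \<open>exp (- tot)\<close> of an empty process.\<close>

lemma emeasure_boxes:
  fixes B :: "nat \<Rightarrow> real set"
  assumes B: "\<And>i. i < q \<Longrightarrow> B i \<in> sets borel" "\<And>i. i < q \<Longrightarrow> B i \<subseteq> {a..1}"
    and incr: "\<And>i j x y. i < j \<Longrightarrow> j < q \<Longrightarrow> x \<in> B i \<Longrightarrow> y \<in> B j \<Longrightarrow> x < y"
  shows "emeasure Q {\<xi>\<in>space Q. card (X \<xi>) = q \<and> (\<forall>i<q. sorted_list_of_set (X \<xi>) ! i \<in> B i)} =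
    ennreal (exp (- tot)) * (\<Prod>i<q. \<integral>\<^sup>+x. ennreal (rate x) * indicator (B i) x \<partial>U01)"
proof -
  interpret I: finite_measure I
    using emeasure_younger_intensity_total[of a \<gamma> \<kappa>] kappa a gamma
    by (intro finite_measureI) (simp add: space_I)
  \<comment> \<open>The boxes are completed by the leftover set \<open>C q\<close>, whose count must
    be \<open>0\<close>, so that the total number of points is fixed by counts in disjoint
    sets.\<close>
  define C where "C i = (if i < q then B i else {a..1} - (\<Union>i<q. B i))" for i
  have Cs: "C i \<in> sets I" for i
  proof -
    have "C i \<in> sets borel" unfolding C_def using B by auto
    moreover have "C i \<inter> {a..1} = C i" using B by (auto simp: C_def)
    ultimately show ?thesis using younger_intensity_Icc[of "C i" a \<kappa> \<gamma>] by simp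
  qed
  have dis: "disjoint_family_on C {..<Suc q}"
    unfolding disjoint_family_on_def
  proof (intro ballI impI)
    fix i j assume ij: "i \<in> {..<Suc q}" "j \<in> {..<Suc q}" "i \<noteq> j"
    show "C i \<inter> C j = {}"
      using ij incr[of i j] incr[of j i] by (cases "i < j"; force simp: C_def)
  qed
  define k where "k i = (if i < q then 1 else 0::nat)" for i
  have eq: "{\<xi>\<in>space Q. card (X \<xi>) = q \<and> (\<forall>i<q. sorted_list_of_set (X \<xi>) ! i \<in> B i)} =
    {\<xi>\<in>space Q. \<forall>i\<in>{..<Suc q}. card (X \<xi> \<inter> C i) \<in> {k i}}"
  proof (intro Collect_cong conj_cong refl)
    fix \<xi> assume \<xi>: "\<xi> \<in> space Q"
    have "X \<xi> \<inter> - (\<Union>i<q. B i) = X \<xi> \<inter> C q" using X(2)[OF \<xi>] by (auto simp: C_def)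
    then show "(card (X \<xi>) = q \<and> (\<forall>i<q. sorted_list_of_set (X \<xi>) ! i \<in> B i)) \<longleftrightarrow>
      (\<forall>i\<in>{..<Suc q}. card (X \<xi> \<inter> C i) \<in> {k i})"
      using sorted_nth_mem_boxes_iff[OF X(1)[OF \<xi>] incr] by (auto simp: C_def k_def less_Suc_eq)
  qed
  have ind: "indep_vars (\<lambda>_. count_space UNIV) (\<lambda>i \<xi>. card (X \<xi> \<inter> C i)) {..<Suc q}"
    using poisson dis Cs unfolding poisson_process_def by blast
  have "prob {\<xi>\<in>space Q. \<forall>i\<in>{..<Suc q}. card (X \<xi> \<inter> C i) \<in> {k i}} =
     prob (\<Inter>i\<in>{..<Suc q}. (\<lambda>\<xi>. card (X \<xi> \<inter> C i)) -` {k i} \<inter> space Q)"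
    by (intro arg_cong[of _ _ prob]) auto
  also have "\<dots> = (\<Prod>i\<in>{..<Suc q}. prob ((\<lambda>\<xi>. card (X \<xi> \<inter> C i)) -` {k i} \<inter> space Q))"
    by (intro indep_varsD[OF ind]) auto
  also have "\<dots> = (\<Prod>i\<in>{..<Suc q}. measure I (C i) ^ k i / fact (k i) * exp (- measure I (C i)))"
  proof (intro prod.cong refl)
    fix i
    have "(\<lambda>\<xi>. card (X \<xi> \<inter> C i)) -` {k i} \<inter> space Q = {\<xi>\<in>space Q. card (X \<xi> \<inter> C i) = k i}" by auto
    then show "prob ((\<lambda>\<xi>. card (X \<xi> \<inter> C i)) -` {k i} \<inter> space Q) = measure I (C i) ^ k i / fact (k i) * exp (- measure I (C i))"
      using poisson Cs by (simp add: poisson_process_def)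
  qed
  also have "\<dots> = (\<Prod>i\<in>{..<Suc q}. measure I (C i) ^ k i) * (\<Prod>i\<in>{..<Suc q}. exp (- measure I (C i)))"
    by (subst prod.distrib[symmetric], intro prod.cong) (auto simp: k_def)
  also have "(\<Prod>i\<in>{..<Suc q}. measure I (C i) ^ k i) = (\<Prod>i<q. measure I (B i))"
    by (auto simp: k_def C_def intro!: prod.cong)
  also have "(\<Prod>i\<in>{..<Suc q}. exp (- measure I (C i))) = exp (- (\<Sum>i\<in>{..<Suc q}. measure I (C i)))"
    by (simp add: exp_sum sum_negf[symmetric] del: sum.lessThan_Suc prod.lessThan_Suc)
  also have "(\<Sum>i\<in>{..<Suc q}. measure I (C i)) = measure I (\<Union>i\<in>{..<Suc q}. C i)"
    using Cs dis by (intro I.finite_measure_finite_Union[symmetric]) auto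
  also have "(\<Union>i\<in>{..<Suc q}. C i) = {a..1}"
    using B(2) by (auto simp: C_def less_Suc_eq split: if_splits)
  also have "measure I {a..1} = tot"
    using emeasure_younger_intensity_total[of a \<gamma> \<kappa>] kappa a gamma total_pos by (simp add: measure_def)
  finally have "emeasure Q {\<xi>\<in>space Q. card (X \<xi>) = q \<and> (\<forall>i<q. sorted_list_of_set (X \<xi>) ! i \<in> B i)} =
     ennreal ((\<Prod>i<q. measure I (B i)) * exp (- tot))"
    unfolding eq emeasure_eq_measure by simp
  also have "\<dots> = ennreal (exp (- tot)) * (\<Prod>i<q. ennreal (measure I (B i)))"
    by (simp add: ennreal_mult prod_nonneg prod_ennreal mult.commute)
  also have "(\<Prod>i<q. ennreal (measure I (B i))) = (\<Prod>i<q. \<integral>\<^sup>+x. ennreal (rate x) * indicator (B i) x \<partial>U01)"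
  proof (intro prod.cong refl)
    fix i assume "i \<in> {..<q}"
    then have i: "i < q" by simp
    then have "B i \<inter> {a..1} = B i" using B(2) by auto
    then show "ennreal (measure I (B i)) = (\<integral>\<^sup>+x. ennreal (rate x) * indicator (B i) x \<partial>U01)"
      using emeasure_younger_intensity[of a "B i" \<kappa> \<gamma>] a B(1)[OF i] Cs[of i] i
      by (simp add: C_def I.emeasure_eq_measure)
  qed
  finally show ?thesis .
qed

lemma ordered_above_measurable [measurable]: "Measurable.pred (PU q) (ordered_above a q)"
  unfolding ordered_above_def[abs_def] by measurable

text \<open>Product sets inside a box form an intersection-stable generator on which
  \<open>emeasure_boxes\<close> identifies the law, and countably many boxes with rational cuts
  cover all ordered tuples. No factorial appears because the points are sorted.\<close>

theorem nn_integral_ordered_points: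
  assumes [measurable]: "H \<in> borel_measurable (PU q)"
  shows "(\<integral>\<^sup>+\<xi>. indicator {\<xi>. card (X \<xi>) = q} \<xi> * H (pts q \<xi>) \<partial>Q) =
    (\<integral>\<^sup>+y. ennreal (exp (- tot)) * (\<Prod>i<q. ennreal (rate (y i))) * indicator {y. ordered_above a q y} y * H y \<partial>PU q)"
proof -
  interpret U: prob_space U01 by (rule prob_space_U01)
  interpret PU: product_sigma_finite "\<lambda>_::nat. U01" ..
  define \<mu>1 where "\<mu>1 = distr (density Q (indicator {\<xi>\<in>space Q. card (X \<xi>) = q})) (PU q) (pts q)"
  define w where "w y = ennreal (exp (- tot)) * (\<Prod>i<q. ennreal (rate (y i))) * indicator {y. ordered_above a q y} y" for y
  define \<mu>2 where "\<mu>2 = density (PU q) w"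
  have w [measurable]: "w \<in> borel_measurable (PU q)"
    unfolding w_def[abs_def] by measurable
  have s [simp]: "sets \<mu>1 = sets (PU q)" "sets \<mu>2 = sets (PU q)"
    by (simp_all add: \<mu>1_def \<mu>2_def)
  have m1: "emeasure \<mu>1 A = emeasure Q {\<xi>\<in>space Q. card (X \<xi>) = q \<and> pts q \<xi> \<in> A}" if [measurable]: "A \<in> sets (PU q)" for A
  proof -
    have "emeasure \<mu>1 A = (\<integral>\<^sup>+\<xi>. indicator {\<xi>\<in>space Q. card (X \<xi>) = q} \<xi> * indicator (pts q -` A \<inter> space Q) \<xi> \<partial>Q)"
      unfolding \<mu>1_def by (subst emeasure_distr) (auto simp: emeasure_density)
    also have "\<dots> = (\<integral>\<^sup>+\<xi>. indicator {\<xi>\<in>space Q. card (X \<xi>) = q \<and> pts q \<xi> \<in> A} \<xi> \<partial>Q)"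
      by (intro nn_integral_cong) (auto split: split_indicator)
    also have "\<dots> = emeasure Q {\<xi>\<in>space Q. card (X \<xi>) = q \<and> pts q \<xi> \<in> A}"
      by (intro nn_integral_indicator) measurable
    finally show ?thesis .
  qed
  \<comment> \<open>Box \<open>i\<close> is the interval between two consecutive cuts. The outer
    cuts are \<open>a\<close> and \<open>1\<close>, the inner ones are rational, so there are
    countably many boxes. Cuts in the wrong order give an empty \<open>Box\<close>.\<close>
  define cut where "cut c i = (if i = 0 then a else if q \<le> i then 1 else of_rat (c ! i))" for c :: "rat list" and i
  define Box where "Box c = {y \<in> space (PU q). (\<forall>i<q. cut c i < cut c (Suc i)) \<and> (\<forall>i<q. cut c i < y i \<and> y i \<le> cut c (Suc i))}" for c
  have Box [measurable]: "Box c \<in> sets (PU q)" for c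
    unfolding Box_def by measurable
  have incr: "cut c (Suc i) \<le> cut c j" if "\<forall>i<q. cut c i < cut c (Suc i)" "i < j" "j \<le> q" for c i j
    using that(2,3)
  proof (induction j)
    case (Suc j)
    have "cut c j < cut c (Suc j)" using that(1) Suc.prems by auto
    with Suc show ?case by (cases "i = j") auto
  qed simp
  have eq_box: "emeasure \<mu>1 (A \<inter> Box c) = emeasure \<mu>2 (A \<inter> Box c)" if [measurable]: "A \<in> sets (PU q)" for A c
  proof (cases "\<forall>i<q. cut c i < cut c (Suc i)")
    case False
    then have "Box c = {}" by (auto simp: Box_def)
    then show ?thesis by simp
  next
    case mono: True
    have cut01: "a \<le> cut c i \<and> cut c (Suc i) \<le> 1" if "i < q" for i
    proof -
      have "cut c (Suc i) \<le> cut c q" using incr[OF mono, of i q] that by auto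
      moreover have "a \<le> cut c i"
        using incr[OF mono, of 0 i] mono that by (cases "i = 0") (force simp: cut_def)+
      ultimately show ?thesis using that by (simp add: cut_def)
    qed
    let ?m1 = "density \<mu>1 (indicator (Box c))" and ?m2 = "density \<mu>2 (indicator (Box c))"
    have "?m1 = ?m2"
    proof (rule measure_eqI_PiM_infinite)
      show "sets ?m1 = sets (PU q)" "sets ?m2 = sets (PU q)" by simp_all
      have "emeasure \<mu>1 (Box c) \<le> emeasure Q (space Q)"
        by (subst m1, simp, rule emeasure_space)
      moreover have "emeasure ?m1 (space ?m1) = emeasure \<mu>1 (Box c \<inter> space \<mu>1)"
        using sets.top[of \<mu>1] by (subst emeasure_restricted) (auto simp del: sets.top)
      moreover have "Box c \<inter> space \<mu>1 = Box c"
        by (intro sets.Int_space_eq2) simp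
      ultimately show "finite_measure ?m1"
        by (intro finite_measureI) (auto simp: emeasure_space_1 top_unique)
      fix A J assume J: "finite J" "J \<subseteq> {..<q}" and A: "\<And>i. i \<in> J \<Longrightarrow> A i \<in> sets U01"
      define B where "B i = (if i \<in> J then A i else UNIV) \<inter> {cut c i<..cut c (Suc i)}" for i
      have Bs [measurable]: "B i \<in> sets borel" for i using A by (auto simp: B_def)
      let ?E = "prod_emb {..<q} (\<lambda>_. U01) J (Pi\<^sub>E J A)"
      have E: "?E \<in> sets (PU q)" using J A by (intro sets_PiM_I) auto
      have EB: "?E \<inter> Box c = Pi\<^sub>E {..<q} B"
        using J mono by (auto simp: prod_emb_def Box_def B_def space_PiM PiE_iff Ball_def)
          (metis lessThan_iff subsetD)
      have "emeasure ?m1 ?E = emeasure \<mu>1 (?E \<inter> Box c)"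
        using E by (subst emeasure_restricted) (auto simp: Int_commute)
      also have "\<dots> = emeasure Q {\<xi>\<in>space Q. card (X \<xi>) = q \<and> (\<forall>i<q. sorted_list_of_set (X \<xi>) ! i \<in> B i)}"
        unfolding EB by (subst m1) (auto simp: pts_def PiE_iff intro!: arg_cong[of _ _ "emeasure Q"])
      also have "\<dots> = ennreal (exp (- tot)) * (\<Prod>i<q. \<integral>\<^sup>+x. ennreal (rate x) * indicator (B i) x \<partial>U01)"
      proof (rule emeasure_boxes)
        fix i assume "i < q" then show "B i \<subseteq> {a..1}" using cut01[of i] by (auto simp: B_def)
      next
        fix i j x y assume "i < j" "j < q" "x \<in> B i" "y \<in> B j"
        then show "x < y" using incr[OF mono, of i j] by (auto simp: B_def)
      qed simp
      also have "(\<Prod>i<q. \<integral>\<^sup>+x. ennreal (rate x) * indicator (B i) x \<partial>U01) =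
         (\<integral>\<^sup>+y. (\<Prod>i<q. ennreal (rate (y i)) * indicator (B i) (y i)) \<partial>PU q)"
        by (intro PU.product_nn_integral_prod[symmetric]) auto
      also have "ennreal (exp (- tot)) * \<dots> = (\<integral>\<^sup>+y. ennreal (exp (- tot)) * (\<Prod>i<q. ennreal (rate (y i)) * indicator (B i) (y i)) \<partial>PU q)"
        by (intro nn_integral_cmult[symmetric]) measurable
      also have "\<dots> = (\<integral>\<^sup>+y. w y * indicator (?E \<inter> Box c) y \<partial>PU q)"
      proof (intro nn_integral_cong)
        fix y assume y: "y \<in> space (PU q)"
        show "ennreal (exp (- tot)) * (\<Prod>i<q. ennreal (rate (y i)) * indicator (B i) (y i)) = w y * indicator (?E \<inter> Box c) y"
        proof (cases "\<forall>i<q. y i \<in> B i")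
          case True
          then have b: "cut c i < y i" "y i \<le> cut c (Suc i)" if "i < q" for i
            using that by (auto simp: B_def)
          have "ordered_above a q y"
            unfolding ordered_above_def
          proof (intro conjI allI impI)
            fix i assume "i < q"
            then show "a < y i" "y i \<le> 1" using b[of i] cut01[of i] by auto
          next
            fix i j assume "i < j" "j < q"
            then show "y i < y j" using b[of i] b[of j] incr[OF mono, of i j] by auto
          qed
          moreover have "y \<in> Pi\<^sub>E {..<q} B" using True y by (auto simp: space_PiM PiE_iff)
          ultimately show ?thesis using True by (simp add: w_def EB prod.distrib)
        next
          case False
          then obtain i where "i < q" "y i \<notin> B i" by auto
          then have "(\<Prod>i<q. ennreal (rate (y i)) * indicator (B i) (y i)) = 0"
            by (intro prod_zero) (auto intro!: bexI[of _ i])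
          moreover have "y \<notin> Pi\<^sub>E {..<q} B" using \<open>i < q\<close> \<open>y i \<notin> B i\<close> by (auto simp: PiE_iff)
          ultimately show ?thesis by (simp add: EB)
        qed
      qed
      also have "\<dots> = emeasure \<mu>2 (?E \<inter> Box c)"
        unfolding \<mu>2_def using E by (subst emeasure_density) auto
      also have "\<dots> = emeasure ?m2 ?E"
        using E by (subst emeasure_restricted) (auto simp: Int_commute)
      finally show "emeasure ?m1 ?E = emeasure ?m2 ?E" .
    qed
    then have "emeasure ?m1 A = emeasure ?m2 A" by simp
    then show ?thesis
      by (simp add: emeasure_restricted Int_commute)
  qed
  define OS where "OS = {y \<in> space (PU q). ordered_above a q y}"
  have OS [measurable]: "OS \<in> sets (PU q)" unfolding OS_def by measurable
  have cover: "OS \<subseteq> (\<Union>c. Box c)"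
  proof
    fix y assume y: "y \<in> OS"
    then have o: "\<And>i. i < q \<Longrightarrow> a < y i \<and> y i \<le> 1" "\<And>i j. i < j \<Longrightarrow> j < q \<Longrightarrow> y i < y j"
      by (auto simp: OS_def ordered_above_def)
    \<comment> \<open>Consecutive points of an ordered tuple are distinct, so a rational cut fits
      between them.\<close>
    have "\<forall>i. \<exists>r::rat. 0 < i \<longrightarrow> i < q \<longrightarrow> y (i - 1) < of_rat r \<and> of_rat r < y i"
      using o(2) by (metis of_rat_dense diff_less zero_less_one)
    then obtain \<rho> where \<rho>: "\<And>i. 0 < i \<Longrightarrow> i < q \<Longrightarrow> y (i - 1) < of_rat (\<rho> i) \<and> of_rat (\<rho> i) < y i" by metis
    define c where "c = map \<rho> [0..<q]"
    have b: "cut c i < y i" "y i \<le> cut c (Suc i)" if "i < q" for i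
      using that o(1)[OF that] \<rho>[of i] \<rho>[of "Suc i"] by (auto simp: cut_def c_def)
    then have "y \<in> Box c" using y by (force simp: Box_def OS_def)
    then show "y \<in> (\<Union>c. Box c)" by auto
  qed
  have "\<mu>1 = \<mu>2"
  proof (rule measure_eqI)
    fix A assume "A \<in> sets \<mu>1"
    then have A [measurable]: "A \<in> sets (PU q)" by simp
    have "emeasure \<mu>1 (A \<inter> OS) = emeasure \<mu>2 (A \<inter> OS)"
    proof (rule measure_eq_countable_cover[where B="\<lambda>n. Box (from_nat n)"])
      show "A \<inter> OS \<subseteq> (\<Union>n. Box (from_nat n))"
        using cover by (auto, metis (no_types, lifting) UN_iff from_nat_to_nat subsetD)
      fix n C assume "C \<in> sets \<mu>2" "C \<subseteq> Box (from_nat n)"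
      then show "emeasure \<mu>1 C = emeasure \<mu>2 C" using eq_box[of C "from_nat n"] by (simp add: Int_absorb2)
    qed auto
    \<comment> \<open>The process lives on the closed interval \<open>{a..1}\<close> whereas
      \<open>ordered_above\<close> excludes \<open>a\<close>; the single point \<open>a\<close>
      carries no intensity and is almost surely not hit.\<close>
    moreover have "emeasure \<mu>1 (A - OS) = 0"
    proof -
      have a_in: "{a} = {a} \<inter> {a..1}" using a by auto
      have "emeasure I {a} = (\<integral>\<^sup>+x. ennreal (rate x) * indicator {a} x \<partial>U01)"
        using emeasure_younger_intensity[of a "{a}" \<kappa> \<gamma>] a a_in by simp
      also have "\<dots> = 0"
        using AE_U01_neq[of a] by (subst nn_integral_0_iff_AE) (auto elim!: eventually_mono)
      finally have "measure I {a} = 0" by (simp add: measure_def)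
      moreover have "{a} \<in> sets I" using younger_intensity_Icc[of "{a}" a \<kappa> \<gamma>] a_in by simp
      moreover have m: "{\<xi>\<in>space Q. card (X \<xi> \<inter> {a}) = 0} \<in> events" by measurable
      moreover have "prob {\<xi>\<in>space Q. card (X \<xi> \<inter> {a}) = 0} =
          measure I {a} ^ 0 / fact 0 * exp (- measure I {a})"
        using poisson \<open>{a} \<in> sets I\<close> unfolding poisson_process_def by blast
      ultimately have "AE \<xi> in Q. card (X \<xi> \<inter> {a}) = 0"
        using prob_Collect_eq_1[OF m] by simp
      then have "AE \<xi> in Q. \<not> (card (X \<xi>) = q \<and> pts q \<xi> \<in> A - OS)"
        using AE_space
      proof eventually_elim
        case (elim \<xi>)
        let ?s = "sorted_list_of_set (X \<xi>)"
        have fin: "finite (X \<xi>)" using X elim by auto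
        have "a \<notin> X \<xi>" using elim fin by auto
        have "ordered_above a q (pts q \<xi>)" if card: "card (X \<xi>) = q"
        proof -
          have "?s ! i \<in> X \<xi>" if "i < q" for i
            using that card fin nth_mem[of i ?s] by simp
          moreover have "?s ! i < ?s ! j" if "i < j" "j < q" for i j
            using that card fin by (intro sorted_wrt_nth_less[of "(<)"]) auto
          ultimately show ?thesis
            using X(2)[OF elim(2)] \<open>a \<notin> X \<xi>\<close> unfolding ordered_above_def pts_def
            by (simp add: subset_iff) (metis order_le_less)
        qed
        moreover have "pts q \<xi> \<in> space (PU q)" by (auto simp: pts_def space_PiM)
        ultimately show ?case by (auto simp: OS_def)
      qed
      then show ?thesis by (subst m1) (auto intro!: emeasure_eq_0_AE)
    qed
    moreover have "emeasure \<mu>2 (A - OS) = 0"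
      unfolding \<mu>2_def by (subst emeasure_density, simp, simp, subst nn_integral_0_iff_AE)
        (auto simp: w_def OS_def split: split_indicator intro!: AE_I2)
    ultimately show "emeasure \<mu>1 A = emeasure \<mu>2 A"
      using emeasure_Un_Int[of "A \<inter> OS" \<mu>1 "A - OS"] emeasure_Un_Int[of "A \<inter> OS" \<mu>2 "A - OS"]
      by (simp add: Int_Diff_Un) (metis Diff_disjoint Int_Diff_Un A OS add.right_neutral emeasure_empty s sets.Diff sets.Int inf_assoc Int_Diff)
  qed simp
  have "(\<integral>\<^sup>+\<xi>. indicator {\<xi>. card (X \<xi>) = q} \<xi> * H (pts q \<xi>) \<partial>Q) = (\<integral>\<^sup>+y. H y \<partial>\<mu>1)"
    unfolding \<mu>1_def by (subst nn_integral_distr, simp, simp, subst nn_integral_density)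
      (auto intro!: nn_integral_cong split: split_indicator)
  also have "\<dots> = (\<integral>\<^sup>+y. w y * H y \<partial>PU q)"
    unfolding \<open>\<mu>1 = \<mu>2\<close> \<mu>2_def by (subst nn_integral_density) auto
  finally show ?thesis by (simp add: w_def)
qed

end

section \<open>Parameters\<close>

locale pa_params =
  fixes M :: "nat pmf" and \<delta> :: real
  assumes M_ge1: "\<And>k. k \<in> set_pmf M \<Longrightarrow> k \<ge> 1"
    and M_integrable: "integrable (measure_pmf M) real"
    and delta_gt: "\<delta> > - real (Inf (set_pmf M))"
begin

definition "EM = measure_pmf.expectation M real"
text \<open>The growth per vertex of the normalisation: a new vertex adds on average
  \<open>2 * EM\<close> to the total degree and \<open>\<delta>\<close> to the sum of the
  shifts.\<close>

definition "\<mu> = 2 * EM + \<delta>"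
abbreviation "\<kappa> \<equiv> chi M \<delta>"

lemma weight_pos: "k \<in> set_pmf M \<Longrightarrow> real k + \<delta> > 0"
proof -
  assume "k \<in> set_pmf M"
  then have "Inf (set_pmf M) \<le> k" by (intro cInf_lower) auto
  then show "real k + \<delta> > 0" using delta_gt by linarith
qed

lemma EM_ge1: "EM \<ge> 1"
  unfolding EM_def using M_ge1
  by (intro measure_pmf.integral_ge_const M_integrable) (auto simp: AE_measure_pmf_iff)

lemma EM_delta_pos: "EM + \<delta> > 0"
proof -
  have "real (Inf (set_pmf M)) \<le> EM"
    unfolding EM_def
    by (intro measure_pmf.integral_ge_const M_integrable)
      (auto simp: AE_measure_pmf_iff intro: cInf_lower)
  then show ?thesis using delta_gt by linarith
qed

lemma mu_pos: "\<mu> > 0"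
  using EM_ge1 EM_delta_pos unfolding \<mu>_def by linarith

lemma kappa_eq: "\<kappa> = (EM + \<delta>) / \<mu>"
  by (simp add: chi_def EM_def \<mu>_def)

lemma one_minus_kappa: "1 - \<kappa> = EM / \<mu>"
  using mu_pos by (simp add: kappa_eq field_simps) (simp add: \<mu>_def)

lemma kappa_bounds: "0 < \<kappa>" "\<kappa> < 1"
proof -
  show "0 < \<kappa>" using mu_pos EM_delta_pos by (simp add: kappa_eq)
  have "0 < 1 - \<kappa>" unfolding one_minus_kappa using mu_pos EM_ge1 by simp
  then show "\<kappa> < 1" by simp
qed

text \<open>\<open>embed_pmf\<close> returns the given weights only if they are nonnegative and sum
  to \<open>1\<close>. Off the support of \<open>M\<close> the factor \<open>real k + d\<close> may
  be negative, but there \<open>pmf M k\<close> vanishes.\<close>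

lemma pmf_tilted:
  assumes "\<And>k. k \<in> set_pmf M \<Longrightarrow> real k + d \<ge> 0" "EM + d > 0"
  shows "pmf (tilted M d) k = (real k + d) / (EM + d) * pmf M k"
proof -
  have nn: "0 \<le> (real k + d) / (EM + d) * pmf M k" for k
    using assms by (cases "k \<in> set_pmf M") (auto simp: set_pmf_iff)
  have "(\<integral>\<^sup>+k. ennreal ((real k + d) / (EM + d) * pmf M k) \<partial>count_space UNIV) =
    (\<integral>\<^sup>+k. ennreal ((real k + d) / (EM + d)) \<partial>measure_pmf M)"
    unfolding nn_integral_measure_pmf using assms
    by (intro nn_integral_cong, case_tac "x \<in> set_pmf M")
      (auto simp: set_pmf_iff ennreal_mult[symmetric] mult.commute intro!: arg_cong[of _ _ ennreal])
  also have "\<dots> = ennreal (\<integral>k. (real k + d) / (EM + d) \<partial>measure_pmf M)"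
    using assms M_integrable by (intro nn_integral_eq_integral) (auto simp: AE_measure_pmf_iff)
  also have "(\<integral>k. (real k + d) / (EM + d) \<partial>measure_pmf M) = 1"
    using assms M_integrable by (simp add: EM_def)
  finally show ?thesis
    using nn unfolding tilted_def EM_def by (subst pmf_embed_pmf) (auto simp: EM_def)
qed

definition strength_shape :: "node \<Rightarrow> nat \<Rightarrow> real" where
  "strength_shape \<nu> k = real k + \<delta> + (if \<nu> = [] then 0 else 1)"

definition is_young :: "node \<Rightarrow> bool" where
  "is_young \<nu> \<longleftrightarrow> (\<exists>i \<nu>'. \<nu> = (Young, i) # \<nu>')"

definition is_old :: "node \<Rightarrow> bool" where
  "is_old \<nu> \<longleftrightarrow> (\<exists>i \<nu>'. \<nu> = (Old, i) # \<nu>')"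

lemma is_young_simps [simp]:
  "\<not> is_young []" "\<not> is_young ((Old, i) # \<nu>)" "is_young ((Young, i) # \<nu>)"
  "\<not> is_old []" "is_old ((Old, i) # \<nu>)" "\<not> is_old ((Young, i) # \<nu>)"
  by (auto simp: is_young_def is_old_def)

lemma node_cases:
  obtains "\<nu> = []" | i \<nu>' where "\<nu> = (Old, i) # \<nu>'" | i \<nu>' where "\<nu> = (Young, i) # \<nu>'"
proof (cases \<nu>)
  case (Cons c \<nu>')
  then show ?thesis using that by (cases c; cases "fst c") auto
qed (use that in auto)

lemma pmf_m_law:
  "pmf (m_law M \<delta> []) k = pmf M k"
  "pmf (m_law M \<delta> ((Old, i) # \<nu>)) k = (real k + \<delta>) / (EM + \<delta>) * pmf M k"
  "pmf (m_law M \<delta> ((Young, i) # \<nu>)) k = (real k + 1) / EM * pmf M (k + 1)"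
proof -
  have t: "pmf (tilted M 0) k = real k / EM * pmf M k" for k
    using pmf_tilted[of 0] EM_ge1 by simp
  show "pmf (m_law M \<delta> []) k = pmf M k" by simp
  show "pmf (m_law M \<delta> ((Old, i) # \<nu>)) k = (real k + \<delta>) / (EM + \<delta>) * pmf M k"
    using pmf_tilted[of \<delta> k] EM_delta_pos weight_pos by (simp add: less_imp_le)
  \<comment> \<open>Truncated subtraction would merge \<open>0\<close> and \<open>1\<close>; the
    size-biased law gives no mass to \<open>0\<close>, so \<open>k\<close> has the single preimage
    \<open>k + 1\<close>.\<close>
  have "0 \<notin> set_pmf (tilted M 0)" by (simp add: set_pmf_iff t)
  then have "(\<lambda>k. k - 1) -` {k} \<inter> set_pmf (tilted M 0) = {k + 1} \<inter> set_pmf (tilted M 0)"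
  proof (intro set_eqI)
    fix x show "x \<in> (\<lambda>k. k - 1) -` {k} \<inter> set_pmf (tilted M 0) \<longleftrightarrow> x \<in> {k + 1} \<inter> set_pmf (tilted M 0)"
      using \<open>0 \<notin> set_pmf (tilted M 0)\<close> by (cases x) auto
  qed
  then have "measure (tilted M 0) ((\<lambda>k. k - 1) -` {k}) = measure (tilted M 0) {k + 1}"
    by (metis measure_Int_set_pmf)
  then show "pmf (m_law M \<delta> ((Young, i) # \<nu>)) k = (real k + 1) / EM * pmf M (k + 1)"
    by (simp add: pmf_map measure_pmf_single t add.commute)
qed

text \<open>A young node with \<open>k\<close> older children stems from the value
  \<open>k + 1\<close> of \<open>M\<close>, and then \<open>k + 1 + \<delta>\<close> is positive by
  \<open>weight_pos\<close>; for the root and for old nodes \<open>k\<close> itself is a value of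
  \<open>M\<close>.\<close>

lemma strength_shape_pos: "pmf (m_law M \<delta> \<nu>) k > 0 \<Longrightarrow> strength_shape \<nu> k > 0"
proof (cases \<nu> rule: node_cases)
  case 1
  assume "pmf (m_law M \<delta> \<nu>) k > 0"
  then show ?thesis using weight_pos[of k] by (simp add: 1 strength_shape_def set_pmf_iff)
next
  case (2 i \<nu>')
  assume *: "pmf (m_law M \<delta> \<nu>) k > 0"
  then have "pmf M k \<noteq> 0" unfolding 2 pmf_m_law by auto
  then show ?thesis using weight_pos[of k] by (simp add: 2 strength_shape_def set_pmf_iff)
next
  case (3 i \<nu>')
  assume *: "pmf (m_law M \<delta> \<nu>) k > 0"
  then have "pmf M (k + 1) \<noteq> 0" unfolding 3 pmf_m_law by auto
  then show ?thesis using weight_pos[of "k + 1"] by (simp add: 3 strength_shape_def set_pmf_iff)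
qed

section \<open>Gamma mixtures\<close>

lemma borel_measurable_gamma_density [measurable]: "gamma_density s \<in> borel_measurable borel"
  unfolding gamma_density_def[abs_def] by measurable

lemma gamma_density_nonneg: "s > 0 \<Longrightarrow> gamma_density s x \<ge> 0"
  by (auto simp: gamma_density_def Gamma_real_pos less_imp_le)

text \<open>The substitution \<open>t = c * x\<close> in Euler's integral for
  \<open>Gamma (s + q)\<close>. With \<open>c = a powr (\<kappa> - 1)\<close>, the exponential is
  the probability that a node of age \<open>a\<close> and strength \<open>x\<close> has no younger
  child, and the resulting rising factorial is what successive attachments to one vertex
  produce.\<close>

lemma nn_integral_gamma_density:
  assumes s: "s > 0" and c: "c > 0"
  shows "(\<integral>\<^sup>+x. ennreal (gamma_density s x) * ennreal (x ^ q * exp (- x * (c - 1))) \<partial>lborel) =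
    ennreal (pochhammer s q * c powr (- (s + q)))"
proof -
  let ?z = "s + real q"
  have z: "?z > 0" using s by linarith
  have "Gamma ?z = (\<integral>\<^sup>+t. ennreal (indicator {0..} t * t powr (?z - 1) / exp t) \<partial>lborel)"
    using Gamma_conv_nn_integral_real[OF z] by simp
  also have "\<dots> = ennreal c * (\<integral>\<^sup>+x. ennreal (indicator {0..} (0 + c * x) * (0 + c * x) powr (?z - 1) / exp (0 + c * x)) \<partial>lborel)"
    using c by (subst nn_integral_real_affine[of _ c 0]) auto
  also have "\<dots> = ennreal c * (\<integral>\<^sup>+x. ennreal (c powr (?z - 1) * Gamma s) *
      (ennreal (gamma_density s x) * ennreal (x ^ q * exp (- x * (c - 1)))) \<partial>lborel)"
  proof (intro arg_cong2[of _ _ _ _ "(*)"] refl nn_integral_cong)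
    fix x :: real
    show "ennreal (indicator {0..} (0 + c * x) * (0 + c * x) powr (?z - 1) / exp (0 + c * x)) =
      ennreal (c powr (?z - 1) * Gamma s) * (ennreal (gamma_density s x) * ennreal (x ^ q * exp (- x * (c - 1))))"
    proof (cases "x > 0")
      case True
      have "x powr (?z - 1) = x powr (s - 1) * x ^ q"
        using True by (simp add: powr_add[symmetric] powr_realpow[symmetric] algebra_simps)
      moreover have "exp (- x) * exp (- x * (c - 1)) = 1 / exp (c * x)"
        by (simp add: exp_add[symmetric] exp_minus[symmetric] field_simps)
      moreover have "Gamma s * (gamma_density s x * (x ^ q * exp (- x * (c - 1)))) =
          (x powr (s - 1) * x ^ q) * (exp (- x) * exp (- x * (c - 1)))"
        using True Gamma_real_pos[OF s] by (simp add: gamma_density_def)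
      ultimately have "c powr (?z - 1) * x powr (?z - 1) / exp (c * x) =
        c powr (?z - 1) * Gamma s * (gamma_density s x * (x ^ q * exp (- x * (c - 1))))"
        by (simp only: mult.assoc) simp
      then show ?thesis
        using True c s Gamma_real_pos[OF s] gamma_density_nonneg[OF s, of x]
        by (simp add: ennreal_mult[symmetric] powr_mult)
    next
      case False
      then have "indicator {0..} (0 + c * x) * (0 + c * x) powr (?z - 1) / exp (0 + c * x) = 0"
        using c mult_pos_neg[of c x] by (cases "x = 0") (auto split: split_indicator)
      then show ?thesis using False by (simp add: gamma_density_def)
    qed
  qed
  also have "\<dots> = ennreal (c * (c powr (?z - 1) * Gamma s)) *
      (\<integral>\<^sup>+x. ennreal (gamma_density s x) * ennreal (x ^ q * exp (- x * (c - 1))) \<partial>lborel)"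
    using c s Gamma_real_pos[OF s] by (subst nn_integral_cmult) (auto simp: ennreal_mult mult.assoc)
  also have "c * (c powr (?z - 1) * Gamma s) = c powr ?z * Gamma s"
    using c by (simp add: powr_diff)
  finally have *: "ennreal (Gamma ?z) = ennreal (c powr ?z * Gamma s) *
      (\<integral>\<^sup>+x. ennreal (gamma_density s x) * ennreal (x ^ q * exp (- x * (c - 1))) \<partial>lborel)" (is "_ = _ * ?I") .
  have pos: "c powr ?z * Gamma s > 0" using c Gamma_real_pos[OF s] by simp
  have "Gamma ?z = pochhammer s q * Gamma s"
  proof -
    have "s \<notin> \<int>\<^sub>\<le>\<^sub>0" using s by (auto elim!: nonpos_Ints_cases)
    then show ?thesis using pochhammer_Gamma[of s q] Gamma_real_pos[OF s] by simp
  qed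
  then have "ennreal (c powr ?z * Gamma s) * ennreal (pochhammer s q * c powr (- ?z)) = ennreal (Gamma ?z)"
    unfolding powr_minus using c pos pochhammer_pos[OF s, of q]
    by (simp add: ennreal_mult[symmetric] field_simps)
  then have "ennreal (c powr ?z * Gamma s) * ennreal (pochhammer s q * c powr (- ?z)) =
      ennreal (c powr ?z * Gamma s) * ?I" using * by simp
  then show ?thesis
    using pos by (subst (asm) ennreal_mult_cancel_left) auto
qed

lemma nn_integral_gamma_density_eq_1: "s > 0 \<Longrightarrow> (\<integral>\<^sup>+x. ennreal (gamma_density s x) \<partial>lborel) = 1"
  using nn_integral_gamma_density[of s 1 0] by simp

lemma sets_m_strength_law [measurable_cong]:
  "sets (m_strength_law M \<delta> \<nu>) = sets (count_space UNIV \<Otimes>\<^sub>M borel)"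
  unfolding m_strength_law_def sets_density by (intro sets_pair_measure_cong) auto

lemma space_m_strength_law [simp]: "space (m_strength_law M \<delta> \<nu>) = UNIV"
  unfolding m_strength_law_def by (simp add: space_pair_measure)

lemma nn_integral_m_strength_law:
  assumes [measurable]: "G \<in> borel_measurable (count_space UNIV \<Otimes>\<^sub>M borel)"
  shows "(\<integral>\<^sup>+kx. G kx \<partial>m_strength_law M \<delta> \<nu>) =
    (\<integral>\<^sup>+k. ennreal (pmf (m_law M \<delta> \<nu>) k) *
      (\<integral>\<^sup>+x. ennreal (gamma_density (strength_shape \<nu> k) x) * G (k, x) \<partial>lborel) \<partial>count_space UNIV)"
proof -
  have [measurable]: "(\<lambda>(k::nat, x). ennreal (pmf (m_law M \<delta> \<nu>) k * gamma_density (strength_shape \<nu> k) x))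
      \<in> borel_measurable (count_space UNIV \<Otimes>\<^sub>M borel)"
    by (subst measurable_split_conv, intro measurable_compose_countable'[where I=UNIV and g=fst and f="\<lambda>k kx. ennreal (pmf (m_law M \<delta> \<nu>) k * gamma_density (strength_shape \<nu> k) (snd kx))"]) auto
  have G [measurable]: "G \<in> borel_measurable (count_space UNIV \<Otimes>\<^sub>M lborel)"
    using assms by (simp cong: measurable_cong_sets sets_pair_measure_cong)
  have "(\<integral>\<^sup>+kx. G kx \<partial>m_strength_law M \<delta> \<nu>) =
    (\<integral>\<^sup>+kx. (case kx of (k, x) \<Rightarrow> ennreal (pmf (m_law M \<delta> \<nu>) k * gamma_density (strength_shape \<nu> k) x)) * G kx \<partial>(count_space UNIV \<Otimes>\<^sub>M lborel))"
    unfolding m_strength_law_def strength_shape_def[symmetric]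
    by (subst nn_integral_density) (auto cong: measurable_cong_sets sets_pair_measure_cong)
  also have "\<dots> = (\<integral>\<^sup>+k. \<integral>\<^sup>+x. ennreal (pmf (m_law M \<delta> \<nu>) k * gamma_density (strength_shape \<nu> k) x) * G (k, x) \<partial>lborel \<partial>count_space UNIV)"
    by (subst lborel.nn_integral_fst[symmetric]) (auto cong: measurable_cong_sets sets_pair_measure_cong)
  also have "\<dots> = (\<integral>\<^sup>+k. ennreal (pmf (m_law M \<delta> \<nu>) k) *
      (\<integral>\<^sup>+x. ennreal (gamma_density (strength_shape \<nu> k) x) * G (k, x) \<partial>lborel) \<partial>count_space UNIV)"
  proof (intro nn_integral_cong)
    fix k :: nat
    have "(\<lambda>x. G (k, x)) \<in> borel_measurable borel" by measurable
    then show "(\<integral>\<^sup>+x. ennreal (pmf (m_law M \<delta> \<nu>) k * gamma_density (strength_shape \<nu> k) x) * G (k, x) \<partial>lborel) =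
      ennreal (pmf (m_law M \<delta> \<nu>) k) * (\<integral>\<^sup>+x. ennreal (gamma_density (strength_shape \<nu> k) x) * G (k, x) \<partial>lborel)"
      by (subst nn_integral_cmult[symmetric]) (auto simp: ennreal_mult' mult.assoc)
  qed
  finally show ?thesis .
qed

lemma prob_space_m_strength_law: "prob_space (m_strength_law M \<delta> \<nu>)"
proof
  have "emeasure (m_strength_law M \<delta> \<nu>) (space (m_strength_law M \<delta> \<nu>)) =
      (\<integral>\<^sup>+kx. 1 \<partial>m_strength_law M \<delta> \<nu>)" by simp
  also have "\<dots> = (\<integral>\<^sup>+k. ennreal (pmf (m_law M \<delta> \<nu>) k) *
      (\<integral>\<^sup>+x. ennreal (gamma_density (strength_shape \<nu> k) x) * 1 \<partial>lborel) \<partial>count_space UNIV)"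
    by (subst nn_integral_m_strength_law) auto
  also have "\<dots> = (\<integral>\<^sup>+k. ennreal (pmf (m_law M \<delta> \<nu>) k) \<partial>count_space UNIV)"
  proof (intro nn_integral_cong)
    fix k
    show "ennreal (pmf (m_law M \<delta> \<nu>) k) *
      (\<integral>\<^sup>+x. ennreal (gamma_density (strength_shape \<nu> k) x) * 1 \<partial>lborel) = ennreal (pmf (m_law M \<delta> \<nu>) k)"
      using strength_shape_pos[of \<nu> k] nn_integral_gamma_density_eq_1
      by (cases "pmf (m_law M \<delta> \<nu>) k = 0") (auto simp: less_le)
  qed
  also have "\<dots> = 1" by (simp add: nn_integral_pmf_eq_1)
  finally show "emeasure (m_strength_law M \<delta> \<nu>) (space (m_strength_law M \<delta> \<nu>)) = 1" .
qed

lemma nn_integral_m_strength_law_fixed: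
  assumes [measurable]: "G \<in> borel_measurable borel"
  shows "(\<integral>\<^sup>+kx. indicator {k} (fst kx) * G (snd kx) \<partial>m_strength_law M \<delta> \<nu>) =
    ennreal (pmf (m_law M \<delta> \<nu>) k) * (\<integral>\<^sup>+x. ennreal (gamma_density (strength_shape \<nu> k) x) * G x \<partial>lborel)"
proof -
  have "(\<integral>\<^sup>+kx. indicator {k} (fst kx) * G (snd kx) \<partial>m_strength_law M \<delta> \<nu>) =
    (\<integral>\<^sup>+k'. ennreal (pmf (m_law M \<delta> \<nu>) k') *
      (\<integral>\<^sup>+x. ennreal (gamma_density (strength_shape \<nu> k') x) * (indicator {k} k' * G x) \<partial>lborel) \<partial>count_space UNIV)"
  proof (subst nn_integral_m_strength_law)
    have "(\<lambda>kx::nat \<times> real. indicator {k} (fst kx) :: ennreal) \<in> borel_measurable (count_space UNIV \<Otimes>\<^sub>M borel)"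
      "(\<lambda>kx::nat \<times> real. G (snd kx)) \<in> borel_measurable (count_space UNIV \<Otimes>\<^sub>M borel)"
      by (rule measurable_compose[OF measurable_fst] measurable_compose[OF measurable_snd], simp)+
    then show "(\<lambda>kx. indicator {k} (fst kx) * G (snd kx)) \<in> borel_measurable (count_space UNIV \<Otimes>\<^sub>M borel)"
      by (rule borel_measurable_times_ennreal)
  qed simp
  also have "\<dots> = (\<integral>\<^sup>+k'. (ennreal (pmf (m_law M \<delta> \<nu>) k) *
      (\<integral>\<^sup>+x. ennreal (gamma_density (strength_shape \<nu> k) x) * G x \<partial>lborel)) * indicator {k} k' \<partial>count_space UNIV)"
    by (intro nn_integral_cong) (auto split: split_indicator)
  also have "\<dots> = ennreal (pmf (m_law M \<delta> \<nu>) k) *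
      (\<integral>\<^sup>+x. ennreal (gamma_density (strength_shape \<nu> k) x) * G x \<partial>lborel)"
    by (subst nn_integral_cmult_indicator) auto
  finally show ?thesis .
qed

section \<open>The offspring of a single node\<close>

text \<open>The age is at most \<open>t\<close> with probability
  \<open>(t / x) powr \<kappa>\<close>, whose derivative is the density on the right. As
  \<open>x < 1\<close>, this density is supported in \<open>[0, 1]\<close> and can be taken with
  respect to \<open>U01\<close>. Both laws are compared on the half-lines
  \<open>{t<..}\<close>.\<close>

lemma nn_integral_old_age:
  assumes x: "0 < x" "x < 1" and [measurable]: "\<Phi> \<in> borel_measurable borel"
  shows "(\<integral>\<^sup>+u. \<Phi> (u powr (1 / \<kappa>) * x) \<partial>U01) =
    (\<integral>\<^sup>+a. ennreal (\<kappa> * a powr (\<kappa> - 1) * x powr (- \<kappa>)) * indicator {a. a < x} a * \<Phi> a \<partial>U01)"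
proof -
  note k = kappa_bounds
  define f where "f a = \<kappa> * a powr (\<kappa> - 1) * x powr (- \<kappa>)" for a
  define W where "W a = ennreal (f a) * indicator {a. a < x} a" for a
  have [measurable]: "f \<in> borel_measurable borel" "W \<in> borel_measurable borel"
    unfolding f_def[abs_def] W_def[abs_def] by measurable
  have f_nonneg: "f a \<ge> 0" for a using k by (simp add: f_def)
  let ?L = "distr U01 borel (\<lambda>u. u powr (1 / \<kappa>) * x)" and ?R = "density U01 W"
  have L: "emeasure ?L {t<..} = (if t \<le> 0 then 1 else if t < x then ennreal (1 - (t / x) powr \<kappa>) else 0)" for t
  proof -
    have *: "emeasure ?L {t<..} = emeasure lborel ({0..1} \<inter> {u. t < u powr (1 / \<kappa>) * x})"
      by (subst emeasure_distr) (auto simp: emeasure_uniform_measure divide_ennreal_def vimage_def)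
    consider "t \<le> 0" | "0 < t" "t < x" | "x \<le> t" using x by linarith
    then show ?thesis
    proof cases
      case 1
      have "emeasure lborel ({0..1} \<inter> {u. t < u powr (1 / \<kappa>) * x}) = emeasure lborel {0..1::real}"
      proof (rule emeasure_eq_AE)
        show "AE u in lborel. (u \<in> {0..1} \<inter> {u. t < u powr (1 / \<kappa>) * x}) = (u \<in> {0..1})"
          using AE_lborel_singleton[of "0::real"]
        proof eventually_elim
          case (elim u)
          then have "u \<in> {0..1} \<Longrightarrow> 0 < u powr (1 / \<kappa>) * x" using x by simp
          then show ?case using 1 by auto
        qed
      qed auto
      then show ?thesis using * 1 by simp
    next
      case 2
      define s where "s = t / x"
      have s: "0 < s" "s < 1" using 2 x by (auto simp: s_def)
      have "t < u powr (1 / \<kappa>) * x \<longleftrightarrow> s powr \<kappa> < u" if "0 \<le> u" for u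
      proof -
        have "t < u powr (1 / \<kappa>) * x \<longleftrightarrow> s < u powr (1 / \<kappa>)"
          using x by (simp add: s_def field_simps)
        also have "\<dots> \<longleftrightarrow> (s powr \<kappa>) powr (1 / \<kappa>) < u powr (1 / \<kappa>)"
          using s k by (simp add: powr_powr)
        also have "\<dots> \<longleftrightarrow> s powr \<kappa> < u"
          using that k s powr_less_mono2[of "1 / \<kappa>" "s powr \<kappa>" u] powr_mono2[of "1 / \<kappa>" u "s powr \<kappa>"]
          by (metis linorder_not_le powr_ge_zero zero_less_divide_1_iff less_imp_le)
        finally show ?thesis .
      qed
      then have "{0..1} \<inter> {u. t < u powr (1 / \<kappa>) * x} = {s powr \<kappa><..1}"
        using order_trans[OF powr_ge_zero[of s \<kappa>]] by (auto simp: less_imp_le)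
      moreover have "s powr \<kappa> \<le> 1" using s k by (intro powr_le1) auto
      ultimately show ?thesis using * 2 by (simp add: s_def)
    next
      case 3
      have "u powr (1 / \<kappa>) * x \<le> t" if "u \<in> {0..1}" for u
      proof -
        have "u powr (1 / \<kappa>) * x \<le> 1 * x" using that x k by (intro mult_right_mono powr_le1) auto
        then show ?thesis using 3 by simp
      qed
      then have "{0..1} \<inter> {u. t < u powr (1 / \<kappa>) * x} = {}" by force
      then show ?thesis using * 3 x by simp
    qed
  qed
  have R: "emeasure ?R {t<..} = (if t \<le> 0 then 1 else if t < x then ennreal (1 - (t / x) powr \<kappa>) else 0)" for t
  proof -
    have *: "emeasure ?R {t<..} = (\<integral>\<^sup>+a. W a * indicator {t<..} a * indicator {0..1} a \<partial>lborel)"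
      by (subst emeasure_density, simp, simp, subst nn_integral_U01) auto
    consider "t \<le> 0" | "0 < t" "t < x" | "x \<le> t" using x by linarith
    then show ?thesis
    proof cases
      case 1
      have "(\<integral>\<^sup>+a. W a * indicator {t<..} a * indicator {0..1} a \<partial>lborel) = (\<integral>\<^sup>+a. ennreal (f a * indicator {0..x} a) \<partial>lborel)"
      proof (rule nn_integral_cong_AE)
        show "AE a in lborel. W a * indicator {t<..} a * indicator {0..1} a = ennreal (f a * indicator {0..x} a)"
          using AE_lborel_singleton[of "0::real"] AE_lborel_singleton[of x]
          by eventually_elim (use 1 x in \<open>auto simp: W_def split: split_indicator\<close>)
      qed
      also have "\<dots> = ennreal 1"
      proof (rule nn_integral_has_integral_lborel)
        have "((\<lambda>a. a powr (\<kappa> - 1)) has_integral (x powr (\<kappa> - 1 + 1) / (\<kappa> - 1 + 1))) {0..x}"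
          using k x by (intro has_integral_powr_from_0) auto
        then have "((\<lambda>a. (\<kappa> * x powr (- \<kappa>)) * a powr (\<kappa> - 1)) has_integral (\<kappa> * x powr (- \<kappa>)) * (x powr (\<kappa> - 1 + 1) / (\<kappa> - 1 + 1))) {0..x}"
          by (rule has_integral_mult_right)
        also have "(\<kappa> * x powr (- \<kappa>)) * (x powr (\<kappa> - 1 + 1) / (\<kappa> - 1 + 1)) = 1"
          using x k by (simp add: powr_minus)
        finally have "(f has_integral 1) {0..x}"
          by (simp add: f_def[abs_def] mult_ac)
        then have "((\<lambda>a. if a \<in> {0..x} then f a else 0) has_integral 1) UNIV"
          by (simp only: has_integral_restrict_UNIV)
        then show "((\<lambda>a. f a * indicator {0..x} a) has_integral 1) UNIV"
          by (rule has_integral_eq[rotated]) auto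
      qed (use f_nonneg in auto)
      finally show ?thesis using * 1 by simp
    next
      case 2
      have "(\<integral>\<^sup>+a. W a * indicator {t<..} a * indicator {0..1} a \<partial>lborel) = (\<integral>\<^sup>+a. ennreal (f a) * indicator {t..x} a \<partial>lborel)"
      proof (rule nn_integral_cong_AE)
        show "AE a in lborel. W a * indicator {t<..} a * indicator {0..1} a = ennreal (f a) * indicator {t..x} a"
          using AE_lborel_singleton[of t] AE_lborel_singleton[of x]
          by eventually_elim (use 2 x in \<open>auto simp: W_def split: split_indicator\<close>)
      qed
      also have "\<dots> = ennreal (x powr \<kappa> * x powr (- \<kappa>) - t powr \<kappa> * x powr (- \<kappa>))"
      proof (rule nn_integral_FTC_Icc)
        fix a assume a: "a \<in> {t..x}"
        then have "((\<lambda>a. a powr \<kappa>) has_real_derivative \<kappa> * a powr (\<kappa> - 1)) (at a)"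
          using 2 by (intro has_real_derivative_powr) auto
        then show "((\<lambda>a. a powr \<kappa> * x powr (- \<kappa>)) has_real_derivative f a) (at a)"
          unfolding f_def by (rule DERIV_cmult_right)
      qed (use 2 f_nonneg in auto)
      also have "x powr \<kappa> * x powr (- \<kappa>) - t powr \<kappa> * x powr (- \<kappa>) = 1 - (t / x) powr \<kappa>"
        using x 2 by (simp add: powr_minus powr_divide field_simps)
      finally show ?thesis using * 2 by simp
    next
      case 3
      have "(\<integral>\<^sup>+a. W a * indicator {t<..} a * indicator {0..1} a \<partial>lborel) = (\<integral>\<^sup>+a. 0 \<partial>(lborel :: real measure))"
        by (intro nn_integral_cong) (use 3 in \<open>auto simp: W_def split: split_indicator\<close>)
      then show ?thesis using * 3 x by simp
    qed
  qed
  have "?L = ?R"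
  proof (rule measure_eqI_lessThan)
    show "emeasure ?L {t<..} < \<infinity>" for t unfolding L by (simp add: less_top[symmetric])
    show "emeasure ?L {t<..} = emeasure ?R {t<..}" for t unfolding L R ..
  qed simp_all
  then have "(\<integral>\<^sup>+y. \<Phi> y \<partial>?L) = (\<integral>\<^sup>+y. \<Phi> y \<partial>?R)" by simp
  also have "(\<integral>\<^sup>+y. \<Phi> y \<partial>?L) = (\<integral>\<^sup>+u. \<Phi> (u powr (1 / \<kappa>) * x) \<partial>U01)"
    by (subst nn_integral_distr) auto
  also have "(\<integral>\<^sup>+y. \<Phi> y \<partial>?R) = (\<integral>\<^sup>+a. W a * \<Phi> a \<partial>U01)"
    by (subst nn_integral_density) auto
  finally show ?thesis by (simp add: W_def f_def)
qed

text \<open>The ordered ages have a density in which the strength occurs as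
  \<open>\<gamma> ^ q * exp (- \<gamma> * (c - 1))\<close> with
  \<open>c = a powr (\<kappa> - 1)\<close>. Gamma mixing gives \<open>c powr (- (s + q))\<close>;
  the factor \<open>c ^ q\<close> of the rates cancels part of it and leaves
  \<open>c powr (- s) = a powr ((1 - \<kappa>) * s)\<close>.\<close>

lemma nn_integral_young_offspring:
  fixes F :: "'v \<Rightarrow> real \<Rightarrow> real \<Rightarrow> real set"
  assumes F: "younger_family \<kappa> Q F" and a: "0 < a" "a < 1" and s: "0 < s"
    and H [measurable]: "H \<in> borel_measurable (\<Pi>\<^sub>M i\<in>{..<q::nat}. U01)"
  shows "(\<integral>\<^sup>+\<gamma>. ennreal (gamma_density s \<gamma>) *
      (\<integral>\<^sup>+\<xi>. indicator {\<xi>. card (F \<xi> a \<gamma>) = q} \<xi> * H (\<lambda>i\<in>{..<q}. sorted_list_of_set (F \<xi> a \<gamma>) ! i) \<partial>Q) \<partial>lborel) =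
    (\<integral>\<^sup>+y. ennreal (pochhammer s q * a powr ((1 - \<kappa>) * s)) *
      (\<Prod>i<q. ennreal ((1 - \<kappa>) * y i powr (- \<kappa>))) * indicator {y. ordered_above a q y} y * H y \<partial>(\<Pi>\<^sub>M i\<in>{..<q}. U01))"
proof -
  note k = kappa_bounds
  interpret U: prob_space U01 by (rule prob_space_U01)
  let ?PU = "\<Pi>\<^sub>M i\<in>{..<q}. U01"
  interpret PU: prob_space ?PU by (intro prob_space_PiM U.prob_space_axioms)
  let ?c = "a powr (\<kappa> - 1)"
  have c: "?c > 0" using a by simp
  have [measurable]: "Measurable.pred ?PU (ordered_above a q)"
    unfolding ordered_above_def[abs_def] by measurable
  define W where "W y = (\<Prod>i<q. ennreal ((1 - \<kappa>) * y i powr (- \<kappa>))) * indicator {y. ordered_above a q y} y * H y" for y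
  have W [measurable]: "W \<in> borel_measurable ?PU"
    unfolding W_def[abs_def] by measurable
  have "(\<integral>\<^sup>+\<gamma>. ennreal (gamma_density s \<gamma>) *
      (\<integral>\<^sup>+\<xi>. indicator {\<xi>. card (F \<xi> a \<gamma>) = q} \<xi> * H (\<lambda>i\<in>{..<q}. sorted_list_of_set (F \<xi> a \<gamma>) ! i) \<partial>Q) \<partial>lborel) =
    (\<integral>\<^sup>+\<gamma>. \<integral>\<^sup>+y. ennreal (?c ^ q) * (ennreal (gamma_density s \<gamma>) * ennreal (\<gamma> ^ q * exp (- \<gamma> * (?c - 1)))) * W y \<partial>?PU \<partial>lborel)"
  proof (intro nn_integral_cong)
    fix \<gamma> :: real
    show "ennreal (gamma_density s \<gamma>) *
      (\<integral>\<^sup>+\<xi>. indicator {\<xi>. card (F \<xi> a \<gamma>) = q} \<xi> * H (\<lambda>i\<in>{..<q}. sorted_list_of_set (F \<xi> a \<gamma>) ! i) \<partial>Q) =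
      (\<integral>\<^sup>+y. ennreal (?c ^ q) * (ennreal (gamma_density s \<gamma>) * ennreal (\<gamma> ^ q * exp (- \<gamma> * (?c - 1)))) * W y \<partial>?PU)"
    proof (cases "\<gamma> > 0")
      case False
      then show ?thesis by (simp add: gamma_density_def)
    next
      case True
      interpret younger_points \<kappa> a \<gamma> Q "\<lambda>\<xi>. F \<xi> a \<gamma>"
        using F k a True by unfold_locales (auto simp: younger_family_def)
      have "ennreal (exp (- tot)) * (\<Prod>i<q. ennreal (rate (y i))) * indicator {y. ordered_above a q y} y * H y =
         ennreal (?c ^ q) * ennreal (\<gamma> ^ q * exp (- \<gamma> * (?c - 1))) * W y" for y
      proof -
        have "ennreal (rate t) = ennreal (?c * \<gamma>) * ennreal ((1 - \<kappa>) * t powr (- \<kappa>))" for t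
          using k True c powr_minus_divide[of a "1 - \<kappa>"]
          by (subst ennreal_mult[symmetric]) (auto simp: younger_rate_def)
        then have "(\<Prod>i<q. ennreal (rate (y i))) = ennreal (?c * \<gamma>) ^ q * (\<Prod>i<q. ennreal ((1 - \<kappa>) * y i powr (- \<kappa>)))"
          by (simp add: prod.distrib)
        moreover have "ennreal (exp (- tot)) * ennreal (?c * \<gamma>) ^ q = ennreal (?c ^ q) * ennreal (\<gamma> ^ q * exp (- \<gamma> * (?c - 1)))"
          using True c by (simp add: younger_total_def ennreal_mult[symmetric] ennreal_power power_mult_distrib mult_ac)
        ultimately have "ennreal (exp (- tot)) * (\<Prod>i<q. ennreal (rate (y i))) =
            ennreal (?c ^ q) * ennreal (\<gamma> ^ q * exp (- \<gamma> * (?c - 1))) * (\<Prod>i<q. ennreal ((1 - \<kappa>) * y i powr (- \<kappa>)))"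
          by (simp only: mult.assoc[symmetric])
        then show ?thesis by (simp only: W_def mult.assoc)
      qed
      then have "(\<integral>\<^sup>+\<xi>. indicator {\<xi>. card (F \<xi> a \<gamma>) = q} \<xi> * H (\<lambda>i\<in>{..<q}. sorted_list_of_set (F \<xi> a \<gamma>) ! i) \<partial>Q) =
         (\<integral>\<^sup>+y. ennreal (?c ^ q) * ennreal (\<gamma> ^ q * exp (- \<gamma> * (?c - 1))) * W y \<partial>?PU)"
        using nn_integral_ordered_points[OF H] by (simp add: pts_def)
      then show ?thesis
        by (simp add: nn_integral_cmult[symmetric] mult_ac)
    qed
  qed
  also have "\<dots> = (\<integral>\<^sup>+\<gamma>. ennreal (?c ^ q) * (ennreal (gamma_density s \<gamma>) * ennreal (\<gamma> ^ q * exp (- \<gamma> * (?c - 1)))) \<partial>lborel) * (\<integral>\<^sup>+y. W y \<partial>?PU)"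
    by (simp add: nn_integral_cmult nn_integral_multc)
  also have "(\<integral>\<^sup>+\<gamma>. ennreal (?c ^ q) * (ennreal (gamma_density s \<gamma>) * ennreal (\<gamma> ^ q * exp (- \<gamma> * (?c - 1)))) \<partial>lborel) =
      ennreal (?c ^ q) * ennreal (pochhammer s q * ?c powr (- (s + real q)))"
    by (subst nn_integral_cmult, measurable, simp only: nn_integral_gamma_density[OF s c])
  also have "\<dots> = ennreal (pochhammer s q * a powr ((1 - \<kappa>) * s))"
  proof -
    have "?c ^ q * ?c powr (- (s + real q)) = ?c powr (- s)"
      using c by (simp add: powr_realpow[symmetric] powr_add[symmetric])
    also have "\<dots> = a powr ((1 - \<kappa>) * s)"
      using a by (simp add: powr_powr algebra_simps)
    finally show ?thesis
      using pochhammer_pos[OF s, of q] c by (simp add: ennreal_mult[symmetric] mult_ac)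
  qed
  also have "\<dots> * (\<integral>\<^sup>+y. W y \<partial>?PU) = (\<integral>\<^sup>+y. ennreal (pochhammer s q * a powr ((1 - \<kappa>) * s)) * W y \<partial>?PU)"
    by (subst nn_integral_cmult) auto
  finally show ?thesis by (simp only: W_def mult.assoc)
qed

end

section \<open>Resampling coordinates of a product measure\<close>

text \<open>Replacing one coordinate by an independent copy keeps a product law unchanged. This lets
  nodes be integrated out one at a time while the integrand stays a function on the full infinite
  product.\<close>

lemma nn_integral_PiM_resample:
  fixes N :: "'i \<Rightarrow> 'a measure"
  assumes N: "\<And>i. prob_space (N i)" and G [measurable]: "G \<in> borel_measurable (PiM UNIV N)"
  shows "(\<integral>\<^sup>+w. G w \<partial>PiM UNIV N) = (\<integral>\<^sup>+w. \<integral>\<^sup>+r. G (w(i := r)) \<partial>N i \<partial>PiM UNIV N)"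
proof -
  interpret P: prob_space "PiM UNIV N" by (intro prob_space_PiM N)
  interpret Ni: prob_space "N i" by (rule N)
  interpret pair_sigma_finite "N i" "PiM UNIV N" ..
  have m [measurable]: "(\<lambda>(x, X). X(i := x)) \<in> measurable (N i \<Otimes>\<^sub>M PiM UNIV N) (PiM UNIV N)"
    unfolding split_beta by (intro measurable_fun_upd[where J=UNIV]) auto
  have "PiM UNIV N = distr (N i \<Otimes>\<^sub>M PiM UNIV N) (PiM UNIV N) (\<lambda>(x, X). X(i := x))"
    using distr_pair_PiM_eq_PiM[of UNIV N i] N by simp
  then have "(\<integral>\<^sup>+w. G w \<partial>PiM UNIV N) = (\<integral>\<^sup>+w. G w \<partial>distr (N i \<Otimes>\<^sub>M PiM UNIV N) (PiM UNIV N) (\<lambda>(x, X). X(i := x)))"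
    by simp
  also have "\<dots> = (\<integral>\<^sup>+p. G (case p of (x, X) \<Rightarrow> X(i := x)) \<partial>(N i \<Otimes>\<^sub>M PiM UNIV N))"
    by (subst nn_integral_distr) auto
  also have "\<dots> = (\<integral>\<^sup>+w. \<integral>\<^sup>+r. G (w(i := r)) \<partial>N i \<partial>PiM UNIV N)"
    by (subst nn_integral_snd[symmetric]) auto
  finally show ?thesis .
qed

section \<open>Independent uniform ages as a reference measure\<close>

abbreviation XU :: "(node \<Rightarrow> real) measure" where "XU \<equiv> PiM UNIV (\<lambda>_. U01)"

lemma prob_space_XU: "prob_space XU"
  by (intro prob_space_PiM prob_space_U01)

lemma space_XU [simp]: "space XU = UNIV"
  by (simp add: space_PiM)

lemma XU_component: "(\<lambda>x. x \<nu>) \<in> borel_measurable XU"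
  using measurable_component_singleton[of \<nu> UNIV "\<lambda>_. U01"] by simp

definition young_upd :: "node \<Rightarrow> nat \<Rightarrow> (node \<Rightarrow> real) \<Rightarrow> (nat \<Rightarrow> real) \<Rightarrow> node \<Rightarrow> real" where
  "young_upd \<nu> q x y \<nu>' = (if \<exists>i<q. \<nu>' = (Young, i) # \<nu> then y (snd (hd \<nu>')) else x \<nu>')"

lemma young_upd_simps [simp]:
  "i < q \<Longrightarrow> young_upd \<nu> q x y ((Young, i) # \<nu>) = y i"
  "young_upd \<nu> q x y \<nu> = x \<nu>"
  "young_upd \<nu> 0 x y = x"
  by (auto simp: young_upd_def)

lemma young_upd_Suc: "young_upd \<nu> (Suc q) x (y(q := a)) = (young_upd \<nu> q x y)((Young, q) # \<nu> := a)"
  by (auto simp: young_upd_def fun_eq_iff less_Suc_eq)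

lemma measurable_XU_I:
  assumes "\<And>\<nu>. (\<lambda>z. f z \<nu>) \<in> borel_measurable N"
  shows "f \<in> measurable N XU"
  using assms by (intro measurable_PiM_single') (auto cong: measurable_cong_sets)

lemma young_upd_measurable:
  assumes f: "f \<in> measurable N XU" and g: "\<And>i. i < q \<Longrightarrow> (\<lambda>z. g z i) \<in> borel_measurable N"
  shows "(\<lambda>z. young_upd \<nu> q (f z) (g z)) \<in> measurable N XU"
proof (rule measurable_XU_I)
  fix \<nu>'
  show "(\<lambda>z. young_upd \<nu> q (f z) (g z) \<nu>') \<in> borel_measurable N"
  proof (cases "\<exists>i<q. \<nu>' = (Young, i) # \<nu>")
    case True
    then show ?thesis using g by (auto simp: young_upd_def)
  next
    case False
    then show ?thesis using measurable_compose[OF f XU_component] by (simp only: young_upd_def if_not_P if_False)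
  qed
qed

lemma emeasure_space_PiM_U01 [simp]:
  "emeasure (PiM J (\<lambda>_. U01)) (space (PiM J (\<lambda>_. U01))) = 1"
  by (intro prob_space.emeasure_space_1 prob_space_PiM prob_space_U01)

lemma PiM_U01_component: "i \<in> J \<Longrightarrow> (\<lambda>y. y i) \<in> borel_measurable (PiM J (\<lambda>_. U01))"
  using measurable_component_singleton[of i J "\<lambda>_. U01"]
  by (subst measurable_cong_sets[OF refl sets_U01[symmetric]])

text \<open>Induction on \<open>q\<close>, resampling one younger child at a time. It exposes a
  finite product over younger siblings, the form in which the law of the ordered points is
  available.\<close>

lemma nn_integral_XU_resample_young:
  assumes "T \<in> borel_measurable XU"
  shows "(\<integral>\<^sup>+x. T x \<partial>XU) = (\<integral>\<^sup>+x. \<integral>\<^sup>+y. T (young_upd \<nu> q x y) \<partial>(\<Pi>\<^sub>M i\<in>{..<q}. U01) \<partial>XU)"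
  using assms
proof (induction q arbitrary: T)
  case 0
  then show ?case by simp
next
  case (Suc q)
  note [measurable] = Suc.prems
  interpret U: prob_space U01 by (rule prob_space_U01)
  interpret PU: product_sigma_finite "\<lambda>_::nat. U01" ..
  let ?c = "(Young, q) # \<nu>"
  have m [measurable]: "(\<lambda>p. (fst p)(?c := snd p)) \<in> measurable (XU \<Otimes>\<^sub>M U01) XU"
    by (intro measurable_fun_upd[where J=UNIV]) auto
  have "(\<integral>\<^sup>+x. T x \<partial>XU) = (\<integral>\<^sup>+x. \<integral>\<^sup>+a. T (x(?c := a)) \<partial>U01 \<partial>XU)"
    by (intro nn_integral_PiM_resample prob_space_U01 Suc.prems)
  also have "\<dots> = (\<integral>\<^sup>+x. \<integral>\<^sup>+y. \<integral>\<^sup>+a. T ((young_upd \<nu> q x y)(?c := a)) \<partial>U01 \<partial>(\<Pi>\<^sub>M i\<in>{..<q}. U01) \<partial>XU)"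
  proof (rule Suc.IH)
    have "(\<lambda>p. T ((fst p)(?c := snd p))) \<in> borel_measurable (XU \<Otimes>\<^sub>M U01)" by measurable
    then show "(\<lambda>x. \<integral>\<^sup>+a. T (x(?c := a)) \<partial>U01) \<in> borel_measurable XU"
      by (intro U.borel_measurable_nn_integral) (simp add: split_beta)
  qed
  also have "\<dots> = (\<integral>\<^sup>+x. \<integral>\<^sup>+y. T (young_upd \<nu> (Suc q) x y) \<partial>(\<Pi>\<^sub>M i\<in>{..<Suc q}. U01) \<partial>XU)"
  proof (intro nn_integral_cong)
    fix x
    have "(\<lambda>y. young_upd \<nu> (Suc q) x y) \<in> measurable (\<Pi>\<^sub>M i\<in>{..<Suc q}. U01) XU"
      by (rule young_upd_measurable) (auto intro: PiM_U01_component)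
    then have "(\<lambda>y. T (young_upd \<nu> (Suc q) x y)) \<in> borel_measurable (\<Pi>\<^sub>M i\<in>insert q {..<q}. U01)"
      by (simp add: lessThan_Suc[symmetric])
    then show "(\<integral>\<^sup>+y. \<integral>\<^sup>+a. T ((young_upd \<nu> q x y)(?c := a)) \<partial>U01 \<partial>(\<Pi>\<^sub>M i\<in>{..<q}. U01)) =
       (\<integral>\<^sup>+y. T (young_upd \<nu> (Suc q) x y) \<partial>(\<Pi>\<^sub>M i\<in>{..<Suc q}. U01))"
      unfolding lessThan_Suc by (subst PU.product_nn_integral_insert) (auto simp: young_upd_Suc)
  qed
  finally show ?case .
qed

section \<open>The joint law of the ages in a finite part of the tree\<close>

locale rppt_params = pa_params +
  fixes Q :: "'v measure" and F :: "'v \<Rightarrow> real \<Rightarrow> real \<Rightarrow> real set"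
  assumes younger: "younger_family (chi M \<delta>) Q F"
begin

definition "Rm \<nu> = U01 \<Otimes>\<^sub>M m_strength_law M \<delta> \<nu> \<Otimes>\<^sub>M Q"

abbreviation "P \<equiv> rppt_space M \<delta> Q"
abbreviation "ag \<equiv> age \<kappa> F"

lemma P_eq: "P = PiM UNIV Rm"
  by (simp add: rppt_space_def Rm_def[abs_def])

lemma prob_space_Q: "prob_space Q"
  using younger by (simp add: younger_family_def)

lemma prob_space_Rm: "prob_space (Rm \<nu>)"
  unfolding Rm_def by (intro prob_space_pair prob_space_U01 prob_space_m_strength_law prob_space_Q)

lemma prob_space_P: "prob_space P"
  unfolding P_eq by (intro prob_space_PiM prob_space_Rm)

lemma finite_F: "\<xi> \<in> space Q \<Longrightarrow> finite (F \<xi> a \<gamma>)"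
  using younger by (simp add: younger_family_def)

lemma card_F_measurable [measurable (raw)]:
  assumes "e \<in> measurable N Q" "g \<in> borel_measurable N" "h \<in> borel_measurable N" "B \<in> sets borel"
  shows "(\<lambda>z. card (F (e z) (g z) (h z) \<inter> B)) \<in> measurable N (count_space UNIV)"
proof -
  have 1: "(\<lambda>(\<xi>, a, \<gamma>). card (F \<xi> a \<gamma> \<inter> B)) \<in> measurable (Q \<Otimes>\<^sub>M borel \<Otimes>\<^sub>M borel) (count_space UNIV)"
    using younger assms(4) by (simp add: younger_family_def)
  have 2: "(\<lambda>z. (e z, g z, h z)) \<in> measurable N (Q \<Otimes>\<^sub>M borel \<Otimes>\<^sub>M borel)"
    using assms by measurable
  from measurable_compose[OF 2 1] show ?thesis by simp
qed

lemma card_F_measurable' [measurable (raw)]: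
  assumes "e \<in> measurable N Q" "g \<in> borel_measurable N" "h \<in> borel_measurable N"
  shows "(\<lambda>z. card (F (e z) (g z) (h z))) \<in> measurable N (count_space UNIV)"
  using card_F_measurable[OF assms, of UNIV] by simp

lemma nth_F_measurable [measurable (raw)]:
  assumes "e \<in> measurable N Q" "g \<in> borel_measurable N" "h \<in> borel_measurable N"
  shows "(\<lambda>z. sorted_list_of_set (F (e z) (g z) (h z)) ! i) \<in> borel_measurable N"
  using finite_F measurable_space[OF assms(1)] card_F_measurable[OF assms]
  by (intro borel_measurable_nth_sorted_list_of_set) auto

lemma P_component: "(\<lambda>w. w \<nu>) \<in> measurable P (Rm \<nu>)"
  unfolding P_eq by (intro measurable_component_singleton) simp

lemma Rm_measurable [measurable]:
  "fst \<in> borel_measurable (Rm \<nu>)"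
  "(\<lambda>r. fst (fst (snd r))) \<in> measurable (Rm \<nu>) (count_space UNIV)"
  "(\<lambda>r. snd (fst (snd r))) \<in> borel_measurable (Rm \<nu>)"
  "(\<lambda>r. snd (snd r)) \<in> measurable (Rm \<nu>) Q"
  unfolding Rm_def by measurable

lemma coordinate_measurable [measurable]:
  "(\<lambda>w. unif w \<nu>) \<in> borel_measurable P"
  "(\<lambda>w. m_minus w \<nu>) \<in> measurable P (count_space UNIV)"
  "(\<lambda>w. strength w \<nu>) \<in> borel_measurable P"
  "(\<lambda>w. noise w \<nu>) \<in> measurable P Q"
  unfolding unif_def m_minus_def strength_def noise_def
  using Rm_measurable[of \<nu>, THEN measurable_compose[OF P_component]] by auto

lemma age_measurable [measurable]: "(\<lambda>w. ag w \<nu>) \<in> borel_measurable P"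
proof (induction \<nu>)
  case Nil
  then show ?case by simp
next
  case (Cons c \<nu>)
  note [measurable] = Cons
  obtain l i where "c = (l, i)" by (cases c)
  then show ?case by (cases l) simp_all
qed

lemma ag_measurable [measurable]: "ag \<in> measurable P XU"
  by (intro measurable_XU_I) measurable

text \<open>Ages depend on the randomness of the node and of its ancestors only. Names grow at the
  front, so the names \<open>zs @ \<nu>\<close> are \<open>\<nu>\<close> and its
  descendants.\<close>

lemma age_fun_upd: "(\<And>zs. \<nu>' \<noteq> zs @ \<nu>) \<Longrightarrow> ag (w(\<nu> := r)) \<nu>' = ag w \<nu>'"
proof (induction \<nu>')
  case Nil
  have "\<nu> \<noteq> []" using Nil[of "[]"] by auto
  then show ?case by (simp add: unif_def)
next
  case (Cons c \<nu>')
  have ne: "\<nu>' \<noteq> zs @ \<nu>" for zs using Cons.prems[of "c # zs"] by auto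
  have "c # \<nu>' \<noteq> \<nu>" using Cons.prems[of "[]"] by simp
  moreover have "\<nu>' \<noteq> \<nu>" using ne[of "[]"] by simp
  ultimately show ?case using Cons.IH[OF ne]
    by (cases c; cases "fst c") (auto simp: unif_def noise_def strength_def)
qed

text \<open>A younger child reads its age from the randomness of its parent. So only the parent has
  to lie outside the subtree of \<open>\<nu>\<close>, and the child may even be \<open>\<nu>\<close>
  itself.\<close>

lemma age_fun_upd_young:
  assumes "\<And>zs. \<nu>' \<noteq> zs @ \<nu>"
  shows "ag (w(\<nu> := r)) ((Young, i) # \<nu>') = ag w ((Young, i) # \<nu>')"
  using age_fun_upd[OF assms] assms[of "[]"] by (simp add: noise_def strength_def)

context
  fixes mm qq :: "node \<Rightarrow> nat" and I :: "node set"
begin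

text \<open>Younger children are counted only at nodes of \<open>I\<close>. The others are boundary
  leaves whose offspring lies too deep, but \<open>m_minus\<close> is fixed there too because a
  pattern prescribes the out-degree of every vertex it uses.\<close>

definition struct_at :: "node \<Rightarrow> 'v sample \<Rightarrow> bool" where
  "struct_at \<nu> w \<longleftrightarrow> m_minus w \<nu> = mm \<nu> \<and>
     (\<nu> \<in> I \<longrightarrow> card (F (noise w \<nu>) (ag w \<nu>) (strength w \<nu>)) = qq \<nu>)"

text \<open>These are the nodes whose ages are known once the randomness at the nodes of
  \<open>S\<close> is revealed, since younger children get their ages from their parents.\<close>

definition with_young :: "node set \<Rightarrow> node set" where
  "with_young S = S \<union> {(Young, i) # \<nu> | i \<nu>. \<nu> \<in> S \<and> \<nu> \<in> I \<and> i < qq \<nu>}"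

definition admissible :: "node set \<Rightarrow> bool" where
  "admissible S \<longleftrightarrow> finite S \<and> (\<forall>c \<nu>. c # \<nu> \<in> S \<longrightarrow> \<nu> \<in> S \<and> \<nu> \<in> I \<and> (\<forall>i. c = (Young, i) \<longrightarrow> i < qq \<nu>))"

definition old_factor :: "node \<Rightarrow> (node \<Rightarrow> real) \<Rightarrow> ennreal" where
  "old_factor \<nu> x = (if is_old \<nu> then ennreal (\<kappa> * x \<nu> powr (\<kappa> - 1) * x (tl \<nu>) powr (- \<kappa>)) * indicator {a. a < x (tl \<nu>)} (x \<nu>) else 1)"

text \<open>What remains of the offspring of a node after its strength has been integrated out,
  except for the factors with exponent \<open>- \<kappa>\<close>, which \<open>tree_density\<close>
  charges to the younger children themselves.\<close>

definition inner_factor :: "node \<Rightarrow> (node \<Rightarrow> real) \<Rightarrow> ennreal" where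
  "inner_factor \<nu> x = (if \<nu> \<in> I then
      ennreal (pochhammer (strength_shape \<nu> (mm \<nu>)) (qq \<nu>) * x \<nu> powr ((1 - \<kappa>) * strength_shape \<nu> (mm \<nu>))) *
      indicator {y. ordered_above (x \<nu>) (qq \<nu>) y} (\<lambda>i. x ((Young, i) # \<nu>)) else 1)"

definition node_factor :: "node \<Rightarrow> (node \<Rightarrow> real) \<Rightarrow> ennreal" where
  "node_factor \<nu> x = ennreal (pmf (m_law M \<delta> \<nu>) (mm \<nu>)) * old_factor \<nu> x * inner_factor \<nu> x"

definition tree_density :: "node set \<Rightarrow> (node \<Rightarrow> real) \<Rightarrow> ennreal" where
  "tree_density S x = (\<Prod>\<nu>\<in>S. node_factor \<nu> x) *
     (\<Prod>\<nu>\<in>{\<nu>\<in>with_young S. is_young \<nu>}. ennreal ((1 - \<kappa>) * x \<nu> powr (- \<kappa>)))"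

lemma indicator_ordered_above_measurable [measurable (raw)]:
  assumes [measurable]: "f \<in> borel_measurable N" "\<And>i. (\<lambda>z. g z i) \<in> borel_measurable N"
  shows "(\<lambda>z. indicator {y. ordered_above (f z) q y} (g z) :: ennreal) \<in> borel_measurable N"
proof -
  have "Measurable.pred N (\<lambda>z. ordered_above (f z) q (g z))"
    unfolding ordered_above_def by measurable
  then show ?thesis by (simp add: indicator_def)
qed

lemma node_factor_measurable [measurable]: "node_factor \<nu> \<in> borel_measurable XU"
proof -
  have "old_factor \<nu> \<in> borel_measurable XU" unfolding old_factor_def[abs_def]
    by (cases "is_old \<nu>") (auto simp: indicator_def)
  moreover have "inner_factor \<nu> \<in> borel_measurable XU"
    unfolding inner_factor_def[abs_def] by (cases "\<nu> \<in> I") auto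
  ultimately show ?thesis unfolding node_factor_def[abs_def] by measurable
qed

lemma tree_density_measurable [measurable]: "tree_density S \<in> borel_measurable XU"
  unfolding tree_density_def[abs_def] by measurable

lemma struct_at_measurable [measurable]: "Measurable.pred P (struct_at \<nu>)"
  unfolding struct_at_def[abs_def] by measurable

lemma admissibleD:
  "admissible S \<Longrightarrow> finite S"
  "admissible S \<Longrightarrow> c # p \<in> S \<Longrightarrow> p \<in> S"
  "admissible S \<Longrightarrow> c # p \<in> S \<Longrightarrow> p \<in> I"
  "admissible S \<Longrightarrow> (Young, i) # p \<in> S \<Longrightarrow> i < qq p"
  unfolding admissible_def by blast+

lemma admissible_suffix: "admissible S \<Longrightarrow> zs @ \<nu> \<in> S \<Longrightarrow> \<nu> \<in> S"
  by (induction zs) (auto dest: admissibleD)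

lemma finite_with_young: "finite S \<Longrightarrow> finite (with_young S)"
proof -
  assume "finite S"
  moreover have "{(Young, i) # \<nu> | i \<nu>. \<nu> \<in> S \<and> \<nu> \<in> I \<and> i < qq \<nu>} \<subseteq> (\<Union>\<nu>\<in>S. (\<lambda>i. (Young, i) # \<nu>) ` {..<qq \<nu>})"
    by auto
  ultimately show ?thesis unfolding with_young_def
    by (intro finite_UnI) (auto elim!: finite_subset)
qed

text \<open>The age of \<open>\<nu>\<close> in terms of the ages \<open>x\<close> of the other nodes
  and a fresh uniform variable \<open>u\<close>. A young node takes its age from \<open>x\<close>,
  where its parent has already put it.\<close>

definition start_age :: "node \<Rightarrow> (node \<Rightarrow> real) \<Rightarrow> real \<Rightarrow> real" where
  "start_age \<nu> x u = (if is_young \<nu> then x \<nu> else if is_old \<nu> then u powr (1 / \<kappa>) * x (tl \<nu>) else u)"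

abbreviation inner_q :: "node \<Rightarrow> nat" where "inner_q \<nu> \<equiv> (if \<nu> \<in> I then qq \<nu> else 0)"

text \<open>The ages after the randomness at \<open>\<nu>\<close> has been revealed.\<close>

definition reveal :: "node \<Rightarrow> (node \<Rightarrow> real) \<Rightarrow> real \<Rightarrow> real \<Rightarrow> 'v \<Rightarrow> node \<Rightarrow> real" where
  "reveal \<nu> x a \<gamma> \<xi> = young_upd \<nu> (inner_q \<nu>) (x(\<nu> := a)) (\<lambda>i. sorted_list_of_set (F \<xi> a \<gamma>) ! i)"

lemma reveal_measurable [measurable (raw)]:
  assumes [measurable]: "f \<in> measurable N XU" "g \<in> borel_measurable N" "h \<in> borel_measurable N" "e \<in> measurable N Q"
  shows "(\<lambda>z. reveal \<nu> (f z) (g z) (h z) (e z)) \<in> measurable N XU"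
proof -
  have "(\<lambda>z. (f z)(\<nu> := g z)) \<in> measurable N XU"
    by (intro measurable_fun_upd[where J=UNIV]) (auto cong: measurable_cong_sets)
  then show ?thesis unfolding reveal_def by (rule young_upd_measurable) measurable
qed

definition count_ok :: "node \<Rightarrow> real \<Rightarrow> real \<Rightarrow> 'v \<Rightarrow> ennreal" where
  "count_ok \<nu> a \<gamma> \<xi> = (if \<nu> \<in> I then indicator {\<xi>. card (F \<xi> a \<gamma>) = qq \<nu>} \<xi> else 1)"

lemma count_ok_measurable [measurable (raw)]:
  assumes [measurable]: "g \<in> borel_measurable N" "h \<in> borel_measurable N" "e \<in> measurable N Q"
  shows "(\<lambda>z. count_ok \<nu> (g z) (h z) (e z)) \<in> borel_measurable N"
proof -
  have "Measurable.pred N (\<lambda>z. card (F (e z) (g z) (h z)) = qq \<nu>)" by measurable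
  then show ?thesis unfolding count_ok_def by (auto simp: indicator_def)
qed

text \<open>The conditional expectation over the randomness at \<open>\<nu>\<close>, given its age
  \<open>a\<close> and the ages \<open>x\<close> that do not depend on this randomness.\<close>

definition node_step :: "node \<Rightarrow> ((node \<Rightarrow> real) \<Rightarrow> ennreal) \<Rightarrow> (node \<Rightarrow> real) \<Rightarrow> real \<Rightarrow> ennreal" where
  "node_step \<nu> H x a = (\<integral>\<^sup>+kg. indicator {mm \<nu>} (fst kg) *
     (\<integral>\<^sup>+\<xi>. count_ok \<nu> a (snd kg) \<xi> * H (reveal \<nu> x a (snd kg) \<xi>) \<partial>Q) \<partial>m_strength_law M \<delta> \<nu>)"

definition node_weight :: "node \<Rightarrow> real \<Rightarrow> (nat \<Rightarrow> real) \<Rightarrow> ennreal" where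
  "node_weight \<nu> a y = ennreal (pmf (m_law M \<delta> \<nu>) (mm \<nu>)) *
     (if \<nu> \<in> I then
      ennreal (pochhammer (strength_shape \<nu> (mm \<nu>)) (qq \<nu>) * a powr ((1 - \<kappa>) * strength_shape \<nu> (mm \<nu>))) *
      indicator {y. ordered_above a (qq \<nu>) y} y else 1) * (\<Prod>i<inner_q \<nu>. ennreal ((1 - \<kappa>) * y i powr (- \<kappa>)))"

text \<open>For an inner node this is \<open>nn_integral_young_offspring\<close>; at a leaf nothing
  is asked of the strength, whose density has integral \<open>1\<close>.\<close>

lemma node_step_eq:
  assumes a: "0 < a" "a < 1" and [measurable]: "H \<in> borel_measurable XU"
  shows "node_step \<nu> H x a =
    (\<integral>\<^sup>+y. node_weight \<nu> a y * H (young_upd \<nu> (inner_q \<nu>) (x(\<nu> := a)) y) \<partial>(\<Pi>\<^sub>M i\<in>{..<inner_q \<nu>}. U01))"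
proof -
  interpret Q: prob_space Q by (rule prob_space_Q)
  let ?s = "strength_shape \<nu> (mm \<nu>)" and ?x = "x(\<nu> := a)"
  define G where "G \<gamma> = (\<integral>\<^sup>+\<xi>. count_ok \<nu> a \<gamma> \<xi> * H (reveal \<nu> x a \<gamma> \<xi>) \<partial>Q)" for \<gamma>
  have G [measurable]: "G \<in> borel_measurable borel"
    unfolding G_def[abs_def] by (intro Q.borel_measurable_nn_integral) measurable
  have "node_step \<nu> H x a = ennreal (pmf (m_law M \<delta> \<nu>) (mm \<nu>)) * (\<integral>\<^sup>+\<gamma>. ennreal (gamma_density ?s \<gamma>) * G \<gamma> \<partial>lborel)"
    unfolding node_step_def G_def[symmetric] by (rule nn_integral_m_strength_law_fixed) measurable
  also have "\<dots> = (\<integral>\<^sup>+y. node_weight \<nu> a y * H (young_upd \<nu> (inner_q \<nu>) ?x y) \<partial>(\<Pi>\<^sub>M i\<in>{..<inner_q \<nu>}. U01))"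
  \<comment> \<open>Gamma densities are integrated only for positive shape, which is guaranteed for
    possible values of \<open>m_minus\<close>; for an impossible value both sides vanish.\<close>
  proof (cases "pmf (m_law M \<delta> \<nu>) (mm \<nu>) = 0")
    case True
    then show ?thesis by (simp add: node_weight_def)
  next
    case False
    then have s: "?s > 0" using strength_shape_pos[of \<nu> "mm \<nu>"] by (simp add: less_le)
    show ?thesis
    proof (cases "\<nu> \<in> I")
      case True
      let ?q = "qq \<nu>" and ?PU = "\<Pi>\<^sub>M i\<in>{..<qq \<nu>}. U01"
      define H' where "H' y = H (young_upd \<nu> ?q ?x y)" for y
      have "(\<lambda>y. young_upd \<nu> ?q ?x y) \<in> measurable ?PU XU"
        by (rule young_upd_measurable) (auto intro: PiM_U01_component)
      then have H' [measurable]: "H' \<in> borel_measurable ?PU"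
        unfolding H'_def[abs_def] by measurable
      have "H (reveal \<nu> x a \<gamma> \<xi>) = H' (\<lambda>i\<in>{..<?q}. sorted_list_of_set (F \<xi> a \<gamma>) ! i)" for \<gamma> \<xi>
        unfolding H'_def reveal_def using True
        by (intro arg_cong[of _ _ H]) (auto simp: young_upd_def fun_eq_iff)
      note H'_reveal = this
      define W where "W y = ennreal (pochhammer ?s ?q * a powr ((1 - \<kappa>) * ?s)) *
         (\<Prod>i<?q. ennreal ((1 - \<kappa>) * y i powr (- \<kappa>))) * indicator {y. ordered_above a ?q y} y * H' y" for y
      have [measurable]: "Measurable.pred ?PU (ordered_above a ?q)"
        unfolding ordered_above_def[abs_def] by measurable
      have W: "W \<in> borel_measurable ?PU" unfolding W_def[abs_def] by measurable
      have "(\<integral>\<^sup>+\<gamma>. ennreal (gamma_density ?s \<gamma>) * G \<gamma> \<partial>lborel) = (\<integral>\<^sup>+y. W y \<partial>?PU)"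
        using nn_integral_young_offspring[OF younger a s H'] True H'_reveal
        by (simp add: G_def count_ok_def W_def)
      moreover have "node_weight \<nu> a y * H' y = ennreal (pmf (m_law M \<delta> \<nu>) (mm \<nu>)) * W y" for y
        using True by (simp add: node_weight_def W_def mult_ac)
      ultimately show ?thesis using True nn_integral_cmult[OF W]
        by (simp add: H'_def)
    next
      case False
      then have "G \<gamma> = H ?x" for \<gamma>
        by (simp add: G_def count_ok_def reveal_def Q.emeasure_space_1)
      then have "(\<integral>\<^sup>+\<gamma>. ennreal (gamma_density ?s \<gamma>) * G \<gamma> \<partial>lborel) = H ?x"
        using nn_integral_gamma_density_eq_1[OF s] by (simp add: nn_integral_multc)
      then show ?thesis using False by (simp add: node_weight_def)
    qed
  qed
  finally show ?thesis .
qed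

lemma tree_density_cong:
  assumes S: "admissible S" and eq: "\<And>\<nu>. \<nu> \<in> with_young S \<Longrightarrow> x \<nu> = y \<nu>"
  shows "tree_density S x = tree_density S y"
proof -
  have "node_factor \<nu> x = node_factor \<nu> y" if \<nu>: "\<nu> \<in> S" for \<nu>
  proof -
    have 1: "x \<nu> = y \<nu>" using \<nu> eq by (auto simp: with_young_def)
    have "old_factor \<nu> x = old_factor \<nu> y"
    proof (cases \<nu> rule: node_cases)
      case (2 i p)
      then have "p \<in> with_young S" using \<nu> S by (auto simp: admissible_def with_young_def)
      then show ?thesis using 1 eq 2 by (simp add: old_factor_def)
    qed (auto simp: old_factor_def)
    moreover have "ordered_above a (qq \<nu>) (\<lambda>i. x ((Young, i) # \<nu>)) = ordered_above a (qq \<nu>) (\<lambda>i. y ((Young, i) # \<nu>))"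
      if "\<nu> \<in> I" for a
    proof -
      have "x ((Young, i) # \<nu>) = y ((Young, i) # \<nu>)" if "i < qq \<nu>" for i
        using \<nu> \<open>\<nu> \<in> I\<close> that by (intro eq) (auto simp: with_young_def)
      then show ?thesis by (auto simp: ordered_above_def)
    qed
    ultimately show ?thesis using 1 by (simp add: node_factor_def inner_factor_def indicator_def)
  qed
  moreover have "(\<Prod>\<nu>\<in>{\<nu>\<in>with_young S. is_young \<nu>}. ennreal ((1 - \<kappa>) * x \<nu> powr (- \<kappa>))) =
      (\<Prod>\<nu>\<in>{\<nu>\<in>with_young S. is_young \<nu>}. ennreal ((1 - \<kappa>) * y \<nu> powr (- \<kappa>)))"
    using eq by (intro prod.cong) auto
  ultimately show ?thesis unfolding tree_density_def by (simp cong: prod.cong)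
qed

text \<open>Induction that removes a node of maximal depth: nothing else in \<open>S\<close> depends
  on its randomness, so resampling its coordinate integrates it out and leaves a functional
  \<open>\<Psi>\<close> of the remaining ages. Then the factors of this node are split off from
  \<open>tree_density\<close>, and the two expressions are matched.\<close>

theorem nn_integral_ages_le:
  assumes "admissible S" "H \<in> borel_measurable XU"
    and "\<And>x y. (\<And>\<nu>. \<nu> \<in> with_young S \<Longrightarrow> x \<nu> = y \<nu>) \<Longrightarrow> H x = H y"
  shows "(\<integral>\<^sup>+w. (\<Prod>\<nu>\<in>S. indicator {w. struct_at \<nu> w} w) * H (ag w) \<partial>P) \<le> (\<integral>\<^sup>+x. tree_density S x * H x \<partial>XU)"
  using assms
proof (induction "card S" arbitrary: S H)
  case 0
  have "finite S" using 0(2) by (rule admissibleD(1))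
  then have "S = {}" using 0(1) by simp
  then have "H x = H (\<lambda>_. 0)" for x using 0(4)[of x "\<lambda>_. 0"] by (simp add: with_young_def)
  then have "H = (\<lambda>_. H (\<lambda>_. 0))" by auto
  then obtain c where c: "H = (\<lambda>_. c)" by metis
  interpret P: prob_space P by (rule prob_space_P)
  interpret X: prob_space XU by (rule prob_space_XU)
  show ?case
    by (simp add: c \<open>S = {}\<close> tree_density_def with_young_def P.emeasure_space_1 X.emeasure_space_1[simplified])
next
  case (Suc n S H)
  note adm = Suc.prems(1) and H [measurable] = Suc.prems(2) and dep = Suc.prems(3)
  have fin: "finite S" using adm by (simp add: admissible_def)
  interpret P: prob_space P by (rule prob_space_P)
  interpret X: prob_space XU by (rule prob_space_XU)
  interpret Q: prob_space Q by (rule prob_space_Q)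
  interpret U: prob_space U01 by (rule prob_space_U01)
  have "S \<noteq> {}" using Suc.hyps(2) by auto
  \<comment> \<open>A deepest node has no descendant in \<open>S\<close>, which is what
    \<open>nosuf\<close> records below.\<close>
  then have "Max (length ` S) \<in> length ` S" using fin by simp
  then obtain \<nu> where \<nu>: "\<nu> \<in> S" "length \<nu> = Max (length ` S)" by auto
  interpret MS: prob_space "m_strength_law M \<delta> \<nu>" by (rule prob_space_m_strength_law)
  interpret R: prob_space "Rm \<nu>" by (rule prob_space_Rm)
  have maxlen: "length \<nu>' \<le> length \<nu>" if "\<nu>' \<in> S" for \<nu>' using \<nu> fin that by simp
  define S0 where "S0 = S - {\<nu>}"
  have S: "S = insert \<nu> S0" "\<nu> \<notin> S0" "finite S0" "card S0 = n"
    using \<nu>(1) fin Suc.hyps(2) by (auto simp: S0_def)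
  have adm0: "admissible S0"
    unfolding admissible_def
  proof (intro conjI allI impI S(3))
    fix c p assume "c # p \<in> S0"
    then have cp: "c # p \<in> S" by (simp add: S0_def)
    then have "p \<noteq> \<nu>" using maxlen[of "c # p"] by auto
    then show "p \<in> S0" using admissibleD(2)[OF adm cp] by (simp add: S0_def)
    show "p \<in> I" by (rule admissibleD(3)[OF adm cp])
    fix i assume "c = (Young, i)"
    then show "i < qq p" using cp admissibleD(4)[OF adm] by blast
  qed
  have nosuf: "\<nu>' \<noteq> zs @ \<nu>" if "\<nu>' \<in> S0" for \<nu>' zs
    using admissible_suffix[OF adm0, of zs \<nu>] S(2) that by auto
  have par: "p \<in> S0" "p \<in> I" if "\<nu> = c # p" for c p
  proof -
    show "p \<in> I" using admissibleD(3)[OF adm] \<nu>(1) that by blast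
    have "p \<in> S" using admissibleD(2)[OF adm] \<nu>(1) that by blast
    then show "p \<in> S0" using that by (auto simp: S0_def)
  qed
  have young_in: "\<nu> \<in> with_young S0 \<longleftrightarrow> is_young \<nu>"
  proof
    assume "is_young \<nu>"
    then obtain i p where p: "\<nu> = (Young, i) # p" by (auto simp: is_young_def)
    then have "i < qq p" using adm \<nu>(1) by (auto simp: admissible_def)
    then show "\<nu> \<in> with_young S0" using par[OF p] p by (auto simp: with_young_def)
  next
    assume "\<nu> \<in> with_young S0" then show "is_young \<nu>" using S(2) by (auto simp: with_young_def)
  qed
  let ?q = "inner_q \<nu>"
  have J_notin: "(Young, i) # \<nu> \<notin> with_young S0" for i
  proof
    assume "(Young, i) # \<nu> \<in> with_young S0"
    then have "(Young, i) # \<nu> \<in> S0 \<or> \<nu> \<in> S0" by (auto simp: with_young_def)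
    then show False using adm0 S(2) by (auto simp: admissible_def)
  qed
  have wy: "with_young S = insert \<nu> (with_young S0) \<union> (\<lambda>i. (Young, i) # \<nu>) ` {..<?q}"
    unfolding S(1) by (auto simp: with_young_def)
  have age_S0: "ag (w(\<nu> := r)) \<nu>' = ag w \<nu>'" if "\<nu>' \<in> with_young S0" for w r \<nu>'
  proof -
    consider "\<nu>' \<in> S0" | i p where "\<nu>' = (Young, i) # p" "p \<in> S0"
      using \<open>\<nu>' \<in> with_young S0\<close> by (auto simp: with_young_def)
    then show ?thesis
    proof cases
      case 1
      then show ?thesis using nosuf by (intro age_fun_upd) auto
    next
      case 2
      then show ?thesis unfolding 2(1) using nosuf by (intro age_fun_upd_young) auto
    qed
  qed
  have age_\<nu>: "ag (w(\<nu> := r)) \<nu> = start_age \<nu> (ag w) (fst r)" for w r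
  proof (cases \<nu> rule: node_cases)
    case 1
    then show ?thesis by (simp add: start_age_def unif_def)
  next
    case (2 i p)
    then have "ag (w(\<nu> := r)) p = ag w p"
      using par by (intro age_S0) (auto simp: with_young_def)
    then show ?thesis using 2 by (simp add: start_age_def unif_def)
  next
    case (3 i p)
    then have "\<nu> \<in> with_young S0" using young_in by simp
    then show ?thesis using age_S0[of \<nu>] 3 by (simp add: start_age_def)
  qed
  \<comment> \<open>The integrand as a function of the ages \<open>x\<close> not governed by
    \<open>\<nu>\<close> and of the fresh randomness \<open>r\<close> at \<open>\<nu>\<close>;
    \<open>\<Psi>\<close> averages it over \<open>r\<close>.\<close>
  define K where "K x r = indicator {mm \<nu>} (fst (fst (snd r))) *
    (count_ok \<nu> (start_age \<nu> x (fst r)) (snd (fst (snd r))) (snd (snd r)) *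
     H (reveal \<nu> x (start_age \<nu> x (fst r)) (snd (fst (snd r))) (snd (snd r))))" for x and r :: "real \<times> (nat \<times> real) \<times> 'v"
  define \<Psi> where "\<Psi> x = (\<integral>\<^sup>+r. K x r \<partial>Rm \<nu>)" for x
  have start_meas [measurable (raw)]: "(\<lambda>z. start_age \<nu> (f z) (g z)) \<in> borel_measurable N"
    if [measurable]: "f \<in> measurable N XU" "g \<in> borel_measurable N" for f g and N :: "'z measure"
    using measurable_compose[OF that(1) XU_component] that(2)
    unfolding start_age_def by (cases "is_young \<nu>"; cases "is_old \<nu>") auto
  have start_meas2 [measurable]: "(\<lambda>z. start_age \<nu> (fst z) (fst (snd z))) \<in> borel_measurable (XU \<Otimes>\<^sub>M Rm \<nu>)"
  proof -
    have "(\<lambda>z. fst z \<nu>') \<in> borel_measurable (XU \<Otimes>\<^sub>M Rm \<nu>)" for \<nu>'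
      using measurable_compose[OF measurable_fst XU_component] by blast
    moreover have "(\<lambda>z. fst (snd z)) \<in> borel_measurable (XU \<Otimes>\<^sub>M Rm \<nu>)" by measurable
    ultimately show ?thesis unfolding start_age_def by (cases "is_young \<nu>"; cases "is_old \<nu>") auto
  qed
  note Rm_m = Rm_measurable[of \<nu>, THEN measurable_compose[OF measurable_snd[of XU "Rm \<nu>"]]]
  have K_meas [measurable]: "(\<lambda>z. K (fst z) (snd z)) \<in> borel_measurable (XU \<Otimes>\<^sub>M Rm \<nu>)"
  proof -
    have "(\<lambda>z. indicator {mm \<nu>} (fst (fst (snd (snd z)))) :: ennreal) \<in> borel_measurable (XU \<Otimes>\<^sub>M Rm \<nu>)"
      by (rule measurable_compose[OF Rm_m(2)]) simp
    then show ?thesis unfolding K_def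
      by (intro borel_measurable_times_ennreal count_ok_measurable measurable_compose[OF reveal_measurable H]
          start_meas2 Rm_m measurable_fst)
  qed
  have \<Psi>_meas [measurable]: "\<Psi> \<in> borel_measurable XU"
    unfolding \<Psi>_def[abs_def] using K_meas by (intro R.borel_measurable_nn_integral) (simp add: split_beta)
  have reveal_eq: "H (reveal \<nu> x a \<gamma> \<xi>) = H (reveal \<nu> y a \<gamma> \<xi>)"
    if "\<And>\<nu>'. \<nu>' \<in> with_young S0 \<Longrightarrow> x \<nu>' = y \<nu>'" for x y a \<gamma> \<xi>
  proof (rule dep)
    fix \<nu>' assume "\<nu>' \<in> with_young S"
    then show "reveal \<nu> x a \<gamma> \<xi> \<nu>' = reveal \<nu> y a \<gamma> \<xi> \<nu>'"
      using that unfolding wy by (auto simp: reveal_def young_upd_def)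
  qed
  have \<Psi>_dep: "\<Psi> x = \<Psi> y" if eq: "\<And>\<nu>'. \<nu>' \<in> with_young S0 \<Longrightarrow> x \<nu>' = y \<nu>'" for x y
  proof -
    have "start_age \<nu> x u = start_age \<nu> y u" for u
    proof (cases \<nu> rule: node_cases)
      case (2 i p)
      then have "p \<in> with_young S0" using par by (auto simp: with_young_def)
      then show ?thesis using eq 2 by (simp add: start_age_def)
    next
      case (3 i p)
      then show ?thesis using eq young_in by (simp add: start_age_def)
    qed (simp add: start_age_def)
    then show ?thesis unfolding \<Psi>_def K_def using reveal_eq[of x y] eq by simp
  qed
  have LHS: "(\<integral>\<^sup>+w. (\<Prod>\<nu>'\<in>S. indicator {w. struct_at \<nu>' w} w) * H (ag w) \<partial>P) =
     (\<integral>\<^sup>+w. (\<Prod>\<nu>'\<in>S0. indicator {w. struct_at \<nu>' w} w) * \<Psi> (ag w) \<partial>P)"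
  proof -
    have m: "(\<lambda>w. (\<Prod>\<nu>'\<in>S. indicator {w. struct_at \<nu>' w} w) * H (ag w)) \<in> borel_measurable (PiM UNIV Rm)"
      unfolding P_eq[symmetric] by measurable
    have "(\<integral>\<^sup>+w. (\<Prod>\<nu>'\<in>S. indicator {w. struct_at \<nu>' w} w) * H (ag w) \<partial>P) =
      (\<integral>\<^sup>+w. \<integral>\<^sup>+r. (\<Prod>\<nu>'\<in>S. indicator {w. struct_at \<nu>' w} (w(\<nu> := r))) * H (ag (w(\<nu> := r))) \<partial>Rm \<nu> \<partial>P)"
      unfolding P_eq by (rule nn_integral_PiM_resample[OF prob_space_Rm m])
    also have "\<dots> = (\<integral>\<^sup>+w. \<integral>\<^sup>+r. (\<Prod>\<nu>'\<in>S0. indicator {w. struct_at \<nu>' w} w) * K (ag w) r \<partial>Rm \<nu> \<partial>P)"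
    proof (intro nn_integral_cong)
      fix w and r :: "real \<times> (nat \<times> real) \<times> 'v"
      have s0: "struct_at \<nu>' (w(\<nu> := r)) = struct_at \<nu>' w" if "\<nu>' \<in> S0" for \<nu>'
      proof -
        have "\<nu>' \<noteq> \<nu>" using that S(2) by auto
        moreover have "ag (w(\<nu> := r)) \<nu>' = ag w \<nu>'" using that by (intro age_S0) (simp add: with_young_def)
        ultimately show ?thesis by (simp add: struct_at_def m_minus_def noise_def strength_def)
      qed
      have s1: "indicator {w. struct_at \<nu> w} (w(\<nu> := r)) =
         indicator {mm \<nu>} (fst (fst (snd r))) * count_ok \<nu> (start_age \<nu> (ag w) (fst r)) (snd (fst (snd r))) (snd (snd r))"
        unfolding struct_at_def count_ok_def mem_Collect_eq indicator_def age_\<nu>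
        by (auto simp: m_minus_def noise_def strength_def)
      have s2: "H (ag (w(\<nu> := r))) = H (reveal \<nu> (ag w) (start_age \<nu> (ag w) (fst r)) (snd (fst (snd r))) (snd (snd r)))"
      proof (rule dep)
        fix \<nu>' assume "\<nu>' \<in> with_young S"
        then consider "\<nu>' = \<nu>" | "\<nu>' \<in> with_young S0" "\<nu>' \<noteq> \<nu>" | i where "\<nu>' = (Young, i) # \<nu>" "i < ?q"
          unfolding wy by auto
        then show "ag (w(\<nu> := r)) \<nu>' = reveal \<nu> (ag w) (start_age \<nu> (ag w) (fst r)) (snd (fst (snd r))) (snd (snd r)) \<nu>'"
        proof cases
          case 1
          then show ?thesis using age_\<nu> by (simp add: reveal_def)
        next
          case 2
          then have "\<nexists>i. i < ?q \<and> \<nu>' = (Young, i) # \<nu>" using J_notin by blast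
          then show ?thesis using 2 age_S0 by (auto simp: reveal_def young_upd_def)
        next
          case 3
          then show ?thesis using age_\<nu> by (simp add: reveal_def noise_def strength_def)
        qed
      qed
      show "(\<Prod>\<nu>'\<in>S. indicator {w. struct_at \<nu>' w} (w(\<nu> := r))) * H (ag (w(\<nu> := r))) =
        (\<Prod>\<nu>'\<in>S0. indicator {w. struct_at \<nu>' w} w) * K (ag w) r"
      proof -
        have "(\<Prod>\<nu>'\<in>S0. indicator {w. struct_at \<nu>' w} (w(\<nu> := r))) = (\<Prod>\<nu>'\<in>S0. indicator {w. struct_at \<nu>' w} w :: ennreal)"
          using s0 by (intro prod.cong) (auto simp: indicator_def)
        then show ?thesis unfolding S(1) using S(2,3) by (simp add: s1 s2 K_def mult_ac)
      qed
    qed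
    also have "\<dots> = (\<integral>\<^sup>+w. (\<Prod>\<nu>'\<in>S0. indicator {w. struct_at \<nu>' w} w) * \<Psi> (ag w) \<partial>P)"
    proof (intro nn_integral_cong)
      fix w
      have "(\<lambda>r. K (ag w) r) \<in> borel_measurable (Rm \<nu>)"
        using measurable_compose[OF measurable_Pair1' K_meas, of "ag w"] by simp
      then show "(\<integral>\<^sup>+r. (\<Prod>\<nu>'\<in>S0. indicator {w. struct_at \<nu>' w} w) * K (ag w) r \<partial>Rm \<nu>) =
        (\<Prod>\<nu>'\<in>S0. indicator {w. struct_at \<nu>' w} w) * \<Psi> (ag w)"
        unfolding \<Psi>_def by (intro nn_integral_cmult)
    qed
    finally show ?thesis .
  qed
  also have "\<dots> \<le> (\<integral>\<^sup>+x. tree_density S0 x * \<Psi> x \<partial>XU)"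
    by (rule Suc.hyps(1)[OF S(4)[symmetric] adm0 \<Psi>_meas \<Psi>_dep])
  also have "\<dots> \<le> (\<integral>\<^sup>+x. tree_density S x * H x \<partial>XU)"
  proof -
    let ?PU = "\<Pi>\<^sub>M i\<in>{..<?q}. U01"
    define T where "T x = tree_density S x * H x" for x
    have T [measurable]: "T \<in> borel_measurable XU" unfolding T_def[abs_def] by measurable
    \<comment> \<open>\<open>T\<close> averaged over the ages of the younger children of
      \<open>\<nu>\<close>; these coordinates play the role of the ordered Poisson points.\<close>
    define T2 where "T2 x = (\<integral>\<^sup>+y. T (young_upd \<nu> ?q x y) \<partial>?PU)" for x
    interpret PU: prob_space ?PU by (intro prob_space_PiM U.prob_space_axioms)
    have T2 [measurable]: "T2 \<in> borel_measurable XU"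
    proof -
      have "(\<lambda>z. young_upd \<nu> ?q (fst z) (snd z)) \<in> measurable (XU \<Otimes>\<^sub>M ?PU) XU"
        by (intro young_upd_measurable) (auto intro: measurable_compose[OF measurable_snd PiM_U01_component])
      then have "(\<lambda>z. T (young_upd \<nu> ?q (fst z) (snd z))) \<in> borel_measurable (XU \<Otimes>\<^sub>M ?PU)" by measurable
      then show ?thesis unfolding T2_def[abs_def]
        by (intro PU.borel_measurable_nn_integral) (simp add: split_beta)
    qed
    have \<Psi>_nested: "\<Psi> x = (\<integral>\<^sup>+u. node_step \<nu> H x (start_age \<nu> x u) \<partial>U01)" for x
    proof -
      let ?MQ = "m_strength_law M \<delta> \<nu> \<Otimes>\<^sub>M Q"
      interpret MQ': prob_space ?MQ by (intro prob_space_pair MS.prob_space_axioms Q.prob_space_axioms)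
      have Kx: "(\<lambda>r. K x r) \<in> borel_measurable (U01 \<Otimes>\<^sub>M ?MQ)"
        using measurable_compose[OF measurable_Pair1' K_meas, of x] by (simp add: Rm_def)
      have "\<Psi> x = (\<integral>\<^sup>+u. \<integral>\<^sup>+s. K x (u, s) \<partial>?MQ \<partial>U01)"
        unfolding \<Psi>_def Rm_def by (rule MQ'.nn_integral_fst[OF Kx, symmetric])
      also have "\<dots> = (\<integral>\<^sup>+u. \<integral>\<^sup>+kg. \<integral>\<^sup>+\<xi>. K x (u, kg, \<xi>) \<partial>Q \<partial>m_strength_law M \<delta> \<nu> \<partial>U01)"
      proof (intro nn_integral_cong)
        fix u
        have "(\<lambda>s. K x (u, s)) \<in> borel_measurable ?MQ"
          using measurable_compose[OF measurable_Pair1' Kx, of u] by simp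
        then show "(\<integral>\<^sup>+s. K x (u, s) \<partial>?MQ) = (\<integral>\<^sup>+kg. \<integral>\<^sup>+\<xi>. K x (u, kg, \<xi>) \<partial>Q \<partial>m_strength_law M \<delta> \<nu>)"
          by (rule Q.nn_integral_fst[symmetric])
      qed
      also have "\<dots> = (\<integral>\<^sup>+u. node_step \<nu> H x (start_age \<nu> x u) \<partial>U01)"
        unfolding node_step_def
      proof (intro nn_integral_cong)
        fix u and kg :: "nat \<times> real"
        have "(\<lambda>\<xi>. count_ok \<nu> (start_age \<nu> x u) (snd kg) \<xi> * H (reveal \<nu> x (start_age \<nu> x u) (snd kg) \<xi>)) \<in> borel_measurable Q"
          by measurable
        then show "(\<integral>\<^sup>+\<xi>. K x (u, kg, \<xi>) \<partial>Q) = indicator {mm \<nu>} (fst kg) *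
          (\<integral>\<^sup>+\<xi>. count_ok \<nu> (start_age \<nu> x u) (snd kg) \<xi> * H (reveal \<nu> x (start_age \<nu> x u) (snd kg) \<xi>) \<partial>Q)"
          unfolding K_def by (subst nn_integral_cmult[symmetric]) simp_all
      qed
      finally show ?thesis .
    qed
    have density_step: "tree_density S (young_upd \<nu> ?q x y) = tree_density S0 x * old_factor \<nu> x * node_weight \<nu> (x \<nu>) y" for x y
    proof -
      let ?z = "young_upd \<nu> ?q x y"
      have z: "?z \<nu>' = x \<nu>'" if "\<nu>' \<in> with_young S0" for \<nu>'
        using that J_notin by (auto simp: young_upd_def)
      have 1: "tree_density S0 ?z = tree_density S0 x" by (intro tree_density_cong adm0 z)
      have 2: "old_factor \<nu> ?z = old_factor \<nu> x"
      proof (cases \<nu> rule: node_cases)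
        case (2 i p)
        then have "p \<in> with_young S0" using par by (auto simp: with_young_def)
        then show ?thesis using z 2 by (simp add: old_factor_def)
      qed (auto simp: old_factor_def)
      have 3: "inner_factor \<nu> ?z = (if \<nu> \<in> I then
        ennreal (pochhammer (strength_shape \<nu> (mm \<nu>)) (qq \<nu>) * x \<nu> powr ((1 - \<kappa>) * strength_shape \<nu> (mm \<nu>))) *
        indicator {y. ordered_above (x \<nu>) (qq \<nu>) y} y else 1)"
        by (auto simp: inner_factor_def indicator_def ordered_above_def)
      have yset: "{\<nu>'\<in>with_young S. is_young \<nu>'} = {\<nu>'\<in>with_young S0. is_young \<nu>'} \<union> (\<lambda>i. (Young, i) # \<nu>) ` {..<?q}"
        unfolding wy using young_in by auto
      have 4: "(\<Prod>\<nu>'\<in>{\<nu>'\<in>with_young S. is_young \<nu>'}. ennreal ((1 - \<kappa>) * ?z \<nu>' powr (- \<kappa>))) =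
        (\<Prod>\<nu>'\<in>{\<nu>'\<in>with_young S0. is_young \<nu>'}. ennreal ((1 - \<kappa>) * ?z \<nu>' powr (- \<kappa>))) *
        (\<Prod>i<?q. ennreal ((1 - \<kappa>) * y i powr (- \<kappa>)))"
        unfolding yset
      proof (subst prod.union_disjoint)
        show "finite {\<nu>' \<in> with_young S0. is_young \<nu>'}" using finite_with_young S(3) by auto
        show "{\<nu>' \<in> with_young S0. is_young \<nu>'} \<inter> (\<lambda>i. (Young, i) # \<nu>) ` {..<?q} = {}" using J_notin by auto
        have "(\<Prod>\<nu>'\<in>(\<lambda>i. (Young, i) # \<nu>) ` {..<?q}. ennreal ((1 - \<kappa>) * ?z \<nu>' powr (- \<kappa>))) =
          (\<Prod>i<?q. ennreal ((1 - \<kappa>) * y i powr (- \<kappa>)))"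
          by (subst prod.reindex) (auto simp: inj_on_def)
        then show "(\<Prod>\<nu>'\<in>{\<nu>'\<in>with_young S0. is_young \<nu>'}. ennreal ((1 - \<kappa>) * ?z \<nu>' powr (- \<kappa>))) *
          (\<Prod>\<nu>'\<in>(\<lambda>i. (Young, i) # \<nu>) ` {..<?q}. ennreal ((1 - \<kappa>) * ?z \<nu>' powr (- \<kappa>))) =
          (\<Prod>\<nu>'\<in>{\<nu>'\<in>with_young S0. is_young \<nu>'}. ennreal ((1 - \<kappa>) * ?z \<nu>' powr (- \<kappa>))) *
          (\<Prod>i<?q. ennreal ((1 - \<kappa>) * y i powr (- \<kappa>)))" by simp
      qed simp
      have "tree_density S ?z = node_factor \<nu> ?z * tree_density S0 ?z * (\<Prod>i<?q. ennreal ((1 - \<kappa>) * y i powr (- \<kappa>)))"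
        unfolding tree_density_def 4 using S(2,3) by (simp add: S(1) mult_ac)
      then show ?thesis unfolding node_factor_def 1 2 3 node_weight_def by (simp only: mult_ac)
    qed
    have T2_eq: "T2 x = tree_density S0 x * old_factor \<nu> x * node_step \<nu> H x (x \<nu>)" if "0 < x \<nu>" "x \<nu> < 1" for x
    proof -
      have "(\<lambda>y. young_upd \<nu> ?q x y) \<in> measurable ?PU XU" by (intro young_upd_measurable) (auto intro: PiM_U01_component)
      moreover have "node_weight \<nu> (x \<nu>) \<in> borel_measurable ?PU"
      proof -
        have "Measurable.pred ?PU (\<lambda>y. ordered_above (x \<nu>) (qq \<nu>) y)" if "\<nu> \<in> I"
          using that unfolding ordered_above_def by simp measurable
        then show ?thesis unfolding node_weight_def[abs_def] by (cases "\<nu> \<in> I") (auto simp: indicator_def)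
      qed
      ultimately have m: "(\<lambda>y. node_weight \<nu> (x \<nu>) y * H (young_upd \<nu> ?q x y)) \<in> borel_measurable ?PU" by measurable
      have "T2 x = (\<integral>\<^sup>+y. tree_density S0 x * old_factor \<nu> x * (node_weight \<nu> (x \<nu>) y * H (young_upd \<nu> ?q x y)) \<partial>?PU)"
        unfolding T2_def T_def density_step by (simp add: mult.assoc)
      also have "\<dots> = tree_density S0 x * old_factor \<nu> x * (\<integral>\<^sup>+y. node_weight \<nu> (x \<nu>) y * H (young_upd \<nu> ?q x y) \<partial>?PU)"
        by (rule nn_integral_cmult[OF m])
      also have "(\<integral>\<^sup>+y. node_weight \<nu> (x \<nu>) y * H (young_upd \<nu> ?q x y) \<partial>?PU) = node_step \<nu> H x (x \<nu>)"
        using node_step_eq[OF that H, of \<nu> x] by simp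
      finally show ?thesis .
    qed
    have total: "(\<integral>\<^sup>+x. T x \<partial>XU) = (\<integral>\<^sup>+x. T2 x \<partial>XU)"
      unfolding T2_def by (rule nn_integral_XU_resample_young[OF T])
    interpret PP: product_prob_space "\<lambda>_::node. U01" UNIV ..
    have AE_x: "AE x in XU. 0 < x \<nu>' \<and> x \<nu>' < 1" for \<nu>' :: node
      using PP.AE_component[OF _ AE_U01, of \<nu>'] by simp
    have "(\<integral>\<^sup>+x. tree_density S0 x * \<Psi> x \<partial>XU) \<le> (\<integral>\<^sup>+x. T x \<partial>XU)"
    \<comment> \<open>The age of a young node is already a variable of the factor of its parent. For
      the root and for old nodes it is new and has to be resampled as well, which for old nodes uses
      \<open>nn_integral_old_age\<close>.\<close>
    proof (cases "is_young \<nu>")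
      case True
      then have "old_factor \<nu> x = 1" for x by (auto simp: old_factor_def is_old_def is_young_def)
      moreover have "\<Psi> x = node_step \<nu> H x (x \<nu>)" for x
        unfolding \<Psi>_nested using True U.emeasure_space_1 by (simp add: start_age_def)
      ultimately have "(\<integral>\<^sup>+x. tree_density S0 x * \<Psi> x \<partial>XU) = (\<integral>\<^sup>+x. T2 x \<partial>XU)"
        by (intro nn_integral_cong_AE eventually_mono[OF AE_x[of \<nu>]]) (simp add: T2_eq)
      then show ?thesis using total by simp
    next
      case False
      have ns: "node_step \<nu> H (x(\<nu> := a)) b = node_step \<nu> H x b" for x a b
        by (simp add: node_step_def reveal_def)
      have d0: "tree_density S0 (x(\<nu> := a)) = tree_density S0 x" for x a
        using False young_in by (intro tree_density_cong adm0) auto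
      have "(\<integral>\<^sup>+x. T2 x \<partial>XU) = (\<integral>\<^sup>+x. \<integral>\<^sup>+a. T2 (x(\<nu> := a)) \<partial>U01 \<partial>XU)"
        by (intro nn_integral_PiM_resample prob_space_U01 T2)
      also have "\<dots> = (\<integral>\<^sup>+x. tree_density S0 x * \<Psi> x \<partial>XU)"
      proof (rule nn_integral_cong_AE)
        have ns_meas: "(\<lambda>a. node_step \<nu> H x a) \<in> borel_measurable borel" for x
        proof -
          have "(\<lambda>p. indicator {mm \<nu>} (fst (snd p)) *
            (\<integral>\<^sup>+\<xi>. count_ok \<nu> (fst p) (snd (snd p)) \<xi> * H (reveal \<nu> x (fst p) (snd (snd p)) \<xi>) \<partial>Q))
             \<in> borel_measurable (borel \<Otimes>\<^sub>M m_strength_law M \<delta> \<nu>)"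
          proof (rule borel_measurable_times_ennreal)
            have "fst \<in> measurable (m_strength_law M \<delta> \<nu>) (count_space UNIV)" by measurable
            note measurable_compose[OF measurable_snd this]
            then show "(\<lambda>p. indicator {mm \<nu>} (fst (snd p)) :: ennreal) \<in> borel_measurable (borel \<Otimes>\<^sub>M m_strength_law M \<delta> \<nu>)"
              by (rule measurable_compose) simp
            have "(\<lambda>(p, \<xi>). count_ok \<nu> (fst p) (snd (snd p)) \<xi> * H (reveal \<nu> x (fst p) (snd (snd p)) \<xi>))
               \<in> borel_measurable ((borel \<Otimes>\<^sub>M m_strength_law M \<delta> \<nu>) \<Otimes>\<^sub>M Q)"
              unfolding split_beta by measurable
            then show "(\<lambda>p. \<integral>\<^sup>+\<xi>. count_ok \<nu> (fst p) (snd (snd p)) \<xi> * H (reveal \<nu> x (fst p) (snd (snd p)) \<xi>) \<partial>Q)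
               \<in> borel_measurable (borel \<Otimes>\<^sub>M m_strength_law M \<delta> \<nu>)"
              by (intro Q.borel_measurable_nn_integral)
          qed
          then show ?thesis unfolding node_step_def
            by (intro MS.borel_measurable_nn_integral) (simp add: split_beta)
        qed
        have pointwise: "(\<integral>\<^sup>+a. T2 (x(\<nu> := a)) \<partial>U01) = tree_density S0 x * \<Psi> x"
          if x: "0 < x (tl \<nu>)" "x (tl \<nu>) < 1" for x
        proof -
          have [measurable]: "(\<lambda>a. old_factor \<nu> (x(\<nu> := a))) \<in> borel_measurable borel"
            by (cases \<nu> rule: node_cases) (auto simp: old_factor_def indicator_def)
          note [measurable] = ns_meas
          have "(\<integral>\<^sup>+a. T2 (x(\<nu> := a)) \<partial>U01) =
            (\<integral>\<^sup>+a. tree_density S0 x * (old_factor \<nu> (x(\<nu> := a)) * node_step \<nu> H x a) \<partial>U01)"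
            by (intro nn_integral_cong_AE eventually_mono[OF AE_U01]) (simp add: T2_eq ns d0 mult.assoc)
          also have "\<dots> = tree_density S0 x * (\<integral>\<^sup>+a. old_factor \<nu> (x(\<nu> := a)) * node_step \<nu> H x a \<partial>U01)"
            by (intro nn_integral_cmult) measurable
          also have "(\<integral>\<^sup>+a. old_factor \<nu> (x(\<nu> := a)) * node_step \<nu> H x a \<partial>U01) = \<Psi> x"
          proof (cases \<nu> rule: node_cases)
            case 1
            then show ?thesis unfolding \<Psi>_nested by (simp add: old_factor_def start_age_def)
          next
            case (2 i p)
            then show ?thesis
              using nn_integral_old_age[OF x ns_meas, of x] by (simp add: \<Psi>_nested old_factor_def start_age_def)
          next
            case (3 i p)
            then show ?thesis using False by simp
          qed
          finally show ?thesis .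
        qed
        show "AE x in XU. (\<integral>\<^sup>+a. T2 (x(\<nu> := a)) \<partial>U01) = tree_density S0 x * \<Psi> x"
          using AE_x[of "tl \<nu>"] by eventually_elim (auto intro: pointwise)
      qed
      finally show ?thesis using total by simp
    qed
    then show ?thesis by (simp add: T_def)
  qed
  finally show ?case .
qed

end

end

section \<open>Attachment histories\<close>

text \<open>Indexes the edges present after the first \<open>j\<close> edges of \<open>v\<close>.
  Vertices \<open>1\<close> and \<open>2\<close> do not occur, since their edges are those of the
  initial graph.\<close>

definition steps :: "(nat \<Rightarrow> nat) \<Rightarrow> nat \<Rightarrow> nat \<Rightarrow> (nat \<times> nat) set" where
  "steps m v j = (SIGMA w:{3..<v}. {1..m w}) \<union> {v} \<times> {1..j}"

text \<open>\<open>H v j\<close> is the vertex to which the \<open>j\<close>-th edge of \<open>v\<close> is attached.\<close>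

definition edges_of :: "edges \<Rightarrow> (nat \<Rightarrow> nat) \<Rightarrow> nat \<Rightarrow> nat \<Rightarrow> (nat \<Rightarrow> nat \<Rightarrow> nat) \<Rightarrow> edges" where
  "edges_of G0 m v j H = G0 + image_mset (\<lambda>(w, i). (w, H w i)) (mset_set (steps m v j))"

lemma finite_steps [simp]: "finite (steps m v j)"
  by (auto simp: steps_def)

lemma steps_Suc: "steps m v (Suc j) = insert (v, Suc j) (steps m v j)"
  by (auto simp: steps_def)

lemma steps_last: "3 \<le> v \<Longrightarrow> steps m v (m v) = steps m (Suc v) 0"
  by (auto simp: steps_def less_Suc_eq)

lemma not_in_steps: "(v, Suc j) \<notin> steps m v j"
  by (auto simp: steps_def)

lemma edges_of_Suc:
  "edges_of G0 m v (Suc j) (H(v := (H v)(Suc j := u))) = add_mset (v, u) (edges_of G0 m v j H)"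
proof -
  have "image_mset (\<lambda>(w, i). (w, (H(v := (H v)(Suc j := u))) w i)) (mset_set (steps m v j)) =
      image_mset (\<lambda>(w, i). (w, H w i)) (mset_set (steps m v j))"
    using not_in_steps[of v j m] by (intro image_mset_cong) auto
  then show ?thesis
    by (simp add: edges_of_def steps_Suc not_in_steps)
qed

lemma deg_edges_of:
  "deg (edges_of G0 m v j H) u = deg G0 u + card {s\<in>steps m v j. fst s = u} +
     card {s\<in>steps m v j. H (fst s) (snd s) = u}"
proof -
  have "size {#e \<in># image_mset (\<lambda>(w, i). (w, H w i)) (mset_set (steps m v j)). P e#} =
     card {s\<in>steps m v j. P (fst s, H (fst s) (snd s))}" for P
    by (simp add: filter_mset_image_mset split_beta comp_def)
  from this[of "\<lambda>e. fst e = u"] this[of "\<lambda>e. snd e = u"] show ?thesis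
    by (simp add: deg_def edges_of_def)
qed

lemma card_steps_source:
  assumes "3 \<le> v"
  shows "card {s\<in>steps m v j. fst s = u} = (if 3 \<le> u \<and> u < v then m u else if u = v then j else 0)"
proof -
  have "{s\<in>steps m v j. fst s = u} =
      (if 3 \<le> u \<and> u < v then {u} \<times> {1..m u} else if u = v then {u} \<times> {1..j} else {})"
    using assms by (auto simp: steps_def)
  then show ?thesis by (simp add: card_cartesian_product)
qed

lemma card_steps: "3 \<le> v \<Longrightarrow> card (steps m v j) = (\<Sum>i\<in>{3..<v}. m i) + j"
  unfolding steps_def by (subst card_Un_disjoint) (auto simp: card_cartesian_product)

lemma measure_bind_pmf_ge:
  assumes c: "c \<ge> 0" and ge: "\<And>x. x \<in> B \<Longrightarrow> measure (measure_pmf (f x)) A \<ge> c"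
  shows "measure (measure_pmf (bind_pmf p f)) A \<ge> measure (measure_pmf p) B * c"
proof -
  have "ennreal (measure (measure_pmf p) B * c) = (\<integral>\<^sup>+x. ennreal c * indicator B x \<partial>measure_pmf p)"
    using c by (simp add: nn_integral_cmult measure_pmf.emeasure_eq_measure ennreal_mult' mult.commute)
  also have "\<dots> \<le> (\<integral>\<^sup>+x. emeasure (measure_pmf (f x)) A \<partial>measure_pmf p)"
    using ge by (intro nn_integral_mono) (auto simp: measure_pmf.emeasure_eq_measure split: split_indicator)
  also have "\<dots> = emeasure (measure_pmf (bind_pmf p f)) A" by (simp add: emeasure_bind_pmf)
  finally show ?thesis by (simp add: measure_pmf.emeasure_eq_measure)
qed

locale pa_graph = pa_params +
  fixes md :: pa_model and G0 :: edges
  assumes G0: "set_mset G0 \<subseteq> {1, 2} \<times> {1, 2}"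
    and G0_deg: "real (deg G0 1) + \<delta> > 0" "real (deg G0 2) + \<delta> > 0"
begin

definition "a2 = deg G0 1 + deg G0 2"

text \<open>The same dynamics as \<open>attach_edges\<close>, with the target of every edge
  recorded. The multiset of edges does not tell which edge of a vertex leads where, but patterns
  prescribe exactly that.\<close>

primrec attach_hist :: "(nat \<Rightarrow> nat) \<Rightarrow> nat \<Rightarrow> nat \<Rightarrow> (nat \<Rightarrow> nat \<Rightarrow> nat) \<Rightarrow> (nat \<Rightarrow> nat \<Rightarrow> nat) pmf" where
  "attach_hist m v 0 H = return_pmf H"
| "attach_hist m v (Suc j) H =
     bind_pmf (attach_hist m v j H) (\<lambda>H'.
       map_pmf (\<lambda>u. H'(v := (H' v)(Suc j := u)))
         (embed_pmf (attach_prob md \<delta> a2 m v (Suc j) (edges_of G0 m v j H'))))"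

primrec hist :: "(nat \<Rightarrow> nat) \<Rightarrow> nat \<Rightarrow> (nat \<Rightarrow> nat \<Rightarrow> nat) pmf" where
  "hist m 0 = return_pmf (\<lambda>_ _. 0)"
| "hist m (Suc n) = (if Suc n \<le> 2 then return_pmf (\<lambda>_ _. 0)
     else bind_pmf (hist m n) (attach_hist m (Suc n) (m (Suc n))))"

text \<open>The transition probabilities depend on the history only through the multiset of edges,
  so forgetting the indices commutes with each attachment.\<close>

lemma map_attach_hist:
  "map_pmf (edges_of G0 m v j) (attach_hist m v j H) = attach_edges md \<delta> a2 m v j (edges_of G0 m v 0 H)"
proof (induction j)
  case (Suc j)
  have "map_pmf (edges_of G0 m v (Suc j)) (attach_hist m v (Suc j) H) =
    bind_pmf (attach_hist m v j H) (\<lambda>H'. map_pmf (\<lambda>u. add_mset (v, u) (edges_of G0 m v j H'))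
       (embed_pmf (attach_prob md \<delta> a2 m v (Suc j) (edges_of G0 m v j H'))))"
    by (simp add: map_bind_pmf pmf.map_comp comp_def edges_of_Suc)
  also have "\<dots> = bind_pmf (map_pmf (edges_of G0 m v j) (attach_hist m v j H)) (\<lambda>E'. map_pmf (\<lambda>u. add_mset (v, u) E')
       (embed_pmf (attach_prob md \<delta> a2 m v (Suc j) E')))"
    by (simp add: bind_map_pmf)
  finally show ?case by (simp add: Suc.IH)
qed simp

lemma map_hist:
  assumes "n \<ge> 2"
  shows "map_pmf (edges_of G0 m (Suc n) 0) (hist m n) = pa_given md \<delta> G0 m n"
  using assms
proof (induction n rule: dec_induct)
  case base
  have "steps m 3 0 = {}" by (auto simp: steps_def)
  then show ?case by (simp add: numeral_2_eq_2 edges_of_def map_return_pmf flip: numeral_3_eq_3)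
next
  case (step n)
  have "map_pmf (edges_of G0 m (Suc (Suc n)) 0) (hist m (Suc n)) =
    bind_pmf (hist m n) (\<lambda>H. map_pmf (edges_of G0 m (Suc n) (m (Suc n))) (attach_hist m (Suc n) (m (Suc n)) H))"
    using step steps_last[of "Suc n" m] by (simp add: map_bind_pmf edges_of_def[abs_def])
  also have "\<dots> = bind_pmf (map_pmf (edges_of G0 m (Suc n) 0) (hist m n)) (attach_edges md \<delta> a2 m (Suc n) (m (Suc n)))"
    by (simp add: map_attach_hist bind_map_pmf)
  finally show ?case using step by (simp add: a2_def)
qed

lemma deg_G0: "u \<noteq> 1 \<Longrightarrow> u \<noteq> 2 \<Longrightarrow> deg G0 u = 0"
proof -
  assume u: "u \<noteq> 1" "u \<noteq> 2"
  have "{#e \<in># G0. fst e = u#} = {#e \<in># G0. False#}" "{#e \<in># G0. snd e = u#} = {#e \<in># G0. False#}"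
    using G0 u by (intro filter_mset_cong refl; fastforce)+
  then show ?thesis by (simp add: deg_def)
qed

definition targets_ok :: "(nat \<Rightarrow> nat) \<Rightarrow> nat \<Rightarrow> nat \<Rightarrow> (nat \<Rightarrow> nat \<Rightarrow> nat) \<Rightarrow> bool" where
  "targets_ok m v j H \<longleftrightarrow> (\<forall>(w, i)\<in>steps m v j. 1 \<le> H w i \<and> H w i \<le> w \<and> (md = Model_D \<longrightarrow> H w i < w))"

definition degrees_ok :: "(nat \<Rightarrow> nat) \<Rightarrow> nat \<Rightarrow> bool" where
  "degrees_ok m n \<longleftrightarrow> m 1 = 1 \<and> m 2 = 1 \<and> (\<forall>i\<in>{3..n}. m i \<in> set_pmf M)"

lemma steps_bounds: "3 \<le> v \<Longrightarrow> (w, i) \<in> steps m v j \<Longrightarrow> 3 \<le> w \<and> w \<le> v"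
  by (auto simp: steps_def)

text \<open>Every attached edge adds one at its source and one at its target, and both lie in
  \<open>{1..v}\<close>.\<close>

lemma sum_deg:
  assumes v: "3 \<le> v" and ok: "targets_ok m v j H"
  shows "(\<Sum>u\<in>{1..v}. deg (edges_of G0 m v j H) u) = a2 + 2 * card (steps m v j)"
proof -
  have "(\<Sum>u\<in>{1..v}. card {s\<in>steps m v j. f s = u}) = card (steps m v j)"
    if "\<And>s. s \<in> steps m v j \<Longrightarrow> f s \<in> {1..v}" for f :: "nat \<times> nat \<Rightarrow> nat"
  proof -
    have "card (steps m v j) = card (\<Union>u\<in>{1..v}. {s\<in>steps m v j. f s = u})"
      using that by (intro arg_cong[of _ _ card]) auto
    also have "\<dots> = (\<Sum>u\<in>{1..v}. card {s\<in>steps m v j. f s = u})"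
      by (intro card_UN_disjoint) auto
    finally show ?thesis by simp
  qed
  from this[of fst] this[of "\<lambda>s. H (fst s) (snd s)"]
  have "(\<Sum>u\<in>{1..v}. card {s\<in>steps m v j. fst s = u}) = card (steps m v j)"
    "(\<Sum>u\<in>{1..v}. card {s\<in>steps m v j. H (fst s) (snd s) = u}) = card (steps m v j)"
    using ok steps_bounds[OF v] by (fastforce simp: targets_ok_def)+
  moreover have "(\<Sum>u\<in>{1..v}. deg G0 u) = (\<Sum>u\<in>{1,2}. deg G0 u)"
    using v deg_G0 by (intro sum.mono_neutral_right) auto
  ultimately show ?thesis by (simp add: deg_edges_of sum.distrib a2_def)
qed

lemma sum_degrees:
  fixes m :: "nat \<Rightarrow> nat" and v :: nat
  assumes "3 \<le> v" "m 1 = 1" "m 2 = 1"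
  shows "(\<Sum>i\<in>{1..v-1}. m i) = (\<Sum>i\<in>{3..<v}. m i) + 2"
proof -
  have "{1..v-1} = {1,2} \<union> {3..<v}" using assms(1) by auto
  then show ?thesis using assms by simp
qed

lemma deg_ge:
  assumes v: "3 \<le> v" and u: "1 \<le> u" "u < v" and d: "degrees_ok m v"
  shows "real (deg (edges_of G0 m v j H) u) + \<delta> > 0"
proof (cases "u \<ge> 3")
  case True
  then have "m u \<in> set_pmf M" using d u by (auto simp: degrees_ok_def)
  then have "real (m u) + \<delta> > 0" by (rule weight_pos)
  moreover have "deg (edges_of G0 m v j H) u \<ge> m u"
    using True u by (simp add: deg_edges_of card_steps_source[OF v])
  ultimately show ?thesis by linarith
next
  case False
  then have "u = 1 \<or> u = 2" using u by linarith
  moreover have "deg (edges_of G0 m v j H) u \<ge> deg G0 u" by (simp add: deg_edges_of)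
  ultimately show ?thesis using G0_deg by (smt (verit) of_nat_mono)
qed

text \<open>The share of \<open>\<delta>\<close> may be negative, but
  \<open>real (m v) + \<delta> > 0\<close> bounds it below by minus the numerator of its fraction,
  and the degree of \<open>v\<close>, increased by one in model A, makes up for it.\<close>

lemma loop_weight_nonneg:
  assumes v: "3 \<le> v" and d: "degrees_ok m v" and j: "Suc j \<le> m v"
  shows "loop_weight md \<delta> m v (Suc j) (edges_of G0 m v j H) \<ge> 0"
    and "loop_weight md \<delta> m v (Suc j) (edges_of G0 m v j H) \<le> real (deg (edges_of G0 m v j H) v) + 1 + \<bar>\<delta>\<bar>"
proof -
  have "m v \<in> set_pmf M" using d v by (auto simp: degrees_ok_def)
  then have w: "real (m v) + \<delta> > 0" by (rule weight_pos)
  have mv: "real (m v) > 0" using j by simp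
  have dg: "deg (edges_of G0 m v j H) v \<ge> j"
    by (simp add: deg_edges_of card_steps_source[OF v])
  have frac: "x / real (m v) * \<delta> \<ge> - x" "x / real (m v) * \<delta> \<le> \<bar>\<delta>\<bar>" if "0 \<le> x" "x \<le> real (m v)" for x
  proof -
    have "x * (real (m v) + \<delta>) \<ge> 0" using that w by simp
    then show "x / real (m v) * \<delta> \<ge> - x" using mv by (simp add: field_simps)
    have "x / real (m v) * \<delta> \<le> x / real (m v) * \<bar>\<delta>\<bar>" using that by (intro mult_left_mono) auto
    also have "\<dots> \<le> 1 * \<bar>\<delta>\<bar>" using that mv by (intro mult_right_mono) auto
    finally show "x / real (m v) * \<delta> \<le> \<bar>\<delta>\<bar>" by simp
  qed
  have "real j \<le> real (m v)" "real (Suc j) \<le> real (m v)" using j by simp_all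
  note f = frac[OF _ this(1)] frac[OF _ this(2)]
  have dg': "real (deg (edges_of G0 m v j H) v) \<ge> real j" using dg by simp
  show "loop_weight md \<delta> m v (Suc j) (edges_of G0 m v j H) \<ge> 0"
    using f dg' by (cases md) auto
  show "loop_weight md \<delta> m v (Suc j) (edges_of G0 m v j H) \<le> real (deg (edges_of G0 m v j H) v) + 1 + \<bar>\<delta>\<bar>"
    using f by (cases md) auto
qed

text \<open>Checks that the prescribed constants are the totals of the weights. In model D the
  degree of \<open>v\<close>, so far equal to \<open>j\<close>, has to be removed from the total
  degree.\<close>

lemma normalisation_eq:
  assumes v: "3 \<le> v" and d: "degrees_ok m v" and j: "Suc j \<le> m v" and ok: "targets_ok m v j H"
  shows "normalisation md \<delta> a2 m v (Suc j) =
    (\<Sum>u\<in>{1..<v}. real (deg (edges_of G0 m v j H) u) + \<delta>) + loop_weight md \<delta> m v (Suc j) (edges_of G0 m v j H)"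
proof -
  let ?d = "\<lambda>u. real (deg (edges_of G0 m v j H) u)"
  have m12: "m 1 = 1" "m 2 = 1" using d by (auto simp: degrees_ok_def)
  have "{1..v} = insert v {1..<v}" using v by auto
  then have "(\<Sum>u\<in>{1..v}. ?d u) = ?d v + (\<Sum>u\<in>{1..<v}. ?d u)" by simp
  moreover have "(\<Sum>u\<in>{1..v}. ?d u) = real (a2 + 2 * card (steps m v j))"
    by (simp only: sum_deg[OF v ok, symmetric] of_nat_sum)
  ultimately have s: "(\<Sum>u\<in>{1..<v}. ?d u) = real a2 + 2 * real (card (steps m v j)) - ?d v" by simp
  have c: "real (card (steps m v j)) = real (\<Sum>i\<in>{1..v-1}. m i) - 2 + real j"
    using card_steps[OF v, of m j] sum_degrees[OF v m12] by simp
  have sum\<delta>: "(\<Sum>u\<in>{1..<v}. ?d u + \<delta>) = (\<Sum>u\<in>{1..<v}. ?d u) + (real v - 1) * \<delta>"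
    using v by (simp add: sum.distrib of_nat_diff)
  show ?thesis
  proof (cases md)
    case Model_D
    have "{s\<in>steps m v j. H (fst s) (snd s) = v} = {}"
    proof -
      have "H w i < v" if "(w, i) \<in> steps m v j" for w i
      proof -
        have "H w i < w" using that ok Model_D unfolding targets_ok_def by auto
        then show ?thesis using steps_bounds[OF v that] by simp
      qed
      then show ?thesis by fastforce
    qed
    moreover have "deg G0 v = 0" using v by (intro deg_G0) auto
    ultimately have "?d v = real j"
      using v by (simp add: deg_edges_of card_steps_source)
    then show ?thesis using Model_D s c sum\<delta> by (simp add: algebra_simps)
  qed (use s c sum\<delta> in \<open>simp_all add: algebra_simps\<close>)
qed

lemma normalisation_pos:
  assumes v: "3 \<le> v" and d: "degrees_ok m v" and j: "Suc j \<le> m v" and ok: "targets_ok m v j H"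
  shows "normalisation md \<delta> a2 m v (Suc j) > 0"
proof -
  have "(\<Sum>u\<in>{1..<v}. real (deg (edges_of G0 m v j H) u) + \<delta>) > 0"
    using v deg_ge[OF v _ _ d] by (intro sum_pos) auto
  then show ?thesis unfolding normalisation_eq[OF assms] using loop_weight_nonneg(1)[OF v d j, of H] by linarith
qed

lemma pmf_attach:
  assumes v: "3 \<le> v" and d: "degrees_ok m v" and j: "Suc j \<le> m v" and ok: "targets_ok m v j H"
  shows "pmf (embed_pmf (attach_prob md \<delta> a2 m v (Suc j) (edges_of G0 m v j H))) u =
    attach_prob md \<delta> a2 m v (Suc j) (edges_of G0 m v j H) u"
proof -
  let ?f = "attach_prob md \<delta> a2 m v (Suc j) (edges_of G0 m v j H)" and ?c = "normalisation md \<delta> a2 m v (Suc j)"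
  note c = normalisation_pos[OF assms]
  have nn: "?f x \<ge> 0" for x
    using c deg_ge[OF v, of x m j H] d loop_weight_nonneg(1)[OF v d j, of H]
    by (auto simp: attach_prob_def less_imp_le)
  have "{1..v} = insert v {1..<v}" using v by auto
  then have "(\<Sum>u\<in>{1..v}. ?f u) = loop_weight md \<delta> m v (Suc j) (edges_of G0 m v j H) / ?c +
      (\<Sum>u\<in>{1..<v}. (real (deg (edges_of G0 m v j H) u) + \<delta>) / ?c)"
    by (simp add: attach_prob_def)
  also have "\<dots> = 1"
    using c normalisation_eq[OF assms] by (simp add: sum_divide_distrib[symmetric] add_divide_distrib[symmetric])
  finally have s: "(\<Sum>u\<in>{1..v}. ?f u) = 1" .
  have "(\<integral>\<^sup>+x. ennreal (?f x) \<partial>count_space UNIV) = (\<Sum>u\<in>{1..v}. ennreal (?f u))"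
    by (rule nn_integral_count_space') (use v in \<open>auto simp: attach_prob_def\<close>)
  also have "\<dots> = ennreal (\<Sum>u\<in>{1..v}. ?f u)" using nn by (rule sum_ennreal)
  finally show ?thesis using nn s by (intro pmf_embed_pmf) auto
qed

lemma attach_support:
  assumes "3 \<le> v" "degrees_ok m v" "Suc j \<le> m v" "targets_ok m v j H"
    and u: "u \<in> set_pmf (embed_pmf (attach_prob md \<delta> a2 m v (Suc j) (edges_of G0 m v j H)))"
  shows "1 \<le> u \<and> u \<le> v \<and> (md = Model_D \<longrightarrow> u < v)"
proof -
  have "attach_prob md \<delta> a2 m v (Suc j) (edges_of G0 m v j H) u \<noteq> 0"
    using u pmf_attach[OF assms(1-4)] by (simp add: set_pmf_iff)
  then show ?thesis using assms(1) by (cases md) (auto simp: attach_prob_def split: if_splits)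
qed

lemma targets_ok_Suc:
  "targets_ok m v (Suc j) (H(v := (H v)(Suc j := u))) \<longleftrightarrow>
    targets_ok m v j H \<and> 1 \<le> u \<and> u \<le> v \<and> (md = Model_D \<longrightarrow> u < v)"
proof -
  have "(\<forall>(w, i)\<in>steps m v j. 1 \<le> (H(v := (H v)(Suc j := u))) w i \<and> (H(v := (H v)(Suc j := u))) w i \<le> w \<and> (md = Model_D \<longrightarrow> (H(v := (H v)(Suc j := u))) w i < w)) \<longleftrightarrow> targets_ok m v j H"
  proof -
    have eq: "(H(v := (H v)(Suc j := u))) w i = H w i" if "(w, i) \<in> steps m v j" for w i
      using that not_in_steps[of v j m] by auto
    show ?thesis unfolding targets_ok_def by (intro ball_cong refl) (auto simp: eq simp del: fun_upd_apply)
  qed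
  then show ?thesis by (auto simp: targets_ok_def[of m v "Suc j"] steps_Suc)
qed

end

section \<open>Patterns and their probabilities\<close>

text \<open>
  A pattern prescribes the out-degrees of the vertices in \<open>N\<close> and all edges into the vertices
  in \<open>I\<close>: the edge \<open>c \<in> C\<close> is the \<open>ix c\<close>-th edge of \<open>src c\<close> and leads to \<open>tg c\<close>.  No other edge may
  lead to a vertex in \<open>I\<close>, so that the degrees of these vertices are deterministic on the event
  that the pattern occurs, which makes its probability an explicit product.
\<close>

locale pattern =
  fixes N I C :: "'i set" and src tg :: "'i \<Rightarrow> 'i" and ix dg :: "'i \<Rightarrow> nat"
  assumes N: "finite N" and I: "I \<subseteq> N" and C: "finite C"
    and src: "\<And>c. c \<in> C \<Longrightarrow> src c \<in> N" and tg: "\<And>c. c \<in> C \<Longrightarrow> tg c \<in> I"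
    and ix: "\<And>c. c \<in> C \<Longrightarrow> 1 \<le> ix c \<and> ix c \<le> dg (src c)"
    and src_ix_inj: "inj_on (\<lambda>c. (src c, ix c)) C"
begin

definition indeg :: "'i \<Rightarrow> nat" where
  "indeg \<nu> = card {c\<in>C. tg c = \<nu>}"

definition allowed :: "('i \<Rightarrow> nat) \<Rightarrow> nat \<Rightarrow> nat \<Rightarrow> nat \<Rightarrow> bool" where
  "allowed v w j u \<longleftrightarrow> (\<forall>\<nu>\<in>I. u = v \<nu> \<longleftrightarrow> (\<exists>c\<in>C. w = v (src c) \<and> j = ix c \<and> \<nu> = tg c))"

definition occurs :: "nat \<Rightarrow> ('i \<Rightarrow> nat) \<Rightarrow> (nat \<Rightarrow> nat) \<Rightarrow> (nat \<Rightarrow> nat \<Rightarrow> nat) \<Rightarrow> bool" where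
  "occurs n v m H \<longleftrightarrow> (\<forall>\<nu>\<in>N. m (v \<nu>) = dg \<nu>) \<and> (\<forall>w\<in>{3..n}. \<forall>j\<in>{1..m w}. allowed v w j (H w j))"

text \<open>Positions start at \<open>3\<close> because the vertices \<open>1\<close> and
  \<open>2\<close> have degrees given by the initial graph. Edges run from the younger vertex to the
  older one.\<close>

definition placed :: "nat \<Rightarrow> ('i \<Rightarrow> nat) \<Rightarrow> bool" where
  "placed n v \<longleftrightarrow> inj_on v N \<and> v ` N \<subseteq> {3..n} \<and> (\<forall>c\<in>C. v (tg c) < v (src c))"

text \<open>The attachment weight of the vertices of \<open>I\<close> that are present when
  \<open>w\<close> arrives, provided that the history has followed the pattern so far.\<close>

definition weight_before :: "real \<Rightarrow> ('i \<Rightarrow> nat) \<Rightarrow> nat \<Rightarrow> real" where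
  "weight_before \<delta> v w = (\<Sum>\<nu>\<in>{\<nu>\<in>I. v \<nu> < w}. real (dg \<nu>) + \<delta> + real (card {c\<in>C. tg c = \<nu> \<and> v (src c) < w}))"

text \<open>A bound for this weight at any time; the absolute value and the summand \<open>1\<close>
  leave room for the weight of a self-loop.\<close>

definition weight_bound :: "real \<Rightarrow> real" where
  "weight_bound \<delta> = (\<Sum>\<nu>\<in>I. real (dg \<nu>) + \<bar>\<delta>\<bar> + real (card C) + 1)"

end

text \<open>Ranks with respect to an injective key run through \<open>0, ..., card A - 1\<close>
  exactly once. Applied to the edges into one vertex in order of attachment, this turns the product
  of their weights into a rising factorial.\<close>

lemma prod_rank:
  fixes key :: "'a \<Rightarrow> 'k::linorder" and g :: "nat \<Rightarrow> 'b::comm_monoid_mult"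
  assumes "finite A" "inj_on key A"
  shows "(\<Prod>c\<in>A. g (card {c'\<in>A. key c' < key c})) = (\<Prod>i<card A. g i)"
  using assms
proof (induction "card A" arbitrary: A)
  case 0
  then show ?case by auto
next
  case (Suc n A)
  have "Max (key ` A) \<in> key ` A" using Suc by (intro Max_in) auto
  then obtain a where a: "a \<in> A" "key a = Max (key ` A)" by auto
  then have max: "key c \<le> key a" if "c \<in> A" for c using Suc.prems that by simp
  have less: "key c < key a" if "c \<in> A - {a}" for c
    using max[of c] that Suc.prems(2) a by (auto simp: inj_on_def less_le)
  have 1: "{c'\<in>A. key c' < key a} = A - {a}" using less by auto
  have 2: "{c'\<in>A. key c' < key c} = {c'\<in>A - {a}. key c' < key c}" if "c \<in> A - {a}" for c
    using less[OF that] by auto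
  have "(\<Prod>c\<in>A. g (card {c'\<in>A. key c' < key c})) =
      g (card (A - {a})) * (\<Prod>c\<in>A - {a}. g (card {c'\<in>A. key c' < key c}))"
    by (subst prod.remove[OF Suc.prems(1) a(1)]) (simp only: 1)
  also have "(\<Prod>c\<in>A - {a}. g (card {c'\<in>A. key c' < key c})) = (\<Prod>c\<in>A - {a}. g (card {c'\<in>A - {a}. key c' < key c}))"
    using 2 by (intro prod.cong) auto
  also have "\<dots> = (\<Prod>i<card (A - {a}). g i)"
    using Suc.hyps(2) Suc.prems a by (intro Suc.hyps(1)) (auto intro: inj_on_subset)
  also have "g (card (A - {a})) * \<dots> = (\<Prod>i<Suc (card (A - {a})). g i)" by (simp add: mult.commute)
  also have "Suc (card (A - {a})) = card A"
    using a Suc.prems by (simp add: card_Diff_singleton card_gt_0_iff[symmetric] Suc.hyps(2)[symmetric])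
  finally show ?case .
qed

section \<open>Histories that follow a pattern, for fixed out-degrees\<close>

locale pa_pattern = pa_graph M \<delta> md G0 + pattern N I C src tg ix dg
  for M :: "nat pmf" and \<delta> :: real and md :: pa_model and G0 :: edges
    and N I C :: "'i set" and src tg :: "'i \<Rightarrow> 'i" and ix dg :: "'i \<Rightarrow> nat" +
  fixes n :: nat and v :: "'i \<Rightarrow> nat" and m :: "nat \<Rightarrow> nat"
  assumes placed: "placed n v" and m_ok: "degrees_ok m n" and m_dg: "\<And>\<nu>. \<nu> \<in> N \<Longrightarrow> m (v \<nu>) = dg \<nu>"
begin

lemma v_inj: "inj_on v N" and v_range: "\<nu> \<in> N \<Longrightarrow> 3 \<le> v \<nu> \<and> v \<nu> \<le> n"
  and v_order: "c \<in> C \<Longrightarrow> v (tg c) < v (src c)"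
  using placed by (auto simp: placed_def)

lemma v_eq_iff: "\<nu> \<in> N \<Longrightarrow> \<nu>' \<in> N \<Longrightarrow> v \<nu> = v \<nu>' \<longleftrightarrow> \<nu> = \<nu>'"
  using v_inj by (auto simp: inj_on_def)

definition good :: "nat \<Rightarrow> nat \<Rightarrow> (nat \<Rightarrow> nat \<Rightarrow> nat) set" where
  "good w j = {H. targets_ok m w j H \<and> (\<forall>(w', i)\<in>steps m w j. allowed v w' i (H w' i))}"

lemma good_last: "3 \<le> w \<Longrightarrow> good w (m w) = good (Suc w) 0"
  by (simp add: good_def targets_ok_def steps_last)

lemma good_Suc: "H(w := (H w)(Suc j := u)) \<in> good w (Suc j) \<longleftrightarrow>
  H \<in> good w j \<and> 1 \<le> u \<and> u \<le> w \<and> (md = Model_D \<longrightarrow> u < w) \<and> allowed v w (Suc j) u"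
proof -
  have eq: "(H(w := (H w)(Suc j := u))) w' i = H w' i" if "(w', i) \<in> steps m w j" for w' i
    using that not_in_steps[of w j m] by auto
  have "(\<forall>(w', i)\<in>steps m w j. allowed v w' i ((H(w := (H w)(Suc j := u))) w' i)) \<longleftrightarrow>
    (\<forall>(w', i)\<in>steps m w j. allowed v w' i (H w' i))"
    by (intro ball_cong refl) (auto simp: eq simp del: fun_upd_apply)
  then show ?thesis
    unfolding good_def mem_Collect_eq targets_ok_Suc steps_Suc by auto
qed

definition earlier :: "'i \<Rightarrow> nat \<Rightarrow> nat \<Rightarrow> nat" where
  "earlier \<nu> w j = card {c\<in>C. tg c = \<nu> \<and> (v (src c), ix c) \<in> steps m w j}"

text \<open>On a history that follows the pattern, the edges into \<open>v \<nu>\<close> are exactly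
  the prescribed ones attached so far, hence their number is deterministic.\<close>

lemma card_targets:
  assumes H: "H \<in> good w j" and \<nu>: "\<nu> \<in> I"
  shows "card {s\<in>steps m w j. H (fst s) (snd s) = v \<nu>} = earlier \<nu> w j"
proof -
  have "{s\<in>steps m w j. H (fst s) (snd s) = v \<nu>} =
      (\<lambda>c. (v (src c), ix c)) ` {c\<in>C. tg c = \<nu> \<and> (v (src c), ix c) \<in> steps m w j}" (is "?L = ?R")
  proof (intro set_eqI iffI)
    fix s assume s: "s \<in> ?L"
    then have "allowed v (fst s) (snd s) (H (fst s) (snd s))" using H by (auto simp: good_def)
    then obtain c where "c \<in> C" "fst s = v (src c)" "snd s = ix c" "\<nu> = tg c"
      using s \<nu> by (auto simp: allowed_def)
    moreover from this have "s = (v (src c), ix c)" by (simp add: prod_eq_iff)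
    ultimately show "s \<in> ?R" using s by auto
  next
    fix s assume "s \<in> ?R"
    then obtain c where c: "c \<in> C" "tg c = \<nu>" "s = (v (src c), ix c)" "s \<in> steps m w j" by auto
    then have "allowed v (v (src c)) (ix c) (H (v (src c)) (ix c))" using H by (auto simp: good_def)
    then have "H (v (src c)) (ix c) = v \<nu>" using c \<nu> by (auto simp: allowed_def)
    then show "s \<in> ?L" using c by auto
  qed
  moreover have "inj_on (\<lambda>c. (v (src c), ix c)) C"
    using src_ix_inj src v_eq_iff by (auto simp: inj_on_def)
  ultimately show ?thesis
    unfolding earlier_def by (simp add: card_image inj_on_subset)
qed

lemma deg_good:
  assumes H: "H \<in> good w j" and \<nu>: "\<nu> \<in> I" and w: "3 \<le> w"
  shows "v \<nu> < w \<Longrightarrow> deg (edges_of G0 m w j H) (v \<nu>) = dg \<nu> + earlier \<nu> w j"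
    and "v \<nu> = w \<Longrightarrow> deg (edges_of G0 m w j H) (v \<nu>) = j + earlier \<nu> w j"
proof -
  have "\<nu> \<in> N" using \<nu> I by auto
  then have "deg G0 (v \<nu>) = 0" "3 \<le> v \<nu>" using v_range[of \<nu>] by (auto intro!: deg_G0)
  then show "v \<nu> < w \<Longrightarrow> deg (edges_of G0 m w j H) (v \<nu>) = dg \<nu> + earlier \<nu> w j"
    "v \<nu> = w \<Longrightarrow> deg (edges_of G0 m w j H) (v \<nu>) = j + earlier \<nu> w j"
    using card_targets[OF H \<nu>] m_dg[OF \<open>\<nu> \<in> N\<close>] w by (simp_all add: deg_edges_of card_steps_source)
qed

lemma earlier_le: "earlier \<nu> w j \<le> card C"
  unfolding earlier_def using C by (intro card_mono) auto

text \<open>One bound for all three models. The share of \<open>\<delta>\<close> given to the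
  arriving vertex is compensated by the terms in \<open>j\<close>, since
  \<open>real (m w) + \<delta> > 0\<close>; the constant \<open>5\<close> covers what
  remains.\<close>

lemma normalisation_lower:
  assumes w: "3 \<le> w" "w \<le> n" and j: "1 \<le> j" "j \<le> m w"
  shows "normalisation md \<delta> a2 m w j \<ge> 2 * real (\<Sum>i\<in>{1..w-1}. m i) + (real w - 1) * \<delta> - 5"
proof -
  have "m w \<in> set_pmf M" using m_ok w by (auto simp: degrees_ok_def)
  then have p: "real (m w) + \<delta> > 0" by (rule weight_pos)
  have f: "x / real (m w) * \<delta> \<ge> - x" if "0 \<le> x" for x
  proof -
    have "x * (real (m w) + \<delta>) \<ge> 0" using that p by simp
    then show "x / real (m w) * \<delta> \<ge> - x" using j by (simp add: field_simps)
  qed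
  show ?thesis using f[of "real j"] f[of "real j - 1"] j by (cases md) auto
qed

lemma normalisation_upper:
  assumes w: "3 \<le> w" "w \<le> n" and j: "1 \<le> j" "j \<le> m w"
  shows "normalisation md \<delta> a2 m w j \<le> 2 * real (\<Sum>i\<in>{1..w-1}. m i) + (real w - 1) * \<delta> + real a2 + 2 * real (m w) + \<bar>\<delta>\<bar>"
proof -
  have f: "x / real (m w) * \<delta> \<le> \<bar>\<delta>\<bar>" if "0 \<le> x" "x \<le> real (m w)" for x
  proof -
    have "x / real (m w) * \<delta> \<le> x / real (m w) * \<bar>\<delta>\<bar>" using that by (intro mult_left_mono) auto
    also have "\<dots> \<le> 1 * \<bar>\<delta>\<bar>" using that by (intro mult_right_mono) (auto simp: divide_le_eq_1)
    finally show "x / real (m w) * \<delta> \<le> \<bar>\<delta>\<bar>" by simp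
  qed
  show ?thesis using f[of "real j"] f[of "real j - 1"] j by (cases md) auto
qed

definition base :: "nat \<Rightarrow> real" where
  "base w = 2 * real (\<Sum>i\<in>{1..w-1}. m i) + (real w - 1) * \<delta> - 5"

text \<open>Lower bounds for the conditional probability that an edge respects the pattern. For the
  other edges of a pattern vertex a crude bound suffices, as there are boundedly many of them. For
  the remaining vertices the exact weight is kept: these factors accumulate over all
  \<open>w\<close> and produce the powers of the ages.\<close>

definition step_prob :: "nat \<Rightarrow> nat \<Rightarrow> real" where
  "step_prob w j = (if \<exists>c\<in>C. w = v (src c) \<and> j = ix c then
      let c = (SOME c. c \<in> C \<and> w = v (src c) \<and> j = ix c)
      in (real (dg (tg c)) + \<delta> + real (earlier (tg c) w (j - 1))) / normalisation md \<delta> a2 m w j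
    else if w \<in> v ` N then 1 - weight_bound \<delta> / base w else 1 - weight_before \<delta> v w / base w)"

lemma step_prob_edge:
  assumes c: "c \<in> C"
  shows "step_prob (v (src c)) (ix c) =
    (real (dg (tg c)) + \<delta> + real (earlier (tg c) (v (src c)) (ix c - 1))) / normalisation md \<delta> a2 m (v (src c)) (ix c)"
proof -
  have "(SOME c'. c' \<in> C \<and> v (src c) = v (src c') \<and> ix c = ix c') = c"
  proof (rule some_equality)
    show "c' = c" if "c' \<in> C \<and> v (src c) = v (src c') \<and> ix c = ix c'" for c'
      using that c src_ix_inj src v_eq_iff by (auto simp: inj_on_def)
  qed (use c in auto)
  then show ?thesis using c by (auto simp: step_prob_def Let_def)
qed

lemma weight_before_le: "weight_before \<delta> v w \<le> weight_bound \<delta>"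
proof -
  have fI: "finite I" using I N finite_subset by auto
  have "weight_before \<delta> v w \<le> (\<Sum>\<nu>\<in>{\<nu>\<in>I. v \<nu> < w}. real (dg \<nu>) + \<bar>\<delta>\<bar> + real (card C) + 1)"
    unfolding weight_before_def
  proof (intro sum_mono)
    fix \<nu>
    have "card {c\<in>C. tg c = \<nu> \<and> v (src c) < w} \<le> card C" using C by (intro card_mono) auto
    then show "real (dg \<nu>) + \<delta> + real (card {c \<in> C. tg c = \<nu> \<and> v (src c) < w}) \<le> real (dg \<nu>) + \<bar>\<delta>\<bar> + real (card C) + 1"
      by linarith
  qed
  also have "\<dots> \<le> weight_bound \<delta>"
    unfolding weight_bound_def using fI by (intro sum_mono2) auto
  finally show ?thesis .
qed

lemma dg_pos: "\<nu> \<in> N \<Longrightarrow> real (dg \<nu>) + \<delta> > 0"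
  using m_dg v_range[of \<nu>] m_ok weight_pos[of "dg \<nu>"] by (force simp: degrees_ok_def)

lemma weight_before_nonneg: "weight_before \<delta> v w \<ge> 0"
  unfolding weight_before_def using dg_pos I by (intro sum_nonneg) (force simp: less_imp_le add_nonneg_nonneg)

text \<open>An unprescribed edge must avoid the vertices \<open>v \<nu>\<close> with
  \<open>\<nu> \<in> I\<close>. Their degrees are known from \<open>deg_good\<close>, so the
  probability of failure is a known weight divided by the normalisation.\<close>

lemma step_prob_le:
  assumes w: "3 \<le> w" "w \<le> n" and j: "Suc j \<le> m w" and H: "H \<in> good w j"
    and base: "(\<exists>\<nu>\<in>N. v \<nu> \<le> w) \<Longrightarrow> base w > 0"
  shows "measure (measure_pmf (embed_pmf (attach_prob md \<delta> a2 m w (Suc j) (edges_of G0 m w j H))))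
     {u. 1 \<le> u \<and> u \<le> w \<and> (md = Model_D \<longrightarrow> u < w) \<and> allowed v w (Suc j) u} \<ge> step_prob w (Suc j)"
proof -
  let ?E = "edges_of G0 m w j H"
  let ?p = "embed_pmf (attach_prob md \<delta> a2 m w (Suc j) ?E)" and ?c = "normalisation md \<delta> a2 m w (Suc j)"
  have d: "degrees_ok m w" using m_ok w by (auto simp: degrees_ok_def)
  have ok: "targets_ok m w j H" using H by (auto simp: good_def)
  note pmf = pmf_attach[OF w(1) d j ok] and c_pos = normalisation_pos[OF w(1) d j ok]
  show ?thesis
  proof (cases "\<exists>c\<in>C. w = v (src c) \<and> Suc j = ix c")
    case True
    then obtain c where c: "c \<in> C" "w = v (src c)" "Suc j = ix c" by auto
    have tgN: "tg c \<in> N" using tg[OF c(1)] I by auto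
    have tgw: "v (tg c) < w" "3 \<le> v (tg c)" using v_order[OF c(1)] c v_range[OF tgN] by auto
    have al: "allowed v w (Suc j) (v (tg c))"
      unfolding allowed_def
    proof (intro ballI iffI)
      fix \<nu> assume \<nu>: "\<nu> \<in> I" "v (tg c) = v \<nu>"
      then have "\<nu> = tg c" using v_eq_iff[of \<nu> "tg c"] tgN I by auto
      then show "\<exists>c\<in>C. w = v (src c) \<and> Suc j = ix c \<and> \<nu> = tg c" using c by auto
    next
      fix \<nu> assume "\<nu> \<in> I" "\<exists>c\<in>C. w = v (src c) \<and> Suc j = ix c \<and> \<nu> = tg c"
      then obtain c' where c': "c' \<in> C" "w = v (src c')" "Suc j = ix c'" "\<nu> = tg c'" by auto
      then have "c' = c" using c src_ix_inj src v_eq_iff by (auto simp: inj_on_def)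
      then show "v (tg c) = v \<nu>" using c' by simp
    qed
    have "step_prob w (Suc j) = attach_prob md \<delta> a2 m w (Suc j) ?E (v (tg c))"
    proof -
      have "step_prob w (Suc j) = (real (dg (tg c)) + \<delta> + real (earlier (tg c) w j)) / ?c"
        using step_prob_edge[OF c(1)] unfolding c(2)[symmetric] c(3)[symmetric] by simp
      then show ?thesis
        using tgw deg_good(1)[OF H tg[OF c(1)] w(1) tgw(1)] by (simp add: attach_prob_def add_ac)
    qed
    also have "\<dots> = measure ?p {v (tg c)}" by (simp add: measure_pmf_single pmf)
    also have "\<dots> \<le> measure ?p {u. 1 \<le> u \<and> u \<le> w \<and> (md = Model_D \<longrightarrow> u < w) \<and> allowed v w (Suc j) u}"
      using al tgw by (intro measure_pmf.finite_measure_mono) auto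
    finally show ?thesis .
  next
    case False
    have al: "allowed v w (Suc j) u \<longleftrightarrow> u \<notin> v ` I" for u
      using False by (auto simp: allowed_def)
    let ?J = "{\<nu>\<in>I. v \<nu> \<le> w}"
    have fJ: "finite ?J" using I N finite_subset by (auto intro: finite_subset[of _ N])
    have injJ: "inj_on v ?J" using v_inj I by (auto intro: inj_on_subset)
    have "1 - (\<Sum>\<nu>\<in>?J. attach_prob md \<delta> a2 m w (Suc j) ?E (v \<nu>)) = 1 - measure ?p (v ` ?J)"
      using fJ injJ by (simp add: measure_measure_pmf_finite pmf sum.reindex)
    also have "\<dots> = measure ?p (UNIV - v ` ?J)"
      using measure_pmf.prob_compl[of "v ` ?J" ?p] by simp
    also have "\<dots> \<le> measure ?p {u. 1 \<le> u \<and> u \<le> w \<and> (md = Model_D \<longrightarrow> u < w) \<and> allowed v w (Suc j) u}"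
      using attach_support[OF w(1) d j ok]
      by (intro measure_pmf.finite_measure_mono_AE) (auto simp: AE_measure_pmf_iff al)
    finally have ge: "1 - (\<Sum>\<nu>\<in>?J. attach_prob md \<delta> a2 m w (Suc j) ?E (v \<nu>)) \<le>
      measure ?p {u. 1 \<le> u \<and> u \<le> w \<and> (md = Model_D \<longrightarrow> u < w) \<and> allowed v w (Suc j) u}" .
    have step: "step_prob w (Suc j) = (if w \<in> v ` N then 1 - weight_bound \<delta> / base w else 1 - weight_before \<delta> v w / base w)"
      unfolding step_prob_def using False by (subst if_not_P) auto
    have low: "?c \<ge> base w"
      unfolding base_def using normalisation_lower[OF w, of "Suc j"] j by simp
    \<comment> \<open>\<open>base w\<close> may be negative for early \<open>w\<close>. It is
      compared with the normalisation only if some pattern vertex is present; otherwise there is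
      nothing to hit.\<close>
    have cmp: "(\<Sum>\<nu>\<in>?J. attach_prob md \<delta> a2 m w (Suc j) ?E (v \<nu>)) \<le> B / base w"
      if "(\<Sum>\<nu>\<in>?J. attach_prob md \<delta> a2 m w (Suc j) ?E (v \<nu>)) \<le> B / ?c" "0 \<le> B" "?J \<noteq> {}" for B
    proof -
      have "base w > 0" using that(3) I by (intro base) auto
      then have "B / ?c \<le> B / base w" using that(2) low c_pos by (intro divide_left_mono) auto
      then show ?thesis using that by linarith
    qed
    have J0: "weight_before \<delta> v w = 0" if "?J = {}"
    proof -
      have "{\<nu>\<in>I. v \<nu> < w} = {}" using that by (auto simp: less_imp_le)
      then show ?thesis by (simp only: weight_before_def sum.empty)
    qed
    have dN: "\<nu> \<in> N" if "\<nu> \<in> ?J" for \<nu> using that I by auto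
    have "(\<Sum>\<nu>\<in>?J. attach_prob md \<delta> a2 m w (Suc j) ?E (v \<nu>)) \<le> (if w \<in> v ` N then weight_bound \<delta> / ?c else weight_before \<delta> v w / ?c)"
    proof (cases "w \<in> v ` N")
      case True
      have "(\<Sum>\<nu>\<in>?J. attach_prob md \<delta> a2 m w (Suc j) ?E (v \<nu>)) \<le> (\<Sum>\<nu>\<in>?J. (real (dg \<nu>) + \<bar>\<delta>\<bar> + real (card C) + 1) / ?c)"
      proof (intro sum_mono)
        fix \<nu> assume \<nu>: "\<nu> \<in> ?J"
        have v3: "3 \<le> v \<nu>" using v_range[OF dN[OF \<nu>]] by simp
        have e: "real (earlier \<nu> w j) \<le> real (card C)" using earlier_le by simp
        show "attach_prob md \<delta> a2 m w (Suc j) ?E (v \<nu>) \<le> (real (dg \<nu>) + \<bar>\<delta>\<bar> + real (card C) + 1) / ?c"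
        proof (cases "v \<nu> < w")
          case True
          then show ?thesis using e v3 \<nu> c_pos deg_good(1)[OF H _ w(1) True]
            by (auto simp: attach_prob_def intro!: divide_right_mono)
        next
          case False
          \<comment> \<open>A self-loop at the arriving vertex: prescribed edges into it come from
            later vertices, so its degree counts only the edges it has sent out so far.\<close>
          then have vw: "v \<nu> = w" using \<nu> by auto
          have "real (deg ?E w) = real j + real (earlier \<nu> w j)"
            using deg_good(2)[OF H _ w(1) vw] \<nu> vw by simp
          moreover have "earlier \<nu> w j = 0"
          proof -
            have "(v (src c), ix c) \<notin> steps m w j" if "c \<in> C" "tg c = \<nu>" for c
              using v_order[OF that(1)] that vw steps_bounds[OF w(1), of "v (src c)" "ix c" m j] by auto
            then have "{c\<in>C. tg c = \<nu> \<and> (v (src c), ix c) \<in> steps m w j} = {}" by auto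
            then show ?thesis by (simp only: earlier_def card.empty)
          qed
          moreover have "real j \<le> real (dg \<nu>)" using j m_dg[OF dN[OF \<nu>]] vw by simp
          ultimately have "loop_weight md \<delta> m w (Suc j) ?E \<le> real (dg \<nu>) + \<bar>\<delta>\<bar> + real (card C) + 1"
            using loop_weight_nonneg(2)[OF w(1) d j, of H] by simp
          then show ?thesis using vw c_pos by (auto simp: attach_prob_def intro!: divide_right_mono)
        qed
      qed
      also have "\<dots> \<le> (\<Sum>\<nu>\<in>I. (real (dg \<nu>) + \<bar>\<delta>\<bar> + real (card C) + 1) / ?c)"
        using c_pos I N finite_subset by (intro sum_mono2) auto
      finally show ?thesis using True by (simp add: weight_bound_def sum_divide_distrib)
    next
      case F: False
      have Jlt: "?J = {\<nu>\<in>I. v \<nu> < w}" using F I by (auto simp: less_le)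
      have "attach_prob md \<delta> a2 m w (Suc j) ?E (v \<nu>) =
        (real (dg \<nu>) + \<delta> + real (card {c\<in>C. tg c = \<nu> \<and> v (src c) < w})) / ?c" if \<nu>: "\<nu> \<in> ?J" for \<nu>
      proof -
        have lt: "v \<nu> < w" "\<nu> \<in> I" using \<nu> Jlt by auto
        have v3: "3 \<le> v \<nu>" using v_range[OF dN[OF \<nu>]] by simp
        have "{c\<in>C. tg c = \<nu> \<and> (v (src c), ix c) \<in> steps m w j} = {c\<in>C. tg c = \<nu> \<and> v (src c) < w}"
        proof (intro Collect_cong conj_cong refl)
          fix c assume c: "c \<in> C"
          have "v (src c) \<noteq> w" using F src[OF c] by auto
          then show "(v (src c), ix c) \<in> steps m w j \<longleftrightarrow> v (src c) < w"
            using v_range[OF src[OF c]] ix[OF c] m_dg[OF src[OF c]] by (auto simp: steps_def)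
        qed
        then have "earlier \<nu> w j = card {c\<in>C. tg c = \<nu> \<and> v (src c) < w}" by (simp add: earlier_def)
        then show ?thesis using v3 lt deg_good(1)[OF H lt(2) w(1) lt(1)] by (simp add: attach_prob_def)
      qed
      then show ?thesis using F by (simp add: weight_before_def Jlt sum_divide_distrib)
    qed
    then have "(\<Sum>\<nu>\<in>?J. attach_prob md \<delta> a2 m w (Suc j) ?E (v \<nu>)) \<le> 1 - step_prob w (Suc j)"
    proof (cases "?J = {}")
      case True
      have "weight_bound \<delta> / base w \<ge> 0" if "w \<in> v ` N"
        using that base weight_before_nonneg[of w] weight_before_le[of w] by (intro divide_nonneg_nonneg) force+
      then have "0 \<le> 1 - step_prob w (Suc j)" using J0[OF True] step by (auto split: if_splits)
      then show ?thesis unfolding True by (simp only: sum.empty)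
    next
      case False
      assume *: "(\<Sum>\<nu>\<in>?J. attach_prob md \<delta> a2 m w (Suc j) ?E (v \<nu>)) \<le> (if w \<in> v ` N then weight_bound \<delta> / ?c else weight_before \<delta> v w / ?c)"
      have nn: "0 \<le> weight_bound \<delta>" using weight_before_nonneg weight_before_le order_trans by blast
      show ?thesis using * cmp[OF _ nn False] cmp[OF _ weight_before_nonneg False] step by (auto split: if_splits)
    qed
    then show ?thesis using ge by linarith
  qed
qed

lemma attach_good:
  assumes w: "3 \<le> w" "w \<le> n" and H: "H \<in> good w 0"
    and base: "(\<exists>\<nu>\<in>N. v \<nu> \<le> w) \<Longrightarrow> base w > 0"
    and nonneg: "\<And>j. 1 \<le> j \<Longrightarrow> j \<le> m w \<Longrightarrow> step_prob w j \<ge> 0"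
  shows "j \<le> m w \<Longrightarrow> measure (measure_pmf (attach_hist m w j H)) (good w j) \<ge> (\<Prod>i\<in>{1..j}. step_prob w i)"
proof (induction j)
  case 0
  then show ?case using H by simp
next
  case (Suc j)
  have "(\<Prod>i\<in>{1..Suc j}. step_prob w i) = (\<Prod>i\<in>{1..j}. step_prob w i) * step_prob w (Suc j)"
    by (simp add: prod.nat_ivl_Suc')
  also have "\<dots> \<le> measure (measure_pmf (attach_hist m w j H)) (good w j) * step_prob w (Suc j)"
    using Suc nonneg[of "Suc j"] by (intro mult_right_mono) auto
  also have "\<dots> \<le> measure (measure_pmf (attach_hist m w (Suc j) H)) (good w (Suc j))"
    unfolding attach_hist.simps
  proof (rule measure_bind_pmf_ge)
    show "0 \<le> step_prob w (Suc j)" using Suc.prems nonneg[of "Suc j"] by simp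
    fix H' assume H': "H' \<in> good w j"
    have "(\<lambda>u. H'(w := (H' w)(Suc j := u))) -` good w (Suc j) =
       {u. 1 \<le> u \<and> u \<le> w \<and> (md = Model_D \<longrightarrow> u < w) \<and> allowed v w (Suc j) u}"
      unfolding vimage_def good_Suc using H' by simp
    then show "step_prob w (Suc j) \<le> measure (measure_pmf (map_pmf (\<lambda>u. H'(w := (H' w)(Suc j := u)))
         (embed_pmf (attach_prob md \<delta> a2 m w (Suc j) (edges_of G0 m w j H'))))) (good w (Suc j))"
      using step_prob_le[OF w Suc.prems H' base] by simp
  qed
  finally show ?case .
qed

text \<open>The chain rule along the arrivals of the vertices, with \<open>attach_good\<close> for
  the edges of one vertex.\<close>

lemma hist_good:
  assumes base: "\<And>w. (\<exists>\<nu>\<in>N. v \<nu> \<le> w) \<Longrightarrow> w \<le> n \<Longrightarrow> base w > 0"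
    and nonneg: "\<And>w j. 3 \<le> w \<Longrightarrow> w \<le> n \<Longrightarrow> 1 \<le> j \<Longrightarrow> j \<le> m w \<Longrightarrow> step_prob w j \<ge> 0"
    and n: "2 \<le> n'" "n' \<le> n"
  shows "measure (measure_pmf (hist m n')) (good (Suc n') 0) \<ge> (\<Prod>w\<in>{3..n'}. \<Prod>j\<in>{1..m w}. step_prob w j)"
  using n
proof (induction n' rule: dec_induct)
  case base
  have "steps m 3 0 = {}" by (auto simp: steps_def)
  then show ?case by (simp add: numeral_2_eq_2 good_def targets_ok_def flip: numeral_3_eq_3)
next
  case (step k)
  let ?w = "Suc k"
  have w: "3 \<le> ?w" "?w \<le> n" using step by auto
  have nn: "0 \<le> (\<Prod>j\<in>{1..m ?w}. step_prob ?w j)" using nonneg[OF w] by (intro prod_nonneg) auto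
  have "{3..?w} = insert ?w {3..k}" using step by auto
  then have "(\<Prod>w\<in>{3..?w}. \<Prod>j\<in>{1..m w}. step_prob w j) =
      (\<Prod>w\<in>{3..k}. \<Prod>j\<in>{1..m w}. step_prob w j) * (\<Prod>j\<in>{1..m ?w}. step_prob ?w j)"
    by (simp add: mult.commute)
  also have "\<dots> \<le> measure (measure_pmf (hist m k)) (good ?w 0) * (\<Prod>j\<in>{1..m ?w}. step_prob ?w j)"
    using step nn by (intro mult_right_mono) auto
  also have "\<dots> \<le> measure (measure_pmf (bind_pmf (hist m k) (attach_hist m ?w (m ?w)))) (good ?w (m ?w))"
    using attach_good[OF w _ base[OF _ w(2)] nonneg[OF w]] nn by (intro measure_bind_pmf_ge) auto
  also have "\<dots> = measure (measure_pmf (hist m ?w)) (good (Suc ?w) 0)"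
    using step good_last[OF w(1)] by simp
  finally show ?case .
qed

lemma good_occurs: "H \<in> good (Suc n) 0 \<Longrightarrow> occurs n v m H"
  using m_dg by (auto simp: good_def occurs_def steps_def)

text \<open>A regrouping: factors of prescribed edges are first collected by source, to separate
  them from the other edges of pattern vertices, then their numerators by target. In order of
  attachment the weight of a target grows by \<open>1\<close> each time, which gives the
  \<open>pochhammer\<close> factor.\<close>

lemma prod_step_prob_ge:
  assumes base: "\<And>w. (\<exists>\<nu>\<in>N. v \<nu> \<le> w) \<Longrightarrow> w \<le> n \<Longrightarrow> base w > 0 \<and> weight_bound \<delta> \<le> base w"
  shows "(\<Prod>w\<in>{3..n}. \<Prod>j\<in>{1..m w}. step_prob w j) \<ge>
    (\<Prod>\<nu>\<in>I. pochhammer (real (dg \<nu>) + \<delta>) (indeg \<nu>)) *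
    (\<Prod>c\<in>C. 1 / normalisation md \<delta> a2 m (v (src c)) (ix c)) *
    (\<Prod>\<nu>\<in>N. (1 - weight_bound \<delta> / base (v \<nu>)) ^ dg \<nu>) *
    (\<Prod>w\<in>{3..n} - v ` N. (1 - weight_before \<delta> v w / base w) ^ m w)"
    and "\<And>w j. 3 \<le> w \<Longrightarrow> w \<le> n \<Longrightarrow> 1 \<le> j \<Longrightarrow> j \<le> m w \<Longrightarrow> step_prob w j \<ge> 0"
proof -
  let ?nm = "\<lambda>c. normalisation md \<delta> a2 m (v (src c)) (ix c)"
  have fI: "finite I" using I N finite_subset by auto
  have norm_pos: "?nm c > 0" if c: "c \<in> C" for c
  proof -
    have s: "src c \<in> N" using src c by auto
    have "base (v (src c)) > 0" using base s v_range[OF s] by auto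
    moreover have "base (v (src c)) \<le> ?nm c"
      unfolding base_def using v_range[OF s] ix[OF c] m_dg[OF s] by (intro normalisation_lower) auto
    ultimately show ?thesis by linarith
  qed
  define W where "W c = (real (dg (tg c)) + \<delta> + real (earlier (tg c) (v (src c)) (ix c - 1)))" for c
  have W_pos: "W c > 0" if "c \<in> C" for c
    using dg_pos[of "tg c"] tg[OF that] I by (auto simp: W_def intro: add_pos_nonneg)
  have pN: "0 \<le> 1 - weight_bound \<delta> / base (v \<nu>)" "1 - weight_bound \<delta> / base (v \<nu>) \<le> 1" if "\<nu> \<in> N" for \<nu>
  proof -
    have "base (v \<nu>) > 0 \<and> weight_bound \<delta> \<le> base (v \<nu>)" using base that v_range[OF that] by auto
    moreover have "weight_bound \<delta> \<ge> 0" using weight_before_nonneg weight_before_le order_trans by blast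
    ultimately show "0 \<le> 1 - weight_bound \<delta> / base (v \<nu>)" "1 - weight_bound \<delta> / base (v \<nu>) \<le> 1" by auto
  qed
  have pF: "0 \<le> 1 - weight_before \<delta> v w / base w" if "w \<le> n" for w
  proof (cases "\<exists>\<nu>\<in>N. v \<nu> \<le> w")
    case True
    then have "base w > 0 \<and> weight_bound \<delta> \<le> base w" using base that by auto
    then show ?thesis using weight_before_le[of w] by simp
  next
    case False
    then have "{\<nu>\<in>I. v \<nu> < w} = {}" using I less_imp_le by blast
    then have "weight_before \<delta> v w = 0" by (simp only: weight_before_def sum.empty)
    then show ?thesis by simp
  qed
  show nonneg: "step_prob w j \<ge> 0" if "3 \<le> w" "w \<le> n" "1 \<le> j" "j \<le> m w" for w j
  proof (cases "\<exists>c\<in>C. w = v (src c) \<and> j = ix c")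
    case True
    then obtain c where c: "c \<in> C" "w = v (src c)" "j = ix c" by auto
    then show ?thesis using step_prob_edge[OF c(1)] W_pos[OF c(1)] norm_pos[OF c(1)] by (simp add: W_def)
  next
    case False
    then show ?thesis using pN pF[OF that(2)] unfolding step_prob_def by (subst if_not_P) auto
  qed
  have free: "(\<Prod>j\<in>{1..m w}. step_prob w j) = (1 - weight_before \<delta> v w / base w) ^ m w" if "w \<in> {3..n} - v ` N" for w
  proof -
    have "step_prob w j = 1 - weight_before \<delta> v w / base w" for j
      using that src unfolding step_prob_def by (subst if_not_P) auto
    then show ?thesis by simp
  qed
  have edges_nonneg: "0 \<le> (\<Prod>c\<in>{c\<in>C. src c = \<nu>}. W c / ?nm c)" for \<nu>
    using W_pos norm_pos by (intro prod_nonneg ballI less_imp_le[OF divide_pos_pos]) auto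
  have pinned: "(\<Prod>j\<in>{1..m (v \<nu>)}. step_prob (v \<nu>) j) \<ge>
      (\<Prod>c\<in>{c\<in>C. src c = \<nu>}. W c / ?nm c) * (1 - weight_bound \<delta> / base (v \<nu>)) ^ dg \<nu>"
    if \<nu>: "\<nu> \<in> N" for \<nu>
  proof -
    let ?J = "ix ` {c\<in>C. src c = \<nu>}" and ?q = "1 - weight_bound \<delta> / base (v \<nu>)"
    have J: "?J \<subseteq> {1..m (v \<nu>)}" using ix m_dg[OF \<nu>] by auto
    have inj: "inj_on ix {c\<in>C. src c = \<nu>}" using src_ix_inj by (auto simp: inj_on_def)
    have "(\<Prod>j\<in>{1..m (v \<nu>)}. step_prob (v \<nu>) j) = (\<Prod>j\<in>{1..m (v \<nu>)} - ?J. step_prob (v \<nu>) j) * (\<Prod>j\<in>?J. step_prob (v \<nu>) j)"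
      using J by (intro prod.subset_diff) auto
    also have "(\<Prod>j\<in>?J. step_prob (v \<nu>) j) = (\<Prod>c\<in>{c\<in>C. src c = \<nu>}. step_prob (v \<nu>) (ix c))"
      using inj by (simp add: prod.reindex)
    also have "\<dots> = (\<Prod>c\<in>{c\<in>C. src c = \<nu>}. W c / ?nm c)"
      using step_prob_edge by (intro prod.cong) (auto simp: W_def)
    also have "(\<Prod>j\<in>{1..m (v \<nu>)} - ?J. step_prob (v \<nu>) j) = (\<Prod>j\<in>{1..m (v \<nu>)} - ?J. ?q)"
    proof (intro prod.cong refl)
      fix j assume j: "j \<in> {1..m (v \<nu>)} - ?J"
      then have "\<not> (\<exists>c\<in>C. v \<nu> = v (src c) \<and> j = ix c)"
        using src v_eq_iff[OF \<nu>] by auto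
      then show "step_prob (v \<nu>) j = ?q" using \<nu> unfolding step_prob_def by (subst if_not_P) auto
    qed
    also have "\<dots> = ?q ^ card ({1..m (v \<nu>)} - ?J)" by simp
    finally have eq: "(\<Prod>j\<in>{1..m (v \<nu>)}. step_prob (v \<nu>) j) =
       ?q ^ card ({1..m (v \<nu>)} - ?J) * (\<Prod>c\<in>{c\<in>C. src c = \<nu>}. W c / ?nm c)" .
    \<comment> \<open>Raising the exponent to \<open>dg \<nu>\<close> only lowers the power, because
      its base lies in \<open>[0, 1]\<close>.\<close>
    have "card ({1..m (v \<nu>)} - ?J) \<le> dg \<nu>"
      using card_mono[of "{1..m (v \<nu>)}" "{1..m (v \<nu>)} - ?J"] m_dg[OF \<nu>] by auto
    then have "?q ^ dg \<nu> \<le> ?q ^ card ({1..m (v \<nu>)} - ?J)" using pN[OF \<nu>] by (intro power_decreasing) auto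
    then show ?thesis unfolding eq
      by (subst mult.commute) (rule mult_right_mono[OF _ edges_nonneg])
  qed
  have "{3..n} = ({3..n} - v ` N) \<union> v ` N" using v_range by auto
  then have "(\<Prod>w\<in>{3..n}. \<Prod>j\<in>{1..m w}. step_prob w j) =
    (\<Prod>w\<in>{3..n} - v ` N. \<Prod>j\<in>{1..m w}. step_prob w j) * (\<Prod>w\<in>v ` N. \<Prod>j\<in>{1..m w}. step_prob w j)"
    using N by (metis (no_types, lifting) prod.union_disjoint finite_Diff finite_atLeastAtMost finite_imageI Diff_disjoint inf_commute)
  also have "(\<Prod>w\<in>{3..n} - v ` N. \<Prod>j\<in>{1..m w}. step_prob w j) = (\<Prod>w\<in>{3..n} - v ` N. (1 - weight_before \<delta> v w / base w) ^ m w)"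
    using free by (intro prod.cong) auto
  also have "(\<Prod>w\<in>v ` N. \<Prod>j\<in>{1..m w}. step_prob w j) = (\<Prod>\<nu>\<in>N. \<Prod>j\<in>{1..m (v \<nu>)}. step_prob (v \<nu>) j)"
    using v_inj by (simp add: prod.reindex)
  finally have total: "(\<Prod>w\<in>{3..n}. \<Prod>j\<in>{1..m w}. step_prob w j) =
    (\<Prod>w\<in>{3..n} - v ` N. (1 - weight_before \<delta> v w / base w) ^ m w) * (\<Prod>\<nu>\<in>N. \<Prod>j\<in>{1..m (v \<nu>)}. step_prob (v \<nu>) j)" .
  have "(\<Prod>\<nu>\<in>N. \<Prod>j\<in>{1..m (v \<nu>)}. step_prob (v \<nu>) j) \<ge>
    (\<Prod>\<nu>\<in>N. (\<Prod>c\<in>{c\<in>C. src c = \<nu>}. W c / ?nm c) * (1 - weight_bound \<delta> / base (v \<nu>)) ^ dg \<nu>)"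
    using pinned pN(1) edges_nonneg by (intro prod_mono conjI mult_nonneg_nonneg zero_le_power) auto
  also have "(\<Prod>\<nu>\<in>N. (\<Prod>c\<in>{c\<in>C. src c = \<nu>}. W c / ?nm c) * (1 - weight_bound \<delta> / base (v \<nu>)) ^ dg \<nu>) =
    (\<Prod>c\<in>C. W c / ?nm c) * (\<Prod>\<nu>\<in>N. (1 - weight_bound \<delta> / base (v \<nu>)) ^ dg \<nu>)"
    unfolding prod.distrib using N C src by (subst prod.group) auto
  also have "(\<Prod>c\<in>C. W c / ?nm c) =
      (\<Prod>c\<in>C. W c) * (\<Prod>c\<in>C. 1 / ?nm c)"
    by (simp add: prod.distrib[symmetric])
  also have "(\<Prod>c\<in>C. W c) = (\<Prod>\<nu>\<in>I. \<Prod>c\<in>{c\<in>C. tg c = \<nu>}. W c)"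
    using fI C tg by (subst prod.group) auto
  also have "\<dots> = (\<Prod>\<nu>\<in>I. pochhammer (real (dg \<nu>) + \<delta>) (indeg \<nu>))"
  proof (intro prod.cong refl)
    fix \<nu> assume \<nu>: "\<nu> \<in> I"
    let ?A = "{c\<in>C. tg c = \<nu>}"
    \<comment> \<open>Encodes the lexicographic order by position of the source and edge index in
      one number; the multiplier exceeds every edge index.\<close>
    define key where "key c = v (src c) * (Suc (\<Sum>\<nu>\<in>N. dg \<nu>)) + ix c" for c
    have ixb: "ix c \<le> (\<Sum>\<nu>\<in>N. dg \<nu>)" if "c \<in> C" for c
      using ix[OF that] member_le_sum[OF src[OF that], of dg] N by force
    have key_less: "key c' < key c \<longleftrightarrow> v (src c') < v (src c) \<or> v (src c') = v (src c) \<and> ix c' < ix c"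
      if "c \<in> C" "c' \<in> C" for c c'
    proof -
      have aux: "a * Suc B + i < b * Suc B + j" if "a < b" "i \<le> B" for a b i j B :: nat
      proof -
        have "a * Suc B + i < Suc a * Suc B" using that by simp
        also have "\<dots> \<le> b * Suc B" using that by (intro mult_right_mono) auto
        finally show ?thesis by simp
      qed
      show ?thesis using aux[of "v (src c')" "v (src c)"] aux[of "v (src c)" "v (src c')"] ixb[OF that(1)] ixb[OF that(2)]
        unfolding key_def by (cases "v (src c')" "v (src c)" rule: linorder_cases) (auto dest: less_asym)
    qed
    have "inj_on key ?A"
    proof (rule inj_onI)
      fix c c' assume c: "c \<in> ?A" "c' \<in> ?A" "key c = key c'"
      then have "v (src c) = v (src c') \<and> ix c = ix c'"
        using key_less[of c c'] key_less[of c' c] by (auto simp: not_less intro: antisym)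
      then show "c = c'" using c src_ix_inj src v_eq_iff by (auto simp: inj_on_def)
    qed
    moreover have "W c = real (dg \<nu>) + \<delta> + real (card {c'\<in>?A. key c' < key c})" if c: "c \<in> ?A" for c
    proof -
      have cC: "c \<in> C" using c by auto
      have "(v (src c'), ix c') \<in> steps m (v (src c)) (ix c - 1) \<longleftrightarrow> key c' < key c" if "c' \<in> C" for c'
        using key_less[OF cC that] v_range[OF src[OF that]] ix[OF that] m_dg[OF src[OF that]] ix[OF cC]
        by (auto simp: steps_def)
      then have "{c'\<in>C. tg c' = \<nu> \<and> (v (src c'), ix c') \<in> steps m (v (src c)) (ix c - 1)} = {c'\<in>?A. key c' < key c}"
        by auto
      then show ?thesis using c by (simp add: W_def earlier_def)
    qed
    ultimately have "(\<Prod>c\<in>?A. W c) = (\<Prod>i<card ?A. real (dg \<nu>) + \<delta> + real i)"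
      using prod_rank[of ?A key "\<lambda>i. real (dg \<nu>) + \<delta> + real i"] C by simp
    then show "(\<Prod>c\<in>?A. W c) = pochhammer (real (dg \<nu>) + \<delta>) (indeg \<nu>)"
      by (simp add: pochhammer_prod indeg_def atLeast0LessThan)
  qed
  finally have fin: "(\<Prod>\<nu>\<in>I. pochhammer (real (dg \<nu>) + \<delta>) (indeg \<nu>)) *
    (\<Prod>c\<in>C. 1 / ?nm c) *
    (\<Prod>\<nu>\<in>N. (1 - weight_bound \<delta> / base (v \<nu>)) ^ dg \<nu>) \<le> (\<Prod>\<nu>\<in>N. \<Prod>j\<in>{1..m (v \<nu>)}. step_prob (v \<nu>) j)" .
  have "0 \<le> (\<Prod>w\<in>{3..n} - v ` N. (1 - weight_before \<delta> v w / base w) ^ m w)"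
    using pF by (intro prod_nonneg) auto
  from mult_right_mono[OF fin this] show "(\<Prod>w\<in>{3..n}. \<Prod>j\<in>{1..m w}. step_prob w j) \<ge>
    (\<Prod>\<nu>\<in>I. pochhammer (real (dg \<nu>) + \<delta>) (indeg \<nu>)) *
    (\<Prod>c\<in>C. 1 / ?nm c) *
    (\<Prod>\<nu>\<in>N. (1 - weight_bound \<delta> / base (v \<nu>)) ^ dg \<nu>) *
    (\<Prod>w\<in>{3..n} - v ` N. (1 - weight_before \<delta> v w / base w) ^ m w)"
    unfolding total by (simp only: mult_ac)
qed

theorem prob_occurs_ge:
  assumes base: "\<And>w. (\<exists>\<nu>\<in>N. v \<nu> \<le> w) \<Longrightarrow> w \<le> n \<Longrightarrow> base w > 0 \<and> weight_bound \<delta> \<le> base w" and n: "2 \<le> n"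
  shows "measure (measure_pmf (hist m n)) {H. occurs n v m H} \<ge>
    (\<Prod>\<nu>\<in>I. pochhammer (real (dg \<nu>) + \<delta>) (indeg \<nu>)) *
    (\<Prod>c\<in>C. 1 / normalisation md \<delta> a2 m (v (src c)) (ix c)) *
    (\<Prod>\<nu>\<in>N. (1 - weight_bound \<delta> / base (v \<nu>)) ^ dg \<nu>) *
    (\<Prod>w\<in>{3..n} - v ` N. (1 - weight_before \<delta> v w / base w) ^ m w)" (is "_ \<ge> ?R")
proof -
  have "?R \<le> (\<Prod>w\<in>{3..n}. \<Prod>j\<in>{1..m w}. step_prob w j)" by (rule prod_step_prob_ge(1)[OF base])
  also have "\<dots> \<le> measure (measure_pmf (hist m n)) (good (Suc n) 0)"
    using base prod_step_prob_ge(2)[OF base] n by (intro hist_good) auto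
  also have "\<dots> \<le> measure (measure_pmf (hist m n)) {H. occurs n v m H}"
    using good_occurs by (intro measure_pmf.finite_measure_mono) auto
  finally show ?thesis .
qed

end

section \<open>Averaging over the out-degrees\<close>

text \<open>Drawing coordinate \<open>w\<close> separately makes it independent of
  \<open>\<phi>\<close>. In the application \<open>\<phi>\<close> indicates that the out-degrees
  before \<open>w\<close> add up to too little.\<close>

lemma Pi_pmf_expectation_independent:
  fixes p :: "nat pmf" and \<phi> :: "('a \<Rightarrow> nat) \<Rightarrow> real"
  assumes A: "finite A" "w \<in> A" and indep: "\<And>g y. \<phi> (g(w := y)) = \<phi> g"
    and int: "integrable (measure_pmf p) real" and \<phi>: "\<And>g. 0 \<le> \<phi> g" "\<And>g. \<phi> g \<le> 1"
  shows "integrable (measure_pmf (Pi_pmf A d (\<lambda>_. p))) (\<lambda>g. real (g w) * \<phi> g)"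
    and "measure_pmf.expectation (Pi_pmf A d (\<lambda>_. p)) (\<lambda>g. real (g w) * \<phi> g) =
      measure_pmf.expectation p real * measure_pmf.expectation (Pi_pmf A d (\<lambda>_. p)) \<phi>"
proof -
  let ?P = "Pi_pmf A d (\<lambda>_. p)" and ?Q = "Pi_pmf (A - {w}) d (\<lambda>_. p)"
  have P: "?P = bind_pmf p (\<lambda>y. map_pmf (\<lambda>f. f(w := y)) ?Q)"
    using A Pi_pmf_insert'[of "A - {w}" w d "\<lambda>_. p"] by (simp add: insert_absorb map_pmf_def)
  have E: "(\<integral>\<^sup>+g. f (g w) * ennreal (\<phi> g) \<partial>?P) = (\<integral>\<^sup>+y. f y \<partial>p) * (\<integral>\<^sup>+g. ennreal (\<phi> g) \<partial>?Q)" for f :: "nat \<Rightarrow> ennreal"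
    unfolding P by (simp add: nn_integral_bind_pmf indep nn_integral_cmult nn_integral_multc)
  have E1: "(\<integral>\<^sup>+g. ennreal (\<phi> g) \<partial>?P) = (\<integral>\<^sup>+g. ennreal (\<phi> g) \<partial>?Q)"
    using E[of "\<lambda>_. 1"] by (simp add: measure_pmf.emeasure_space_1[simplified])
  have int\<phi>: "integrable ?P \<phi>"
    using \<phi> by (intro measure_pmf.integrable_const_bound[of _ 1]) auto
  have "(\<integral>\<^sup>+g. ennreal (real (g w) * \<phi> g) \<partial>?P) = (\<integral>\<^sup>+g. ennreal (real (g w)) * ennreal (\<phi> g) \<partial>?P)"
    using \<phi> by (simp add: ennreal_mult')
  also have "\<dots> = (\<integral>\<^sup>+y. ennreal (real y) \<partial>p) * (\<integral>\<^sup>+g. ennreal (\<phi> g) \<partial>?P)"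
    unfolding E1 by (rule E)
  also have "(\<integral>\<^sup>+y. ennreal (real y) \<partial>p) = ennreal (measure_pmf.expectation p real)"
    by (rule nn_integral_eq_integral[OF int]) simp
  also have "(\<integral>\<^sup>+g. ennreal (\<phi> g) \<partial>?P) = ennreal (measure_pmf.expectation ?P \<phi>)"
    using \<phi> by (intro nn_integral_eq_integral int\<phi>) simp
  also have "ennreal (measure_pmf.expectation p real) * \<dots> = ennreal (measure_pmf.expectation p real * measure_pmf.expectation ?P \<phi>)"
    using \<phi> by (simp add: ennreal_mult'' Bochner_Integration.integral_nonneg)
  finally have *: "(\<integral>\<^sup>+g. ennreal (real (g w) * \<phi> g) \<partial>?P) = ennreal (measure_pmf.expectation p real * measure_pmf.expectation ?P \<phi>)" .
  show i: "integrable ?P (\<lambda>g. real (g w) * \<phi> g)"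
    using * \<phi> by (intro integrableI_nonneg) auto
  show "measure_pmf.expectation ?P (\<lambda>g. real (g w) * \<phi> g) = measure_pmf.expectation p real * measure_pmf.expectation ?P \<phi>"
    using * \<phi> i by (subst (asm) nn_integral_eq_integral)
      (auto simp: Bochner_Integration.integral_nonneg)
qed

text \<open>Jensen's inequality in tangent form:
  \<open>exp (- Y) \<ge> exp (- y) * (1 - (Y - y))\<close>, and the right side has expectation at
  least \<open>exp (- y)\<close> if the mean of \<open>Y\<close> is at most \<open>y\<close>. Thus
  only means have to be bounded.\<close>

lemma expectation_exp_ge:
  fixes p :: "'a pmf" and Y \<phi> :: "'a \<Rightarrow> real" and W y :: real
  assumes W: "W \<ge> 0" and Y: "integrable (measure_pmf p) Y" "measure_pmf.expectation p Y \<le> y"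
    and \<phi>: "\<And>g. g \<in> set_pmf p \<Longrightarrow> W * exp (- Y g) \<le> \<phi> g" and b: "\<And>g. 0 \<le> \<phi> g" "\<And>g. \<phi> g \<le> 1"
  shows "W * exp (- y) \<le> measure_pmf.expectation p \<phi>"
proof -
  have "W * exp (- y) * (1 - (Y g - y)) \<le> \<phi> g" if "g \<in> set_pmf p" for g
  proof -
    have "1 - (Y g - y) \<le> exp (- (Y g - y))" using exp_ge_add_one_self[of "- (Y g - y)"] by linarith
    then have "W * exp (- y) * (1 - (Y g - y)) \<le> W * exp (- y) * exp (- (Y g - y))"
      using W by (intro mult_left_mono) auto
    also have "\<dots> = W * exp (- Y g)" by (simp add: exp_add[symmetric] mult.assoc)
    finally show ?thesis using \<phi>[OF that] by simp
  qed
  moreover have "integrable (measure_pmf p) \<phi>"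
    using b by (intro measure_pmf.integrable_const_bound[of _ 1]) auto
  ultimately have "measure_pmf.expectation p (\<lambda>g. W * exp (- y) * (1 - (Y g - y))) \<le> measure_pmf.expectation p \<phi>"
    using Y(1) by (intro integral_mono_AE) (auto simp: AE_measure_pmf_iff)
  also have "measure_pmf.expectation p (\<lambda>g. W * exp (- y) * (1 - (Y g - y))) =
      W * exp (- y) * (1 - (measure_pmf.expectation p Y - y))"
    using Y(1) by simp
  finally have *: "W * exp (- y) * (1 - (measure_pmf.expectation p Y - y)) \<le> measure_pmf.expectation p \<phi>" .
  have "W * exp (- y) * 1 \<le> W * exp (- y) * (1 - (measure_pmf.expectation p Y - y))"
    using W Y(2) by (intro mult_left_mono) auto
  then show ?thesis using * by simp
qed

lemma sum_inverse_le_ln: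
  assumes "1 \<le> a" "a \<le> n"
  shows "(\<Sum>w\<in>{Suc a..n}. 1 / real w) \<le> ln (real n / real a)"
  using assms(2)
proof (induction n rule: dec_induct)
  case base
  then show ?case by simp
next
  case (step k)
  have k: "real k > 0" using step assms by simp
  have "ln (real k / real (Suc k)) \<le> real k / real (Suc k) - 1" using k by (intro ln_le_minus_one) auto
  also have "\<dots> = - (1 / real (Suc k))" by (simp add: field_simps)
  finally have "1 / real (Suc k) \<le> ln (real (Suc k)) - ln (real k)" using k by (simp add: ln_div)
  moreover have "{Suc a..Suc k} = insert (Suc k) {Suc a..k}" using step by auto
  ultimately show ?case using step k assms by (simp add: ln_div)
qed

lemma sum_inverse_square_le:
  assumes "1 \<le> a"
  shows "(\<Sum>w\<in>{Suc a..n}. 1 / real w ^ 2) \<le> 1 / real a"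
proof (cases "a \<le> n")
  case True
  then have "(\<Sum>w\<in>{Suc a..n}. 1 / real w ^ 2) \<le> 1 / real a - 1 / real n"
  proof (induction n rule: dec_induct)
    case (step k)
    have k: "real k > 0" using step assms by simp
    have "1 / real (Suc k) ^ 2 \<le> 1 / (real k * real (Suc k))"
      using k by (intro divide_left_mono) (auto simp: power2_eq_square)
    also have "\<dots> = 1 / real k - 1 / real (Suc k)" using k by (simp add: field_simps)
    finally have "1 / real (Suc k) ^ 2 \<le> 1 / real k - 1 / real (Suc k)" .
    moreover have "{Suc a..Suc k} = insert (Suc k) {Suc a..k}" using step by auto
    ultimately show ?case using step by simp
  qed simp
  then show ?thesis by (smt (verit) of_nat_0_le_iff zero_le_divide_1_iff)
qed simp

section \<open>A weak law for lower deviations of the out-degrees\<close>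

context pa_params
begin

text \<open>Truncation at \<open>K\<close> lowers the mean by less than \<open>\<eta> / 2\<close>
  and makes the summands bounded, so that Hoeffding's inequality applies. Its exponential bound is
  weakened to \<open>c / card A\<close>, which becomes summable together with the factor
  \<open>1 / w\<close> that accompanies it later.\<close>

lemma lower_tail:
  assumes \<eta>: "\<eta> > 0"
  obtains c where "c \<ge> 0"
    "\<And>A B. finite B \<Longrightarrow> A \<subseteq> B \<Longrightarrow> A \<noteq> {} \<Longrightarrow>
      measure (measure_pmf (Pi_pmf B 1 (\<lambda>_. M))) {g. real (\<Sum>i\<in>A. g i) \<le> (EM - \<eta>) * real (card A)} \<le> c / real (card A)"
proof -
  have "(\<lambda>K. measure_pmf.expectation M (\<lambda>k. min (real k) (real K))) \<longlonglongrightarrow> measure_pmf.expectation M real"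
  proof (rule integral_dominated_convergence[where w=real])
    show "AE k in measure_pmf M. (\<lambda>K. min (real k) (real K)) \<longlonglongrightarrow> real k"
    proof (rule AE_I2)
      fix k
      have "eventually (\<lambda>K. min (real k) (real K) = real k) sequentially"
        using eventually_ge_at_top[of k] by eventually_elim auto
      then show "(\<lambda>K. min (real k) (real K)) \<longlonglongrightarrow> real k" by (rule tendsto_eventually)
    qed
  qed (use M_integrable in auto)
  then have "eventually (\<lambda>K. measure_pmf.expectation M (\<lambda>k. min (real k) (real K)) > EM - \<eta> / 2) sequentially"
    using \<eta> by (intro order_tendstoD) (auto simp: EM_def)
  then obtain K where K: "K \<ge> 1" "measure_pmf.expectation M (\<lambda>k. min (real k) (real K)) > EM - \<eta> / 2"
    by (metis (no_types, lifting) eventually_sequentially nle_le)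
  define h where "h k = min (real k) (real K)" for k :: nat
  define e where "e = measure_pmf.expectation M h"
  have e: "e > EM - \<eta> / 2" using K by (simp add: e_def h_def[abs_def])
  \<comment> \<open>For a deviation of \<open>\<eta> / 2 * card A\<close> and summands in
    \<open>[0, K]\<close>, Hoeffding's exponent is \<open>- card A / c\<close>; then
    \<open>exp (- t) \<le> 1 / t\<close> is applied.\<close>
  define c where "c = 2 * real K ^ 2 / \<eta> ^ 2"
  show ?thesis
  proof (rule that[of c])
    show "c \<ge> 0" by (simp add: c_def)
    fix A B :: "'b set" assume B: "finite B" "A \<subseteq> B" "A \<noteq> {}"
    have A: "finite A" using B finite_subset by auto
    let ?P = "Pi_pmf A 1 (\<lambda>_. M)"
    interpret P: prob_space "measure_pmf ?P" by (rule measure_pmf.prob_space_axioms)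
    interpret Hoeffding_ineq "measure_pmf ?P" A "\<lambda>i g. h (g i)" "\<lambda>_. 0" "\<lambda>_. real K" "\<Sum>i\<in>A. measure_pmf.expectation ?P (\<lambda>g. h (g i))"
    proof unfold_locales
      show "prob_space.indep_vars (measure_pmf ?P) (\<lambda>_. borel) (\<lambda>i g. h (g i)) A"
        using prob_space.indep_vars_compose2[OF measure_pmf.prob_space_axioms
            indep_vars_Pi_pmf[OF A, of 1 "\<lambda>_. M"], of "\<lambda>_. h" "\<lambda>_. borel"] by simp
    qed (auto simp: A h_def)
    have Eh: "measure_pmf.expectation ?P (\<lambda>g. h (g i)) = e" if "i \<in> A" for i
    proof -
      have "map_pmf (\<lambda>g. g i) ?P = M" using A that by (simp add: Pi_pmf_component)
      then have "e = measure_pmf.expectation (map_pmf (\<lambda>g. g i) ?P) h" by (simp only: e_def)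
      then show ?thesis by simp
    qed
    have cA: "real (card A) > 0" using A B by (simp add: card_gt_0_iff)
    have "measure ?P {g. real (\<Sum>i\<in>A. g i) \<le> (EM - \<eta>) * real (card A)} \<le>
      measure ?P {g\<in>space ?P. (\<Sum>i\<in>A. h (g i)) \<le> (\<Sum>i\<in>A. measure_pmf.expectation ?P (\<lambda>g. h (g i))) - \<eta> / 2 * real (card A)}"
    proof (intro measure_pmf.finite_measure_mono subsetI CollectI conjI)
      fix g assume "g \<in> {g. real (\<Sum>i\<in>A. g i) \<le> (EM - \<eta>) * real (card A)}"
      then have "real (\<Sum>i\<in>A. g i) \<le> (EM - \<eta>) * real (card A)" by simp
      moreover have "(\<Sum>i\<in>A. h (g i)) \<le> real (\<Sum>i\<in>A. g i)" by (auto simp: h_def intro!: sum_mono)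
      moreover have "(EM - \<eta>) * real (card A) \<le> (e - \<eta> / 2) * real (card A)"
        using e cA by (intro mult_right_mono) auto
      ultimately show "(\<Sum>i\<in>A. h (g i)) \<le> (\<Sum>i\<in>A. measure_pmf.expectation ?P (\<lambda>g. h (g i))) - \<eta> / 2 * real (card A)"
        using Eh by (simp add: algebra_simps)
    qed auto
    also have "\<dots> \<le> exp (-2 * (\<eta> / 2 * real (card A))\<^sup>2 / (\<Sum>i\<in>A. (real K - 0)\<^sup>2))"
      using \<eta> K cA by (intro Hoeffding_ineq_le) auto
    also have "-2 * (\<eta> / 2 * real (card A))\<^sup>2 / (\<Sum>i\<in>A. (real K - 0)\<^sup>2) = - (real (card A) / c)"
      using cA K \<eta> by (simp add: c_def power2_eq_square field_simps)
    also have "exp (- (real (card A) / c)) \<le> c / real (card A)"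
    proof -
      have c0: "c > 0" using K \<eta> by (simp add: c_def)
      have "real (card A) / c \<le> exp (real (card A) / c)" using exp_ge_add_one_self[of "real (card A) / c"] by linarith
      then show ?thesis using c0 cA by (simp add: exp_minus field_simps)
    qed
    finally have *: "measure ?P {g. real (\<Sum>i\<in>A. g i) \<le> (EM - \<eta>) * real (card A)} \<le> c / real (card A)" .
    have "measure ?P {g. real (\<Sum>i\<in>A. g i) \<le> (EM - \<eta>) * real (card A)} =
      measure (Pi_pmf B 1 (\<lambda>_. M)) {g. real (\<Sum>i\<in>A. g i) \<le> (EM - \<eta>) * real (card A)}"
      unfolding Pi_pmf_subset[OF B(1,2)] by (simp add: vimage_def)
    then show "measure (Pi_pmf B 1 (\<lambda>_. M)) {g. real (\<Sum>i\<in>A. g i) \<le> (EM - \<eta>) * real (card A)} \<le> c / real (card A)"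
      using * by simp
  qed
qed

lemma Pi_pmf_integrable_component:
  assumes "finite B" "i \<in> B"
  shows "integrable (measure_pmf (Pi_pmf B 1 (\<lambda>_. M))) (\<lambda>g. real (g i))"
    and "measure_pmf.expectation (Pi_pmf B 1 (\<lambda>_. M)) (\<lambda>g. real (g i)) = EM"
proof -
  have m: "map_pmf (\<lambda>g. g i) (Pi_pmf B 1 (\<lambda>_. M)) = M" using assms by (simp add: Pi_pmf_component)
  show "integrable (measure_pmf (Pi_pmf B 1 (\<lambda>_. M))) (\<lambda>g. real (g i))"
    using M_integrable by (subst (asm) m[symmetric]) (simp add: map_pmf_rep_eq integrable_distr_eq)
  show "measure_pmf.expectation (Pi_pmf B 1 (\<lambda>_. M)) (\<lambda>g. real (g i)) = EM"
    unfolding EM_def by (subst (2) m[symmetric]) simp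
qed

lemma mu_gt_1: "\<mu> > 1"
  using EM_ge1 EM_delta_pos unfolding \<mu>_def by linarith

end

section \<open>Pattern probabilities averaged over the out-degrees\<close>

locale pa_pat = pa_graph M \<delta> md G0 + pattern N I C src tg ix dg
  for M :: "nat pmf" and \<delta> :: real and md :: pa_model and G0 :: edges
    and N I C :: "'i set" and src tg :: "'i \<Rightarrow> 'i" and ix dg :: "'i \<Rightarrow> nat"
begin

definition with_pinned :: "('i \<Rightarrow> nat) \<Rightarrow> (nat \<Rightarrow> nat) \<Rightarrow> nat \<Rightarrow> nat" where
  "with_pinned v g i = (if i \<in> v ` N then dg (the_inv_into N v i) else g i)"

text \<open>Keeping only the event that the pattern vertices have their prescribed out-degrees costs
  a factor \<open>pmf M (dg \<nu>)\<close> for each; the other out-degrees remain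
  independent.\<close>

lemma expectation_pinned_ge:
  assumes v: "placed n v" and \<phi>: "\<And>m. 0 \<le> \<phi> m" "\<And>m. \<phi> m \<le> 1"
  shows "measure_pmf.expectation (Pi_pmf {3..n} 1 (\<lambda>_. M)) \<phi> \<ge>
    (\<Prod>\<nu>\<in>N. pmf M (dg \<nu>)) * measure_pmf.expectation (Pi_pmf ({3..n} - v ` N) 1 (\<lambda>_. M)) (\<lambda>g. \<phi> (with_pinned v g))"
proof -
  let ?V = "v ` N" and ?F = "{3..n} - v ` N"
  have inj: "inj_on v N" and V: "?V \<subseteq> {3..n}" using v by (auto simp: placed_def)
  define f0 where "f0 i = (if i \<in> ?V then dg (the_inv_into N v i) else 1)" for i
  let ?P1 = "Pi_pmf ?V 1 (\<lambda>_. M)" and ?P2 = "Pi_pmf ?F 1 (\<lambda>_. M)"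
  have int: "integrable (measure_pmf p) f" if "\<And>x. 0 \<le> f x" "\<And>x. f x \<le> 1" for p :: "'z pmf" and f :: "'z \<Rightarrow> real"
    using that by (intro measure_pmf.integrable_const_bound[of _ 1]) auto
  have "{3..n} = ?V \<union> ?F" using V by auto
  then have P: "Pi_pmf {3..n} 1 (\<lambda>_. M) = map_pmf (\<lambda>(f, g) x. if x \<in> ?V then f x else g x) (pair_pmf ?P1 ?P2)"
    using Pi_pmf_union[of ?V ?F 1 "\<lambda>_. M"] N by simp
  have f0: "pmf ?P1 f0 = (\<Prod>\<nu>\<in>N. pmf M (dg \<nu>))"
  proof -
    have "pmf ?P1 f0 = (\<Prod>i\<in>?V. pmf M (f0 i))" using N by (intro pmf_Pi') (auto simp: f0_def)
    also have "\<dots> = (\<Prod>\<nu>\<in>N. pmf M (dg \<nu>))"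
      using inj by (simp add: prod.reindex f0_def the_inv_into_f_f)
    finally show ?thesis .
  qed
  have "ennreal (pmf ?P1 f0 * measure_pmf.expectation ?P2 (\<lambda>g. \<phi> (with_pinned v g))) =
     (\<integral>\<^sup>+g. ennreal (\<phi> (with_pinned v g)) \<partial>?P2) * ennreal (pmf ?P1 f0)"
    using \<phi> by (subst nn_integral_eq_integral) (auto simp: int ennreal_mult mult.commute intro!: Bochner_Integration.integral_nonneg)
  also have "\<dots> = (\<integral>\<^sup>+f. (\<integral>\<^sup>+g. ennreal (\<phi> (with_pinned v g)) \<partial>?P2) * indicator {f0} f \<partial>?P1)"
    by (subst nn_integral_cmult_indicator) (auto simp: emeasure_pmf_single)
  also have "\<dots> \<le> (\<integral>\<^sup>+f. (\<integral>\<^sup>+g. ennreal (\<phi> (\<lambda>x. if x \<in> ?V then f x else g x)) \<partial>?P2) \<partial>?P1)"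
  proof (intro nn_integral_mono)
    fix f
    have "(\<lambda>x. if x \<in> ?V then f0 x else g x) = with_pinned v g" for g
      by (auto simp: f0_def with_pinned_def)
    then show "(\<integral>\<^sup>+g. ennreal (\<phi> (with_pinned v g)) \<partial>?P2) * indicator {f0} f \<le>
      (\<integral>\<^sup>+g. ennreal (\<phi> (\<lambda>x. if x \<in> ?V then f x else g x)) \<partial>?P2)"
      by (auto split: split_indicator)
  qed
  also have "\<dots> = (\<integral>\<^sup>+m. ennreal (\<phi> m) \<partial>Pi_pmf {3..n} 1 (\<lambda>_. M))"
    unfolding P nn_integral_map_pmf nn_integral_pair_pmf' by simp
  also have "\<dots> = ennreal (measure_pmf.expectation (Pi_pmf {3..n} 1 (\<lambda>_. M)) \<phi>)"
    using \<phi> by (intro nn_integral_eq_integral int) auto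
  finally show ?thesis
    unfolding f0 using \<phi> by (simp add: Bochner_Integration.integral_nonneg)
qed

definition joint :: "nat \<Rightarrow> ((nat \<Rightarrow> nat) \<times> (nat \<Rightarrow> nat \<Rightarrow> nat)) pmf" where
  "joint n = bind_pmf (Pi_pmf {3..n} 1 (\<lambda>_. M)) (\<lambda>m. map_pmf (Pair m) (hist m n))"

definition prob_occurs :: "nat \<Rightarrow> ('i \<Rightarrow> nat) \<Rightarrow> real" where
  "prob_occurs n v = measure (measure_pmf (joint n)) {(m, H). occurs n v m H}"

lemma prob_occurs_eq:
  "prob_occurs n v = measure_pmf.expectation (Pi_pmf {3..n} 1 (\<lambda>_. M)) (\<lambda>m. measure (measure_pmf (hist m n)) {H. occurs n v m H})"
proof -
  let ?P = "Pi_pmf {3..n} 1 (\<lambda>_. M)"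
  have "ennreal (prob_occurs n v) = (\<integral>\<^sup>+m. ennreal (measure (measure_pmf (hist m n)) {H. occurs n v m H}) \<partial>?P)"
    unfolding prob_occurs_def joint_def measure_pmf.emeasure_eq_measure[symmetric] emeasure_bind_pmf
    by (intro nn_integral_cong) (simp add: vimage_def)
  also have "\<dots> = ennreal (measure_pmf.expectation ?P (\<lambda>m. measure (measure_pmf (hist m n)) {H. occurs n v m H}))"
    by (intro nn_integral_eq_integral measure_pmf.integrable_const_bound[of _ 1]) auto
  finally show ?thesis
    by (subst (asm) ennreal_inj) (auto simp: prob_occurs_def Bochner_Integration.integral_nonneg)
qed

text \<open>Each prescribed edge has one target and counts only after its source has arrived.
  Forgetting which target it belongs to splits the weight into one indicator per vertex and one per
  edge.\<close>

lemma weight_before_le_sum: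
  assumes "placed n v"
  shows "weight_before \<delta> v w \<le> (\<Sum>\<nu>\<in>I. (real (dg \<nu>) + \<delta>) * of_bool (v \<nu> < w)) + (\<Sum>c\<in>C. of_bool (v (src c) < w))"
proof -
  have fI: "finite I" using I N finite_subset by auto
  have "(\<Sum>\<nu>\<in>{\<nu>\<in>I. v \<nu> < w}. card {c\<in>C. tg c = \<nu> \<and> v (src c) < w}) = card (\<Union>\<nu>\<in>{\<nu>\<in>I. v \<nu> < w}. {c\<in>C. tg c = \<nu> \<and> v (src c) < w})"
    using fI C by (intro card_UN_disjoint[symmetric]) auto
  also have "\<dots> \<le> card {c\<in>C. v (src c) < w}" using C by (intro card_mono) auto
  finally have 1: "real (\<Sum>\<nu>\<in>{\<nu>\<in>I. v \<nu> < w}. card {c\<in>C. tg c = \<nu> \<and> v (src c) < w}) \<le> real (card {c\<in>C. v (src c) < w})"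
    by (simp only: of_nat_le_iff)
  have 2: "real (card {c\<in>C. v (src c) < w}) = (\<Sum>c\<in>C. of_bool (v (src c) < w))"
    using C by (simp add: Int_def)
  have 3: "(\<Sum>\<nu>\<in>{\<nu>\<in>I. v \<nu> < w}. real (dg \<nu>) + \<delta>) = (\<Sum>\<nu>\<in>I. (real (dg \<nu>) + \<delta>) * of_bool (v \<nu> < w))"
    using fI by (intro sum.mono_neutral_cong_left) auto
  show ?thesis using 1 2 3 unfolding weight_before_def sum.distrib[of "\<lambda>\<nu>. real (dg \<nu>) + \<delta>"] by simp
qed

text \<open>A unit of weight present after time \<open>v\<close> contributes the sum of
  \<open>1 / w\<close> over \<open>v < w \<le> n\<close>, at most \<open>ln (n / v)\<close>. These
  logarithms become the powers of the ages.\<close>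

lemma sum_weight_before_le:
  assumes v: "placed n v" and dg: "\<And>\<nu>. \<nu> \<in> I \<Longrightarrow> real (dg \<nu>) + \<delta> > 0"
  shows "(\<Sum>w\<in>{1..n}. weight_before \<delta> v w / real w) \<le>
    (\<Sum>\<nu>\<in>I. (real (dg \<nu>) + \<delta>) * ln (real n / real (v \<nu>))) + (\<Sum>c\<in>C. ln (real n / real (v (src c))))"
proof -
  have h: "(\<Sum>w\<in>{1..n}. of_bool (v \<nu> < w) / real w) \<le> ln (real n / real (v \<nu>))" if "\<nu> \<in> N" for \<nu>
  proof -
    have r: "3 \<le> v \<nu>" "v \<nu> \<le> n" using v that by (auto simp: placed_def)
    have "(\<Sum>w\<in>{1..n}. of_bool (v \<nu> < w) / real w) = (\<Sum>w\<in>{Suc (v \<nu>)..n}. 1 / real w)"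
      using r by (intro sum.mono_neutral_cong_right) auto
    also have "\<dots> \<le> ln (real n / real (v \<nu>))" using r by (intro sum_inverse_le_ln) auto
    finally show ?thesis .
  qed
  have "(\<Sum>w\<in>{1..n}. weight_before \<delta> v w / real w) \<le>
    (\<Sum>w\<in>{1..n}. ((\<Sum>\<nu>\<in>I. (real (dg \<nu>) + \<delta>) * of_bool (v \<nu> < w)) + (\<Sum>c\<in>C. of_bool (v (src c) < w))) / real w)"
    by (intro sum_mono divide_right_mono weight_before_le_sum[OF v]) auto
  also have "\<dots> = (\<Sum>w\<in>{1..n}. \<Sum>\<nu>\<in>I. (real (dg \<nu>) + \<delta>) * (of_bool (v \<nu> < w) / real w)) +
      (\<Sum>w\<in>{1..n}. \<Sum>c\<in>C. of_bool (v (src c) < w) / real w)"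
    by (simp add: add_divide_distrib sum_divide_distrib sum.distrib)
  also have "\<dots> = (\<Sum>\<nu>\<in>I. (real (dg \<nu>) + \<delta>) * (\<Sum>w\<in>{1..n}. of_bool (v \<nu> < w) / real w)) +
      (\<Sum>c\<in>C. \<Sum>w\<in>{1..n}. of_bool (v (src c) < w) / real w)"
    by (subst (1 2) sum.swap) (simp add: sum_distrib_left)
  also have "\<dots> \<le> (\<Sum>\<nu>\<in>I. (real (dg \<nu>) + \<delta>) * ln (real n / real (v \<nu>))) + (\<Sum>c\<in>C. ln (real n / real (v (src c))))"
    using dg h src I by (intro add_mono sum_mono mult_left_mono) (auto simp: less_imp_le)
  finally show ?thesis .
qed

end

context pa_pat
begin

lemma weight_bound_nonneg: "weight_bound \<delta> \<ge> 0"
  unfolding weight_bound_def by (intro sum_nonneg) auto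

text \<open>The product for fixed out-degrees is bounded below by a constant times
  \<open>exp (- Y)\<close>, where the mean of \<open>Y\<close> is easy to bound, and
  \<open>expectation_exp_ge\<close> applies. \<open>K\<close> depends on the pattern and on
  \<open>\<eta>\<close>, but neither on \<open>n\<close> nor on the positions, which enter the error
  terms only through their lower bound \<open>s\<close>.\<close>

lemma prob_occurs_ge:
  assumes \<eta>: "0 < \<eta>" "\<eta> < 1/4"
  obtains K where "K > 0"
    "\<And>n s v. placed n v \<Longrightarrow> 3 \<le> n \<Longrightarrow> K \<le> real s \<Longrightarrow> (\<And>\<nu>. \<nu> \<in> N \<Longrightarrow> s \<le> v \<nu>) \<Longrightarrow>
      prob_occurs n v \<ge> (\<Prod>\<nu>\<in>N. pmf M (dg \<nu>)) * ((\<Prod>\<nu>\<in>I. pochhammer (real (dg \<nu>) + \<delta>) (indeg \<nu>)) *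
        (\<Prod>c\<in>C. 1 / (\<mu> * real (v (src c)) + K)) * (1 - K / real s) ^ (\<Sum>\<nu>\<in>N. dg \<nu>) *
        (exp (- (K / real s)) *
        (\<Prod>\<nu>\<in>I. (real (v \<nu>) / real n) powr (EM / (\<mu> - 2 * \<eta>) * (real (dg \<nu>) + \<delta>))) *
        (\<Prod>c\<in>C. (real (v (src c)) / real n) powr (EM / (\<mu> - 2 * \<eta>)))))"
proof -
  obtain c0 where c0: "c0 \<ge> 0" and tail: "\<And>A B. finite (B::nat set) \<Longrightarrow> A \<subseteq> B \<Longrightarrow> A \<noteq> {} \<Longrightarrow>
      measure (measure_pmf (Pi_pmf B 1 (\<lambda>_. M))) {g. real (\<Sum>i\<in>A. g i) \<le> (EM - \<eta>) * real (card A)} \<le> c0 / real (card A)"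
    using lower_tail[OF \<eta>(1)] by metis
  define D where "D = (\<Sum>\<nu>\<in>N. dg \<nu>)"
  define nN where "nN = real (card N)"
  define Kc where "Kc = weight_bound \<delta>"
  \<comment> \<open>\<open>K1\<close> is the deterministic loss in the lower bound for
    \<open>base\<close>, \<open>K2\<close> its loss against \<open>(\<mu> - 2 * \<eta>) * w\<close>
    outside \<open>bad\<close>, \<open>K3\<close> collects terms of order \<open>1 / w ^ 2\<close>,
    and \<open>K4\<close> is the gap in the upper bound for the normalisation. \<open>K\<close>
    dominates every multiple of them that is used below.\<close>
  define K1 where "K1 = nN + 8 + (nN + 3) * \<bar>\<delta>\<bar>"
  define K2 where "K2 = 2 * EM * (3 + nN) + \<bar>\<delta>\<bar> + 5"
  define K3 where "K3 = Kc * (8 * K2 + 4 * c0) + 8 * Kc ^ 2"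
  define K4 where "K4 = 4 + 4 * real D + real a2 + \<bar>\<delta>\<bar>"
  define K where "K = 2 * K1 + 4 * Kc + 4 * K2 + (2 * (3 + nN) + 2) + (K4 + \<bar>\<delta>\<bar>) + EM * K3 + 3"
  define \<beta> where "\<beta> = EM / (\<mu> - 2 * \<eta>)"
  have nN: "nN \<ge> 0" and Kc: "Kc \<ge> 0" using weight_bound_nonneg by (simp_all add: nN_def Kc_def)
  have K1: "K1 \<ge> 0" and K2: "K2 \<ge> 0" using nN EM_ge1 by (simp_all add: K1_def K2_def)
  have K3: "K3 \<ge> 0" using Kc K2 c0 by (simp add: K3_def)
  have K4: "K4 \<ge> 0" by (simp add: K4_def)
  have EK3: "EM * K3 \<ge> 0" using K3 EM_ge1 by simp
  have Kpos: "K > 0" using K1 Kc K2 nN K4 EK3 by (simp add: K_def)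
  have mu2: "\<mu> - 2 * \<eta> > 1/2" using mu_gt_1 \<eta> by simp
  have \<beta>: "\<beta> \<ge> 0" using mu2 EM_ge1 by (simp add: \<beta>_def)
  show ?thesis
  proof (rule that[OF Kpos])
    fix n s v
    assume v: "placed n v" and n3: "3 \<le> n" and sK: "K \<le> real s" and sv: "\<And>\<nu>. \<nu> \<in> N \<Longrightarrow> s \<le> v \<nu>"
    let ?Ppmf = "\<Prod>\<nu>\<in>N. pmf M (dg \<nu>)"
    let ?W = "(\<Prod>\<nu>\<in>I. pochhammer (real (dg \<nu>) + \<delta>) (indeg \<nu>)) *
        (\<Prod>c\<in>C. 1 / (\<mu> * real (v (src c)) + K)) * (1 - K / real s) ^ D"
    let ?X = "exp (- (K / real s)) *
        (\<Prod>\<nu>\<in>I. (real (v \<nu>) / real n) powr (\<beta> * (real (dg \<nu>) + \<delta>))) *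
        (\<Prod>c\<in>C. (real (v (src c)) / real n) powr \<beta>)"
    have goal: "?Ppmf * (?W * ?X) \<le> prob_occurs n v"
    proof (cases "\<forall>\<nu>\<in>N. dg \<nu> \<in> set_pmf M")
      case False
      then have "?Ppmf = 0" using N by (auto simp: set_pmf_iff)
      then show ?thesis unfolding prob_occurs_def by simp
    next
      case dgM: True
      have spos: "real s > 0" using sK Kpos by linarith
      have KK: "2 * K1 \<le> K" "4 * Kc \<le> K" "4 * K2 \<le> K" "2 * nN + 8 \<le> K" "K4 + \<bar>\<delta>\<bar> \<le> K" "EM * K3 \<le> K" "3 \<le> K"
        using K1 Kc K2 nN K4 EK3 by (simp_all add: K_def)
      have sb: "real s \<ge> 2 * K1" "real s \<ge> 4 * Kc" "real s \<ge> 4 * K2" "real s \<ge> 2 * nN + 8" "K \<ge> K4 + \<bar>\<delta>\<bar>" "K \<ge> EM * K3" "K \<ge> 4 * Kc" "real s \<ge> 3"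
        by (rule order_trans[OF KK(1) sK] order_trans[OF KK(2) sK] order_trans[OF KK(3) sK] order_trans[OF KK(4) sK]
          KK(5) KK(6) KK(2) order_trans[OF KK(7) sK])+
      let ?F = "{3..n} - v ` N"
      let ?P = "Pi_pmf ?F 1 (\<lambda>_. M)"
      let ?E = "measure_pmf.expectation ?P"
      have finF: "finite ?F" by simp
      have fI: "finite I" using I N finite_subset by auto
      have vr: "3 \<le> v \<nu>" "v \<nu> \<le> n" if "\<nu> \<in> N" for \<nu> using v that by (auto simp: placed_def)
      have vinj: "inj_on v N" using v by (simp add: placed_def)
      have dgpos: "real (dg \<nu>) + \<delta> > 0" if "\<nu> \<in> N" for \<nu> using weight_pos dgM that by auto
      \<comment> \<open>Only unpinned out-degrees enter \<open>A\<close>, \<open>T\<close> and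
        \<open>b\<close>, so that these are functions of the independent variables alone; dropping
        the pinned ones keeps \<open>b w g\<close> below \<open>base w\<close>.\<close>
      define A where "A w = {3..<w} - v ` N" for w
      have A_sub: "A w \<subseteq> ?F" if "w \<le> n" for w using that by (auto simp: A_def)
      have A_card: "real (card (A w)) \<ge> real w - 3 - nN" "real (card (A w)) \<le> real w - 3" if "3 \<le> w" for w
      proof -
        have "card {3..<w} - card (v ` N) \<le> card (A w)" unfolding A_def by (rule diff_card_le_card_Diff) (use N in auto)
        moreover have "card (v ` N) \<le> card N" by (rule card_image_le[OF N])
        ultimately show "real (card (A w)) \<ge> real w - 3 - nN" using that by (simp add: nN_def)
        have "card (A w) \<le> card {3..<w}" unfolding A_def by (intro card_mono) auto
        then show "real (card (A w)) \<le> real w - 3" using that by simp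
      qed
      define T where "T w g = real (\<Sum>i\<in>A w. g i)" for w and g :: "nat \<Rightarrow> nat"
      define b where "b w g = 2 * T w g + (real w - 1) * \<delta> - 5" for w g
      have supp: "g i \<in> set_pmf M" if "g \<in> set_pmf ?P" "i \<in> ?F" for g i
        using that by (auto simp: set_Pi_pmf PiE_dflt_def)
      \<comment> \<open>Valid for all possible out-degrees, because
        \<open>2 * k + \<delta> \<ge> 1\<close> for \<open>k\<close> in the support of
        \<open>M\<close>. It gives \<open>b w g \<ge> w / 2\<close> even where the weak law
        fails.\<close>
      have b_ge: "b w g \<ge> real w - K1" if g: "g \<in> set_pmf ?P" and w: "3 \<le> w" "w \<le> n" for w g
      proof -
        have "real (card (A w)) \<le> (\<Sum>i\<in>A w. 2 * real (g i) + \<delta>)"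
        proof -
          have "(\<Sum>i\<in>A w. 1) \<le> (\<Sum>i\<in>A w. 2 * real (g i) + \<delta>)"
          proof (intro sum_mono)
            fix i assume "i \<in> A w"
            then have "g i \<in> set_pmf M" using supp[OF g] A_sub[OF w(2)] by auto
            then show "1 \<le> 2 * real (g i) + \<delta>" using weight_pos[of "g i"] M_ge1[of "g i"] by simp
          qed
          then show ?thesis by simp
        qed
        also have "\<dots> = 2 * T w g + real (card (A w)) * \<delta>" by (simp add: T_def sum.distrib sum_distrib_left)
        finally have 1: "real (card (A w)) \<le> 2 * T w g + real (card (A w)) * \<delta>" .
        have "(real w - 1 - real (card (A w))) * \<delta> \<ge> - ((nN + 3) * \<bar>\<delta>\<bar>)"
        proof -
          have "\<bar>(real w - 1 - real (card (A w))) * \<delta>\<bar> \<le> (nN + 3) * \<bar>\<delta>\<bar>"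
            unfolding abs_mult using A_card[OF w(1)] by (intro mult_right_mono) auto
          then show ?thesis by linarith
        qed
        then have "b w g \<ge> real (card (A w)) - (nN + 3) * \<bar>\<delta>\<bar> - 5"
          using 1 unfolding b_def by (simp add: algebra_simps)
        then show ?thesis using A_card(1)[OF w(1)] unfolding K1_def by linarith
      qed
      have b_half: "b w g \<ge> real w / 2" if g: "g \<in> set_pmf ?P" and w: "s \<le> w" "w \<le> n" for w g
      proof -
        have "3 \<le> w" using sb(8) w by linarith
        moreover have "real s \<le> real w" using w by simp
        ultimately show ?thesis using b_ge[OF g _ w(2)] sb(1) by linarith
      qed
      define bad where "bad w = {g. T w g \<le> (EM - \<eta>) * real (card (A w))}" for w
      \<comment> \<open>Outside \<open>bad\<close> the mean out-degree falls short by at most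
        \<open>\<eta>\<close>, which the sum of degrees counts twice: hence
        \<open>\<mu> - 2 * \<eta>\<close>. The second term absorbs the constant \<open>K2\<close>
        when the reciprocal is expanded.\<close>
      define \<alpha> where "\<alpha> w = 1 / ((\<mu> - 2 * \<eta>) * real w) + 8 * K2 / real w ^ 2" for w
      have inv_b: "1 / b w g \<le> \<alpha> w + 2 / real w * indicator (bad w) g"
        if g: "g \<in> set_pmf ?P" and w: "s \<le> w" "w \<le> n" for w g
      proof -
        have w0: "real w > 0" and w3: "3 \<le> w" and ws: "real s \<le> real w" using spos sb(8) w by auto
        have bp: "b w g \<ge> real w / 2" by (rule b_half[OF g w])
        show ?thesis
        proof (cases "g \<in> bad w")
          case True
          have "1 / b w g \<le> 1 / (real w / 2)" using bp w0 by (intro divide_left_mono) auto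
          moreover have "\<alpha> w \<ge> 0" using mu2 K2 w0 by (simp add: \<alpha>_def)
          ultimately show ?thesis using True by simp
        next
          case False
          let ?x = "(\<mu> - 2 * \<eta>) * real w"
          have "2 * ((EM - \<eta>) * (real w - 3 - nN)) \<le> 2 * ((EM - \<eta>) * real (card (A w)))"
            using A_card(1)[OF w3] EM_ge1 \<eta> by (intro mult_left_mono) auto
          also have "\<dots> \<le> 2 * T w g" using False by (simp add: bad_def)
          finally have 1: "2 * ((EM - \<eta>) * (real w - 3 - nN)) \<le> 2 * T w g" .
          have 2: "2 * ((EM - \<eta>) * (real w - 3 - nN)) \<ge> 2 * (EM - \<eta>) * real w - 2 * EM * (3 + nN)"
          proof -
            have "\<eta> * (3 + nN) \<ge> 0" using \<eta> nN by simp
            then show ?thesis by (simp add: algebra_simps)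
          qed
          have 3: "(real w - 1) * \<delta> \<ge> real w * \<delta> - \<bar>\<delta>\<bar>" by (simp add: algebra_simps)
          have "b w g \<ge> ?x - K2"
            using 1 2 3 unfolding b_def K2_def \<mu>_def by (simp add: algebra_simps)
          moreover have x: "?x \<ge> real w / 2" using mult_right_mono[of "1/2" "\<mu> - 2 * \<eta>" "real w"] mu2 w0 by simp
          moreover have q: "?x - K2 \<ge> real w / 4" using x sb(3) ws by linarith
          ultimately have "1 / b w g \<le> 1 / (?x - K2)" using w0 by (intro divide_left_mono) auto
          also have "1 / (?x - K2) = 1 / ?x + K2 / (?x * (?x - K2))"
          proof -
            have "?x \<noteq> 0" "?x - K2 \<noteq> 0" using x q w0 by linarith+
            then show ?thesis by (simp add: divide_simps)
          qed
          also have "K2 / (?x * (?x - K2)) \<le> K2 / (real w / 2 * (real w / 4))"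
            using x q w0 K2 by (intro divide_left_mono mult_mono) auto
          also have "K2 / (real w / 2 * (real w / 4)) = 8 * K2 / real w ^ 2" by (simp add: power2_eq_square)
          finally show ?thesis using False by (simp add: \<alpha>_def)
        qed
      qed
      have bad_prob: "measure ?P (bad w) \<le> 2 * c0 / real w" if w: "s \<le> w" "w \<le> n" for w
      proof -
        have w0: "real w > 0" and w3: "3 \<le> w" and ws: "real s \<le> real w" using spos sb(8) w by auto
        have cA: "real (card (A w)) \<ge> real w / 2" using A_card(1)[OF w3] sb(4) ws by linarith
        then have "A w \<noteq> {}" using w0 by auto
        then have "measure ?P (bad w) \<le> c0 / real (card (A w))"
          unfolding bad_def T_def using A_sub[OF w(2)] by (intro tail) auto
        also have "\<dots> \<le> c0 / (real w / 2)" using cA w0 c0 by (intro divide_left_mono) auto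
        finally show ?thesis by (simp add: mult.commute)
      qed
      let ?D = "\<lambda>w. weight_before \<delta> v w"
      have D_nonneg: "?D w \<ge> 0" for w
        unfolding weight_before_def using dgpos I by (intro sum_nonneg) (force simp: less_imp_le add_nonneg_nonneg)
      have D_le: "?D w \<le> Kc" for w
      proof -
        have "?D w \<le> (\<Sum>\<nu>\<in>{\<nu>\<in>I. v \<nu> < w}. real (dg \<nu>) + \<bar>\<delta>\<bar> + real (card C) + 1)"
          unfolding weight_before_def
        proof (intro sum_mono)
          fix \<nu>
          have "card {c\<in>C. tg c = \<nu> \<and> v (src c) < w} \<le> card C" using C by (intro card_mono) auto
          then show "real (dg \<nu>) + \<delta> + real (card {c \<in> C. tg c = \<nu> \<and> v (src c) < w}) \<le> real (dg \<nu>) + \<bar>\<delta>\<bar> + real (card C) + 1"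
            by linarith
        qed
        also have "\<dots> \<le> Kc" unfolding Kc_def weight_bound_def using fI by (intro sum_mono2) auto
        finally show ?thesis .
      qed
      define U where "U c g = 2 * T (v (src c)) g + (real (v (src c)) - 1) * \<delta> + K4" for c g
      define B where "B c = \<mu> * real (v (src c)) + K" for c
      \<comment> \<open>Comes from \<open>ln (1 - x) \<ge> - x - 2 * x ^ 2\<close> with
        \<open>x = ?D w / base w\<close>: the linear part is bounded by \<open>inv_b\<close>, the
        square by \<open>x \<le> 2 * Kc / w\<close>. For \<open>w \<le> s\<close> no pattern vertex
        precedes \<open>w\<close>.\<close>
      define z where "z w g = (if s < w then ?D w * (\<alpha> w + 2 / real w * indicator (bad w) g) + 8 * Kc ^ 2 / real w ^ 2 else 0)" for w and g :: "nat \<Rightarrow> nat"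
      \<comment> \<open>For prescribed edges, \<open>u \<le> exp (u - 1)\<close> with
        \<open>u = U / B\<close> gives \<open>1 / U \<ge> 1 / B * exp (- (U / B - 1))\<close>; this
        part of \<open>Y\<close> has mean at most \<open>0\<close> as \<open>B\<close> bounds the
        mean of \<open>U\<close>.\<close>
      define Y where "Y g = (\<Sum>c\<in>C. U c g / B c - 1) + (\<Sum>w\<in>?F. real (g w) * z w g)" for g
      have B_pos: "B c > 0" for c using mu_pos Kpos by (simp add: B_def add_nonneg_pos)
      have EU: "integrable ?P (U c) \<and> ?E (U c) \<le> B c" if c: "c \<in> C" for c
      proof -
        let ?w = "v (src c)"
        have w: "3 \<le> ?w" "?w \<le> n" using vr src c by auto
        have comp: "integrable ?P (\<lambda>g. real (g i))" "?E (\<lambda>g. real (g i)) = EM" if "i \<in> A ?w" for i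
          using Pi_pmf_integrable_component[OF finF, of i] A_sub[OF w(2)] that by auto
        have Ti: "integrable ?P (T ?w)" unfolding T_def of_nat_sum
          using comp by (intro Bochner_Integration.integrable_sum) auto
        have "?E (T ?w) = (\<Sum>i\<in>A ?w. EM)"
          unfolding T_def of_nat_sum
          by (subst Bochner_Integration.integral_sum[OF comp(1)]) (simp_all add: comp(2)[simplified])
        also have "\<dots> \<le> real ?w * EM" using A_card(2)[OF w(1)] EM_ge1 by (auto intro!: mult_right_mono)
        finally have ET: "?E (T ?w) \<le> real ?w * EM" .
        have i: "integrable ?P (U c)" unfolding U_def[abs_def] using Ti by simp
        have "?E (U c) = 2 * ?E (T ?w) + (real ?w - 1) * \<delta> + K4"
          unfolding U_def[abs_def] using Ti by simp
        also have "\<dots> \<le> 2 * (real ?w * EM) + (real ?w * \<delta> + \<bar>\<delta>\<bar>) + K4"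
          using ET by (simp add: algebra_simps)
        also have "\<dots> = \<mu> * real ?w + (K4 + \<bar>\<delta>\<bar>)" by (simp add: \<mu>_def algebra_simps)
        also have "\<dots> \<le> B c" using sb(5) by (simp add: B_def)
        finally show ?thesis using i by simp
      qed
      have Ez: "integrable ?P (\<lambda>g. real (g w) * z w g) \<and>
        ?E (\<lambda>g. real (g w) * z w g) \<le> (if s < w then \<beta> * (?D w / real w) + EM * K3 * (1 / real w ^ 2) else 0)"
        if w: "w \<in> ?F" for w
      proof (cases "s < w")
        case False
        then show ?thesis by (simp add: z_def)
      next
        case True
        have w0: "real w > 0" and wn: "s \<le> w" "w \<le> n" using True spos w by auto
        let ?c1 = "?D w * \<alpha> w + 8 * Kc ^ 2 / real w ^ 2" and ?c2 = "?D w * (2 / real w)"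
        \<comment> \<open>The event \<open>bad w\<close> involves only out-degrees of earlier
          vertices, so it is independent of \<open>g w\<close>.\<close>
        have wA: "w \<notin> A w" by (auto simp: A_def)
        have ind: "indicator (bad w) (g(w := y)) = (indicator (bad w) g :: real)" for g y
        proof -
          have "T w (g(w := y)) = T w g" unfolding T_def using wA by (intro arg_cong[of _ _ real] sum.cong) auto
          then show ?thesis by (simp add: bad_def indicator_def)
        qed
        note E = Pi_pmf_expectation_independent[OF _ w, of "indicator (bad w)" M 1, OF _ ind M_integrable]
        have E1: "integrable ?P (\<lambda>g. real (g w) * indicator (bad w) g)"
          "?E (\<lambda>g. real (g w) * indicator (bad w) g) = EM * measure ?P (bad w)"
          using E by (simp_all add: EM_def)
        have E2: "integrable ?P (\<lambda>g. real (g w))" "?E (\<lambda>g. real (g w)) = EM"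
          by (rule Pi_pmf_integrable_component[OF finF w])+
        have zz: "(\<lambda>g. real (g w) * z w g) = (\<lambda>g. ?c1 * real (g w) + ?c2 * (real (g w) * indicator (bad w) g))"
          using True by (auto simp: z_def algebra_simps)
        have i: "integrable ?P (\<lambda>g. real (g w) * z w g)" unfolding zz using E1(1) E2(1) by simp
        have "?E (\<lambda>g. real (g w) * z w g) = ?c1 * EM + ?c2 * (EM * measure ?P (bad w))"
          unfolding zz using E1 E2 by simp
        also have "\<dots> = EM * (?D w * (\<alpha> w + 2 / real w * measure ?P (bad w)) + 8 * Kc ^ 2 / real w ^ 2)"
          by (simp add: algebra_simps)
        also have "\<dots> \<le> EM * (?D w * (\<alpha> w + 2 / real w * (2 * c0 / real w)) + 8 * Kc ^ 2 / real w ^ 2)"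
          using bad_prob[OF wn] D_nonneg w0 EM_ge1 by (intro mult_left_mono add_mono) auto
        also have "?D w * (\<alpha> w + 2 / real w * (2 * c0 / real w)) = ?D w / ((\<mu> - 2 * \<eta>) * real w) + ?D w * ((8 * K2 + 4 * c0) / real w ^ 2)"
          by (simp add: \<alpha>_def power2_eq_square add_divide_distrib distrib_left)
        also have "?D w * ((8 * K2 + 4 * c0) / real w ^ 2) \<le> Kc * ((8 * K2 + 4 * c0) / real w ^ 2)"
          using D_le K2 c0 by (intro mult_right_mono) auto
        also have "EM * (?D w / ((\<mu> - 2 * \<eta>) * real w) + Kc * ((8 * K2 + 4 * c0) / real w ^ 2) + 8 * Kc ^ 2 / real w ^ 2) =
            \<beta> * (?D w / real w) + EM * K3 * (1 / real w ^ 2)"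
          by (simp add: \<beta>_def K3_def add_divide_distrib distrib_left)
        finally have "?E (\<lambda>g. real (g w) * z w g) \<le> \<beta> * (?D w / real w) + EM * K3 * (1 / real w ^ 2)"
          using EM_ge1 by simp
        then show ?thesis using i True by simp
      qed
      define y where "y = \<beta> * ((\<Sum>\<nu>\<in>I. (real (dg \<nu>) + \<delta>) * ln (real n / real (v \<nu>))) + (\<Sum>c\<in>C. ln (real n / real (v (src c))))) + K / real s"
      have Y_int: "integrable ?P Y"
        unfolding Y_def[abs_def] using EU Ez by (intro Bochner_Integration.integrable_add Bochner_Integration.integrable_sum) auto
      have "?E Y = (\<Sum>c\<in>C. ?E (U c) / B c - 1) +
          (\<Sum>w\<in>?F. ?E (\<lambda>g. real (g w) * z w g))"
        unfolding Y_def[abs_def] using EU Ez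
        by (subst Bochner_Integration.integral_add) (auto intro!: Bochner_Integration.integrable_sum sum.cong)
      also have "\<dots> \<le> 0 + (\<Sum>w\<in>?F. if s < w then \<beta> * (?D w / real w) + EM * K3 * (1 / real w ^ 2) else 0)"
        using EU Ez B_pos by (intro add_mono sum_nonpos sum_mono) (auto simp: divide_le_eq_1)
      also have "\<dots> \<le> (\<Sum>w\<in>{1..n}. \<beta> * (?D w / real w)) + (\<Sum>w\<in>{Suc s..n}. EM * K3 * (1 / real w ^ 2))"
      proof -
        have "(\<Sum>w\<in>?F. if s < w then \<beta> * (?D w / real w) + EM * K3 * (1 / real w ^ 2) else 0) \<le>
          (\<Sum>w\<in>?F. \<beta> * (?D w / real w)) + (\<Sum>w\<in>?F. if s < w then EM * K3 * (1 / real w ^ 2) else 0)"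
          unfolding sum.distrib[symmetric] using \<beta> D_nonneg by (intro sum_mono) auto
        also have "(\<Sum>w\<in>?F. \<beta> * (?D w / real w)) \<le> (\<Sum>w\<in>{1..n}. \<beta> * (?D w / real w))"
          using \<beta> D_nonneg by (intro sum_mono2) auto
        also have "(\<Sum>w\<in>?F. if s < w then EM * K3 * (1 / real w ^ 2) else 0) = (\<Sum>w\<in>?F \<inter> {Suc s..n}. EM * K3 * (1 / real w ^ 2))"
          by (intro sum.mono_neutral_cong_right) auto
        also have "\<dots> \<le> (\<Sum>w\<in>{Suc s..n}. EM * K3 * (1 / real w ^ 2))"
          using EK3 by (intro sum_mono2) auto
        finally show ?thesis by simp
      qed
      also have "\<dots> = \<beta> * (\<Sum>w\<in>{1..n}. ?D w / real w) + EM * K3 * (\<Sum>w\<in>{Suc s..n}. 1 / real w ^ 2)"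
        by (simp only: sum_distrib_left)
      also have "\<dots> \<le> \<beta> * ((\<Sum>\<nu>\<in>I. (real (dg \<nu>) + \<delta>) * ln (real n / real (v \<nu>))) + (\<Sum>c\<in>C. ln (real n / real (v (src c))))) + EM * K3 * (1 / real s)"
        using \<beta> EK3 dgpos I spos sum_inverse_square_le[of s n]
        by (intro add_mono mult_left_mono sum_weight_before_le[OF v]) auto
      also have "\<dots> \<le> y" using sb(6) spos by (simp add: y_def divide_right_mono)
      finally have Y_le: "?E Y \<le> y" .
      have exp_y: "exp (- y) = ?X"
      proof -
        have e: "exp (- (\<beta> * (x * ln (real n / real (v \<nu>))))) = (real (v \<nu>) / real n) powr (\<beta> * x)" if "\<nu> \<in> N" for \<nu> x
        proof -
          have p: "real (v \<nu>) > 0" "real n > 0" using vr[OF that] n3 by auto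
          then have "ln (real n / real (v \<nu>)) = - ln (real (v \<nu>) / real n)" by (simp add: ln_div)
          then show ?thesis using p by (simp add: powr_def mult_ac)
        qed
        have "exp (- y) = exp (- (K / real s)) * exp (\<Sum>\<nu>\<in>I. - (\<beta> * ((real (dg \<nu>) + \<delta>) * ln (real n / real (v \<nu>))))) *
           exp (\<Sum>c\<in>C. - (\<beta> * (1 * ln (real n / real (v (src c))))))"
          unfolding y_def
          by (simp only: sum_negf sum_distrib_left[symmetric] exp_add[symmetric] mult_1_left) (simp add: algebra_simps)
        also have "\<dots> = exp (- (K / real s)) * (\<Prod>\<nu>\<in>I. exp (- (\<beta> * ((real (dg \<nu>) + \<delta>) * ln (real n / real (v \<nu>)))))) *
           (\<Prod>c\<in>C. exp (- (\<beta> * (1 * ln (real n / real (v (src c)))))))"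
          using C fI by (simp add: exp_sum)
        also have "\<dots> = ?X"
          using I src by (intro arg_cong2[of _ _ _ _ "(*)"] prod.cong refl) (auto simp only: e mult_1_right subset_iff)
        finally show ?thesis .
      qed
      have W_nonneg: "0 \<le> ?W"
        using dgpos I sK spos mu_pos Kpos
        by (intro mult_nonneg_nonneg prod_nonneg zero_le_power ballI) (auto intro!: pochhammer_nonneg simp: subset_iff)
      have main: "?W * exp (- y) \<le> ?E (\<lambda>g. measure (measure_pmf (hist (with_pinned v g) n)) {H. occurs n v (with_pinned v g) H})"
      proof (rule expectation_exp_ge[OF W_nonneg Y_int Y_le])
        fix g assume g: "g \<in> set_pmf ?P"
        define m where "m = with_pinned v g"
        have m_dg: "m (v \<nu>) = dg \<nu>" if "\<nu> \<in> N" for \<nu>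
          using that vinj by (simp add: m_def with_pinned_def the_inv_into_f_f)
        have m_F: "m i = g i" if "i \<notin> v ` N" for i using that by (simp add: m_def with_pinned_def)
        have g_out: "g i = 1" if "i \<notin> ?F" for i
          using g that set_Pi_pmf_subset[of ?F 1 "\<lambda>_. M"] by blast
        \<comment> \<open>The default value \<open>1\<close> of \<open>Pi_pmf\<close> outside its
          index set supplies the out-degrees of the initial vertices.\<close>
        have m12: "m 1 = 1" "m 2 = 1"
        proof -
          have "1 \<notin> v ` N" "2 \<notin> v ` N" using vr by force+
          then show "m 1 = 1" "m 2 = 1" using m_F g_out by auto
        qed
        have deg_ok: "degrees_ok m n"
          unfolding degrees_ok_def
        proof (intro conjI m12 ballI)
          fix i assume "i \<in> {3..n}"
          then show "m i \<in> set_pmf M" using m_dg m_F dgM supp[OF g] by (cases "i \<in> v ` N") auto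
        qed
        interpret pa_pattern M \<delta> md G0 N I C src tg ix dg n v m
          by unfold_locales (use v deg_ok m_dg in auto)
        have S: "T w g \<le> real (\<Sum>i\<in>{1..w-1}. m i)" "real (\<Sum>i\<in>{1..w-1}. m i) \<le> T w g + 2 + real D" if w: "3 \<le> w" "w \<le> n" for w
        proof -
          have "(\<Sum>i\<in>{3..<w}. m i) = (\<Sum>i\<in>{3..<w} - v ` N. m i) + (\<Sum>i\<in>{3..<w} \<inter> v ` N. m i)"
            by (metis sum.Int_Diff finite_atLeastLessThan add.commute)
          also have "(\<Sum>i\<in>{3..<w} - v ` N. m i) = (\<Sum>i\<in>A w. g i)" using m_F by (auto simp: A_def intro!: sum.cong)
          finally have e: "(\<Sum>i\<in>{1..w-1}. m i) = (\<Sum>i\<in>A w. g i) + (\<Sum>i\<in>{3..<w} \<inter> v ` N. m i) + 2"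
            using sum_degrees[OF w(1) m12] by simp
          have "(\<Sum>i\<in>{3..<w} \<inter> v ` N. m i) \<le> (\<Sum>i\<in>v ` N. m i)" using N by (intro sum_mono2) auto
          also have "\<dots> = D" using vinj m_dg by (simp add: sum.reindex D_def)
          finally show "T w g \<le> real (\<Sum>i\<in>{1..w-1}. m i)" "real (\<Sum>i\<in>{1..w-1}. m i) \<le> T w g + 2 + real D"
            using e by (simp_all add: T_def del: of_nat_sum)
        qed
        have base_b: "b w g \<le> base w" if "3 \<le> w" "w \<le> n" for w using S(1)[OF that] by (simp add: b_def base_def)
        have base_half: "real w / 2 \<le> base w" if "s \<le> w" "w \<le> n" for w
          using b_half[OF g that] base_b[of w] that sb(8) by linarith
        have base_ok: "base w > 0 \<and> weight_bound \<delta> \<le> base w" if "\<exists>\<nu>\<in>N. v \<nu> \<le> w" "w \<le> n" for w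
        proof -
          have sw: "s \<le> w" using that sv by force
          then have "real s \<le> real w" by simp
          then show ?thesis using base_half[OF sw that(2)] spos sb(2) Kc by (simp add: Kc_def[symmetric])
        qed
        let ?nm = "\<lambda>c. normalisation md \<delta> a2 m (v (src c)) (ix c)"
        have p1: "(\<Prod>c\<in>C. 1 / B c) * exp (- (\<Sum>c\<in>C. U c g / B c - 1)) \<le> (\<Prod>c\<in>C. 1 / ?nm c)"
        proof -
          have "(\<Prod>c\<in>C. 1 / B c) * exp (- (\<Sum>c\<in>C. U c g / B c - 1)) = (\<Prod>c\<in>C. 1 / B c * exp (- (U c g / B c - 1)))"
            by (simp only: exp_sum[OF C] sum_negf[symmetric] prod.distrib)
          also have "\<dots> \<le> (\<Prod>c\<in>C. 1 / ?nm c)"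
          proof (intro prod_mono conjI)
            fix c assume c: "c \<in> C"
            have s: "src c \<in> N" by (rule src[OF c])
            note r = vr[OF s]
            have ixc: "1 \<le> ix c" "ix c \<le> m (v (src c))" using ix[OF c] m_dg[OF s] by auto
            have np: "?nm c > 0"
              using normalisation_lower[OF r ixc] base_ok[of "v (src c)"] s r by (force simp: base_def)
            have "dg (src c) \<le> D" unfolding D_def using s N by (intro member_le_sum) auto
            then have nU: "?nm c \<le> U c g"
              using normalisation_upper[OF r ixc] S(2)[OF r] m_dg[OF s] by (simp add: U_def K4_def)
            show "0 \<le> 1 / B c * exp (- (U c g / B c - 1))" using B_pos[of c] by simp
            have "U c g / B c \<le> exp (U c g / B c - 1)" using exp_ge_add_one_self[of "U c g / B c - 1"] by simp
            then have "1 / B c * exp (- (U c g / B c - 1)) \<le> 1 / U c g"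
              using B_pos[of c] np nU by (simp add: exp_minus field_simps)
            also have "\<dots> \<le> 1 / ?nm c" using np nU by (intro divide_left_mono) auto
            finally show "1 / B c * exp (- (U c g / B c - 1)) \<le> 1 / ?nm c" .
          qed
          finally show ?thesis .
        qed
        have p2: "(1 - K / real s) ^ D \<le> (\<Prod>\<nu>\<in>N. (1 - weight_bound \<delta> / base (v \<nu>)) ^ dg \<nu>)"
        proof -
          have "(1 - K / real s) ^ D = (\<Prod>\<nu>\<in>N. (1 - K / real s) ^ dg \<nu>)" by (simp add: D_def power_sum)
          also have "\<dots> \<le> (\<Prod>\<nu>\<in>N. (1 - weight_bound \<delta> / base (v \<nu>)) ^ dg \<nu>)"
          proof (intro prod_mono conjI)
            fix \<nu> assume \<nu>: "\<nu> \<in> N"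
            show "0 \<le> (1 - K / real s) ^ dg \<nu>" using sK spos by simp
            have "real s / 2 \<le> base (v \<nu>)" using base_half[OF sv[OF \<nu>] vr(2)[OF \<nu>]] sv[OF \<nu>] by simp
            then have "weight_bound \<delta> / base (v \<nu>) \<le> Kc / (real s / 2)"
              using Kc spos unfolding Kc_def by (intro divide_left_mono) auto
            also have "\<dots> \<le> K / real s" using sb(7) Kc spos by (simp add: divide_right_mono)
            finally show "(1 - K / real s) ^ dg \<nu> \<le> (1 - weight_bound \<delta> / base (v \<nu>)) ^ dg \<nu>"
              using sK spos by (intro power_mono) auto
          qed
          finally show ?thesis .
        qed
        have p3: "exp (- (\<Sum>w\<in>?F. real (g w) * z w g)) \<le> (\<Prod>w\<in>?F. (1 - ?D w / base w) ^ m w)"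
        proof -
          have "exp (- (\<Sum>w\<in>?F. real (g w) * z w g)) = (\<Prod>w\<in>?F. exp (- (real (g w) * z w g)))"
            by (simp add: exp_sum sum_negf[symmetric])
          also have "\<dots> \<le> (\<Prod>w\<in>?F. (1 - ?D w / base w) ^ m w)"
          proof (intro prod_mono conjI)
            fix w assume w: "w \<in> ?F"
            have mw: "m w = g w" using m_F w by auto
            show "exp (- (real (g w) * z w g)) \<le> (1 - ?D w / base w) ^ m w"
            proof (cases "s < w")
              case False
              have "{\<nu>\<in>I. v \<nu> < w} = {}" using False sv I by force
              then have "?D w = 0" by (simp only: weight_before_def sum.empty)
              then show ?thesis using False by (simp add: z_def)
            next
              case True
              have w0: "real w > 0" and wn: "s \<le> w" "w \<le> n" "3 \<le> w" and ws: "real s \<le> real w" using True spos w by auto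
              let ?x = "?D w / base w"
              have bh: "real w / 2 \<le> base w" by (rule base_half[OF wn(1,2)])
              have x0: "0 \<le> ?x" using D_nonneg[of w] bh w0 by simp
              have "?x \<le> Kc / (real w / 2)" using D_le[of w] D_nonneg[of w] bh w0 Kc by (intro frac_le) auto
              then have xK: "?x \<le> 2 * Kc / real w" by (simp add: mult.commute)
              also have "\<dots> \<le> 1/2" using sb(2) ws w0 by (simp add: field_simps)
              finally have x2: "?x \<le> 1/2" .
              have "1 / base w \<le> 1 / b w g"
                using base_b[OF wn(3,2)] b_half[OF g wn(1,2)] w0 bh by (intro divide_left_mono) auto
              also note inv_b[OF g wn(1,2)]
              finally have "?D w * (1 / base w) \<le> ?D w * (\<alpha> w + 2 / real w * indicator (bad w) g)"
                by (intro mult_left_mono D_nonneg)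
              then have x1: "?x \<le> ?D w * (\<alpha> w + 2 / real w * indicator (bad w) g)" by simp
              have "?x ^ 2 \<le> (2 * Kc / real w) ^ 2" using xK x0 by (intro power_mono)
              then have x3: "2 * ?x ^ 2 \<le> 8 * Kc ^ 2 / real w ^ 2" by (simp add: power_divide power_mult_distrib)
              have "- z w g \<le> - ?x - 2 * ?x ^ 2" using x1 x3 True by (simp add: z_def)
              also have "\<dots> \<le> ln (1 - ?x)" using x0 x2 by (rule ln_one_minus_pos_lower_bound)
              finally have "- z w g \<le> ln (1 - ?x)" .
              moreover have "0 < 1 - ?x" using x2 by linarith
              ultimately have "exp (- z w g) \<le> 1 - ?x" using ln_ge_iff[of "1 - ?x" "- z w g"] by blast
              then have "exp (- z w g) ^ g w \<le> (1 - ?x) ^ g w" by (intro power_mono) auto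
              also have "exp (- z w g) ^ g w = exp (- (real (g w) * z w g))" by (simp add: exp_of_nat_mult[symmetric])
              finally show ?thesis using mw by simp
            qed
          qed auto
          finally show ?thesis .
        qed
        let ?po = "\<Prod>\<nu>\<in>I. pochhammer (real (dg \<nu>) + \<delta>) (indeg \<nu>)"
        have po: "0 \<le> ?po" using dgpos I by (intro prod_nonneg) (auto intro!: pochhammer_nonneg simp: subset_iff)
        have B1: "0 \<le> (\<Prod>c\<in>C. 1 / B c)" using B_pos by (intro prod_nonneg) (auto simp: less_imp_le)
        have s1: "0 \<le> (1 - K / real s) ^ D" using sK spos by simp
        have "?W * exp (- Y g) = ?po * ((\<Prod>c\<in>C. 1 / B c) * exp (- (\<Sum>c\<in>C. U c g / B c - 1))) * (1 - K / real s) ^ D *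
           exp (- (\<Sum>w\<in>?F. real (g w) * z w g))"
          unfolding Y_def B_def[symmetric] minus_add_distrib exp_add by (simp only: mult_ac)
        also have "\<dots> \<le> ?po * (\<Prod>c\<in>C. 1 / ?nm c) *
           (\<Prod>\<nu>\<in>N. (1 - weight_bound \<delta> / base (v \<nu>)) ^ dg \<nu>) * (\<Prod>w\<in>?F. (1 - ?D w / base w) ^ m w)"
          using po B1 s1 order_trans[OF s1 p2] order_trans[OF mult_nonneg_nonneg[OF B1 exp_ge_zero] p1]
          by (intro mult_mono p1 p2 p3 mult_nonneg_nonneg mult_left_mono) auto
        also have "\<dots> \<le> measure (measure_pmf (hist m n)) {H. occurs n v m H}"
          using base_ok n3 by (intro pa_pattern.prob_occurs_ge[OF pa_pattern_axioms]) auto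
        finally show "?W * exp (- Y g) \<le> measure (measure_pmf (hist (with_pinned v g) n)) {H. occurs n v (with_pinned v g) H}"
          by (simp only: m_def)
      qed auto
      have "?Ppmf * (?W * exp (- y)) \<le> ?Ppmf * ?E (\<lambda>g. measure (measure_pmf (hist (with_pinned v g) n)) {H. occurs n v (with_pinned v g) H})"
        by (intro mult_left_mono main prod_nonneg) auto
      also have "\<dots> \<le> prob_occurs n v"
        unfolding prob_occurs_eq by (intro expectation_pinned_ge[OF v]) auto
      finally show ?thesis unfolding exp_y .
    qed
    then show "(\<Prod>\<nu>\<in>N. pmf M (dg \<nu>)) * ((\<Prod>\<nu>\<in>I. pochhammer (real (dg \<nu>) + \<delta>) (indeg \<nu>)) *
        (\<Prod>c\<in>C. 1 / (\<mu> * real (v (src c)) + K)) * (1 - K / real s) ^ (\<Sum>\<nu>\<in>N. dg \<nu>) *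
        (exp (- (K / real s)) *
        (\<Prod>\<nu>\<in>I. (real (v \<nu>) / real n) powr (EM / (\<mu> - 2 * \<eta>) * (real (dg \<nu>) + \<delta>))) *
        (\<Prod>c\<in>C. (real (v (src c)) / real n) powr (EM / (\<mu> - 2 * \<eta>))))) \<le> prob_occurs n v"
      unfolding D_def \<beta>_def .
  qed
qed

end

section \<open>The limiting density of a pattern\<close>

text \<open>Rounding up sends \<open>(0, 1)\<close> into \<open>{1..n}\<close> and cuts it into
  intervals of equal length \<open>1 / n\<close>, one per vertex.\<close>

definition scaled :: "nat \<Rightarrow> ('i \<Rightarrow> real) \<Rightarrow> 'i \<Rightarrow> nat" where
  "scaled n x \<nu> = nat \<lceil>real n * x \<nu>\<rceil>"

lemma scaled_tendsto:
  assumes "0 < x \<nu>"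
  shows "(\<lambda>n. real (scaled n x \<nu>) / real n) \<longlonglongrightarrow> x \<nu>"
proof (rule tendsto_sandwich)
  show "eventually (\<lambda>n. x \<nu> \<le> real (scaled n x \<nu>) / real n) sequentially"
    using eventually_gt_at_top[of 0]
  proof eventually_elim
    case (elim n)
    have "real n * x \<nu> \<le> real (scaled n x \<nu>)" unfolding scaled_def by linarith
    then show ?case using elim by (simp add: field_simps)
  qed
  show "eventually (\<lambda>n. real (scaled n x \<nu>) / real n \<le> x \<nu> + 1 / real n) sequentially"
    using eventually_gt_at_top[of 0]
  proof eventually_elim
    case (elim n)
    have "0 \<le> real n * x \<nu>" using assms by simp
    then have "real (scaled n x \<nu>) \<le> real n * x \<nu> + 1" unfolding scaled_def by linarith
    then show ?case using elim by (simp add: field_simps)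
  qed
  have "(\<lambda>n. x \<nu> + 1 / real n) \<longlonglongrightarrow> x \<nu> + 0" by (intro tendsto_intros lim_1_over_n)
  then show "(\<lambda>n. x \<nu> + 1 / real n) \<longlonglongrightarrow> x \<nu>" by simp
qed simp

lemma eventually_ge_real_at_top: "eventually (\<lambda>n. real n \<ge> c) sequentially"
  using filterlim_real_sequentially by (simp add: filterlim_at_top)

context pa_pat
begin

definition generic :: "('i \<Rightarrow> real) \<Rightarrow> bool" where
  "generic x \<longleftrightarrow> (\<forall>\<nu>\<in>N. 0 < x \<nu> \<and> x \<nu> < 1) \<and> inj_on x N \<and> (\<forall>c\<in>C. x (tg c) < x (src c))"

text \<open>A vertex of \<open>I\<close> contributes the power belonging to its weight on arrival.
  An edge with source of age \<open>x\<close> contributes \<open>1 / (\<mu> * x)\<close> from the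
  normalisation and, by adding a unit of weight from then on, \<open>x powr (1 - \<kappa>)\<close>;
  together \<open>x powr (- \<kappa>) / \<mu>\<close>.\<close>

definition pattern_density :: "('i \<Rightarrow> real) \<Rightarrow> real" where
  "pattern_density x = (\<Prod>\<nu>\<in>N. pmf M (dg \<nu>)) *
     (\<Prod>\<nu>\<in>I. pochhammer (real (dg \<nu>) + \<delta>) (indeg \<nu>) * x \<nu> powr ((1 - \<kappa>) * (real (dg \<nu>) + \<delta>))) *
     (\<Prod>c\<in>C. x (src c) powr (- \<kappa>) / \<mu>)"

lemma scaled_le: "0 \<le> x \<nu> \<Longrightarrow> x \<nu> \<le> 1 \<Longrightarrow> scaled n x \<nu> \<le> n"
proof -
  assume "0 \<le> x \<nu>" "x \<nu> \<le> 1"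
  then have "real n * x \<nu> \<le> real n" using mult_left_le[of "x \<nu>" "real n"] by simp
  then show ?thesis unfolding scaled_def by linarith
qed

lemma eventually_scaled_less:
  assumes "0 < x \<nu>" "x \<nu> < x \<nu>'"
  shows "eventually (\<lambda>n. scaled n x \<nu> < scaled n x \<nu>') sequentially"
proof -
  have "eventually (\<lambda>n. real n \<ge> 1 / (x \<nu>' - x \<nu>)) sequentially"
    by (rule eventually_ge_real_at_top)
  then show ?thesis
  proof eventually_elim
    case (elim n)
    then have "real n * x \<nu> + 1 \<le> real n * x \<nu>'" using assms by (simp add: field_simps)
    moreover have "0 \<le> real n * x \<nu>" using assms by simp
    ultimately show ?case unfolding scaled_def by linarith
  qed
qed

lemma eventually_placed:
  assumes x: "generic x"
  shows "eventually (\<lambda>n. placed n (scaled n x)) sequentially"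
proof -
  have "eventually (\<lambda>n. \<forall>\<nu>\<in>N. \<forall>\<nu>'\<in>N. \<nu> \<noteq> \<nu>' \<longrightarrow> scaled n x \<nu> \<noteq> scaled n x \<nu>') sequentially"
  proof (intro eventually_ball_finite N ballI)
    fix \<nu> \<nu>' assume *: "\<nu> \<in> N" "\<nu>' \<in> N"
    show "eventually (\<lambda>n. \<nu> \<noteq> \<nu>' \<longrightarrow> scaled n x \<nu> \<noteq> scaled n x \<nu>') sequentially"
    proof (cases "\<nu> = \<nu>'")
      case False
      then have "x \<nu> \<noteq> x \<nu>'" using x * by (auto simp: generic_def inj_on_def)
      then consider "x \<nu> < x \<nu>'" | "x \<nu>' < x \<nu>" by linarith
      then show ?thesis
        using eventually_scaled_less[of x \<nu> \<nu>'] eventually_scaled_less[of x \<nu>' \<nu>] x *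
        by cases (auto simp: generic_def elim!: eventually_mono)
    qed simp
  qed
  moreover have "eventually (\<lambda>n. \<forall>\<nu>\<in>N. 3 \<le> scaled n x \<nu>) sequentially"
  proof (intro eventually_ball_finite N ballI)
    fix \<nu> assume \<nu>: "\<nu> \<in> N"
    have "eventually (\<lambda>n. real n \<ge> 3 / x \<nu>) sequentially" by (rule eventually_ge_real_at_top)
    then show "eventually (\<lambda>n. 3 \<le> scaled n x \<nu>) sequentially"
    proof eventually_elim
      case (elim n)
      then have "3 \<le> real n * x \<nu>" using x \<nu> by (simp add: field_simps generic_def)
      then show ?case unfolding scaled_def by linarith
    qed
  qed
  moreover have "eventually (\<lambda>n. \<forall>c\<in>C. scaled n x (tg c) < scaled n x (src c)) sequentially"
  proof (intro eventually_ball_finite C ballI eventually_scaled_less)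
    fix c assume c: "c \<in> C"
    then show "0 < x (tg c)" "x (tg c) < x (src c)" using x tg[OF c] I by (auto simp: generic_def)
  qed
  ultimately show ?thesis
  proof eventually_elim
    case (elim n)
    then show ?case
      using x scaled_le[of x _ n] unfolding placed_def by (auto simp: inj_on_def generic_def less_imp_le)
  qed
qed

text \<open>Two limits in succession: \<open>n\<close> to infinity for fixed \<open>\<eta>\<close>,
  where the errors \<open>K / s\<close> vanish since \<open>s\<close> grows linearly, then
  \<open>\<eta>\<close> to \<open>0\<close>, where \<open>EM / (\<mu> - 2 * \<eta>)\<close> tends to
  \<open>1 - \<kappa>\<close>. Each prescribed edge has probability of order \<open>1 / n\<close>,
  hence the factor \<open>real n ^ card C\<close>.\<close>

theorem pattern_density_le_liminf:
  assumes x: "generic x"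
  shows "ennreal (pattern_density x) \<le> liminf (\<lambda>n. ennreal (real n ^ card C * prob_occurs n (scaled n x)))"
proof -
  let ?L = "liminf (\<lambda>n. ennreal (real n ^ card C * prob_occurs n (scaled n x)))"
  have x0: "0 < x \<nu>" "x \<nu> < 1" if "\<nu> \<in> N" for \<nu> using x that by (auto simp: generic_def)
  \<comment> \<open>A positive lower bound for all ages; the additional \<open>1/2\<close> covers an
    empty \<open>N\<close>.\<close>
  define a where "a = Min (insert (1/2) (x ` N))"
  have a: "0 < a" "a \<le> x \<nu>" if "\<nu> \<in> N" for \<nu>
    using N x0 that by (auto simp: a_def)
  have a0: "0 < a" using N x0 by (auto simp: a_def)
  define G where "G b = (\<Prod>\<nu>\<in>N. pmf M (dg \<nu>)) * ((\<Prod>\<nu>\<in>I. pochhammer (real (dg \<nu>) + \<delta>) (indeg \<nu>)) *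
        (\<Prod>c\<in>C. 1 / (\<mu> * x (src c))) *
        ((\<Prod>\<nu>\<in>I. x \<nu> powr (b * (real (dg \<nu>) + \<delta>))) * (\<Prod>c\<in>C. x (src c) powr b)))" for b
  have le: "ennreal (G (EM / (\<mu> - 2 * \<eta>))) \<le> ?L" if \<eta>: "0 < \<eta>" "\<eta> < 1/4" for \<eta>
  proof -
    define b where "b = EM / (\<mu> - 2 * \<eta>)"
    define R where "R K n s v = (\<Prod>\<nu>\<in>N. pmf M (dg \<nu>)) * ((\<Prod>\<nu>\<in>I. pochhammer (real (dg \<nu>) + \<delta>) (indeg \<nu>)) *
        (\<Prod>c\<in>C. 1 / (\<mu> * real (v (src c)) + K)) * (1 - K / real s) ^ (\<Sum>\<nu>\<in>N. dg \<nu>) *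
        (exp (- (K / real s)) *
        (\<Prod>\<nu>\<in>I. (real (v \<nu>) / real n) powr (b * (real (dg \<nu>) + \<delta>))) *
        (\<Prod>c\<in>C. (real (v (src c)) / real n) powr b)))" for K and n s :: nat and v :: "'i \<Rightarrow> nat"
    have "\<exists>K>0. \<forall>n s v. placed n v \<longrightarrow> 3 \<le> n \<longrightarrow> K \<le> real s \<longrightarrow> (\<forall>\<nu>\<in>N. s \<le> v \<nu>) \<longrightarrow> R K n s v \<le> prob_occurs n v"
      by (rule prob_occurs_ge[OF \<eta>, folded b_def, folded R_def]) blast
    then obtain K where K: "K > 0" and bound: "\<And>n s v. placed n v \<Longrightarrow> 3 \<le> n \<Longrightarrow> K \<le> real s \<Longrightarrow> \<forall>\<nu>\<in>N. s \<le> v \<nu> \<Longrightarrow>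
      R K n s v \<le> prob_occurs n v" by blast
    define s where "s n = nat \<lfloor>a * real n\<rfloor>" for n
    have s_lim: "filterlim (\<lambda>n. real (s n)) at_top sequentially"
      unfolding filterlim_at_top
    proof
      fix Z :: real
      have "eventually (\<lambda>n. real n \<ge> (Z + 1) / a) sequentially" by (rule eventually_ge_real_at_top)
      then show "eventually (\<lambda>n. Z \<le> real (s n)) sequentially"
      proof eventually_elim
        case (elim n)
        then have "Z + 1 \<le> a * real n" using a0 by (simp add: field_simps)
        then show ?case unfolding s_def by linarith
      qed
    qed
    have Ks: "(\<lambda>n. K / real (s n)) \<longlonglongrightarrow> 0"
      by (rule real_tendsto_divide_at_top[OF tendsto_const s_lim])
    define g where "g n = (\<Prod>\<nu>\<in>N. pmf M (dg \<nu>)) * ((\<Prod>\<nu>\<in>I. pochhammer (real (dg \<nu>) + \<delta>) (indeg \<nu>)) *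
        (\<Prod>c\<in>C. 1 / (\<mu> * (real (scaled n x (src c)) / real n) + K / real n)) * (1 - K / real (s n)) ^ (\<Sum>\<nu>\<in>N. dg \<nu>) *
        (exp (- (K / real (s n))) *
        (\<Prod>\<nu>\<in>I. (real (scaled n x \<nu>) / real n) powr (b * (real (dg \<nu>) + \<delta>))) *
        (\<Prod>c\<in>C. (real (scaled n x (src c)) / real n) powr b)))" for n
    have L: "(\<lambda>n. real (scaled n x \<nu>) / real n) \<longlonglongrightarrow> x \<nu>" if "\<nu> \<in> N" for \<nu>
      using x0(1)[OF that] by (rule scaled_tendsto)
    have L_powr: "(\<lambda>n. (real (scaled n x \<nu>) / real n) powr e) \<longlonglongrightarrow> x \<nu> powr e" if "\<nu> \<in> N" for \<nu> e
      using x0(1)[OF that] by (intro tendsto_powr L that tendsto_const) auto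
    have L_edge: "(\<lambda>n. 1 / (\<mu> * (real (scaled n x \<nu>) / real n) + K / real n)) \<longlonglongrightarrow> 1 / (\<mu> * x \<nu> + 0)" if "\<nu> \<in> N" for \<nu>
      using x0(1)[OF that] mu_pos
      by (intro tendsto_divide tendsto_const tendsto_add tendsto_mult L that lim_const_over_n) auto
    have "g \<longlonglongrightarrow> (\<Prod>\<nu>\<in>N. pmf M (dg \<nu>)) * ((\<Prod>\<nu>\<in>I. pochhammer (real (dg \<nu>) + \<delta>) (indeg \<nu>)) *
        (\<Prod>c\<in>C. 1 / (\<mu> * x (src c) + 0)) * (1 - 0) ^ (\<Sum>\<nu>\<in>N. dg \<nu>) *
        (exp (- 0) *
        (\<Prod>\<nu>\<in>I. x \<nu> powr (b * (real (dg \<nu>) + \<delta>))) *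
        (\<Prod>c\<in>C. x (src c) powr b)))"
      unfolding g_def[abs_def] using I src
      by (intro tendsto_mult tendsto_const tendsto_prod L_powr L_edge tendsto_power tendsto_diff tendsto_exp tendsto_minus Ks) auto
    then have "g \<longlonglongrightarrow> G b" by (simp add: G_def)
    then have "(\<lambda>n. ennreal (g n)) \<longlonglongrightarrow> ennreal (G b)" by (rule tendsto_ennrealI)
    then have "ennreal (G b) = liminf (\<lambda>n. ennreal (g n))"
      by (intro lim_imp_Liminf[symmetric]) auto
    also have "\<dots> \<le> ?L"
    proof (rule Liminf_mono)
      have "eventually (\<lambda>n. K \<le> real (s n)) sequentially" using s_lim by (simp add: filterlim_at_top)
      with eventually_placed[OF x] eventually_ge_at_top[of 3]
      show "eventually (\<lambda>n. ennreal (g n) \<le> ennreal (real n ^ card C * prob_occurs n (scaled n x))) sequentially"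
      proof eventually_elim
        case (elim n)
        have n0: "real n > 0" using elim by simp
        have sv: "s n \<le> scaled n x \<nu>" if "\<nu> \<in> N" for \<nu>
        proof -
          have "a * real n \<le> real n * x \<nu>"
            using mult_right_mono[OF a(2)[OF that], of "real n"] by (simp add: mult.commute)
          then show ?thesis unfolding s_def scaled_def by linarith
        qed
        have p: "(\<Prod>c\<in>C. 1 / (\<mu> * (real (scaled n x (src c)) / real n) + K / real n)) =
            real n ^ card C * (\<Prod>c\<in>C. 1 / (\<mu> * real (scaled n x (src c)) + K))"
        proof -
          have "(\<Prod>c\<in>C. 1 / (\<mu> * (real (scaled n x (src c)) / real n) + K / real n)) =
              (\<Prod>c\<in>C. real n * (1 / (\<mu> * real (scaled n x (src c)) + K)))"
            using n0 by (intro prod.cong refl) (simp add: add_divide_distrib[symmetric])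
          then show ?thesis by (simp only: prod.distrib prod_constant)
        qed
        have "g n = real n ^ card C * R K n (s n) (scaled n x)"
          unfolding g_def p R_def by (simp only: mult_ac)
        also have "\<dots> \<le> real n ^ card C * prob_occurs n (scaled n x)"
          using elim sv by (intro mult_left_mono bound) auto
        finally show ?case by (rule ennreal_leI)
      qed
    qed
    finally show ?thesis unfolding b_def .
  qed
  \<comment> \<open>The sequence \<open>1 / (k + 5)\<close> tends to \<open>0\<close> and stays
    below \<open>1/4\<close>, as \<open>le\<close> requires.\<close>
  have "(\<lambda>k. EM / (\<mu> - 2 * (1 / real (k + 5)))) \<longlonglongrightarrow> EM / (\<mu> - 2 * 0)"
    using mu_pos by (intro tendsto_intros LIMSEQ_ignore_initial_segment lim_1_over_n) auto
  then have b_lim: "(\<lambda>k. EM / (\<mu> - 2 * (1 / real (k + 5)))) \<longlonglongrightarrow> 1 - \<kappa>" by (simp add: one_minus_kappa)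
  have "(\<lambda>k. G (EM / (\<mu> - 2 * (1 / real (k + 5))))) \<longlonglongrightarrow> G (1 - \<kappa>)"
    unfolding G_def using x0 I src
    by (intro tendsto_mult tendsto_prod tendsto_powr tendsto_const b_lim) (force simp: subset_iff)+
  then have lim: "(\<lambda>k. ennreal (G (EM / (\<mu> - 2 * (1 / real (k + 5)))))) \<longlonglongrightarrow> ennreal (G (1 - \<kappa>))"
    by (rule tendsto_ennrealI)
  have "ennreal (G (1 - \<kappa>)) \<le> ?L"
    by (rule LIMSEQ_le_const2[OF lim]) (intro exI[of _ 0] allI impI le, auto simp: field_simps)
  also have "G (1 - \<kappa>) = pattern_density x"
  proof -
    have "(\<Prod>c\<in>C. 1 / (\<mu> * x (src c))) * (\<Prod>c\<in>C. x (src c) powr (1 - \<kappa>)) = (\<Prod>c\<in>C. x (src c) powr (- \<kappa>) / \<mu>)"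
      unfolding prod.distrib[symmetric]
    proof (intro prod.cong refl)
      fix c assume "c \<in> C"
      then have "x (src c) > 0" using x0 src by auto
      then show "1 / (\<mu> * x (src c)) * x (src c) powr (1 - \<kappa>) = x (src c) powr (- \<kappa>) / \<mu>"
        by (simp add: powr_diff powr_minus field_simps)
    qed
    then show ?thesis unfolding G_def pattern_density_def prod.distrib by (simp add: mult_ac)
  qed
  finally show ?thesis .
qed

end

section \<open>Disjoint sums of patterns\<close>

text \<open>Second moments count pairs of embedded trees. A disjoint pair is again a pattern, so the
  estimate for one pattern also covers joint probabilities.\<close>

lemma pattern_Plus:
  assumes "pattern N I C src tg ix dg" "pattern N' I' C' src' tg' ix' dg'"
  shows "pattern (N <+> N') (I <+> I') (C <+> C') (map_sum src src') (map_sum tg tg')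
    (case_sum ix ix') (case_sum dg dg')"
proof -
  interpret A: pattern N I C src tg ix dg by fact
  interpret B: pattern N' I' C' src' tg' ix' dg' by fact
  show ?thesis
  proof
    show "inj_on (\<lambda>c. (map_sum src src' c, case_sum ix ix' c)) (C <+> C')"
    proof (rule inj_onI)
      fix c c'
      assume "c \<in> C <+> C'" "c' \<in> C <+> C'"
        and "(map_sum src src' c, case_sum ix ix' c) = (map_sum src src' c', case_sum ix ix' c')"
      then show "c = c'"
        by (elim PlusE) (auto intro: inj_onD[OF A.src_ix_inj] inj_onD[OF B.src_ix_inj])
    qed
  qed (use A.N A.I A.C A.src A.tg A.ix B.N B.I B.C B.src B.tg B.ix in auto)
qed

locale pa_pat_pair =
  A: pa_pat M \<delta> md G0 N I C src tg ix dg + B: pa_pat M \<delta> md G0 N' I' C' src' tg' ix' dg'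
  for M :: "nat pmf" and \<delta> :: real and md :: pa_model and G0 :: edges
    and N I C :: "'i set" and src tg :: "'i \<Rightarrow> 'i" and ix dg :: "'i \<Rightarrow> nat"
    and N' I' C' :: "'j set" and src' tg' :: "'j \<Rightarrow> 'j" and ix' dg' :: "'j \<Rightarrow> nat"
begin

sublocale S: pa_pat M \<delta> md G0 "N <+> N'" "I <+> I'" "C <+> C'" "map_sum src src'" "map_sum tg tg'"
  "case_sum ix ix'" "case_sum dg dg'"
  by (intro pa_pat.intro A.pa_graph_axioms pattern_Plus A.pattern_axioms B.pattern_axioms)

lemma indeg_Inl: "S.indeg (Inl \<nu>) = A.indeg \<nu>"
proof -
  have "{c \<in> C <+> C'. map_sum tg tg' c = Inl \<nu>} = Inl ` {c\<in>C. tg c = \<nu>}" by auto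
  then show ?thesis by (simp add: S.indeg_def A.indeg_def card_image)
qed

lemma indeg_Inr: "S.indeg (Inr \<nu>) = B.indeg \<nu>"
proof -
  have "{c \<in> C <+> C'. map_sum tg tg' c = Inr \<nu>} = Inr ` {c\<in>C'. tg' c = \<nu>}" by auto
  then show ?thesis by (simp add: S.indeg_def B.indeg_def card_image)
qed

text \<open>No edge of the combined pattern joins the two sides, so all factors split. This is the
  asymptotic independence of two disjoint neighbourhoods.\<close>

lemma pattern_density_Plus:
  "S.pattern_density (case_sum x y) = A.pattern_density x * B.pattern_density y"
proof -
  have f: "finite I" "finite I'" using A.I A.N B.I B.N finite_subset by blast+
  show ?thesis
    unfolding S.pattern_density_def A.pattern_density_def B.pattern_density_def
    using A.N A.C B.N B.C f by (simp add: prod.Plus comp_def indeg_Inl indeg_Inr mult_ac)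
qed

text \<open>An edge of one pattern never has its target in the other, so the constraints on the
  targets of one side single out its own edges.\<close>

lemma occurs_Plus:
  assumes p: "S.placed n (case_sum v v')" and o: "S.occurs n (case_sum v v') m H"
  shows "A.occurs n v m H" "B.occurs n v' m H"
proof -
  have ne: "v \<nu> \<noteq> v' \<nu>'" if "\<nu> \<in> N" "\<nu>' \<in> N'" for \<nu> \<nu>'
  proof
    assume "v \<nu> = v' \<nu>'"
    then have "case_sum v v' (Inl \<nu>) = case_sum v v' (Inr \<nu>')" by simp
    then show False using p that unfolding S.placed_def inj_on_def by blast
  qed
  show "A.occurs n v m H"
    unfolding A.occurs_def
  proof (intro conjI ballI)
    fix \<nu> assume "\<nu> \<in> N" then show "m (v \<nu>) = dg \<nu>" using o unfolding S.occurs_def by force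
  next
    fix w j assume wj: "w \<in> {3..n}" "j \<in> {1..m w}"
    show "A.allowed v w j (H w j)"
      unfolding A.allowed_def
    proof
      fix \<nu> assume \<nu>: "\<nu> \<in> I"
      have "H w j = v \<nu> \<longleftrightarrow> (\<exists>c\<in>C <+> C'. w = case_sum v v' (map_sum src src' c) \<and> j = case_sum ix ix' c \<and> Inl \<nu> = map_sum tg tg' c)"
        using o wj \<nu> unfolding S.occurs_def S.allowed_def by (metis InlI old.sum.simps(5))
      then show "(H w j = v \<nu>) = (\<exists>c\<in>C. w = v (src c) \<and> j = ix c \<and> \<nu> = tg c)" by (simp add: Plus_def bex_Un)
    qed
  qed
  show "B.occurs n v' m H"
    unfolding B.occurs_def
  proof (intro conjI ballI)
    fix \<nu> assume "\<nu> \<in> N'" then show "m (v' \<nu>) = dg' \<nu>" using o unfolding S.occurs_def by force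
  next
    fix w j assume wj: "w \<in> {3..n}" "j \<in> {1..m w}"
    show "B.allowed v' w j (H w j)"
      unfolding B.allowed_def
    proof
      fix \<nu> assume \<nu>: "\<nu> \<in> I'"
      have "H w j = v' \<nu> \<longleftrightarrow> (\<exists>c\<in>C <+> C'. w = case_sum v v' (map_sum src src' c) \<and> j = case_sum ix ix' c \<and> Inr \<nu> = map_sum tg tg' c)"
        using o wj \<nu> unfolding S.occurs_def S.allowed_def by (metis InrI old.sum.simps(6))
      then show "(H w j = v' \<nu>) = (\<exists>c\<in>C'. w = v' (src' c) \<and> j = ix' c \<and> \<nu> = tg' c)" by (simp add: Plus_def bex_Un)
    qed
  qed
qed

lemma generic_Plus:
  assumes "A.generic x" "B.generic y" "\<And>\<nu> \<nu>'. \<nu> \<in> N \<Longrightarrow> \<nu>' \<in> N' \<Longrightarrow> x \<nu> \<noteq> y \<nu>'"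
  shows "S.generic (case_sum x y)"
  using assms unfolding S.generic_def A.generic_def B.generic_def
  by (auto simp: inj_on_def) metis+

end

section \<open>Tree patterns\<close>

fun valid_node :: "(node \<Rightarrow> nat) \<Rightarrow> (node \<Rightarrow> nat) \<Rightarrow> node \<Rightarrow> bool" where
  "valid_node mm qq [] \<longleftrightarrow> True"
| "valid_node mm qq ((Old, i) # \<nu>) \<longleftrightarrow> valid_node mm qq \<nu> \<and> i < mm \<nu>"
| "valid_node mm qq ((Young, i) # \<nu>) \<longleftrightarrow> valid_node mm qq \<nu> \<and> i < qq \<nu>"

definition inner_nodes :: "nat \<Rightarrow> (node \<Rightarrow> nat) \<Rightarrow> (node \<Rightarrow> nat) \<Rightarrow> node set" where
  "inner_nodes k mm qq = {\<nu>. valid_node mm qq \<nu> \<and> length \<nu> \<le> k}"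

text \<open>All edges into inner nodes are prescribed, so the younger children of nodes at depth
  \<open>k\<close> must belong to the pattern as sources. Older children beyond depth
  \<open>k\<close> are merely targets and are left open.\<close>

definition tree_nodes :: "nat \<Rightarrow> (node \<Rightarrow> nat) \<Rightarrow> (node \<Rightarrow> nat) \<Rightarrow> node set" where
  "tree_nodes k mm qq = inner_nodes k mm qq \<union> {(Young, i) # \<nu> | i \<nu>. \<nu> \<in> inner_nodes k mm qq \<and> i < qq \<nu>}"

text \<open>The value \<open>0\<close> off the relevant nodes makes the representation unique, so
  that structures are countable and determined by the tree they describe.\<close>

definition structures :: "nat \<Rightarrow> ((node \<Rightarrow> nat) \<times> (node \<Rightarrow> nat)) set" where
  "structures k = {(mm, qq). (\<forall>\<nu>. \<nu> \<notin> tree_nodes k mm qq \<longrightarrow> mm \<nu> = 0) \<and> (\<forall>\<nu>. \<nu> \<notin> inner_nodes k mm qq \<longrightarrow> qq \<nu> = 0)}"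

lemma finite_inner_nodes: "finite (inner_nodes k mm qq)"
proof (induction k)
  case 0
  have "inner_nodes 0 mm qq \<subseteq> {[]}" by (auto simp: inner_nodes_def)
  then show ?case using finite_subset by auto
next
  case (Suc k)
  have "inner_nodes (Suc k) mm qq \<subseteq> insert [] (\<Union>\<nu>\<in>inner_nodes k mm qq.
      (\<lambda>i. (Old, i) # \<nu>) ` {..<mm \<nu>} \<union> (\<lambda>i. (Young, i) # \<nu>) ` {..<qq \<nu>})"
  proof
    fix \<nu> assume "\<nu> \<in> inner_nodes (Suc k) mm qq"
    then have \<nu>: "valid_node mm qq \<nu>" "length \<nu> \<le> Suc k" by (auto simp: inner_nodes_def)
    show "\<nu> \<in> insert [] (\<Union>\<nu>\<in>inner_nodes k mm qq. (\<lambda>i. (Old, i) # \<nu>) ` {..<mm \<nu>} \<union> (\<lambda>i. (Young, i) # \<nu>) ` {..<qq \<nu>})"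
    proof (cases \<nu>)
      case (Cons c p)
      then show ?thesis using \<nu> by (cases c; cases "fst c") (auto simp: inner_nodes_def)
    qed simp
  qed
  then show ?case using Suc finite_subset by fastforce
qed

lemma finite_tree_nodes: "finite (tree_nodes k mm qq)"
proof -
  have "tree_nodes k mm qq \<subseteq> inner_nodes k mm qq \<union> (\<Union>\<nu>\<in>inner_nodes k mm qq. (\<lambda>i. (Young, i) # \<nu>) ` {..<qq \<nu>})"
    by (auto simp: tree_nodes_def)
  then show ?thesis using finite_inner_nodes finite_subset by fastforce
qed

text \<open>Both functions have finite support and are encoded by the finite sets \<open>G\<close>
  of their nonzero values.\<close>

lemma countable_structures: "countable (structures k)"
proof -
  define G where "G f = {(\<nu>, f \<nu>) | \<nu>. f \<nu> \<noteq> 0}" for f :: "node \<Rightarrow> nat"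
  have G: "f = g" if "G f = G g" for f g
  proof
    fix \<nu>
    have "(\<nu>, n) \<in> G f \<longleftrightarrow> (\<nu>, n) \<in> G g" for n using that by simp
    then have "(n = f \<nu> \<and> f \<nu> \<noteq> 0) \<longleftrightarrow> (n = g \<nu> \<and> g \<nu> \<noteq> 0)" for n by (simp add: G_def)
    then show "f \<nu> = g \<nu>" by metis
  qed
  have fin: "finite (G f)" if "finite A" "\<forall>\<nu>. \<nu> \<notin> A \<longrightarrow> f \<nu> = 0" for f A
  proof -
    have "G f \<subseteq> (\<lambda>\<nu>. (\<nu>, f \<nu>)) ` A"
    proof
      fix e assume "e \<in> G f"
      then obtain \<nu> where "e = (\<nu>, f \<nu>)" "f \<nu> \<noteq> 0" unfolding G_def by (elim CollectE exE conjE) metis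
      moreover from this have "\<nu> \<in> A" using that(2) by metis
      ultimately show "e \<in> (\<lambda>\<nu>. (\<nu>, f \<nu>)) ` A" by simp
    qed
    then show ?thesis using that(1) finite_subset by blast
  qed
  have cl: "countable (UNIV :: label set)"
    by (rule countable_subset[of _ "{Old, Young}"]) (auto intro: label.exhaust)
  have cn: "countable (UNIV :: node set)"
  proof -
    have "countable (UNIV :: (label \<times> nat) set)"
      using countable_SIGMA[OF cl, of "\<lambda>_. UNIV :: nat set"] by (simp add: UNIV_Times_UNIV[symmetric] del: UNIV_Times_UNIV)
    then have "countable (lists (UNIV :: (label \<times> nat) set))" by (rule countable_lists)
    then show ?thesis by (simp add: lists_UNIV)
  qed
  have cnn: "countable (UNIV :: (node \<times> nat) set)"
    using countable_SIGMA[OF cn, of "\<lambda>_. UNIV :: nat set"] by (simp add: UNIV_Times_UNIV[symmetric] del: UNIV_Times_UNIV)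
  have cf: "countable {A :: (node \<times> nat) set. finite A}"
    using countable_Collect_finite_subset[OF cnn] by simp
  have "inj_on (map_prod G G) (structures k)"
    using G by (auto simp: inj_on_def)
  moreover have "map_prod G G ` structures k \<subseteq> {A. finite A} \<times> {A. finite A}"
  proof
    fix t assume "t \<in> map_prod G G ` structures k"
    then obtain mm qq where t: "t = (G mm, G qq)" and "(mm, qq) \<in> structures k" by auto
    then have "\<forall>\<nu>. \<nu> \<notin> tree_nodes k mm qq \<longrightarrow> mm \<nu> = 0" "\<forall>\<nu>. \<nu> \<notin> inner_nodes k mm qq \<longrightarrow> qq \<nu> = 0"
      by (simp_all add: structures_def)
    then have "finite (G mm)" "finite (G qq)"
      using fin[OF finite_tree_nodes] fin[OF finite_inner_nodes] by simp_all
    then show "t \<in> {A. finite A} \<times> {A. finite A}" using t by simp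
  qed
  then have "countable (map_prod G G ` structures k)"
    by (rule countable_subset) (intro countable_SIGMA cf)
  ultimately show ?thesis by (metis countable_image_inj_on)
qed

locale tree_struct =
  fixes k :: nat and mm qq :: "node \<Rightarrow> nat"
begin

abbreviation "In \<equiv> inner_nodes k mm qq"
abbreviation "Tn \<equiv> tree_nodes k mm qq"

definition yng :: "node \<Rightarrow> bool" where "yng \<nu> \<longleftrightarrow> (\<exists>i p. \<nu> = (Young, i) # p)"

definition outdeg :: "node \<Rightarrow> nat" where "outdeg \<nu> = mm \<nu> + of_bool (yng \<nu>)"

text \<open>Each non-root node names the edge to its parent. Edges point from the younger to the
  older vertex: from the node to its parent for label \<open>Young\<close>, the other way round for
  \<open>Old\<close>.\<close>

definition t_src :: "node \<Rightarrow> node" where "t_src c = (if yng c then c else tl c)"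
definition t_tg :: "node \<Rightarrow> node" where "t_tg c = (if yng c then tl c else c)"

text \<open>
  If the edge of \<open>p\<close> to its parent is the \<open>J p\<close>-th one, then the edges to the children with label
  \<open>Old\<close> are the other ones, in order.
\<close>

definition old_ix :: "(node \<Rightarrow> nat) \<Rightarrow> node \<Rightarrow> nat \<Rightarrow> nat" where
  "old_ix J p i = (if yng p \<and> J p \<le> i + 1 then i + 2 else i + 1)"

definition t_ix :: "(node \<Rightarrow> nat) \<Rightarrow> node \<Rightarrow> nat" where
  "t_ix J c = (if yng c then J c else old_ix J (tl c) (snd (hd c)))"

definition parent_edges :: "(node \<Rightarrow> nat) set" where
  "parent_edges = (\<Pi>\<^sub>E \<nu>\<in>{\<nu>\<in>Tn. yng \<nu>}. {1..outdeg \<nu>})"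

lemma yng_simps [simp]: "\<not> yng []" "\<not> yng ((Old, i) # p)" "yng ((Young, i) # p)"
  by (auto simp: yng_def)

lemma In_sub: "In \<subseteq> Tn" by (auto simp: tree_nodes_def)

lemma root_In [simp]: "[] \<in> In" by (simp add: inner_nodes_def)

lemma root_Tn [simp]: "[] \<in> Tn" using In_sub by auto

lemma In_Cons:
  "(Old, i) # p \<in> In \<longleftrightarrow> p \<in> In \<and> length p < k \<and> i < mm p"
  "(Young, i) # p \<in> In \<longleftrightarrow> p \<in> In \<and> length p < k \<and> i < qq p"
  by (auto simp: inner_nodes_def)

lemma Tn_Cons:
  "(Old, i) # p \<in> Tn \<longleftrightarrow> p \<in> In \<and> length p < k \<and> i < mm p"
  "(Young, i) # p \<in> Tn \<longleftrightarrow> p \<in> In \<and> i < qq p"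
  using In_Cons by (auto simp: tree_nodes_def)

lemma Tn_tl: "c # p \<in> Tn \<Longrightarrow> p \<in> In"
  using Tn_Cons by (cases c; cases "fst c") auto

lemma In_tl: "c # p \<in> In \<Longrightarrow> p \<in> In"
  by (rule Tn_tl, rule subsetD[OF In_sub])

lemma Tn_not_young: "\<nu> \<in> Tn \<Longrightarrow> \<not> yng \<nu> \<Longrightarrow> \<nu> \<in> In"
  by (auto simp: tree_nodes_def)

lemma old_ix_inj: "old_ix J p i = old_ix J p i' \<Longrightarrow> i = i'"
  by (auto simp: old_ix_def split: if_splits)

lemma old_ix_ne: "yng p \<Longrightarrow> old_ix J p i \<noteq> J p"
  by (auto simp: old_ix_def)

lemma old_ix_surj:
  assumes "1 \<le> j" "j \<le> outdeg p" "yng p \<Longrightarrow> j \<noteq> J p" "yng p \<Longrightarrow> 1 \<le> J p \<and> J p \<le> outdeg p"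
  obtains i where "i < mm p" "j = old_ix J p i"
proof (cases "yng p \<and> J p < j")
  case True
  then have "j \<ge> 2" using assms(4) by auto
  then obtain i where "j = i + 2" by (metis le_add_diff_inverse2)
  then show ?thesis using True assms(2) that[of i] by (auto simp: old_ix_def outdeg_def)
next
  case False
  show ?thesis
  proof (rule that[of "j - 1"])
    show "j - 1 < mm p" using False assms by (cases "yng p") (auto simp: outdeg_def)
    show "j = old_ix J p (j - 1)" using False assms by (auto simp: old_ix_def)
  qed
qed

lemma cons_cases:
  assumes "c \<in> Tn - {[]}"
  obtains i p where "c = (Old, i) # p" "p \<in> In" "length p < k" "i < mm p"
  | i p where "c = (Young, i) # p" "p \<in> In" "i < qq p"
proof (cases c)
  case (Cons d p)
  obtain l i where "d = (l, i)" by (cases d)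
  then show ?thesis using that assms Cons Tn_Cons by (cases l) auto
qed (use assms in auto)

text \<open>Distinct edges with the same source have distinct indices, since \<open>old_ix\<close>
  is injective and skips the index of the edge to the parent.\<close>

lemma pattern:
  assumes J: "J \<in> parent_edges"
  shows "pattern Tn In (Tn - {[]}) t_src t_tg (t_ix J) outdeg"
proof
  have Jr: "1 \<le> J c \<and> J c \<le> outdeg c" if "c \<in> Tn" "yng c" for c
    using J that by (auto simp: parent_edges_def PiE_iff)
  show "finite Tn" "finite (Tn - {[]})" using finite_tree_nodes by auto
  show "In \<subseteq> Tn" by (rule In_sub)
  fix c assume c: "c \<in> Tn - {[]}"
  show "t_src c \<in> Tn"
    using c by (cases rule: cons_cases) (auto simp: t_src_def Tn_Cons subsetD[OF In_sub])
  show "t_tg c \<in> In" using c by (cases rule: cons_cases) (auto simp: t_tg_def In_Cons)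
  show "1 \<le> t_ix J c \<and> t_ix J c \<le> outdeg (t_src c)"
    using c
  proof (cases rule: cons_cases)
    case (2 i p)
    then show ?thesis using Jr[of c] c by (simp add: t_ix_def t_src_def)
  qed (auto simp: t_ix_def t_src_def old_ix_def outdeg_def)
next
  show "inj_on (\<lambda>c. (t_src c, t_ix J c)) (Tn - {[]})"
  proof (rule inj_onI)
    fix c c' assume c: "c \<in> Tn - {[]}" and c': "c' \<in> Tn - {[]}" and eq: "(t_src c, t_ix J c) = (t_src c', t_ix J c')"
    show "c = c'"
      using c
    proof (cases rule: cons_cases)
      case (1 i p)
      note c1 = this
      show ?thesis using c'
      proof (cases rule: cons_cases)
        case (1 i' p')
        then show ?thesis using c1 eq old_ix_inj by (auto simp: t_src_def t_ix_def)
      next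
        case (2 i' p')
        then have "p = c'" "old_ix J p i = J c'" using c1 eq by (auto simp: t_src_def t_ix_def)
        then show ?thesis using old_ix_ne[of p J i] 2 by auto
      qed
    next
      case (2 i p)
      note c1 = this
      show ?thesis using c'
      proof (cases rule: cons_cases)
        case (1 i' p')
        then have "p' = c" "old_ix J p' i' = J c" using c1 eq by (auto simp: t_src_def t_ix_def)
        then show ?thesis using old_ix_ne[of p' J i'] 2 by auto
      next
        case (2 i' p')
        then show ?thesis using c1 eq by (auto simp: t_src_def)
      qed
    qed
  qed
qed

lemma card_parent_edges: "card parent_edges = (\<Prod>\<nu>\<in>{\<nu>\<in>Tn. yng \<nu>}. outdeg \<nu>)"
  unfolding parent_edges_def using finite_tree_nodes by (subst card_PiE) auto

lemma finite_parent_edges: "finite parent_edges"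
  unfolding parent_edges_def using finite_tree_nodes by (intro finite_PiE) auto

text \<open>Matches the numbering of younger children by age in the tree, so that an embedded tree
  is counted once and not once per relabelling.\<close>

definition increasing :: "(node \<Rightarrow> 'a::linorder) \<Rightarrow> bool" where
  "increasing v \<longleftrightarrow> (\<forall>\<nu>\<in>In. \<forall>i j. i < j \<longrightarrow> j < qq \<nu> \<longrightarrow> v ((Young, i) # \<nu>) < v ((Young, j) # \<nu>))"

lemma indeg:
  assumes "\<nu> \<in> In"
  shows "card {c\<in>Tn - {[]}. t_tg c = \<nu>} = qq \<nu> + of_bool (\<nu> \<noteq> [] \<and> \<not> yng \<nu>)"
proof -
  have "{c\<in>Tn - {[]}. t_tg c = \<nu>} = (\<lambda>i. (Young, i) # \<nu>) ` {..<qq \<nu>} \<union> (if \<nu> \<noteq> [] \<and> \<not> yng \<nu> then {\<nu>} else {})" (is "?L = ?R")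
  proof (intro set_eqI iffI)
    fix c assume c: "c \<in> ?L"
    then have "c \<in> Tn - {[]}" by auto
    then show "c \<in> ?R" using c by (cases rule: cons_cases) (auto simp: t_tg_def)
  next
    fix c assume "c \<in> ?R"
    then show "c \<in> ?L" using assms In_sub by (auto simp: t_tg_def Tn_Cons split: if_splits)
  qed
  moreover have "card ((\<lambda>i. (Young, i) # \<nu>) ` {..<qq \<nu>}) = qq \<nu>" by (subst card_image) (auto simp: inj_on_def)
  moreover have "(\<lambda>i. (Young, i) # \<nu>) ` {..<qq \<nu>} \<inter> (if \<nu> \<noteq> [] \<and> \<not> yng \<nu> then {\<nu>} else {}) = {}" by auto
  ultimately show ?thesis by (simp add: card_Un_disjoint)
qed

end

section \<open>Comparison of the densities\<close>

locale pa_rppt = rppt_params M \<delta> Q F + pa_graph M \<delta> md G0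
  for M :: "nat pmf" and \<delta> :: real and Q :: "'v measure" and F :: "'v \<Rightarrow> real \<Rightarrow> real \<Rightarrow> real set"
    and md :: pa_model and G0 :: edges

locale struct_pat = pa_rppt M \<delta> Q F md G0 + tree_struct k mm qq
  for M :: "nat pmf" and \<delta> :: real and Q :: "'v measure" and F :: "'v \<Rightarrow> real \<Rightarrow> real \<Rightarrow> real set"
    and md :: pa_model and G0 :: edges and k :: nat and mm qq :: "node \<Rightarrow> nat" +
  fixes J :: "node \<Rightarrow> nat"
  assumes J: "J \<in> parent_edges"
begin

sublocale pat: pa_pat M \<delta> md G0 Tn In "Tn - {[]}" t_src t_tg "t_ix J" outdeg
  by (intro pa_pat.intro pa_graph_axioms pattern J)

lemma with_young_Tn: "with_young qq In Tn = Tn"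
  unfolding with_young_def by (auto simp: Tn_Cons)

lemma admissible_Tn: "admissible qq In Tn"
  unfolding admissible_def
proof (intro conjI allI impI)
  show "finite Tn" by (rule finite_tree_nodes)
  fix c \<nu> i assume "c # \<nu> \<in> Tn"
  then show "\<nu> \<in> In" by (rule Tn_tl)
  then show "\<nu> \<in> Tn" using In_sub by auto
  assume "c = (Young, i)"
  then show "i < qq \<nu>" using \<open>c # \<nu> \<in> Tn\<close> by (simp add: Tn_Cons)
qed

text \<open>The two products agree node by node. \<open>EM + \<delta>\<close> in the law of old
  nodes cancels against \<open>\<kappa>\<close>, and \<open>EM\<close> in that of young nodes
  against \<open>1 - \<kappa>\<close>, each leaving \<open>1 / \<mu>\<close>. For old nodes the bias
  \<open>k + \<delta>\<close> extends the rising factorial by one factor, which belongs to the edge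
  from the parent. For young nodes the bias counts the choices for the edge to the parent.\<close>

lemma tree_density_le:
  assumes x: "\<And>\<nu>. \<nu> \<in> Tn \<Longrightarrow> 0 < x \<nu> \<and> x \<nu> < 1" and inj: "inj_on x Tn"
  shows "tree_density mm qq In Tn x \<le>
    of_nat (card parent_edges) * ennreal (pat.pattern_density x) * indicator {x. pat.generic x \<and> increasing x} x"
proof -
  have fin: "finite Tn" by (rule finite_tree_nodes)
  show ?thesis
  proof (cases "pat.generic x \<and> increasing x")
    case False
    \<comment> \<open>If the order of the ages is violated, an indicator in the tree density
      vanishes, in \<open>old_factor\<close> or through \<open>ordered_above\<close>.\<close>
    have "\<exists>\<nu>\<in>Tn. node_factor mm qq In \<nu> x = 0"
    proof (cases "increasing x")
      case True
      then have "\<exists>c\<in>Tn - {[]}. \<not> x (t_tg c) < x (t_src c)"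
        using False x inj unfolding pat.generic_def by blast
      then obtain c where c: "c \<in> Tn - {[]}" "\<not> x (t_tg c) < x (t_src c)" by blast
      from c(1) show ?thesis
      proof (cases rule: cons_cases)
        case (1 i p)
        then have "\<not> x c < x p" using c(2) by (simp add: t_tg_def t_src_def)
        then have "node_factor mm qq In c x = 0"
          using 1 by (simp add: node_factor_def old_factor_def)
        then show ?thesis using c(1) by auto
      next
        case (2 i p)
        then have "\<not> x p < x c" using c(2) by (simp add: t_tg_def t_src_def)
        then have "\<not> ordered_above (x p) (qq p) (\<lambda>i. x ((Young, i) # p))"
          using 2 by (auto simp: ordered_above_def)
        then have "node_factor mm qq In p x = 0"
          using 2 by (simp add: node_factor_def inner_factor_def)
        then show ?thesis using 2 In_sub by auto
      qed
    next
      case False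
      then obtain \<nu> i j where *: "\<nu> \<in> In" "i < j" "j < qq \<nu>" "\<not> x ((Young, i) # \<nu>) < x ((Young, j) # \<nu>)"
        unfolding increasing_def by blast
      then have "\<not> ordered_above (x \<nu>) (qq \<nu>) (\<lambda>i. x ((Young, i) # \<nu>))"
        by (auto simp: ordered_above_def)
      then have "node_factor mm qq In \<nu> x = 0"
        using * by (simp add: node_factor_def inner_factor_def)
      then show ?thesis using * In_sub by auto
    qed
    then have "tree_density mm qq In Tn x = 0"
      unfolding tree_density_def using fin by (simp add: prod_zero_iff)
    then show ?thesis by simp
  next
    case True
    then have gen: "pat.generic x" and inc: "increasing x" by auto
    have less: "x (t_tg c) < x (t_src c)" if "c \<in> Tn - {[]}" for c
      using gen that by (auto simp: pat.generic_def)
    define old where "old \<nu> = (if is_old \<nu> then \<kappa> * x \<nu> powr (\<kappa> - 1) * x (tl \<nu>) powr (- \<kappa>) else 1)" for \<nu>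
    define inner where "inner \<nu> = (if \<nu> \<in> In then
        pochhammer (strength_shape \<nu> (mm \<nu>)) (qq \<nu>) * x \<nu> powr ((1 - \<kappa>) * strength_shape \<nu> (mm \<nu>)) else 1)" for \<nu>
    define young where "young \<nu> = (if is_young \<nu> then (1 - \<kappa>) * x \<nu> powr (- \<kappa>) else 1)" for \<nu>
    \<comment> \<open>\<open>A\<close> collects the factors of one node in the tree,
      \<open>B\<close> those in the pattern; the edge between a node and its parent is charged to
      the node.\<close>
    define A where "A \<nu> = pmf (m_law M \<delta> \<nu>) (mm \<nu>) * old \<nu> * inner \<nu> * young \<nu>" for \<nu>
    define B where "B \<nu> = (if yng \<nu> then real (outdeg \<nu>) else 1) * pmf M (outdeg \<nu>) *
        (if \<nu> \<in> In then pochhammer (real (outdeg \<nu>) + \<delta>) (pat.indeg \<nu>) * x \<nu> powr ((1 - \<kappa>) * (real (outdeg \<nu>) + \<delta>)) else 1) *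
        (if \<nu> = [] then 1 else x (t_src \<nu>) powr (- \<kappa>) / \<mu>)" for \<nu>
    have old0: "old \<nu> \<ge> 0" and young0: "young \<nu> \<ge> 0" for \<nu>
      using kappa_bounds by (auto simp: old_def young_def)
    have AB: "A \<nu> = B \<nu>" if \<nu>: "\<nu> \<in> Tn" for \<nu>
    proof (cases \<nu> rule: node_cases)
      case 1
      then show ?thesis
        using indeg[of "[]"] by (simp add: A_def B_def old_def inner_def young_def outdeg_def pmf_m_law strength_shape_def pat.indeg_def)
    next
      case (2 i p)
      have In: "\<nu> \<in> In" using \<nu> 2 by (intro Tn_not_young) auto
      have x0: "x \<nu> > 0" using x \<nu> by auto
      have d: "pat.indeg \<nu> = Suc (qq \<nu>)" using indeg[OF In] 2 by (simp add: pat.indeg_def)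
      let ?s = "real (mm \<nu>) + \<delta>"
      \<comment> \<open>The density of an old age lowers the shape \<open>?s + 1\<close> to
        \<open>?s\<close>, the weight of the vertex on arrival, before its parent has attached to
        it.\<close>
      have p1: "x \<nu> powr (\<kappa> - 1) * x \<nu> powr ((1 - \<kappa>) * (?s + 1)) = x \<nu> powr ((1 - \<kappa>) * ?s)"
        by (subst powr_add[symmetric]) (simp add: algebra_simps)
      have "A \<nu> = ((?s / (EM + \<delta>)) * \<kappa>) * pmf M (mm \<nu>) * (x \<nu> powr (\<kappa> - 1) * x \<nu> powr ((1 - \<kappa>) * (?s + 1))) *
          x p powr (- \<kappa>) * pochhammer (?s + 1) (qq \<nu>)"
        using 2 In by (simp add: A_def old_def inner_def young_def pmf_m_law strength_shape_def mult_ac del: m_law.simps)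
      also have "?s / (EM + \<delta>) * \<kappa> = ?s / \<mu>"
        using EM_delta_pos by (simp add: kappa_eq)
      also have "?s / \<mu> * pmf M (mm \<nu>) * (x \<nu> powr (\<kappa> - 1) * x \<nu> powr ((1 - \<kappa>) * (?s + 1))) *
          x p powr (- \<kappa>) * pochhammer (?s + 1) (qq \<nu>) =
          pmf M (mm \<nu>) * (?s * pochhammer (?s + 1) (qq \<nu>) * x \<nu> powr ((1 - \<kappa>) * ?s)) * (x p powr (- \<kappa>) / \<mu>)"
        unfolding p1 by (simp add: mult_ac)
      also have "\<dots> = B \<nu>"
        using 2 In d by (simp add: B_def outdeg_def t_src_def pochhammer_rec)
      finally show ?thesis .
    next
      case (3 i p)
      have d: "pat.indeg \<nu> = qq \<nu>" if "\<nu> \<in> In" using indeg[OF that] 3 by (simp add: pat.indeg_def)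
      have "(real (mm \<nu>) + 1) / EM * (1 - \<kappa>) = (real (mm \<nu>) + 1) / \<mu>"
        using EM_ge1 by (simp add: one_minus_kappa)
      moreover have "A \<nu> = ((real (mm \<nu>) + 1) / EM * (1 - \<kappa>)) * pmf M (mm \<nu> + 1) * inner \<nu> * x \<nu> powr (- \<kappa>)"
        using 3 by (simp add: A_def old_def young_def pmf_m_law mult_ac del: m_law.simps)
      moreover have "inner \<nu> = (if \<nu> \<in> In then pochhammer (real (outdeg \<nu>) + \<delta>) (pat.indeg \<nu>) * x \<nu> powr ((1 - \<kappa>) * (real (outdeg \<nu>) + \<delta>)) else 1)"
        using 3 d by (simp add: inner_def outdeg_def strength_shape_def add_ac)
      ultimately show ?thesis
        using 3 by (simp add: B_def outdeg_def t_src_def add_ac mult_ac)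
    qed
    have nf: "node_factor mm qq In \<nu> x * ennreal (young \<nu>) = ennreal (A \<nu>)" if \<nu>: "\<nu> \<in> Tn" for \<nu>
    proof -
      have "old_factor \<nu> x = ennreal (old \<nu>)"
      proof (cases "is_old \<nu>")
        case True
        then obtain i p where "\<nu> = (Old, i) # p" by (auto simp: is_old_def)
        then show ?thesis using less[of \<nu>] \<nu> by (simp add: old_factor_def old_def t_tg_def t_src_def)
      qed (simp add: old_factor_def old_def)
      moreover have "inner_factor mm qq In \<nu> x = ennreal (inner \<nu>)"
      proof (cases "\<nu> \<in> In")
        case True
        have "ordered_above (x \<nu>) (qq \<nu>) (\<lambda>i. x ((Young, i) # \<nu>))"
          unfolding ordered_above_def
        proof (intro conjI allI impI)
          fix i assume "i < qq \<nu>"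
          then have "(Young, i) # \<nu> \<in> Tn" using True by (simp add: Tn_Cons)
          then show "x \<nu> < x ((Young, i) # \<nu>)" "x ((Young, i) # \<nu>) \<le> 1"
            using less[of "(Young, i) # \<nu>"] x[of "(Young, i) # \<nu>"] by (auto simp: t_tg_def t_src_def)
        next
          fix i j assume "i < j" "j < qq \<nu>"
          then show "x ((Young, i) # \<nu>) < x ((Young, j) # \<nu>)"
            using inc True by (auto simp: increasing_def)
        qed
        then show ?thesis using True by (simp add: inner_factor_def inner_def)
      qed (simp add: inner_factor_def inner_def)
      ultimately have "node_factor mm qq In \<nu> x = ennreal (pmf (m_law M \<delta> \<nu>) (mm \<nu>) * old \<nu>) * ennreal (inner \<nu>)"
        using old0 by (simp add: node_factor_def ennreal_mult')
      also have "\<dots> = ennreal (pmf (m_law M \<delta> \<nu>) (mm \<nu>) * old \<nu> * inner \<nu>)"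
        using old0 by (subst ennreal_mult') auto
      finally show ?thesis
        using young0 by (simp add: A_def ennreal_mult'')
    qed
    have "(\<Prod>\<nu>\<in>{\<nu>\<in>Tn. is_young \<nu>}. ennreal ((1 - \<kappa>) * x \<nu> powr (- \<kappa>))) = (\<Prod>\<nu>\<in>Tn. ennreal (young \<nu>))"
      using fin by (subst prod.inter_filter) (auto simp: young_def intro!: prod.cong)
    then have "tree_density mm qq In Tn x = (\<Prod>\<nu>\<in>Tn. node_factor mm qq In \<nu> x) * (\<Prod>\<nu>\<in>Tn. ennreal (young \<nu>))"
      unfolding tree_density_def with_young_Tn by simp
    also have "\<dots> = (\<Prod>\<nu>\<in>Tn. ennreal (A \<nu>))"
      unfolding prod.distrib[symmetric] by (intro prod.cong refl nf)
    also have "\<dots> = (\<Prod>\<nu>\<in>Tn. ennreal (B \<nu>))"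
      by (simp add: AB)
    also have "\<dots> \<le> ennreal (\<Prod>\<nu>\<in>Tn. B \<nu>)"
    \<comment> \<open>Moving \<open>ennreal\<close> out of the product relies on nonnegative
      factors, available for possible out-degrees; an impossible one makes the left side
      zero.\<close>
    proof (cases "\<forall>\<nu>\<in>Tn. pmf M (outdeg \<nu>) > 0")
      case True
      have "B \<nu> \<ge> 0" if "\<nu> \<in> Tn" for \<nu>
      proof -
        have "pmf M (outdeg \<nu>) > 0" using True that by blast
        then have "outdeg \<nu> \<in> set_pmf M" by (simp add: set_pmf_iff)
        then have "real (outdeg \<nu>) + \<delta> > 0" by (rule weight_pos)
        then have "pochhammer (real (outdeg \<nu>) + \<delta>) (pat.indeg \<nu>) \<ge> 0"
          by (intro less_imp_le pochhammer_pos)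
        then show ?thesis using mu_pos by (simp add: B_def)
      qed
      then show ?thesis by (subst prod_ennreal) auto
    next
      case False
      then obtain \<nu> where \<nu>: "\<nu> \<in> Tn" "pmf M (outdeg \<nu>) = 0" using pmf_nonneg by (metis less_eq_real_def)
      then have "ennreal (B \<nu>) = 0" by (simp add: B_def)
      then have *: "(\<Prod>\<nu>\<in>Tn. ennreal (B \<nu>)) = 0"
        using fin \<nu>(1) by (intro prod_zero bexI[of _ \<nu>])
      show ?thesis unfolding * by (rule zero_le)
    qed
    also have "(\<Prod>\<nu>\<in>Tn. B \<nu>) = real (card parent_edges) * pat.pattern_density x"
    proof -
      have "(\<Prod>\<nu>\<in>Tn. if yng \<nu> then real (outdeg \<nu>) else 1) = real (card parent_edges)"
        unfolding card_parent_edges of_nat_prod using fin by (subst prod.inter_filter) auto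
      moreover have "(\<Prod>\<nu>\<in>Tn. if \<nu> \<in> In then g \<nu> else 1) = (\<Prod>\<nu>\<in>In. g \<nu>)" for g :: "node \<Rightarrow> real"
        using fin In_sub prod.inter_restrict[of Tn g In] by (simp add: Int_absorb1)
      moreover have "(\<Prod>\<nu>\<in>Tn. if \<nu> = [] then 1 else g \<nu>) = (\<Prod>\<nu>\<in>Tn - {[]}. g \<nu>)" for g :: "node \<Rightarrow> real"
        using fin by (subst prod.remove[of _ "[]"]) (auto intro: prod.cong)
      ultimately show ?thesis
        by (simp add: B_def prod.distrib pat.pattern_density_def mult_ac)
    qed
    also have "ennreal (real (card parent_edges) * pat.pattern_density x) = of_nat (card parent_edges) * ennreal (pat.pattern_density x)"
      by (simp add: ennreal_mult' ennreal_of_nat_eq_real_of_nat)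
    finally show ?thesis using True by simp
  qed
qed

end

section \<open>Structures of the tree\<close>

context rppt_params
begin

abbreviation n_young :: "'v sample \<Rightarrow> node \<Rightarrow> nat" where
  "n_young w \<nu> \<equiv> card (F (noise w \<nu>) (ag w \<nu>) (strength w \<nu>))"

definition has_struct :: "nat \<Rightarrow> (node \<Rightarrow> nat) \<times> (node \<Rightarrow> nat) \<Rightarrow> 'v sample \<Rightarrow> bool" where
  "has_struct k t w \<longleftrightarrow> (\<forall>\<nu>\<in>tree_nodes k (fst t) (snd t).
     struct_at (fst t) (snd t) (inner_nodes k (fst t) (snd t)) \<nu> w)"

lemma has_struct_valid_node:
  assumes "has_struct k t w" "length \<nu> \<le> k"
  shows "valid_node (fst t) (snd t) \<nu> \<longleftrightarrow> in_tree \<kappa> F w \<nu>"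
  using assms(2)
proof (induction \<nu>)
  case (Cons c \<nu>)
  have *: "m_minus w \<nu> = fst t \<nu>" "n_young w \<nu> = snd t \<nu>" if "valid_node (fst t) (snd t) \<nu>"
    using assms(1) that Cons.prems by (auto simp: has_struct_def struct_at_def tree_nodes_def inner_nodes_def)
  show ?case
    using Cons * by (cases c; cases "fst c") auto
qed simp

text \<open>The actual counts of the tree, set to \<open>0\<close> off the relevant nodes. The cut
  does not change which names of length at most \<open>k\<close> are valid, since their ancestors
  are relevant.\<close>

lemma ex_has_struct: "\<exists>t\<in>structures k. has_struct k t w"
proof -
  define mm where "mm \<nu> = (if \<nu> \<in> tree_nodes k (m_minus w) (n_young w) then m_minus w \<nu> else 0)" for \<nu>
  define qq where "qq \<nu> = (if \<nu> \<in> inner_nodes k (m_minus w) (n_young w) then n_young w \<nu> else 0)" for \<nu>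
  have v: "valid_node mm qq \<nu> \<longleftrightarrow> valid_node (m_minus w) (n_young w) \<nu>" if "length \<nu> \<le> k" for \<nu>
    using that
  proof (induction \<nu>)
    case (Cons c \<nu>)
    have "mm \<nu> = m_minus w \<nu>" "qq \<nu> = n_young w \<nu>" if "valid_node (m_minus w) (n_young w) \<nu>"
      using that Cons.prems by (simp_all add: mm_def qq_def tree_nodes_def inner_nodes_def)
    then show ?case using Cons by (cases c; cases "fst c") auto
  qed simp
  have I: "inner_nodes k mm qq = inner_nodes k (m_minus w) (n_young w)"
    using v by (auto simp: inner_nodes_def)
  have q: "qq \<nu> = n_young w \<nu>" if "\<nu> \<in> inner_nodes k (m_minus w) (n_young w)" for \<nu>
    using that by (simp add: qq_def)
  have "{(Young, i) # \<nu> | i \<nu>. \<nu> \<in> inner_nodes k mm qq \<and> i < qq \<nu>} =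
     {(Young, i) # \<nu> | i \<nu>. \<nu> \<in> inner_nodes k (m_minus w) (n_young w) \<and> i < n_young w \<nu>}"
    unfolding I using q by (intro Collect_cong) (metis (no_types, lifting))
  then have T: "tree_nodes k mm qq = tree_nodes k (m_minus w) (n_young w)"
    unfolding tree_nodes_def I by simp
  have "(mm, qq) \<in> structures k"
    unfolding structures_def by (auto simp: I T mm_def qq_def)
  moreover have "has_struct k (mm, qq) w"
    by (auto simp: has_struct_def struct_at_def I T mm_def qq_def)
  ultimately show ?thesis by blast
qed

lemma has_struct_measurable [measurable]: "Measurable.pred P (has_struct k t)"
  unfolding has_struct_def[abs_def] using finite_tree_nodes
  by (intro pred_intros_finite struct_at_measurable)

lemma looks_like_rppt:
  assumes r: "r > 0" and h: "snd h \<in> verts (fst h)" and t: "has_struct (inner_radius r) t w"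
  shows "looks_like r (rppt \<kappa> F w) h \<longleftrightarrow>
    tree_looks_like r h (inner_nodes (inner_radius r) (fst t) (snd t)) (ag w)"
proof -
  define I where "I = inner_nodes (inner_radius r) (fst t) (snd t)"
  interpret tree_struct "inner_radius r" "fst t" "snd t" .
  have I_eq: "I = {\<nu>. in_tree \<kappa> F w \<nu> \<and> length \<nu> \<le> inner_radius r}"
    unfolding I_def inner_nodes_def using has_struct_valid_node[OF t] by auto
  have mult: "mult (fst (rppt \<kappa> F w)) a b = of_bool (nb a b)" for a b
    by (simp add: rppt_def nb_def)
  have vt: "verts (fst (rppt \<kappa> F w)) = {\<nu>. in_tree \<kappa> F w \<nu>}" by (simp add: rppt_def)
  have "ball_verts (inner_radius r) (fst (rppt \<kappa> F w), id []) = id ` I"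
  proof (rule ball_verts_tree)
    show "[] \<in> I" by (simp add: I_eq)
    show "\<nu> \<in> I" if "c # \<nu> \<in> I" for c \<nu>
      using that unfolding I_def by (rule In_tl)
    show "length \<nu> \<le> inner_radius r" if "\<nu> \<in> I" for \<nu> using that by (simp add: I_eq)
    show "id ` I \<subseteq> verts (fst (rppt \<kappa> F w))" by (auto simp: I_eq vt)
    show "mult (fst (rppt \<kappa> F w)) (id a) (id b) = of_bool (nb a b)" for a b
      by (simp add: mult)
    fix a u assume a: "a \<in> I" "length a < inner_radius r" "u \<in> verts (fst (rppt \<kappa> F w))"
      "0 < mult (fst (rppt \<kappa> F w)) (id a) u"
    then have "nb a u" by (simp add: mult)
    moreover have "u \<in> I" using a \<open>nb a u\<close> by (auto simp: I_eq vt nb_def)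
    ultimately show "\<exists>b\<in>I. u = id b \<and> nb a b" by auto
  qed
  then have "looks_like r (fst (rppt \<kappa> F w), id []) h \<longleftrightarrow> tree_looks_like r h I (\<lambda>a. mark (fst (rppt \<kappa> F w)) (id a))"
    using r h mult by (intro looks_like_iff_tree_looks_like) (auto simp: I_def finite_inner_nodes)
  then show ?thesis by (simp add: rppt_def I_def)
qed

end

lemma tree_looks_like_cong:
  assumes "\<And>a. a \<in> I \<Longrightarrow> x a = y a"
  shows "tree_looks_like r h I x \<longleftrightarrow> tree_looks_like r h I y"
  unfolding tree_looks_like_def using assms by simp

text \<open>The candidates for \<open>\<psi>\<close> depend only on \<open>h\<close>,
  \<open>r\<close> and \<open>I\<close>, and restricted to \<open>I\<close> they are finitely many.
  As a condition on the marks the predicate is a finite union of closed boxes, which gives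
  measurability and stability under small changes.\<close>

lemma tree_looks_like_iff_finite:
  fixes h :: "nat rooted"
  assumes I: "finite I" "[] \<in> I"
  obtains \<Psi> :: "('b list \<Rightarrow> nat) set" where "finite \<Psi>"
    "\<And>x. tree_looks_like r h I x \<longleftrightarrow> (\<exists>\<psi>\<in>\<Psi>. \<forall>a\<in>I. \<bar>x a - mark (fst h) (\<psi> a)\<bar> \<le> 1 / r)"
proof -
  define \<Psi> where "\<Psi> = {\<psi> \<in> I \<rightarrow>\<^sub>E ball_verts (inner_radius r) h. bij_betw \<psi> I (ball_verts (inner_radius r) h) \<and> \<psi> [] = snd h \<and>
     (\<forall>a\<in>I. \<forall>b\<in>I. of_bool (nb a b) = mult (fst h) (\<psi> a) (\<psi> b))}"
  show ?thesis
  proof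
    show "finite \<Psi>"
    proof (cases "finite (ball_verts (inner_radius r) h)")
      case True
      then have "finite (I \<rightarrow>\<^sub>E ball_verts (inner_radius r) h)" using I by (intro finite_PiE) auto
      then show ?thesis by (rule finite_subset[rotated]) (auto simp: \<Psi>_def)
    next
      case False
      then have "\<Psi> = {}" using I by (auto simp: \<Psi>_def bij_betw_finite)
      then show ?thesis by simp
    qed
    fix x
    show "tree_looks_like r h I x \<longleftrightarrow> (\<exists>\<psi>\<in>\<Psi>. \<forall>a\<in>I. \<bar>x a - mark (fst h) (\<psi> a)\<bar> \<le> 1 / r)"
    proof
      assume "tree_looks_like r h I x"
      then obtain \<psi> where \<psi>: "bij_betw \<psi> I (ball_verts (inner_radius r) h)" "\<psi> [] = snd h"
        "\<forall>a\<in>I. \<forall>b\<in>I. of_bool (nb a b) = mult (fst h) (\<psi> a) (\<psi> b)"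
        "\<forall>a\<in>I. \<bar>x a - mark (fst h) (\<psi> a)\<bar> \<le> 1 / r"
        unfolding tree_looks_like_def by blast
      have "bij_betw (restrict \<psi> I) I (ball_verts (inner_radius r) h)"
        using \<psi>(1) by (subst bij_betw_cong[of I _ \<psi>]) auto
      moreover have "restrict \<psi> I \<in> I \<rightarrow>\<^sub>E ball_verts (inner_radius r) h"
        using bij_betw_imp_funcset[OF \<psi>(1)] by (simp add: PiE_iff Pi_iff)
      moreover have "\<forall>a\<in>I. \<forall>b\<in>I. of_bool (nb a b) = mult (fst h) (restrict \<psi> I a) (restrict \<psi> I b)"
        using \<psi>(3) by simp
      ultimately have "restrict \<psi> I \<in> \<Psi>"
        unfolding \<Psi>_def using \<psi>(2) I(2) by (intro CollectI conjI) simp_all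
      moreover have "\<forall>a\<in>I. \<bar>x a - mark (fst h) (restrict \<psi> I a)\<bar> \<le> 1 / r" using \<psi>(4) by simp
      ultimately show "\<exists>\<psi>\<in>\<Psi>. \<forall>a\<in>I. \<bar>x a - mark (fst h) (\<psi> a)\<bar> \<le> 1 / r" by blast
    next
      assume "\<exists>\<psi>\<in>\<Psi>. \<forall>a\<in>I. \<bar>x a - mark (fst h) (\<psi> a)\<bar> \<le> 1 / r"
      then show "tree_looks_like r h I x"
        unfolding \<Psi>_def tree_looks_like_def by blast
    qed
  qed
qed

lemma tree_looks_like_measurable [measurable]:
  fixes I :: "node set"
  assumes I: "finite I" "[] \<in> I"
  shows "Measurable.pred XU (tree_looks_like r h I)"
proof -
  obtain \<Psi> :: "(node \<Rightarrow> nat) set" where \<Psi>: "finite \<Psi>"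
    "\<And>x. tree_looks_like r h I x \<longleftrightarrow> (\<exists>\<psi>\<in>\<Psi>. \<forall>a\<in>I. \<bar>x a - mark (fst h) (\<psi> a)\<bar> \<le> 1 / r)"
    using tree_looks_like_iff_finite[OF I] by metis
  have "Measurable.pred XU (\<lambda>x. \<bar>x a - c\<bar> \<le> d)" for a c d
    using XU_component[of a] by measurable
  then show ?thesis
    unfolding \<Psi>(2)[abs_def] using \<Psi>(1) I(1) by (intro pred_intros_finite) auto
qed

text \<open>Membership in a finite union of boxes is locally constant away from their boundaries,
  and the last assumption keeps \<open>x\<close> off these.\<close>

lemma eventually_tree_looks_like_iff:
  fixes h :: "nat rooted"
  assumes r: "r > 0" and I: "finite I" "[] \<in> I" and lim: "\<And>a. a \<in> I \<Longrightarrow> (\<lambda>n. y n a) \<longlonglongrightarrow> x a"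
    and x: "\<And>a v. a \<in> I \<Longrightarrow> \<bar>x a - mark (fst h) v\<bar> \<noteq> 1 / r"
  shows "eventually (\<lambda>n. tree_looks_like r h I (y n) \<longleftrightarrow> tree_looks_like r h I x) sequentially"
proof -
  obtain \<Psi> :: "('a list \<Rightarrow> nat) set" where \<Psi>: "finite \<Psi>"
    "\<And>x. tree_looks_like r h I x \<longleftrightarrow> (\<exists>\<psi>\<in>\<Psi>. \<forall>a\<in>I. \<bar>x a - mark (fst h) (\<psi> a)\<bar> \<le> 1 / r)"
    using tree_looks_like_iff_finite[OF I] by metis
  have ev: "eventually (\<lambda>n. \<bar>y n a - mark (fst h) v\<bar> \<le> 1 / r \<longleftrightarrow> \<bar>x a - mark (fst h) v\<bar> \<le> 1 / r) sequentially" if "a \<in> I" for a v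
  proof -
    have l: "(\<lambda>n. \<bar>y n a - mark (fst h) v\<bar>) \<longlonglongrightarrow> \<bar>x a - mark (fst h) v\<bar>"
      by (intro tendsto_intros lim that)
    show ?thesis
    proof (cases "\<bar>x a - mark (fst h) v\<bar> < 1 / r")
      case True
      from order_tendstoD(2)[OF l this] show ?thesis
        by eventually_elim (use True in auto)
    next
      case False
      then have "1 / r < \<bar>x a - mark (fst h) v\<bar>" using x[OF that, of v] by simp
      from order_tendstoD(1)[OF l this] show ?thesis
        by eventually_elim (use False x[OF that, of v] in auto)
    qed
  qed
  have "eventually (\<lambda>n. \<forall>\<psi>\<in>\<Psi>. \<forall>a\<in>I. \<bar>y n a - mark (fst h) (\<psi> a)\<bar> \<le> 1 / r \<longleftrightarrow> \<bar>x a - mark (fst h) (\<psi> a)\<bar> \<le> 1 / r) sequentially"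
    using \<Psi>(1) I(1) ev by (intro eventually_ball_finite ballI) auto
  then show ?thesis
    by eventually_elim (simp add: \<Psi>(2))
qed

section \<open>Occurrences of tree patterns in the graph\<close>

text \<open>Used to recover the numbering of younger children from the mere set of vertices attached
  to their parent.\<close>

lemma increasing_enumeration_unique:
  fixes f g :: "nat \<Rightarrow> nat"
  assumes f: "\<And>i j. i < j \<Longrightarrow> j < q \<Longrightarrow> f i < f j" and g: "\<And>i j. i < j \<Longrightarrow> j < q' \<Longrightarrow> g i < g j"
    and eq: "f ` {..<q} = g ` {..<q'}"
  shows "q = q'" and "\<And>i. i < q \<Longrightarrow> f i = g i"
proof -
  have s: "sorted (map f [0..<q]) \<and> distinct (map f [0..<q])" if "\<And>i j. i < j \<Longrightarrow> j < q \<Longrightarrow> f i < f j" for f :: "nat \<Rightarrow> nat" and q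
  proof -
    have "sorted_wrt (<) (map f [0..<q])" using that by (simp add: sorted_wrt_iff_nth_less)
    then show ?thesis by (simp add: strict_sorted_iff)
  qed
  have e: "map f [0..<q] = map g [0..<q']"
    using s[of q f] s[of q' g] f g eq by (intro sorted_distinct_set_unique) (auto simp: lessThan_atLeast0)
  then show "q = q'" by (metis diff_zero length_map length_upt)
  then show "f i = g i" if "i < q" for i
    using e that by simp
qed

context tree_struct
begin

text \<open>The occurrence of a tree pattern as a property of the history alone, together with the
  numbering of younger children by position.\<close>

definition located :: "nat \<Rightarrow> (nat \<Rightarrow> nat) \<Rightarrow> (nat \<Rightarrow> nat \<Rightarrow> nat) \<Rightarrow> (node \<Rightarrow> nat) \<Rightarrow> (node \<Rightarrow> nat) \<Rightarrow> bool" where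
  "located n m H J v \<longleftrightarrow> J \<in> parent_edges \<and> inj_on v Tn \<and> v ` Tn \<subseteq> {3..n} \<and> increasing v \<and>
     (\<forall>\<nu>\<in>Tn. m (v \<nu>) = outdeg \<nu>) \<and>
     (\<forall>w\<in>{3..n}. \<forall>j\<in>{1..m w}. \<forall>\<nu>\<in>In. H w j = v \<nu> \<longleftrightarrow>
        (\<exists>c\<in>Tn - {[]}. w = v (t_src c) \<and> j = t_ix J c \<and> \<nu> = t_tg c))"

context
  fixes n :: nat and m :: "nat \<Rightarrow> nat" and H :: "nat \<Rightarrow> nat \<Rightarrow> nat" and J v :: "node \<Rightarrow> nat"
  assumes loc: "located n m H J v"
begin

interpretation pattern Tn In "Tn - {[]}" t_src t_tg "t_ix J" outdeg
  using loc by (intro pattern) (simp add: located_def)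

lemma located_inj: "\<nu> \<in> Tn \<Longrightarrow> \<nu>' \<in> Tn \<Longrightarrow> v \<nu> = v \<nu>' \<longleftrightarrow> \<nu> = \<nu>'"
  using loc by (auto simp: located_def inj_on_def)

lemma located_range: "\<nu> \<in> Tn \<Longrightarrow> v \<nu> \<in> {3..n}"
  using loc by (auto simp: located_def)

lemma located_outdeg: "\<nu> \<in> Tn \<Longrightarrow> m (v \<nu>) = outdeg \<nu>"
  using loc by (auto simp: located_def)

lemma located_iff:
  assumes "w \<in> {3..n}" "j \<in> {1..m w}" "\<nu> \<in> In"
  shows "H w j = v \<nu> \<longleftrightarrow> (\<exists>c\<in>Tn - {[]}. w = v (t_src c) \<and> j = t_ix J c \<and> \<nu> = t_tg c)"
proof -
  have "\<forall>w\<in>{3..n}. \<forall>j\<in>{1..m w}. \<forall>\<nu>\<in>In. H w j = v \<nu> \<longleftrightarrow>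
        (\<exists>c\<in>Tn - {[]}. w = v (t_src c) \<and> j = t_ix J c \<and> \<nu> = t_tg c)"
    using loc unfolding located_def by (elim conjE)
  then show ?thesis using assms by blast
qed

lemma located_parent_edge: "\<nu> \<in> Tn \<Longrightarrow> yng \<nu> \<Longrightarrow> J \<nu> \<in> {1..outdeg \<nu>}"
  using loc by (auto simp: located_def parent_edges_def PiE_iff)

lemma located_edge:
  assumes c: "c \<in> Tn - {[]}"
  shows "H (v (t_src c)) (t_ix J c) = v (t_tg c)"
proof -
  have "v (t_src c) \<in> {3..n}" "t_ix J c \<in> {1..m (v (t_src c))}"
    using src[OF c] ix[OF c] located_range located_outdeg by auto
  then show ?thesis using located_iff tg[OF c] c by blast
qed

lemma located_edges_into:
  assumes "\<nu> \<in> In"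
  shows "{(w, j). w \<in> {3..n} \<and> j \<in> {1..m w} \<and> H w j = v \<nu>} =
    (\<lambda>c. (v (t_src c), t_ix J c)) ` {c\<in>Tn - {[]}. t_tg c = \<nu>}" (is "?L = ?R")
proof (intro set_eqI iffI)
  fix e assume "e \<in> ?L"
  then obtain w j where e: "e = (w, j)" "w \<in> {3..n}" "j \<in> {1..m w}" "H w j = v \<nu>" by auto
  then obtain c where "c\<in>Tn - {[]}" "w = v (t_src c)" "j = t_ix J c" "\<nu> = t_tg c"
    using located_iff assms by metis
  then show "e \<in> ?R" using e(1) by blast
next
  fix e assume "e \<in> ?R"
  then obtain c where c: "c\<in>Tn - {[]}" "t_tg c = \<nu>" "e = (v (t_src c), t_ix J c)" by auto
  then show "e \<in> ?L"
    using located_edge[OF c(1)] src[OF c(1)] ix[OF c(1)] located_range located_outdeg by auto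
qed

lemma edge_between_iff:
  assumes "\<nu> \<in> Tn" "\<nu>' \<in> In"
  shows "{c\<in>Tn - {[]}. t_src c = \<nu> \<and> t_tg c = \<nu>'} =
    (if yng \<nu> \<and> tl \<nu> = \<nu>' then {\<nu>} else if \<nu>' \<noteq> [] \<and> \<not> yng \<nu>' \<and> tl \<nu>' = \<nu> then {\<nu>'} else {})"
proof (intro set_eqI iffI)
  fix c assume "c \<in> {c\<in>Tn - {[]}. t_src c = \<nu> \<and> t_tg c = \<nu>'}"
  then have c: "c \<in> Tn - {[]}" "t_src c = \<nu>" "t_tg c = \<nu>'" by auto
  from c(1) show "c \<in> (if yng \<nu> \<and> tl \<nu> = \<nu>' then {\<nu>} else if \<nu>' \<noteq> [] \<and> \<not> yng \<nu>' \<and> tl \<nu>' = \<nu> then {\<nu>'} else {})"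
  proof (cases rule: cons_cases)
    case (1 i p)
    then have "\<nu> = p" "\<nu>' = (Old, i) # p" using c by (auto simp: t_src_def t_tg_def)
    moreover have "tl p \<noteq> (Old, i) # p" by (metis length_Cons length_tl less_Suc_eq_le diff_le_self nat_less_le n_not_Suc_n not_less_eq_eq)
    ultimately show ?thesis using 1 by simp
  next
    case (2 i p)
    then show ?thesis using c by (auto simp: t_src_def t_tg_def)
  qed
next
  fix c assume "c \<in> (if yng \<nu> \<and> tl \<nu> = \<nu>' then {\<nu>} else if \<nu>' \<noteq> [] \<and> \<not> yng \<nu>' \<and> tl \<nu>' = \<nu> then {\<nu>'} else {})"
  then show "c \<in> {c\<in>Tn - {[]}. t_src c = \<nu> \<and> t_tg c = \<nu>'}"
    using assms In_sub by (auto simp: t_src_def t_tg_def split: if_splits)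
qed

context
  fixes G0 :: edges and E
  assumes G0: "set_mset G0 \<subseteq> {1, 2} \<times> {1, 2}"
  defines "E \<equiv> edges_of G0 m (Suc n) 0 H"
begin

text \<open>Edges with an end at \<open>3\<close> or later do not belong to the initial graph, so
  the history accounts for all of them.\<close>

lemma count_edges:
  assumes "a \<ge> 3 \<or> b \<ge> 3"
  shows "count E (a, b) = (if a \<in> {3..n} then card {j\<in>{1..m a}. H a j = b} else 0)"
proof -
  have "(a, b) \<notin> set_mset G0" using assms G0 by auto
  then have 1: "count G0 (a, b) = 0" by (simp add: not_in_iff)
  have st: "steps m (Suc n) 0 = (SIGMA w:{3..n}. {1..m w})"
    by (auto simp: steps_def)
  have "count (image_mset (\<lambda>(w, i). (w, H w i)) (mset_set (steps m (Suc n) 0))) (a, b) =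
      card {s\<in>steps m (Suc n) 0. (case s of (w, i) \<Rightarrow> (w, H w i)) = (a, b)}"
    by (simp add: count_image_mset_eq_card_vimage)
  also have "{s\<in>steps m (Suc n) 0. (case s of (w, i) \<Rightarrow> (w, H w i)) = (a, b)} =
      (if a \<in> {3..n} then Pair a ` {j\<in>{1..m a}. H a j = b} else {})"
    unfolding st by auto
  also have "card \<dots> = (if a \<in> {3..n} then card {j\<in>{1..m a}. H a j = b} else 0)"
    by (simp add: card_image inj_on_def)
  finally show ?thesis unfolding E_def edges_of_def by (simp add: 1)
qed

lemma count_located:
  assumes "\<nu> \<in> Tn" "\<nu>' \<in> In"
  shows "count E (v \<nu>, v \<nu>') = of_bool (yng \<nu> \<and> tl \<nu> = \<nu>') + of_bool (\<nu>' \<noteq> [] \<and> \<not> yng \<nu>' \<and> tl \<nu>' = \<nu> \<and> \<not> (yng \<nu> \<and> tl \<nu> = \<nu>'))"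
proof -
  have r: "v \<nu> \<in> {3..n}" by (rule located_range[OF assms(1)])
  have "{j\<in>{1..m (v \<nu>)}. H (v \<nu>) j = v \<nu>'} = t_ix J ` {c\<in>Tn - {[]}. t_src c = \<nu> \<and> t_tg c = \<nu>'}"
  proof -
    have "{j\<in>{1..m (v \<nu>)}. H (v \<nu>) j = v \<nu>'} = {j. (v \<nu>, j) \<in> {(w, j). w \<in> {3..n} \<and> j \<in> {1..m w} \<and> H w j = v \<nu>'}}"
      using r by auto
    also have "\<dots> = t_ix J ` {c\<in>Tn - {[]}. t_src c = \<nu> \<and> t_tg c = \<nu>'}"
      unfolding located_edges_into[OF assms(2)] using assms(1) src located_inj by auto
    finally show ?thesis .
  qed
  then have "count E (v \<nu>, v \<nu>') = card (t_ix J ` {c\<in>Tn - {[]}. t_src c = \<nu> \<and> t_tg c = \<nu>'})"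
    using r by (subst count_edges) auto
  then show ?thesis unfolding edge_between_iff[OF assms] by auto
qed

text \<open>The edge between parent and child is prescribed once and in one direction only, and all
  other edges into inner vertices come from prescribed sources; so there are no loops, multiple
  edges or chords.\<close>

lemma edge_mult_located:
  assumes "\<nu> \<in> In" "\<nu>' \<in> In"
  shows "edge_mult E (v \<nu>) (v \<nu>') = of_bool (nb \<nu> \<nu>')"
proof (cases "\<nu> = \<nu>'")
  case True
  have "\<not> nb \<nu> \<nu>" by (auto simp: nb_def)
  moreover have "tl \<nu> = \<nu> \<Longrightarrow> \<nu> = []" by (cases \<nu>) auto
  moreover note count_located[OF subsetD[OF In_sub assms(1)] assms(1)]
  ultimately show ?thesis
    using True by (auto simp: edge_mult_def)
next
  case False
  then have "v \<nu> \<noteq> v \<nu>'" using located_inj assms In_sub by auto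
  then have e: "edge_mult E (v \<nu>) (v \<nu>') = count E (v \<nu>, v \<nu>') + count E (v \<nu>', v \<nu>)"
    by (simp add: edge_mult_def)
  have *: "count E (v a, v b) + count E (v b, v a) = 1" if "a = c # b" "a \<in> In" "b \<in> In" for a b c
  proof -
    have "tl b \<noteq> a" using that by (cases b) auto
    moreover have "a \<in> Tn" "b \<in> Tn" using that In_sub by auto
    moreover have "yng b \<Longrightarrow> b \<noteq> []" by (auto simp: yng_def)
    ultimately show ?thesis
      using that count_located[of a b] count_located[of b a] by auto
  qed
  show ?thesis
  proof (cases "nb \<nu> \<nu>'")
    case True
    then show ?thesis using e *[of \<nu> _ \<nu>'] *[of \<nu>' _ \<nu>] assms by (auto simp: nb_def)
  next
    case nnb: False
    have "tl a = b \<Longrightarrow> a \<noteq> [] \<Longrightarrow> nb a b \<and> nb b a" for a b :: node by (cases a) (auto simp: nb_def)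
    moreover have "nb \<nu>' \<nu> = nb \<nu> \<nu>'" by (auto simp: nb_def)
    moreover have "yng a \<Longrightarrow> a \<noteq> []" for a by (auto simp: yng_def)
    ultimately have "\<not> (yng \<nu> \<and> tl \<nu> = \<nu>')" "\<not> (yng \<nu>' \<and> tl \<nu>' = \<nu>)"
       "\<not> (\<nu> \<noteq> [] \<and> tl \<nu> = \<nu>')" "\<not> (\<nu>' \<noteq> [] \<and> tl \<nu>' = \<nu>)" using nnb by metis+
    then show ?thesis
      using e nnb count_located[of \<nu> \<nu>'] count_located[of \<nu>' \<nu>] assms In_sub by auto
  qed
qed

text \<open>Edges into an inner vertex come from its parent or its children. The outgoing ones
  number \<open>outdeg \<nu>\<close>, and by \<open>old_ix_surj\<close> they are exhausted by the
  edge to the parent and those to older children, which belong to the tree as long as the depth of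
  \<open>\<nu>\<close> is below \<open>k\<close>.\<close>

lemma located_neighbour:
  assumes \<nu>: "\<nu> \<in> In" "length \<nu> < k" and u: "edge_mult E (v \<nu>) u > 0"
  shows "\<exists>\<nu>'\<in>In. u = v \<nu>' \<and> nb \<nu> \<nu>'"
proof -
  have \<nu>T: "\<nu> \<in> Tn" using \<nu> In_sub by auto
  have r: "v \<nu> \<in> {3..n}" by (rule located_range[OF \<nu>T])
  have "edge_mult E (v \<nu>) (v \<nu>) = 0"
    using edge_mult_located[OF \<nu>(1) \<nu>(1)] by (simp add: nb_def)
  then have "u \<noteq> v \<nu>" using u by auto
  then have "count E (v \<nu>, u) > 0 \<or> count E (u, v \<nu>) > 0"
    using u by (auto simp: edge_mult_def split: if_splits)
  then show ?thesis
  proof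
    assume "count E (u, v \<nu>) > 0"
    moreover have "count E (u, v \<nu>) = (if u \<in> {3..n} then card {j\<in>{1..m u}. H u j = v \<nu>} else 0)"
      using r by (intro count_edges) auto
    ultimately have u3: "u \<in> {3..n}" and "card {j\<in>{1..m u}. H u j = v \<nu>} \<noteq> 0"
      by (metis less_irrefl)+
    then have "{j\<in>{1..m u}. H u j = v \<nu>} \<noteq> {}" by (metis card.empty)
    then obtain j where "j \<in> {1..m u}" "H u j = v \<nu>" by blast
    then obtain c where c: "c \<in> Tn - {[]}" "u = v (t_src c)" "\<nu> = t_tg c"
      using located_iff[OF u3 _ \<nu>(1)] by auto
    from c(1) show ?thesis
    proof (cases rule: cons_cases)
      case (1 i p)
      then show ?thesis using c by (intro bexI[of _ p]) (auto simp: t_src_def t_tg_def nb_def)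
    next
      case (2 i p)
      then have "c \<in> In" using c \<nu> by (simp add: In_Cons t_tg_def)
      then show ?thesis using 2 c by (intro bexI[of _ c]) (auto simp: t_src_def t_tg_def nb_def)
    qed
  next
    assume "count E (v \<nu>, u) > 0"
    moreover have "count E (v \<nu>, u) = card {j\<in>{1..m (v \<nu>)}. H (v \<nu>) j = u}"
      using r by (subst count_edges) auto
    ultimately have "{j\<in>{1..m (v \<nu>)}. H (v \<nu>) j = u} \<noteq> {}" by (metis card.empty less_irrefl)
    then obtain j where j: "j \<in> {1..outdeg \<nu>}" "H (v \<nu>) j = u"
      using located_outdeg[OF \<nu>T] by auto
    show ?thesis
    proof (cases "yng \<nu> \<and> j = J \<nu>")
      case True
      then obtain i p where p: "\<nu> = (Young, i) # p" by (auto simp: yng_def)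
      then have "u = v p"
        using located_edge[of \<nu>] \<nu>T True j(2) by (simp add: t_src_def t_tg_def t_ix_def)
      moreover have "p \<in> In" using p \<nu> In_tl by auto
      ultimately show ?thesis using p by (auto simp: nb_def)
    next
      case False
      obtain i where i: "i < mm \<nu>" "j = old_ix J \<nu> i"
      proof (rule old_ix_surj[of j \<nu> J])
        show "1 \<le> j" "j \<le> outdeg \<nu>" using j by auto
        show "j \<noteq> J \<nu>" if "yng \<nu>" using False that by auto
        show "1 \<le> J \<nu> \<and> J \<nu> \<le> outdeg \<nu>" if "yng \<nu>" using located_parent_edge[OF \<nu>T that] by auto
      qed
      let ?c = "(Old, i) # \<nu>"
      have "?c \<in> In" using \<nu> i by (simp add: In_Cons)
      moreover have "u = v ?c"
        using located_edge[of ?c] \<open>?c \<in> In\<close> In_sub j(2) i by (auto simp: t_src_def t_tg_def t_ix_def)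
      ultimately show ?thesis by (auto simp: nb_def)
    qed
  qed
qed

lemma looks_like_located:
  assumes r: "r > 0" "k = inner_radius r" and h: "snd h \<in> verts (fst h)"
  shows "looks_like r (marked_graph n E, v []) h \<longleftrightarrow> tree_looks_like r h In (\<lambda>\<nu>. real (v \<nu>) / real n)"
proof -
  have inj: "inj_on v In" using loc In_sub by (auto simp: located_def intro: inj_on_subset)
  have m: "mult (marked_graph n E) (v a) (v b) = of_bool (nb a b)" if "a \<in> In" "b \<in> In" for a b
    using edge_mult_located that by (simp add: marked_graph_def)
  have "ball_verts k (marked_graph n E, v []) = v ` In"
  proof (rule ball_verts_tree)
    show "length \<nu> \<le> k" if "\<nu> \<in> In" for \<nu> using that by (simp add: inner_nodes_def)
    show "v ` In \<subseteq> verts (marked_graph n E)"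
      using located_range In_sub by (force simp: marked_graph_def)
    show "\<exists>b\<in>In. u = v b \<and> nb a b"
      if "a \<in> In" "length a < k" "0 < mult (marked_graph n E) (v a) u" for a u
      using located_neighbour that by (simp add: marked_graph_def)
  qed (use m In_tl in auto)
  then show ?thesis
    using looks_like_iff_tree_looks_like[OF r(1) finite_inner_nodes[of k mm qq] root_In inj _ m h]
    by (simp add: r(2) marked_graph_def)
qed

end

end

end

text \<open>The tree is read off from the history, starting at the root. At each node the edge to
  the parent is known; the other outgoing edges give the older children in order, and the other
  incoming ones the younger children, sorted by position.\<close>

lemma located_unique_aux:
  assumes A: "tree_struct.located k mm qq n m H J v" and B: "tree_struct.located k mm' qq' n m H J' v'"
    and root: "v [] = v' []" and \<nu>: "\<nu> \<in> inner_nodes k mm qq"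
  shows "\<nu> \<in> inner_nodes k mm' qq' \<and> v \<nu> = v' \<nu> \<and> mm \<nu> = mm' \<nu> \<and> qq \<nu> = qq' \<nu> \<and>
    (\<forall>i<qq \<nu>. v ((Young, i) # \<nu>) = v' ((Young, i) # \<nu>) \<and> J ((Young, i) # \<nu>) = J' ((Young, i) # \<nu>))"
proof -
  interpret A: tree_struct k mm qq .
  interpret B: tree_struct k mm' qq' .
  \<comment> \<open>The induction also carries the edge to the parent, which has to be excluded when
    children are read off.\<close>
  define R where "R \<nu> \<longleftrightarrow> \<nu> \<in> inner_nodes k mm' qq' \<and> v \<nu> = v' \<nu> \<and>
    (\<nu> \<noteq> [] \<longrightarrow> v (tl \<nu>) = v' (tl \<nu>) \<and> A.t_ix J \<nu> = A.t_ix J' \<nu>)" for \<nu>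
  have step: "mm p = mm' p \<and> qq p = qq' p \<and>
      (\<forall>i<qq p. v ((Young, i) # p) = v' ((Young, i) # p) \<and> J ((Young, i) # p) = J' ((Young, i) # p)) \<and>
      (\<forall>i<mm p. length p < k \<longrightarrow> v ((Old, i) # p) = v' ((Old, i) # p))"
    if p: "p \<in> A.In" and R: "R p" for p
  proof -
    have p': "p \<in> B.In" "v p = v' p" using R by (auto simp: R_def)
    have pT: "p \<in> A.Tn" "p \<in> B.Tn" using p p' A.In_sub B.In_sub by auto
    have Jp: "J p = J' p" if "A.yng p"
      using R that by (auto simp: R_def A.t_ix_def A.yng_def)
    have "A.outdeg p = B.outdeg p"
      using A.located_outdeg[OF A pT(1)] B.located_outdeg[OF B pT(2)] p' by simp
    then have mm: "mm p = mm' p" by (simp add: A.outdeg_def B.outdeg_def)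
    have old: "v ((Old, i) # p) = v' ((Old, i) # p)" if "i < mm p" "length p < k" for i
    proof -
      let ?c = "(Old, i) # p"
      have "?c \<in> A.Tn - {[]}" "?c \<in> B.Tn - {[]}" using that p p' mm by (auto simp: A.Tn_Cons B.Tn_Cons)
      from A.located_edge[OF A this(1)] B.located_edge[OF B this(2)]
      have "v ?c = H (v p) (A.old_ix J p i)" "v' ?c = H (v' p) (A.old_ix J' p i)"
        by (auto simp: A.t_src_def A.t_tg_def A.t_ix_def)
      moreover have "A.old_ix J p i = A.old_ix J' p i" using Jp by (auto simp: A.old_ix_def)
      ultimately show ?thesis using p' by simp
    qed
    define e where "e i = (v ((Young, i) # p), J ((Young, i) # p))" for i
    define e' where "e' i = (v' ((Young, i) # p), J' ((Young, i) # p))" for i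
    \<comment> \<open>The incoming edge from the parent, present only at old nodes; it is the same
      for both trees and cancels when the sets of incoming edges are compared.\<close>
    define par where "par = (if p \<noteq> [] \<and> \<not> A.yng p then {(v (tl p), A.t_ix J p)} else {})"
    have into: "{c \<in> tree_nodes k mm qq - {[]}. A.t_tg c = p} =
      (\<lambda>i. (Young, i) # p) ` {..<qq p} \<union> (if p \<noteq> [] \<and> \<not> A.yng p then {p} else {})"
      if "p \<in> inner_nodes k mm qq" for mm qq
    proof (intro set_eqI iffI)
      interpret tree_struct k mm qq .
      fix c
      {
        assume c: "c \<in> {c \<in> tree_nodes k mm qq - {[]}. A.t_tg c = p}"
        then have "c \<in> tree_nodes k mm qq - {[]}" by auto
        then show "c \<in> (\<lambda>i. (Young, i) # p) ` {..<qq p} \<union> (if p \<noteq> [] \<and> \<not> A.yng p then {p} else {})"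
          using c by (cases rule: cons_cases) (auto simp: t_tg_def)
      }
      assume "c \<in> (\<lambda>i. (Young, i) # p) ` {..<qq p} \<union> (if p \<noteq> [] \<and> \<not> A.yng p then {p} else {})"
      then show "c \<in> {c \<in> tree_nodes k mm qq - {[]}. A.t_tg c = p}"
        using that In_sub by (auto simp: t_tg_def Tn_Cons split: if_splits)
    qed
    have S: "{(w, j). w \<in> {3..n} \<and> j \<in> {1..m w} \<and> H w j = v p} = e ` {..<qq p} \<union> par"
      unfolding A.located_edges_into[OF A p] into[OF p] e_def par_def
      by (auto simp: image_Un image_image A.t_src_def A.t_ix_def)
    have S': "{(w, j). w \<in> {3..n} \<and> j \<in> {1..m w} \<and> H w j = v p} = e' ` {..<qq' p} \<union> par"
      unfolding p'(2) B.located_edges_into[OF B p'(1)] into[OF p'(1)] e'_def par_def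
      using R by (auto simp: R_def image_Un image_image A.t_src_def A.t_ix_def)
    have par: "par \<inter> e ` {..<qq p} = {}"
    proof -
      have "v (tl p) \<noteq> v ((Young, i) # p)" if "p \<noteq> []" "i < qq p" for i
      proof -
        have "tl p \<in> A.In" using p that A.In_tl by (cases p) auto
        then have "tl p \<in> A.Tn" using A.In_sub by auto
        moreover have "(Young, i) # p \<in> A.Tn" using that p by (simp add: A.Tn_Cons)
        moreover have "tl p \<noteq> (Young, i) # p" by (cases p) auto
        ultimately show ?thesis using A.located_inj[OF A] by blast
      qed
      then show ?thesis by (auto simp: par_def e_def)
    qed
    have par': "par \<inter> e' ` {..<qq' p} = {}"
    proof -
      have "v' (tl p) \<noteq> v' ((Young, i) # p)" if "p \<noteq> []" "i < qq' p" for i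
      proof -
        have "tl p \<in> B.In" using p' that B.In_tl by (cases p) auto
        then have "tl p \<in> B.Tn" using B.In_sub by auto
        moreover have "(Young, i) # p \<in> B.Tn" using that p' by (simp add: B.Tn_Cons)
        moreover have "tl p \<noteq> (Young, i) # p" by (cases p) auto
        ultimately show ?thesis using B.located_inj[OF B] by blast
      qed
      then show ?thesis using R by (auto simp: par_def e'_def R_def)
    qed
    have "X = Y" if "S = X \<union> Z" "S = Y \<union> Z" "Z \<inter> X = {}" "Z \<inter> Y = {}" for X Y Z S :: "(nat \<times> nat) set"
      using that by (intro set_eqI) (metis Un_iff disjoint_iff)
    from this[OF S S' par par'] have ee: "e ` {..<qq p} = e' ` {..<qq' p}" .
    then have "fst ` e ` {..<qq p} = fst ` e' ` {..<qq' p}" by simp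
    then have im: "(\<lambda>i. v ((Young, i) # p)) ` {..<qq p} = (\<lambda>i. v' ((Young, i) # p)) ` {..<qq' p}"
      by (simp add: image_image e_def e'_def)
    have inc: "\<And>i j. i < j \<Longrightarrow> j < qq p \<Longrightarrow> v ((Young, i) # p) < v ((Young, j) # p)"
      "\<And>i j. i < j \<Longrightarrow> j < qq' p \<Longrightarrow> v' ((Young, i) # p) < v' ((Young, j) # p)"
      using A B p p' by (auto simp: A.located_def B.located_def A.increasing_def B.increasing_def)
    have uq1: "qq p = qq' p"
      by (rule increasing_enumeration_unique(1)[where f = "\<lambda>i. v ((Young, i) # p)" and g = "\<lambda>i. v' ((Young, i) # p)"])
        (use inc im in simp_all)
    have uq2: "v ((Young, i) # p) = v' ((Young, i) # p)" if "i < qq p" for i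
      by (rule increasing_enumeration_unique(2)[where f = "\<lambda>i. v ((Young, i) # p)" and g = "\<lambda>i. v' ((Young, i) # p)", OF _ _ im that])
        (use inc in simp_all)
    have "J ((Young, i) # p) = J' ((Young, i) # p)" if i: "i < qq p" for i
    proof -
      have "e i \<in> e' ` {..<qq' p}" using ee i by auto
      then obtain j where j: "j < qq' p" "e i = e' j" by auto
      then have "v' ((Young, j) # p) = v' ((Young, i) # p)" using uq2[OF i] by (simp add: e_def e'_def)
      moreover have "(Young, j) # p \<in> B.Tn" "(Young, i) # p \<in> B.Tn"
        using j i uq1 p' by (auto simp: B.Tn_Cons)
      ultimately have "j = i" using B.located_inj[OF B] by blast
      then show ?thesis using j by (simp add: e_def e'_def)
    qed
    then show ?thesis using mm old uq1 uq2 by blast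
  qed
  have R: "R \<nu>" if "\<nu> \<in> A.In" for \<nu>
    using that
  proof (induction \<nu>)
    case Nil
    then show ?case using root by (simp add: R_def)
  next
    case (Cons c p)
    have p: "p \<in> A.In" using Cons.prems by (rule A.In_tl)
    note Rp = Cons.IH[OF p]
    note st = step[OF p Rp]
    obtain l i where c: "c = (l, i)" by (cases c)
    show ?case
    proof (cases l)
      case Old
      then have i: "i < mm p" "length p < k" using Cons.prems c by (auto simp: A.In_Cons)
      have "J p = J' p" if "A.yng p"
        using Rp that by (auto simp: R_def A.t_ix_def A.yng_def)
      then have "A.t_ix J (c # p) = A.t_ix J' (c # p)" using Old c by (auto simp: A.t_ix_def A.old_ix_def)
      then show ?thesis using st i Old c Rp by (simp add: R_def B.In_Cons)
    next
      case Young
      then have i: "i < qq p" "length p < k" using Cons.prems c by (auto simp: A.In_Cons)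
      then have "A.t_ix J (c # p) = A.t_ix J' (c # p)" using st Young c by (simp add: A.t_ix_def)
      then show ?thesis using st i Young c Rp by (simp add: R_def B.In_Cons)
    qed
  qed
  from R[OF \<nu>] step[OF \<nu> R[OF \<nu>]] show ?thesis unfolding R_def by blast
qed

text \<open>Equality on inner nodes extends to all data, because structures vanish off the relevant
  nodes and the maps for positions and parent edges are extensional.\<close>

lemma located_unique:
  assumes A: "tree_struct.located k mm qq n m H J v" and B: "tree_struct.located k mm' qq' n m H J' v'"
    and S: "(mm, qq) \<in> structures k" "(mm', qq') \<in> structures k"
    and v: "v \<in> tree_nodes k mm qq \<rightarrow>\<^sub>E X" "v' \<in> tree_nodes k mm' qq' \<rightarrow>\<^sub>E X"
    and root: "v [] = v' []"
  shows "mm = mm' \<and> qq = qq' \<and> J = J' \<and> v = v'"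
proof -
  interpret A: tree_struct k mm qq .
  interpret B: tree_struct k mm' qq' .
  note a = located_unique_aux[OF A B root]
  have I: "A.In = B.In"
    using a located_unique_aux[OF B A root[symmetric]] by blast
  have qI: "qq \<nu> = qq' \<nu>" "mm \<nu> = mm' \<nu>" if "\<nu> \<in> A.In" for \<nu> using a[OF that] by auto
  have qq: "qq = qq'"
  proof
    fix \<nu>
    show "qq \<nu> = qq' \<nu>" using qI(1)[of \<nu>] S I by (cases "\<nu> \<in> A.In") (auto simp: structures_def)
  qed
  have T: "A.Tn = B.Tn" using I qq by (simp add: tree_nodes_def)
  have vJ: "v \<nu> = v' \<nu> \<and> (A.yng \<nu> \<longrightarrow> J \<nu> = J' \<nu>)" if "\<nu> \<in> A.Tn" for \<nu>
  proof (cases "A.yng \<nu>")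
    case True
    then obtain i p where "\<nu> = (Young, i) # p" by (auto simp: A.yng_def)
    then show ?thesis using a[of p] that by (auto simp: A.Tn_Cons)
  next
    case False
    then show ?thesis using a[of \<nu>] A.Tn_not_young[OF that] by auto
  qed
  have "mm \<nu> = mm' \<nu>" for \<nu>
  proof (cases "\<nu> \<in> A.Tn")
    case True
    have "A.outdeg \<nu> = B.outdeg \<nu>"
      using A.located_outdeg[OF A True] B.located_outdeg[OF B] True T vJ[OF True] by simp
    then show ?thesis by (simp add: A.outdeg_def B.outdeg_def)
  next
    case False
    then show ?thesis using S T by (auto simp: structures_def)
  qed
  then have mm: "mm = mm'" by auto
  have "v = v'" using v vJ T by (intro PiE_ext[of v A.Tn "\<lambda>_. X" v']) auto
  moreover have "J = J'"
  proof (rule PiE_ext)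
    show "J \<in> (\<Pi>\<^sub>E \<nu>\<in>{\<nu>\<in>A.Tn. A.yng \<nu>}. {1..A.outdeg \<nu>})" using A by (simp add: A.located_def A.parent_edges_def)
    show "J' \<in> (\<Pi>\<^sub>E \<nu>\<in>{\<nu>\<in>A.Tn. A.yng \<nu>}. {1..A.outdeg \<nu>})"
      using B by (simp add: B.located_def B.parent_edges_def mm qq A.outdeg_def B.outdeg_def)
  qed (use vJ in auto)
  ultimately show ?thesis using mm qq by simp
qed

section \<open>Riemann sums\<close>

lemma AE_XU_component: "AE u in U01. Q u \<Longrightarrow> AE x in XU. Q (x \<nu>)"
  using AE_PiM_component[of UNIV "\<lambda>_. U01" \<nu> Q] prob_space_U01 by simp

text \<open>A resampled coordinate \<open>\<nu>\<close> hits the fixed value \<open>x \<nu>'\<close>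
  with probability \<open>0\<close>.\<close>

lemma AE_XU_neq: "\<nu> \<noteq> \<nu>' \<Longrightarrow> AE x in XU. x \<nu> \<noteq> x \<nu>'"
proof -
  assume ne: "\<nu> \<noteq> \<nu>'"
  have s: "{x. x \<nu> = x \<nu>'} \<in> sets XU"
    using borel_measurable_eq[OF XU_component[of \<nu>] XU_component[of \<nu>']] by simp
  have "emeasure XU {x. x \<nu> = x \<nu>'} = (\<integral>\<^sup>+x. indicator {x. x \<nu> = x \<nu>'} x \<partial>XU)"
    using s by simp
  also have "\<dots> = (\<integral>\<^sup>+x. \<integral>\<^sup>+u. indicator {x. x \<nu> = x \<nu>'} (x(\<nu> := u)) \<partial>U01 \<partial>XU)"
    using s by (intro nn_integral_PiM_resample prob_space_U01) simp
  also have "\<dots> = (\<integral>\<^sup>+x. 0 \<partial>XU)"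
  proof (intro nn_integral_cong)
    fix x
    have "(\<integral>\<^sup>+u. indicator {x. x \<nu> = x \<nu>'} (x(\<nu> := u)) \<partial>U01) = (\<integral>\<^sup>+u. indicator {x \<nu>'} u \<partial>U01)"
      using ne by (intro nn_integral_cong) (simp add: indicator_def)
    also have "\<dots> = (\<integral>\<^sup>+u. 0 \<partial>U01)"
      using AE_U01_neq[of "x \<nu>'"] by (intro nn_integral_cong_AE) (auto elim!: eventually_mono)
    finally show "(\<integral>\<^sup>+u. indicator {x. x \<nu> = x \<nu>'} (x(\<nu> := u)) \<partial>U01) = 0" by simp
  qed
  finally have "emeasure XU {x. x \<nu> = x \<nu>'} = 0" by simp
  then show ?thesis using s by (intro AE_I'[of "{x. x \<nu> = x \<nu>'}"]) auto
qed

lemma AE_XU_distinct: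
  assumes "finite N"
  shows "AE x in XU. (\<forall>\<nu>\<in>N. 0 < x \<nu> \<and> x \<nu> < 1) \<and> inj_on x N"
proof -
  have "AE x in XU. \<forall>\<nu>\<in>N. 0 < x \<nu> \<and> x \<nu> < 1"
    using assms by (intro AE_finite_allI AE_XU_component[OF AE_U01])
  moreover have "AE x in XU. \<forall>\<nu>\<in>N. \<forall>\<nu>'\<in>N. \<nu> \<noteq> \<nu>' \<longrightarrow> x \<nu> \<noteq> x \<nu>'"
    using assms AE_XU_neq by (intro AE_finite_allI) auto
  ultimately show ?thesis by eventually_elim (auto simp: inj_on_def)
qed

definition cell :: "nat \<Rightarrow> node set \<Rightarrow> (node \<Rightarrow> nat) \<Rightarrow> (node \<Rightarrow> real) set" where
  "cell n N v = {x. \<forall>\<nu>\<in>N. scaled n x \<nu> = v \<nu>}"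

lemma scaled_set: "{u. nat \<lceil>real n * u\<rceil> = j} \<in> sets borel"
proof -
  have "(\<lambda>u. nat \<lceil>real n * u\<rceil>) \<in> measurable borel (count_space UNIV)" by measurable
  then have "(\<lambda>u. nat \<lceil>real n * u\<rceil>) -` {j} \<inter> space borel \<in> sets borel" by (rule measurable_sets) simp
  then show ?thesis by (simp add: vimage_def)
qed

lemma cell_eq: "cell n N v = {x \<in> space XU. \<forall>\<nu>\<in>N. x \<nu> \<in> {u. nat \<lceil>real n * u\<rceil> = v \<nu>}}"
  by (simp add: cell_def scaled_def)

lemma cell_sets: "finite N \<Longrightarrow> cell n N v \<in> sets XU"
  unfolding cell_eq
proof (rule sets.sets_Collect_finite_All)
  fix \<nu>
  have "(\<lambda>x. x \<nu>) -` {u. nat \<lceil>real n * u\<rceil> = v \<nu>} \<inter> space XU \<in> sets XU"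
    using XU_component scaled_set by (rule measurable_sets)
  then show "{x \<in> space XU. x \<nu> \<in> {u. nat \<lceil>real n * u\<rceil> = v \<nu>}} \<in> sets XU"
    by (simp add: vimage_def)
qed

lemma emeasure_scaled_set:
  assumes n: "n > 0" and j: "j \<ge> 1"
  shows "emeasure U01 {u. nat \<lceil>real n * u\<rceil> = j} \<le> ennreal (1 / real n)"
proof -
  have "emeasure U01 {u. nat \<lceil>real n * u\<rceil> = j} = (\<integral>\<^sup>+u. indicator {u. nat \<lceil>real n * u\<rceil> = j} u \<partial>U01)"
    using scaled_set by simp
  also have "\<dots> = (\<integral>\<^sup>+u. indicator {u. nat \<lceil>real n * u\<rceil> = j} u * indicator {0..1} u \<partial>lborel)"
    using scaled_set by (intro nn_integral_U01) simp
  also have "\<dots> \<le> (\<integral>\<^sup>+u. indicator {(real j - 1) / real n .. real j / real n} u \<partial>lborel)"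
  proof (intro nn_integral_mono)
    fix u :: real
    have "u \<in> {(real j - 1) / real n .. real j / real n}" if "nat \<lceil>real n * u\<rceil> = j"
    proof -
      have "\<lceil>real n * u\<rceil> = int j" using that j by linarith
      then have "real j - 1 < real n * u" "real n * u \<le> real j" by linarith+
      then show ?thesis using n by (simp add: field_simps)
    qed
    then show "indicator {u. nat \<lceil>real n * u\<rceil> = j} u * indicator {0..1} u \<le> (indicator {(real j - 1) / real n .. real j / real n} u :: ennreal)"
      by (auto simp: indicator_def)
  qed
  also have "\<dots> = emeasure lborel {(real j - 1) / real n .. real j / real n}" by simp
  also have "\<dots> = ennreal (1 / real n)"
    using n by (subst emeasure_lborel_Icc) (auto simp: field_simps)
  finally show ?thesis .
qed

lemma emeasure_cell:
  assumes "finite N" "n > 0" "\<And>\<nu>. \<nu> \<in> N \<Longrightarrow> v \<nu> \<ge> 1"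
  shows "emeasure XU (cell n N v) \<le> ennreal ((1 / real n) ^ card N)"
proof -
  interpret product_prob_space "\<lambda>_::node. U01" UNIV
    by (intro product_prob_spaceI prob_space_U01)
  have "emeasure XU (cell n N v) = (\<Prod>\<nu>\<in>N. emeasure U01 {u. nat \<lceil>real n * u\<rceil> = v \<nu>})"
    unfolding cell_eq using assms(1) scaled_set by (intro emeasure_PiM_Collect) auto
  also have "\<dots> \<le> (\<Prod>\<nu>\<in>N. ennreal (1 / real n))"
    using assms(3) emeasure_scaled_set[OF assms(2)] by (intro prod_mono_ennreal) auto
  also have "\<dots> = ennreal ((1 / real n) ^ card N)"
    by (simp add: ennreal_power)
  finally show ?thesis .
qed

lemma (in pattern) occurs_cong:
  assumes "\<And>\<nu>. \<nu> \<in> N \<Longrightarrow> v \<nu> = v' \<nu>"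
  shows "occurs n v m H \<longleftrightarrow> occurs n v' m H"
proof -
  have 1: "v \<nu> = v' \<nu>" if "\<nu> \<in> I" for \<nu> using assms I that by auto
  have 2: "v (src c) = v' (src c)" if "c \<in> C" for c using assms src that by auto
  have "allowed v w j u \<longleftrightarrow> allowed v' w j u" for w j u
    unfolding allowed_def using 1 2 by (intro ball_cong refl) (simp cong: bex_cong)
  then show ?thesis unfolding occurs_def using assms by simp
qed

lemma (in pattern) placed_cong:
  assumes "\<And>\<nu>. \<nu> \<in> N \<Longrightarrow> v \<nu> = v' \<nu>"
  shows "placed n v \<longleftrightarrow> placed n v'"
proof -
  have 1: "v (tg c) = v' (tg c)" if "c \<in> C" for c using assms I tg that by (metis subsetD)
  have 2: "v (src c) = v' (src c)" if "c \<in> C" for c using assms src that by auto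
  have "inj_on v N \<longleftrightarrow> inj_on v' N" using assms by (rule inj_on_cong)
  moreover have "v ` N = v' ` N" using assms by (intro image_cong) auto
  ultimately show ?thesis unfolding placed_def using 1 2 by simp
qed

lemma (in tree_struct) increasing_cong:
  assumes "\<And>\<nu>. \<nu> \<in> Tn \<Longrightarrow> v \<nu> = v' \<nu>"
  shows "increasing v \<longleftrightarrow> increasing v'"
  unfolding increasing_def
proof (intro ball_cong refl all_cong1 imp_cong)
  fix \<nu> i j assume "\<nu> \<in> In" "i < j" "j < qq \<nu>"
  then have "v ((Young, i) # \<nu>) = v' ((Young, i) # \<nu>)" "v ((Young, j) # \<nu>) = v' ((Young, j) # \<nu>)"
    by (intro assms; simp add: Tn_Cons)+
  then show "v ((Young, i) # \<nu>) < v ((Young, j) # \<nu>) \<longleftrightarrow> v' ((Young, i) # \<nu>) < v' ((Young, j) # \<nu>)"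
    by simp
qed

context struct_pat
begin

lemma eventually_increasing:
  assumes x: "increasing x" and pos: "\<And>\<nu>. \<nu> \<in> Tn \<Longrightarrow> 0 < x \<nu>"
  shows "eventually (\<lambda>n. increasing (scaled n x)) sequentially"
proof -
  have "eventually (\<lambda>n. \<forall>\<nu>\<in>In. \<forall>i\<in>{..<qq \<nu>}. \<forall>j\<in>{..<qq \<nu>}. i < j \<longrightarrow> scaled n x ((Young, i) # \<nu>) < scaled n x ((Young, j) # \<nu>)) sequentially"
  proof (intro eventually_ball_finite finite_inner_nodes finite_lessThan ballI)
    fix \<nu> i j assume *: "\<nu> \<in> In" "i \<in> {..<qq \<nu>}" "j \<in> {..<qq \<nu>}"
    show "eventually (\<lambda>n. i < j \<longrightarrow> scaled n x ((Young, i) # \<nu>) < scaled n x ((Young, j) # \<nu>)) sequentially"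
    proof (cases "i < j")
      case True
      then have "x ((Young, i) # \<nu>) < x ((Young, j) # \<nu>)" using x * by (auto simp: increasing_def)
      moreover have "0 < x ((Young, i) # \<nu>)" using * by (intro pos) (simp add: Tn_Cons)
      ultimately show ?thesis using pat.eventually_scaled_less by (auto intro: eventually_mono)
    qed simp
  qed
  then show ?thesis by eventually_elim (auto simp: increasing_def)
qed

lemma pattern_density_measurable: "pat.pattern_density \<in> borel_measurable XU"
proof -
  have "(\<lambda>x. x \<nu> powr c) \<in> borel_measurable XU" for \<nu> c
    using XU_component[of \<nu>] by measurable
  then show ?thesis unfolding pat.pattern_density_def[abs_def]
    by (intro borel_measurable_times borel_measurable_const borel_measurable_prod borel_measurable_divide)
qed

lemma generic_increasing_measurable:
  "Measurable.pred XU (\<lambda>x. pat.generic x \<and> increasing x)"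
proof -
  have l: "Measurable.pred XU (\<lambda>x. x \<nu> < x \<nu>')" "Measurable.pred XU (\<lambda>x. x \<nu> = x \<nu>')"
     "Measurable.pred XU (\<lambda>x. 0 < x \<nu>)" "Measurable.pred XU (\<lambda>x. x \<nu> < 1)" for \<nu> \<nu>'
    using borel_measurable_less[OF XU_component[of \<nu>] XU_component[of \<nu>']]
      borel_measurable_eq[OF XU_component[of \<nu>] XU_component[of \<nu>']]
      borel_measurable_less[OF borel_measurable_const XU_component[of \<nu>]]
      borel_measurable_less[OF XU_component[of \<nu>] borel_measurable_const]
    by (simp_all add: pred_def)
  show ?thesis
    unfolding pat.generic_def increasing_def inj_on_def
    by (intro pred_intros_logic pred_intros_finite finite_tree_nodes finite_inner_nodes finite_Diff
        pred_intros_countable l) auto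
qed

definition weight :: "((node \<Rightarrow> real) \<Rightarrow> bool) \<Rightarrow> (node \<Rightarrow> real) \<Rightarrow> ennreal" where
  "weight b x = ennreal (pat.pattern_density x) * indicator {x. (pat.generic x \<and> increasing x) \<and> b x} x"

lemma weight_measurable:
  assumes "Measurable.pred XU b"
  shows "weight b \<in> borel_measurable XU"
proof -
  have "{x. (pat.generic x \<and> increasing x) \<and> b x} \<in> sets XU"
    using pred_intros_logic(3)[OF generic_increasing_measurable assms] by (simp add: pred_def)
  then show ?thesis
    unfolding weight_def[abs_def] using pattern_density_measurable by measurable
qed

end

section \<open>Pairs of tree patterns and Fatou's lemma\<close>

locale struct_pat_pair =
  A: struct_pat M \<delta> Q F md G0 k mm qq J + B: struct_pat M \<delta> Q F md G0 k mm' qq' J'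
  for M :: "nat pmf" and \<delta> :: real and Q :: "'v measure" and F :: "'v \<Rightarrow> real \<Rightarrow> real \<Rightarrow> real set"
    and md :: pa_model and G0 :: edges and k :: nat and mm qq J mm' qq' J' :: "node \<Rightarrow> nat"
begin

sublocale pr: pa_pat_pair M \<delta> md G0 A.Tn A.In "A.Tn - {[]}" A.t_src A.t_tg "A.t_ix J" A.outdeg
    B.Tn B.In "B.Tn - {[]}" B.t_src B.t_tg "B.t_ix J'" B.outdeg
  by (intro pa_pat_pair.intro A.pat.pa_pat_axioms B.pat.pa_pat_axioms)

definition pair_term :: "((node \<Rightarrow> real) \<Rightarrow> bool) \<Rightarrow> ((node \<Rightarrow> real) \<Rightarrow> bool) \<Rightarrow> nat \<Rightarrow> (node \<Rightarrow> nat) \<Rightarrow> (node \<Rightarrow> nat) \<Rightarrow> real" where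
  "pair_term b b' n v v' = (if pr.S.placed n (case_sum v v') \<and> A.increasing v \<and> B.increasing v' \<and>
     b (\<lambda>\<nu>. real (v \<nu>) / real n) \<and> b' (\<lambda>\<nu>. real (v' \<nu>) / real n) then pr.S.prob_occurs n (case_sum v v') else 0)"

lemma pair_term_nonneg: "0 \<le> pair_term b b' n v v'"
  by (simp add: pair_term_def pr.S.prob_occurs_def)

definition sites :: "nat \<Rightarrow> (node \<Rightarrow> nat) set" where "sites n = A.Tn \<rightarrow>\<^sub>E {1..n}"
definition sites' :: "nat \<Rightarrow> (node \<Rightarrow> nat) set" where "sites' n = B.Tn \<rightarrow>\<^sub>E {1..n}"

lemma finite_sites: "finite (sites n)" "finite (sites' n)"
  unfolding sites_def sites'_def by (intro finite_PiE finite_tree_nodes; simp)+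

definition n_edges :: nat where "n_edges = card ((A.Tn - {[]}) <+> (B.Tn - {[]}))"

lemma n_edges_eq: "card A.Tn + card B.Tn = n_edges + 2"
proof -
  have "card A.Tn = Suc (card (A.Tn - {[]}))" "card B.Tn = Suc (card (B.Tn - {[]}))"
    by (intro card.remove finite_tree_nodes A.root_Tn B.root_Tn)+
  moreover have "n_edges = card (A.Tn - {[]}) + card (B.Tn - {[]})"
    unfolding n_edges_def by (intro card_Plus finite_Diff finite_tree_nodes)
  ultimately show ?thesis by linarith
qed

text \<open>A function of the ages that is constant on products of cells of side
  \<open>1 / n\<close> and equals there the rescaled probability of the position, so that sums over
  positions become integrals.\<close>

definition step_fn :: "((node \<Rightarrow> real) \<Rightarrow> bool) \<Rightarrow> ((node \<Rightarrow> real) \<Rightarrow> bool) \<Rightarrow> nat \<Rightarrow> (node \<Rightarrow> real) \<Rightarrow> (node \<Rightarrow> real) \<Rightarrow> ennreal" where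
  "step_fn b b' n x y = (\<Sum>v\<in>sites n. \<Sum>v'\<in>sites' n.
     ennreal (real n ^ n_edges * pair_term b b' n v v') * indicator (cell n A.Tn v) x * indicator (cell n B.Tn v') y)"

lemma inner_integral:
  "(\<integral>\<^sup>+y. step_fn b b' n x y \<partial>XU) = (\<Sum>v\<in>sites n. \<Sum>v'\<in>sites' n.
     ennreal (real n ^ n_edges * pair_term b b' n v v') * indicator (cell n A.Tn v) x * emeasure XU (cell n B.Tn v'))"
proof -
  have [measurable]: "cell n B.Tn v' \<in> sets XU" for v' by (intro cell_sets finite_tree_nodes)
  show ?thesis
    unfolding step_fn_def by (simp add: nn_integral_sum nn_integral_cmult)
qed

text \<open>Two trees have two more nodes than edges. Cells have measure at most
  \<open>1 / n\<close> per node and probabilities are scaled by \<open>n\<close> per edge, which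
  leaves \<open>1 / n ^ 2\<close>.\<close>

lemma step_fn_integral:
  assumes n: "n > 0"
  shows "(\<integral>\<^sup>+x. \<integral>\<^sup>+y. step_fn b b' n x y \<partial>XU \<partial>XU) \<le>
    (\<Sum>v\<in>sites n. \<Sum>v'\<in>sites' n. ennreal (pair_term b b' n v v' / real n ^ 2))"
proof -
  have [measurable]: "cell n A.Tn v \<in> sets XU" for v by (intro cell_sets finite_tree_nodes)
  have "(\<integral>\<^sup>+x. \<integral>\<^sup>+y. step_fn b b' n x y \<partial>XU \<partial>XU) = (\<Sum>v\<in>sites n. \<Sum>v'\<in>sites' n.
     ennreal (real n ^ n_edges * pair_term b b' n v v') * emeasure XU (cell n A.Tn v) * emeasure XU (cell n B.Tn v'))"
    unfolding inner_integral by (simp add: nn_integral_sum nn_integral_cmult nn_integral_multc)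
  also have "\<dots> \<le> (\<Sum>v\<in>sites n. \<Sum>v'\<in>sites' n. ennreal (pair_term b b' n v v' / real n ^ 2))"
  proof (intro sum_mono)
    fix v v' assume v: "v \<in> sites n" "v' \<in> sites' n"
    have "ennreal (real n ^ n_edges * pair_term b b' n v v') * emeasure XU (cell n A.Tn v) * emeasure XU (cell n B.Tn v') \<le>
        ennreal (real n ^ n_edges * pair_term b b' n v v') * ennreal ((1 / real n) ^ card A.Tn) * ennreal ((1 / real n) ^ card B.Tn)"
    proof (intro mult_mono order_refl emeasure_cell finite_tree_nodes n)
      show "1 \<le> v \<nu>" if "\<nu> \<in> A.Tn" for \<nu> using v(1) that by (auto simp: sites_def PiE_iff)
      show "1 \<le> v' \<nu>" if "\<nu> \<in> B.Tn" for \<nu> using v(2) that by (auto simp: sites'_def PiE_iff)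
    qed auto
    also have "\<dots> = ennreal (real n ^ n_edges * pair_term b b' n v v' * (1 / real n) ^ card A.Tn * (1 / real n) ^ card B.Tn)"
      using pair_term_nonneg by (simp add: ennreal_mult'' ennreal_mult')
    also have "real n ^ n_edges * pair_term b b' n v v' * (1 / real n) ^ card A.Tn * (1 / real n) ^ card B.Tn =
        real n ^ n_edges * pair_term b b' n v v' * (1 / real n) ^ (n_edges + 2)"
      unfolding n_edges_eq[symmetric] by (simp add: power_add)
    also have "\<dots> = pair_term b b' n v v' / real n ^ 2"
      using n by (simp add: power_add field_simps power2_eq_square)
    finally show "ennreal (real n ^ n_edges * pair_term b b' n v v') * emeasure XU (cell n A.Tn v) * emeasure XU (cell n B.Tn v')
      \<le> ennreal (pair_term b b' n v v' / real n ^ 2)" .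
  qed
  finally show ?thesis .
qed

text \<open>For large \<open>n\<close> the pair \<open>(x, y)\<close> lies in the cell of the
  rounded positions, which by genericity are distinct and correctly ordered; this single term of the
  sum already has the required lower limit.\<close>

lemma weight_le_liminf:
  assumes x: "\<And>\<nu>. \<nu> \<in> A.Tn \<Longrightarrow> 0 < x \<nu> \<and> x \<nu> < 1" and y: "\<And>\<nu>. \<nu> \<in> B.Tn \<Longrightarrow> 0 < y \<nu> \<and> y \<nu> < 1"
    and xy: "\<And>\<nu> \<nu>'. \<nu> \<in> A.Tn \<Longrightarrow> \<nu>' \<in> B.Tn \<Longrightarrow> x \<nu> \<noteq> y \<nu>'"
    and b: "eventually (\<lambda>n. b (\<lambda>\<nu>. real (scaled n x \<nu>) / real n) \<longleftrightarrow> b x) sequentially"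
    and b': "eventually (\<lambda>n. b' (\<lambda>\<nu>. real (scaled n y \<nu>) / real n) \<longleftrightarrow> b' y) sequentially"
    and cong: "\<And>x y. \<forall>\<nu>\<in>A.Tn. x \<nu> = y \<nu> \<Longrightarrow> b x = b y" and cong': "\<And>x y. \<forall>\<nu>\<in>B.Tn. x \<nu> = y \<nu> \<Longrightarrow> b' x = b' y"
  shows "A.weight b x * B.weight b' y \<le> liminf (\<lambda>n. step_fn b b' n x y)"
proof (cases "A.pat.generic x \<and> A.increasing x \<and> b x \<and> B.pat.generic y \<and> B.increasing y \<and> b' y")
  case False
  then have *: "A.weight b x * B.weight b' y = 0" by (auto simp: A.weight_def B.weight_def)
  show ?thesis unfolding * by (rule zero_le)
next
  case True
  let ?z = "case_sum x y"
  have gen: "pr.S.generic ?z" using True xy by (intro pr.generic_Plus) auto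
  have sc: "scaled n ?z = case_sum (scaled n x) (scaled n y)" for n
    by (rule ext) (simp add: scaled_def split: sum.split)
  have "A.weight b x * B.weight b' y = ennreal (A.pat.pattern_density x) * ennreal (B.pat.pattern_density y)"
    using True by (simp add: A.weight_def B.weight_def)
  also have "\<dots> \<le> ennreal (pr.S.pattern_density ?z)"
    unfolding pr.pattern_density_Plus
    by (cases "0 \<le> A.pat.pattern_density x") (simp_all add: ennreal_mult' ennreal_neg)
  also have "\<dots> \<le> liminf (\<lambda>n. ennreal (real n ^ n_edges * pr.S.prob_occurs n (scaled n ?z)))"
    unfolding n_edges_def by (rule pr.S.pattern_density_le_liminf[OF gen])
  also have "\<dots> \<le> liminf (\<lambda>n. step_fn b b' n x y)"
  proof (rule Liminf_mono)
    have ev: "eventually (\<lambda>n. pr.S.placed n (scaled n ?z)) sequentially" "eventually (\<lambda>n. A.increasing (scaled n x)) sequentially"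
      "eventually (\<lambda>n. B.increasing (scaled n y)) sequentially"
      using True x y by (auto intro!: pr.S.eventually_placed gen A.eventually_increasing B.eventually_increasing)
    show "eventually (\<lambda>n. ennreal (real n ^ n_edges * pr.S.prob_occurs n (scaled n ?z)) \<le> step_fn b b' n x y) sequentially"
      using ev b b'
    proof eventually_elim
      case (elim n)
      \<comment> \<open>\<open>sites\<close> consists of extensional functions, so the rounded
        positions are restricted to the nodes.\<close>
      define v where "v = restrict (scaled n x) A.Tn"
      define v' where "v' = restrict (scaled n y) B.Tn"
      have veq: "v \<nu> = scaled n x \<nu>" if "\<nu> \<in> A.Tn" for \<nu> using that by (simp add: v_def)
      have veq': "v' \<nu> = scaled n y \<nu>" if "\<nu> \<in> B.Tn" for \<nu> using that by (simp add: v'_def)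
      have cs: "case_sum v v' \<nu> = scaled n ?z \<nu>" if "\<nu> \<in> A.Tn <+> B.Tn" for \<nu>
        using that veq veq' by (auto simp: sc)
      have rng: "case_sum (scaled n x) (scaled n y) ` (A.Tn <+> B.Tn) \<subseteq> {3..n}"
        using elim(1) unfolding sc pr.S.placed_def by blast
      have v: "v \<in> sites n"
        unfolding v_def sites_def using rng by (force simp: PiE_iff image_subset_iff)
      have v': "v' \<in> sites' n"
        unfolding v'_def sites'_def using rng by (force simp: PiE_iff image_subset_iff)
      have pl: "pr.S.placed n (case_sum v v')"
        using elim(1) pr.S.placed_cong[of "case_sum v v'" "scaled n ?z" n] cs by blast
      have po: "pr.S.prob_occurs n (case_sum v v') = pr.S.prob_occurs n (scaled n ?z)"
      proof -
        have "pr.S.occurs n (case_sum v v') = pr.S.occurs n (scaled n ?z)"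
          by (intro ext, rule pr.S.occurs_cong, rule cs)
        then show ?thesis unfolding pr.S.prob_occurs_def by (rule arg_cong)
      qed
      have "A.increasing v" "B.increasing v'"
        using elim(2,3) A.increasing_cong[of v "scaled n x"] B.increasing_cong[of v' "scaled n y"] veq veq' by blast+
      moreover have "b (\<lambda>\<nu>. real (v \<nu>) / real n)"
        using cong[of "\<lambda>\<nu>. real (v \<nu>) / real n" "\<lambda>\<nu>. real (scaled n x \<nu>) / real n"] veq elim(4) True by simp
      moreover have "b' (\<lambda>\<nu>. real (v' \<nu>) / real n)"
        using cong'[of "\<lambda>\<nu>. real (v' \<nu>) / real n" "\<lambda>\<nu>. real (scaled n y \<nu>) / real n"] veq' elim(5) True by simp
      ultimately have pt: "pair_term b b' n v v' = pr.S.prob_occurs n (scaled n ?z)"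
        using pl po by (simp add: pair_term_def)
      have c: "x \<in> cell n A.Tn v" "y \<in> cell n B.Tn v'" by (simp_all add: cell_def veq veq')
      have "ennreal (real n ^ n_edges * pr.S.prob_occurs n (scaled n ?z)) =
          ennreal (real n ^ n_edges * pair_term b b' n v v') * indicator (cell n A.Tn v) x * indicator (cell n B.Tn v') y"
        using c pt by simp
      also have "\<dots> \<le> (\<Sum>v'\<in>sites' n. ennreal (real n ^ n_edges * pair_term b b' n v v') * indicator (cell n A.Tn v) x * indicator (cell n B.Tn v') y)"
        using v' finite_sites by (intro member_le_sum) auto
      also have "\<dots> \<le> step_fn b b' n x y"
        unfolding step_fn_def
        by (rule member_le_sum[where f = "\<lambda>v. \<Sum>v'\<in>sites' n. ennreal (real n ^ n_edges * pair_term b b' n v v') * indicator (cell n A.Tn v) x * indicator (cell n B.Tn v') y"])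
          (use v finite_sites in auto)
      finally show ?case .
    qed
  qed
  finally show ?thesis .
qed

text \<open>Fatou's lemma, once for each tree, after the pointwise bound. Uniform ages almost surely
  differ, also between the two trees, so this bound holds almost everywhere.\<close>

theorem weights_le_liminf:
  assumes m: "Measurable.pred XU b" "Measurable.pred XU b'"
    and b: "AE x in XU. eventually (\<lambda>n. b (\<lambda>\<nu>. real (scaled n x \<nu>) / real n) \<longleftrightarrow> b x) sequentially"
    and b': "AE x in XU. eventually (\<lambda>n. b' (\<lambda>\<nu>. real (scaled n x \<nu>) / real n) \<longleftrightarrow> b' x) sequentially"
    and cong: "\<And>x y. \<forall>\<nu>\<in>A.Tn. x \<nu> = y \<nu> \<Longrightarrow> b x = b y" and cong': "\<And>x y. \<forall>\<nu>\<in>B.Tn. x \<nu> = y \<nu> \<Longrightarrow> b' x = b' y"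
  shows "(\<integral>\<^sup>+x. A.weight b x \<partial>XU) * (\<integral>\<^sup>+y. B.weight b' y \<partial>XU) \<le>
    liminf (\<lambda>n. \<Sum>v\<in>sites n. \<Sum>v'\<in>sites' n. ennreal (pair_term b b' n v v' / real n ^ 2))"
proof -
  have cs [measurable]: "cell n A.Tn v \<in> sets XU" "cell n B.Tn v \<in> sets XU" for n v by (intro cell_sets finite_tree_nodes)+
  have "(\<integral>\<^sup>+x. A.weight b x \<partial>XU) * (\<integral>\<^sup>+y. B.weight b' y \<partial>XU) = (\<integral>\<^sup>+x. \<integral>\<^sup>+y. A.weight b x * B.weight b' y \<partial>XU \<partial>XU)"
    using A.weight_measurable[OF m(1)] B.weight_measurable[OF m(2)] by (simp add: nn_integral_cmult nn_integral_multc)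
  also have "\<dots> \<le> (\<integral>\<^sup>+x. \<integral>\<^sup>+y. liminf (\<lambda>n. step_fn b b' n x y) \<partial>XU \<partial>XU)"
  proof (rule nn_integral_mono_AE)
    show "AE x in XU. (\<integral>\<^sup>+y. A.weight b x * B.weight b' y \<partial>XU) \<le> (\<integral>\<^sup>+y. liminf (\<lambda>n. step_fn b b' n x y) \<partial>XU)"
      using AE_XU_distinct[OF finite_tree_nodes, of k mm qq] b
    proof eventually_elim
      case (elim x)
      have "AE y in XU. \<forall>\<nu>\<in>A.Tn. \<forall>\<nu>'\<in>B.Tn. y \<nu>' \<noteq> x \<nu>"
        by (intro AE_finite_allI finite_tree_nodes AE_XU_component AE_U01_neq)
      note ne = this
      note x = \<open>(\<forall>\<nu>\<in>A.Tn. 0 < x \<nu> \<and> x \<nu> < 1) \<and> inj_on x A.Tn\<close>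
        \<open>\<forall>\<^sub>F n in sequentially. b (\<lambda>\<nu>. real (scaled n x \<nu>) / real n) = b x\<close>
      have "AE y in XU. A.weight b x * B.weight b' y \<le> liminf (\<lambda>n. step_fn b b' n x y)"
        using AE_XU_distinct[OF finite_tree_nodes, of k mm' qq'] b' ne
      proof eventually_elim
        case (elim y)
        show ?case
        proof (rule weight_le_liminf)
          show "x \<nu> \<noteq> y \<nu>'" if "\<nu> \<in> A.Tn" "\<nu>' \<in> B.Tn" for \<nu> \<nu>' using elim(3) that by metis
        qed (use elim(1,2) x cong cong' in blast)+
      qed
      then show ?case by (rule nn_integral_mono_AE)
    qed
  qed
  also have "\<dots> \<le> (\<integral>\<^sup>+x. liminf (\<lambda>n. \<integral>\<^sup>+y. step_fn b b' n x y \<partial>XU) \<partial>XU)"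
    by (intro nn_integral_mono nn_integral_liminf) (simp add: step_fn_def)
  also have "\<dots> \<le> liminf (\<lambda>n. \<integral>\<^sup>+x. \<integral>\<^sup>+y. step_fn b b' n x y \<partial>XU \<partial>XU)"
    by (intro nn_integral_liminf) (simp add: inner_integral)
  also have "\<dots> \<le> liminf (\<lambda>n. \<Sum>v\<in>sites n. \<Sum>v'\<in>sites' n. ennreal (pair_term b b' n v v' / real n ^ 2))"
    by (intro Liminf_mono eventually_mono[OF eventually_gt_at_top[of 0]] step_fn_integral)
  finally show ?thesis .
qed

lemma located_if_occurs:
  assumes "A.pat.placed n v" "A.increasing v" "A.pat.occurs n v m H"
  shows "A.located n m H J v"
  using assms A.J unfolding A.located_def A.pat.placed_def A.pat.occurs_def A.pat.allowed_def by blast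

lemma located_if_occurs':
  assumes "B.pat.placed n v" "B.increasing v" "B.pat.occurs n v m H"
  shows "B.located n m H J' v"
  using assms B.J unfolding B.located_def B.pat.placed_def B.pat.occurs_def B.pat.allowed_def by blast

lemma pair_term_le:
  "ennreal (pair_term b b' n v v') \<le> (\<integral>\<^sup>+z. of_bool (A.located n (fst z) (snd z) J v \<and> b (\<lambda>\<nu>. real (v \<nu>) / real n)) *
     of_bool (B.located n (fst z) (snd z) J' v' \<and> b' (\<lambda>\<nu>. real (v' \<nu>) / real n)) \<partial>A.pat.joint n)"
proof (cases "pr.S.placed n (case_sum v v') \<and> A.increasing v \<and> B.increasing v' \<and>
     b (\<lambda>\<nu>. real (v \<nu>) / real n) \<and> b' (\<lambda>\<nu>. real (v' \<nu>) / real n)")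
  case True
  then have S: "pr.S.placed n (case_sum v v')" by blast
  have inj: "inj_on (case_sum v v') (A.Tn <+> B.Tn)" and rng: "case_sum v v' ` (A.Tn <+> B.Tn) \<subseteq> {3..n}"
    and ord: "\<And>c. c \<in> (A.Tn - {[]}) <+> (B.Tn - {[]}) \<Longrightarrow> case_sum v v' (map_sum A.t_tg B.t_tg c) < case_sum v v' (map_sum A.t_src B.t_src c)"
    using S unfolding pr.S.placed_def by blast+
  have pA: "A.pat.placed n v"
    unfolding A.pat.placed_def
  proof (intro conjI ballI)
    show "inj_on v A.Tn" using inj_onD[OF inj, of "Inl _" "Inl _"] by (auto intro!: inj_onI)
    show "v ` A.Tn \<subseteq> {3..n}" using rng by force
    show "v (A.t_tg c) < v (A.t_src c)" if "c \<in> A.Tn - {[]}" for c using ord[of "Inl c"] that by auto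
  qed
  have pB: "B.pat.placed n v'"
    unfolding B.pat.placed_def
  proof (intro conjI ballI)
    show "inj_on v' B.Tn" using inj_onD[OF inj, of "Inr _" "Inr _"] by (auto intro!: inj_onI)
    show "v' ` B.Tn \<subseteq> {3..n}" using rng by force
    show "v' (B.t_tg c) < v' (B.t_src c)" if "c \<in> B.Tn - {[]}" for c using ord[of "Inr c"] that by auto
  qed
  have "ennreal (pair_term b b' n v v') = (\<integral>\<^sup>+z. indicator {(m, H). pr.S.occurs n (case_sum v v') m H} z \<partial>pr.S.joint n)"
    using True by (simp add: pair_term_def pr.S.prob_occurs_def measure_pmf.emeasure_eq_measure)
  also have "\<dots> \<le>
     (\<integral>\<^sup>+z. of_bool (A.located n (fst z) (snd z) J v \<and> b (\<lambda>\<nu>. real (v \<nu>) / real n)) *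
     of_bool (B.located n (fst z) (snd z) J' v' \<and> b' (\<lambda>\<nu>. real (v' \<nu>) / real n)) \<partial>A.pat.joint n)"
  proof (intro nn_integral_mono)
    fix z
    have "A.located n (fst z) (snd z) J v" "B.located n (fst z) (snd z) J' v'" if "pr.S.occurs n (case_sum v v') (fst z) (snd z)"
      using pr.occurs_Plus[OF S that] True located_if_occurs[OF pA] located_if_occurs'[OF pB] by blast+
    then show "indicator {(m, H). pr.S.occurs n (case_sum v v') m H} z \<le>
      (of_bool (A.located n (fst z) (snd z) J v \<and> b (\<lambda>\<nu>. real (v \<nu>) / real n)) *
       of_bool (B.located n (fst z) (snd z) J' v' \<and> b' (\<lambda>\<nu>. real (v' \<nu>) / real n)) :: ennreal)"
      using True by (auto simp: indicator_def split_beta)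
  qed
  finally show ?thesis .
next
  case False
  then have "pair_term b b' n v v' = 0" unfolding pair_term_def by (rule if_not_P)
  then show ?thesis by simp
qed

end

section \<open>Second moments\<close>

text \<open>Fatou's lemma for the counting measure.\<close>

lemma sum_liminf_le:
  fixes f :: "nat \<Rightarrow> 'a \<Rightarrow> ennreal"
  assumes "finite A"
  shows "(\<Sum>a\<in>A. liminf (\<lambda>n. f n a)) \<le> liminf (\<lambda>n. \<Sum>a\<in>A. f n a)"
proof -
  have "(\<integral>\<^sup>+a. liminf (\<lambda>n. f n a) \<partial>count_space A) \<le> liminf (\<lambda>n. \<integral>\<^sup>+a. f n a \<partial>count_space A)"
    by (intro nn_integral_liminf) simp
  then show ?thesis using assms by (simp add: nn_integral_count_space_finite)
qed

context pa_rppt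
begin

abbreviation joint :: "nat \<Rightarrow> ((nat \<Rightarrow> nat) \<times> (nat \<Rightarrow> nat \<Rightarrow> nat)) pmf" where
  "joint \<equiv> pa_pat.joint M \<delta> md G0"

abbreviation pe :: "nat \<Rightarrow> (node \<Rightarrow> nat) \<times> (node \<Rightarrow> nat) \<Rightarrow> (node \<Rightarrow> nat) set" where
  "pe k t \<equiv> tree_struct.parent_edges k (fst t) (snd t)"

lemma parent_edges_nonempty: "pe k t \<noteq> {}"
proof -
  interpret tree_struct k "fst t" "snd t" .
  show ?thesis by (auto simp: parent_edges_def PiE_eq_empty_iff outdeg_def)
qed

lemma struct_patI: "J \<in> pe k t \<Longrightarrow> struct_pat M \<delta> Q F G0 k (fst t) (snd t) J"
  by (intro struct_pat.intro pa_rppt_axioms struct_pat_axioms.intro)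

context
  fixes r :: real and h :: "nat rooted"
  assumes r: "r > 0" and h: "snd h \<in> verts (fst h)"
begin

abbreviation "K \<equiv> inner_radius r"

definition sees :: "bool \<Rightarrow> (node \<Rightarrow> nat) \<times> (node \<Rightarrow> nat) \<Rightarrow> (node \<Rightarrow> real) \<Rightarrow> bool" where
  "sees \<beta> t x \<longleftrightarrow> tree_looks_like r h (inner_nodes K (fst t) (snd t)) x = \<beta>"

lemma root_inner: "[] \<in> inner_nodes K (fst t) (snd t)"
  by (simp add: inner_nodes_def)

lemma sees_measurable: "Measurable.pred XU (sees \<beta> t)"
proof -
  have "Measurable.pred XU (tree_looks_like r h (inner_nodes K (fst t) (snd t)))"
    by (intro tree_looks_like_measurable finite_inner_nodes root_inner)
  then show ?thesis unfolding sees_def[abs_def] by measurable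
qed

lemma sees_cong: "\<forall>\<nu>\<in>tree_nodes K (fst t) (snd t). x \<nu> = y \<nu> \<Longrightarrow> sees \<beta> t x = sees \<beta> t y"
  unfolding sees_def by (subst tree_looks_like_cong[where y = y]) (auto simp: tree_nodes_def)

text \<open>Only two ages lie at distance exactly \<open>1 / r\<close> from a given mark, and
  \<open>h\<close> has countably many vertices, so almost every age profile avoids the
  boundary.\<close>

lemma AE_eventually_sees:
  "AE x in XU. eventually (\<lambda>n. sees \<beta> t (\<lambda>\<nu>. real (scaled n x \<nu>) / real n) \<longleftrightarrow> sees \<beta> t x) sequentially"
proof -
  let ?I = "inner_nodes K (fst t) (snd t)"
  have "AE u in U01. \<bar>u - c\<bar> \<noteq> 1 / r" for c
    using AE_U01_neq[of "c + 1 / r"] AE_U01_neq[of "c - 1 / r"] by eventually_elim auto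
  then have "AE x in XU. \<forall>a\<in>?I. \<forall>v::nat. \<bar>x a - mark (fst h) v\<bar> \<noteq> 1 / r"
    by (intro AE_finite_allI finite_inner_nodes AE_all_countable[THEN iffD2] allI AE_XU_component)
  then show ?thesis
    using AE_XU_distinct[OF finite_inner_nodes, of K "fst t" "snd t"]
  proof eventually_elim
    case (elim x)
    have "eventually (\<lambda>n. tree_looks_like r h ?I (\<lambda>\<nu>. real (scaled n x \<nu>) / real n) \<longleftrightarrow> tree_looks_like r h ?I x) sequentially"
      using elim by (intro eventually_tree_looks_like_iff r finite_inner_nodes root_inner scaled_tendsto) auto
    then show ?case by eventually_elim (simp add: sees_def)
  qed
qed

definition wt :: "bool \<Rightarrow> (node \<Rightarrow> nat) \<times> (node \<Rightarrow> nat) \<Rightarrow> ennreal" where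
  "wt \<beta> t = (\<integral>\<^sup>+x. struct_pat.weight M \<delta> K (fst t) (snd t) (sees \<beta> t) x \<partial>XU)"

definition tree_event :: "bool \<Rightarrow> (node \<Rightarrow> nat) \<times> (node \<Rightarrow> nat) \<Rightarrow> 'v sample set" where
  "tree_event \<beta> t = {w \<in> space P. has_struct K t w \<and> looks_like r (rppt \<kappa> F w) h = \<beta>}"

lemma tree_event_eq: "tree_event \<beta> t = {w \<in> space P. has_struct K t w \<and> sees \<beta> t (ag w)}"
  unfolding tree_event_def sees_def using looks_like_rppt[OF r h] by blast

lemma tree_event_sets: "tree_event \<beta> t \<in> sets P"
proof -
  have "Measurable.pred P (\<lambda>w. sees \<beta> t (ag w))"
    by (rule measurable_compose[OF ag_measurable sees_measurable])
  then have "Measurable.pred P (\<lambda>w. has_struct K t w \<and> sees \<beta> t (ag w))"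
    using has_struct_measurable by (rule pred_intros_logic(3)[rotated])
  then show ?thesis unfolding tree_event_eq by (simp add: pred_def)
qed

text \<open>The joint density of the ages followed by the comparison of densities; the factor counts
  the possible edges to the parents of the young nodes.\<close>

lemma emeasure_tree_event_le: "emeasure P (tree_event \<beta> t) \<le> of_nat (card (pe K t)) * wt \<beta> t"
proof -
  obtain J where J: "J \<in> pe K t" using parent_edges_nonempty by blast
  interpret S: struct_pat M \<delta> Q F md G0 K "fst t" "snd t" J using J by (rule struct_patI)
  let ?H = "\<lambda>x. indicator {x. sees \<beta> t x} x :: ennreal"
  have Hm: "?H \<in> borel_measurable XU"
    using sees_measurable by (intro borel_measurable_indicator) (simp add: pred_def)
  have "emeasure P (tree_event \<beta> t) = (\<integral>\<^sup>+w. indicator (tree_event \<beta> t) w \<partial>P)"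
    using tree_event_sets by simp
  also have "\<dots> = (\<integral>\<^sup>+w. (\<Prod>\<nu>\<in>S.Tn. indicator {w. struct_at (fst t) (snd t) S.In \<nu> w} w) * ?H (ag w) \<partial>P)"
  proof (intro nn_integral_cong)
    fix w assume w: "w \<in> space P"
    have "(\<Prod>\<nu>\<in>S.Tn. indicator {w. struct_at (fst t) (snd t) S.In \<nu> w} w) = (of_bool (has_struct K t w) :: ennreal)"
      using finite_tree_nodes by (auto simp: has_struct_def indicator_def prod_zero_iff)
    then show "indicator (tree_event \<beta> t) w = (\<Prod>\<nu>\<in>S.Tn. indicator {w. struct_at (fst t) (snd t) S.In \<nu> w} w) * ?H (ag w)"
      using w by (auto simp: tree_event_eq indicator_def)
  qed
  also have "\<dots> \<le> (\<integral>\<^sup>+x. tree_density (fst t) (snd t) S.In S.Tn x * ?H x \<partial>XU)"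
  proof (rule nn_integral_ages_le[OF S.admissible_Tn Hm])
    fix x y :: "node \<Rightarrow> real" assume "\<And>\<nu>. \<nu> \<in> with_young (snd t) S.In S.Tn \<Longrightarrow> x \<nu> = y \<nu>"
    then have "\<forall>\<nu>\<in>S.Tn. x \<nu> = y \<nu>" unfolding S.with_young_Tn by blast
    then show "?H x = ?H y" using sees_cong[of t x y \<beta>] by (simp add: indicator_def)
  qed
  also have "\<dots> \<le> (\<integral>\<^sup>+x. of_nat (card (pe K t)) * S.weight (sees \<beta> t) x \<partial>XU)"
  proof (rule nn_integral_mono_AE)
    show "AE x in XU. tree_density (fst t) (snd t) S.In S.Tn x * ?H x \<le> of_nat (card (pe K t)) * S.weight (sees \<beta> t) x"
      using AE_XU_distinct[OF finite_tree_nodes, of K "fst t" "snd t"]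
    proof eventually_elim
      case (elim x)
      have "tree_density (fst t) (snd t) S.In S.Tn x \<le>
         of_nat (card (pe K t)) * ennreal (S.pat.pattern_density x) * indicator {x. S.pat.generic x \<and> S.increasing x} x"
        using elim by (intro S.tree_density_le) auto
      then have "tree_density (fst t) (snd t) S.In S.Tn x * ?H x \<le>
         of_nat (card (pe K t)) * ennreal (S.pat.pattern_density x) * indicator {x. S.pat.generic x \<and> S.increasing x} x * ?H x"
        by (intro mult_right_mono) auto
      also have "\<dots> = of_nat (card (pe K t)) * S.weight (sees \<beta> t) x"
        by (auto simp: S.weight_def indicator_def)
      finally show ?case .
    qed
  qed
  also have "\<dots> = of_nat (card (pe K t)) * wt \<beta> t"
    unfolding wt_def using S.weight_measurable[OF sees_measurable] by (intro nn_integral_cmult)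
  finally show ?thesis .
qed

definition n_like :: "bool \<Rightarrow> nat \<Rightarrow> (nat \<Rightarrow> nat) \<times> (nat \<Rightarrow> nat \<Rightarrow> nat) \<Rightarrow> nat" where
  "n_like \<beta> n z = card {v\<in>{1..n}. looks_like r (marked_graph n (edges_of G0 (fst z) (Suc n) 0 (snd z)), v) h = \<beta>}"

definition fits :: "bool \<Rightarrow> nat \<Rightarrow> (nat \<Rightarrow> nat) \<times> (nat \<Rightarrow> nat \<Rightarrow> nat) \<Rightarrow>
    ((node \<Rightarrow> nat) \<times> (node \<Rightarrow> nat)) \<times> (node \<Rightarrow> nat) \<Rightarrow> (node \<Rightarrow> nat) \<Rightarrow> bool" where
  "fits \<beta> n z tJ v \<longleftrightarrow> tree_struct.located K (fst (fst tJ)) (snd (fst tJ)) n (fst z) (snd z) (snd tJ) v \<and>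
     sees \<beta> (fst tJ) (\<lambda>\<nu>. real (v \<nu>) / real n)"

definition places :: "nat \<Rightarrow> ((node \<Rightarrow> nat) \<times> (node \<Rightarrow> nat)) \<times> (node \<Rightarrow> nat) \<Rightarrow> (node \<Rightarrow> nat) set" where
  "places n tJ = tree_nodes K (fst (fst tJ)) (snd (fst tJ)) \<rightarrow>\<^sub>E {1..n}"

lemma finite_places: "finite (places n tJ)"
  unfolding places_def by (intro finite_PiE finite_tree_nodes) simp

lemma finite_pe: "finite (pe k t)"
  by (rule tree_struct.finite_parent_edges)

text \<open>Sending an embedded tree to its root vertex is injective by
  \<open>located_unique\<close>, and by \<open>looks_like_located\<close> this vertex is counted on
  the right.\<close>

lemma fits_le_n_like:
  assumes T: "finite T" "T \<subseteq> structures K"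
  shows "(\<Sum>tJ\<in>Sigma T (pe K). \<Sum>v\<in>places n tJ. of_bool (fits \<beta> n z tJ v)) \<le> n_like \<beta> n z"
proof -
  let ?Z = "Sigma (Sigma T (pe K)) (places n)"
  have fin: "finite (Sigma T (pe K))" using T finite_pe by auto
  have finZ: "finite ?Z" using fin finite_places by auto
  have "(\<Sum>tJ\<in>Sigma T (pe K). \<Sum>v\<in>places n tJ. of_bool (fits \<beta> n z tJ v)) = (\<Sum>(tJ, v)\<in>?Z. of_bool (fits \<beta> n z tJ v) :: nat)"
    using fin finite_places by (intro sum.Sigma) auto
  also have "\<dots> = card {y\<in>?Z. fits \<beta> n z (fst y) (snd y)}"
    using finZ by (simp add: split_beta sum_of_bool_eq Int_def)
  also have "\<dots> \<le> n_like \<beta> n z"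
    unfolding n_like_def
  proof (rule card_inj_on_le)
    show "inj_on (\<lambda>y. snd y []) {y\<in>?Z. fits \<beta> n z (fst y) (snd y)}"
    proof (rule inj_onI)
      fix y y' assume y: "y \<in> {y\<in>?Z. fits \<beta> n z (fst y) (snd y)}" and y': "y' \<in> {y\<in>?Z. fits \<beta> n z (fst y) (snd y)}"
        and eq: "snd y [] = snd y' []"
      obtain mm qq J v where a: "y = (((mm, qq), J), v)" by (metis prod.collapse)
      obtain mm' qq' J' v' where b: "y' = (((mm', qq'), J'), v')" by (metis prod.collapse)
      have "mm = mm' \<and> qq = qq' \<and> J = J' \<and> v = v'"
      proof (rule located_unique)
        show "tree_struct.located K mm qq n (fst z) (snd z) J v" using y a by (simp add: fits_def)
        show "tree_struct.located K mm' qq' n (fst z) (snd z) J' v'" using y' b by (simp add: fits_def)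
        show "(mm, qq) \<in> structures K" "(mm', qq') \<in> structures K" using y y' a b T(2) by auto
        show "v \<in> tree_nodes K mm qq \<rightarrow>\<^sub>E {1..n}" "v' \<in> tree_nodes K mm' qq' \<rightarrow>\<^sub>E {1..n}"
          using y y' a b by (simp_all add: places_def)
        show "v [] = v' []" using eq a b by simp
      qed
      then show "y = y'" using a b by simp
    qed
    show "(\<lambda>y. snd y []) ` {y\<in>?Z. fits \<beta> n z (fst y) (snd y)} \<subseteq>
        {v\<in>{1..n}. looks_like r (marked_graph n (edges_of G0 (fst z) (Suc n) 0 (snd z)), v) h = \<beta>}"
    proof
      fix u assume "u \<in> (\<lambda>y. snd y []) ` {y\<in>?Z. fits \<beta> n z (fst y) (snd y)}"
      then obtain t J v where y: "((t, J), v) \<in> ?Z" "fits \<beta> n z (t, J) v" "u = v []" by auto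
      interpret tree_struct K "fst t" "snd t" .
      have loc: "located n (fst z) (snd z) J v" and s: "sees \<beta> t (\<lambda>\<nu>. real (v \<nu>) / real n)"
        using y(2) by (simp_all add: fits_def)
      have "looks_like r (marked_graph n (edges_of G0 (fst z) (Suc n) 0 (snd z)), v []) h = \<beta>"
        using looks_like_located[OF loc G0 r refl h] s by (simp add: sees_def)
      moreover have "v [] \<in> {1..n}" using located_range[OF loc root_Tn] by auto
      ultimately show "u \<in> {v\<in>{1..n}. looks_like r (marked_graph n (edges_of G0 (fst z) (Suc n) 0 (snd z)), v) h = \<beta>}"
        using y(3) by simp
    qed
  qed auto
  finally show ?thesis .
qed

definition pair_sum :: "bool \<Rightarrow> bool \<Rightarrow> nat \<Rightarrow> ((node \<Rightarrow> nat) \<times> (node \<Rightarrow> nat)) \<times> (node \<Rightarrow> nat) \<Rightarrow>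
    ((node \<Rightarrow> nat) \<times> (node \<Rightarrow> nat)) \<times> (node \<Rightarrow> nat) \<Rightarrow> ennreal" where
  "pair_sum \<beta> \<beta>' n a a' = (\<Sum>v\<in>places n a. \<Sum>v'\<in>places n a'.
     \<integral>\<^sup>+z. of_bool (fits \<beta> n z a v) * of_bool (fits \<beta>' n z a' v') \<partial>joint n)"

lemma wt_le_liminf_pair_sum:
  assumes "J \<in> pe K t" "J' \<in> pe K t'"
  shows "wt \<beta> t * wt \<beta>' t' \<le> liminf (\<lambda>n. pair_sum \<beta> \<beta>' n (t, J) (t', J') * ennreal (1 / real n ^ 2))"
proof -
  interpret S: struct_pat_pair M \<delta> Q F md G0 K "fst t" "snd t" J "fst t'" "snd t'" J'
    using assms by (intro struct_pat_pair.intro struct_patI)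
  have "wt \<beta> t * wt \<beta>' t' \<le> liminf (\<lambda>n. \<Sum>v\<in>S.sites n. \<Sum>v'\<in>S.sites' n. ennreal (S.pair_term (sees \<beta> t) (sees \<beta>' t') n v v' / real n ^ 2))"
    unfolding wt_def by (intro S.weights_le_liminf sees_measurable AE_eventually_sees sees_cong)
  also have "\<dots> \<le> liminf (\<lambda>n. pair_sum \<beta> \<beta>' n (t, J) (t', J') * ennreal (1 / real n ^ 2))"
  proof (intro Liminf_mono always_eventually allI)
    fix n
    have "ennreal (S.pair_term (sees \<beta> t) (sees \<beta>' t') n v v' / real n ^ 2) \<le>
       (\<integral>\<^sup>+z. of_bool (fits \<beta> n z (t, J) v) * of_bool (fits \<beta>' n z (t', J') v') \<partial>joint n) * ennreal (1 / real n ^ 2)" for v v'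
    proof -
      have "ennreal (S.pair_term (sees \<beta> t) (sees \<beta>' t') n v v' / real n ^ 2) =
          ennreal (S.pair_term (sees \<beta> t) (sees \<beta>' t') n v v') * ennreal (1 / real n ^ 2)"
        by (subst ennreal_mult''[symmetric]) auto
      also have "\<dots> \<le> (\<integral>\<^sup>+z. of_bool (fits \<beta> n z (t, J) v) * of_bool (fits \<beta>' n z (t', J') v') \<partial>joint n) * ennreal (1 / real n ^ 2)"
        using S.pair_term_le by (intro mult_right_mono) (simp_all add: fits_def)
      finally show ?thesis .
    qed
    then show "(\<Sum>v\<in>S.sites n. \<Sum>v'\<in>S.sites' n. ennreal (S.pair_term (sees \<beta> t) (sees \<beta>' t') n v v' / real n ^ 2)) \<le>
       pair_sum \<beta> \<beta>' n (t, J) (t', J') * ennreal (1 / real n ^ 2)"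
      unfolding pair_sum_def sum_distrib_right S.sites_def S.sites'_def places_def fst_conv snd_conv
      by (intro sum_mono)
  qed
  finally show ?thesis .
qed

definition second_moment :: "bool \<Rightarrow> bool \<Rightarrow> nat \<Rightarrow> ennreal" where
  "second_moment \<beta> \<beta>' n = (\<integral>\<^sup>+z. of_nat (n_like \<beta> n z) * of_nat (n_like \<beta>' n z) \<partial>joint n) * ennreal (1 / real n ^ 2)"

text \<open>Lower limits are superadditive over finitely many structures. The sums over pairs of
  trees combine into a product of two counts, each at most \<open>n_like\<close>.\<close>

lemma wt_sums_le_liminf:
  assumes T: "finite T" "T \<subseteq> structures K"
  shows "(\<Sum>t\<in>T. of_nat (card (pe K t)) * wt \<beta> t) * (\<Sum>t\<in>T. of_nat (card (pe K t)) * wt \<beta>' t) \<le>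
    liminf (second_moment \<beta> \<beta>')"
proof -
  let ?Z = "Sigma T (pe K)"
  have fin: "finite ?Z" using T finite_pe by auto
  have Z: "(\<Sum>t\<in>T. of_nat (card (pe K t)) * wt \<beta> t) = (\<Sum>a\<in>?Z. wt \<beta> (fst a))" for \<beta>
  proof -
    have "(\<Sum>a\<in>?Z. wt \<beta> (fst a)) = (\<Sum>t\<in>T. \<Sum>J\<in>pe K t. wt \<beta> t)"
      using T finite_pe by (subst sum.Sigma) (auto simp: split_beta)
    then show ?thesis by simp
  qed
  have "(\<Sum>a\<in>?Z. wt \<beta> (fst a)) * (\<Sum>a\<in>?Z. wt \<beta>' (fst a)) = (\<Sum>a\<in>?Z. \<Sum>a'\<in>?Z. wt \<beta> (fst a) * wt \<beta>' (fst a'))"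
    by (rule sum_product)
  also have "\<dots> \<le> (\<Sum>a\<in>?Z. \<Sum>a'\<in>?Z. liminf (\<lambda>n. pair_sum \<beta> \<beta>' n a a' * ennreal (1 / real n ^ 2)))"
  proof (intro sum_mono)
    fix a a' assume "a \<in> ?Z" "a' \<in> ?Z"
    then show "wt \<beta> (fst a) * wt \<beta>' (fst a') \<le> liminf (\<lambda>n. pair_sum \<beta> \<beta>' n a a' * ennreal (1 / real n ^ 2))"
      using wt_le_liminf_pair_sum[of "snd a" "fst a" "snd a'" "fst a'" \<beta> \<beta>'] by auto
  qed
  also have "\<dots> \<le> (\<Sum>a\<in>?Z. liminf (\<lambda>n. \<Sum>a'\<in>?Z. pair_sum \<beta> \<beta>' n a a' * ennreal (1 / real n ^ 2)))"
    by (intro sum_mono sum_liminf_le fin)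
  also have "\<dots> \<le> liminf (\<lambda>n. \<Sum>a\<in>?Z. \<Sum>a'\<in>?Z. pair_sum \<beta> \<beta>' n a a' * ennreal (1 / real n ^ 2))"
    by (intro sum_liminf_le fin)
  also have "\<dots> \<le> liminf (second_moment \<beta> \<beta>')"
  proof (intro Liminf_mono always_eventually allI)
    fix n
    define N where "N \<beta> z = (\<Sum>a\<in>?Z. \<Sum>v\<in>places n a. of_bool (fits \<beta> n z a v) :: ennreal)" for \<beta> z
    have N: "N \<beta> z \<le> of_nat (n_like \<beta> n z)" for \<beta> z
    proof -
      have "N \<beta> z = of_nat (\<Sum>a\<in>?Z. \<Sum>v\<in>places n a. of_bool (fits \<beta> n z a v))"
        by (simp add: N_def)
      also have "\<dots> \<le> of_nat (n_like \<beta> n z)"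
        using fits_le_n_like[OF T] by (rule of_nat_mono)
      finally show ?thesis .
    qed
    have "(\<Sum>a\<in>?Z. \<Sum>a'\<in>?Z. pair_sum \<beta> \<beta>' n a a') =
      (\<integral>\<^sup>+z. (\<Sum>a\<in>?Z. \<Sum>a'\<in>?Z. \<Sum>v\<in>places n a. \<Sum>v'\<in>places n a'. of_bool (fits \<beta> n z a v) * of_bool (fits \<beta>' n z a' v')) \<partial>joint n)"
      unfolding pair_sum_def by (simp add: nn_integral_sum)
    also have "\<dots> = (\<integral>\<^sup>+z. N \<beta> z * N \<beta>' z \<partial>joint n)"
      by (simp only: N_def sum_product)
    also have "\<dots> \<le> (\<integral>\<^sup>+z. of_nat (n_like \<beta> n z) * of_nat (n_like \<beta>' n z) \<partial>joint n)"
      by (intro nn_integral_mono mult_mono N) auto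
    finally show "(\<Sum>a\<in>?Z. \<Sum>a'\<in>?Z. pair_sum \<beta> \<beta>' n a a' * ennreal (1 / real n ^ 2)) \<le> second_moment \<beta> \<beta>' n"
      unfolding second_moment_def sum_distrib_right[symmetric] by (rule mult_right_mono) simp
  qed
  finally show ?thesis unfolding Z .
qed

section \<open>Passing to all structures of the tree\<close>

definition like_prob :: "bool \<Rightarrow> real" where
  "like_prob \<beta> = measure P {w \<in> space P. looks_like r (rppt \<kappa> F w) h = \<beta>}"

lemma like_event_eq: "{w \<in> space P. looks_like r (rppt \<kappa> F w) h = \<beta>} = (\<Union>t\<in>structures K. tree_event \<beta> t)"
  unfolding tree_event_def using ex_has_struct[of K] by blast

lemma like_event_sets: "{w \<in> space P. looks_like r (rppt \<kappa> F w) h = \<beta>} \<in> sets P"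
  unfolding like_event_eq using countable_structures tree_event_sets by (intro sets.countable_UN') auto

lemma like_prob_add: "like_prob True + like_prob False = 1"
proof -
  interpret P: prob_space P by (rule prob_space_P)
  have "like_prob False = measure P (space P - {w \<in> space P. looks_like r (rppt \<kappa> F w) h = True})"
    unfolding like_prob_def by (rule arg_cong[where f = "measure P"]) auto
  then show ?thesis
    using P.prob_compl[OF like_event_sets[of True]] by (simp add: like_prob_def)
qed

text \<open>The countably many structures exhaust the event in the tree; finite subfamilies are
  handled by \<open>wt_sums_le_liminf\<close>, and continuity from below gives the full
  probability.\<close>

theorem second_moment_liminf: "ennreal (like_prob \<beta> * like_prob \<beta>') \<le> liminf (second_moment \<beta> \<beta>')"
proof -
  interpret P: prob_space P by (rule prob_space_P)
  define e where "e = from_nat_into (structures K)"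
  have ne: "structures K \<noteq> {}" using ex_has_struct by blast
  have e: "range e = structures K" unfolding e_def by (rule range_from_nat_into[OF ne countable_structures])
  define A where "A \<beta> i = (\<Union>t\<in>e ` {..i}. tree_event \<beta> t)" for \<beta> and i :: nat
  have As: "A \<beta> i \<in> sets P" for \<beta> i
    unfolding A_def using tree_event_sets by (intro sets.finite_UN) auto
  have lim: "(\<lambda>i. measure P (A \<beta> i)) \<longlonglongrightarrow> like_prob \<beta>" for \<beta>
  proof -
    have "(\<Union>i. A \<beta> i) = (\<Union>t\<in>range e. tree_event \<beta> t)" by (auto simp: A_def)
    then have "(\<Union>i. A \<beta> i) = {w \<in> space P. looks_like r (rppt \<kappa> F w) h = \<beta>}" unfolding e like_event_eq .
    moreover have "(\<lambda>i. measure P (A \<beta> i)) \<longlonglongrightarrow> measure P (\<Union>i. A \<beta> i)"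
      using As by (intro P.finite_Lim_measure_incseq) (auto simp: A_def incseq_def intro: order_trans)
    ultimately show ?thesis by (simp add: like_prob_def)
  qed
  have le: "ennreal (measure P (A \<beta> i)) \<le> (\<Sum>t\<in>e ` {..i}. of_nat (card (pe K t)) * wt \<beta> t)" for \<beta> i
  proof -
    have "ennreal (measure P (A \<beta> i)) = emeasure P (A \<beta> i)" by (simp add: P.emeasure_eq_measure)
    also have "\<dots> \<le> (\<Sum>t\<in>e ` {..i}. emeasure P (tree_event \<beta> t))"
      unfolding A_def using tree_event_sets by (intro emeasure_subadditive_finite) auto
    also have "\<dots> \<le> (\<Sum>t\<in>e ` {..i}. of_nat (card (pe K t)) * wt \<beta> t)"
      by (intro sum_mono emeasure_tree_event_le)
    finally show ?thesis .
  qed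
  have "ennreal (measure P (A \<beta> i) * measure P (A \<beta>' i)) \<le> liminf (second_moment \<beta> \<beta>')" for i
  proof -
    have "ennreal (measure P (A \<beta> i) * measure P (A \<beta>' i)) = ennreal (measure P (A \<beta> i)) * ennreal (measure P (A \<beta>' i))"
      by (simp add: ennreal_mult')
    also have "\<dots> \<le> (\<Sum>t\<in>e ` {..i}. of_nat (card (pe K t)) * wt \<beta> t) * (\<Sum>t\<in>e ` {..i}. of_nat (card (pe K t)) * wt \<beta>' t)"
      by (intro mult_mono le) auto
    also have "\<dots> \<le> liminf (second_moment \<beta> \<beta>')"
      using e by (intro wt_sums_le_liminf) auto
    finally show ?thesis .
  qed
  moreover have "(\<lambda>i. ennreal (measure P (A \<beta> i) * measure P (A \<beta>' i))) \<longlonglongrightarrow> ennreal (like_prob \<beta> * like_prob \<beta>')"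
    by (intro tendsto_ennrealI tendsto_mult lim)
  ultimately show ?thesis
    by (intro LIMSEQ_le_const2) auto
qed

section \<open>From second moments to convergence in probability\<close>

lemma n_like_add: "n_like True n z + n_like False n z = n"
proof -
  let ?L = "\<lambda>v. looks_like r (marked_graph n (edges_of G0 (fst z) (Suc n) 0 (snd z)), v) h"
  have "n_like True n z + n_like False n z = card ({v\<in>{1..n}. ?L v = True} \<union> {v\<in>{1..n}. ?L v = False})"
    unfolding n_like_def by (intro card_Un_disjoint[symmetric]) auto
  also have "{v\<in>{1..n}. ?L v = True} \<union> {v\<in>{1..n}. ?L v = False} = {1..n}" by auto
  finally show ?thesis by simp
qed

definition frac :: "bool \<Rightarrow> nat \<Rightarrow> (nat \<Rightarrow> nat) \<times> (nat \<Rightarrow> nat \<Rightarrow> nat) \<Rightarrow> real" where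
  "frac \<beta> n z = real (n_like \<beta> n z) / real n"

lemma frac_bounds: "0 \<le> frac \<beta> n z" "frac \<beta> n z \<le> 1"
proof -
  have "n_like \<beta> n z \<le> n" using n_like_add[of n z] by (cases \<beta>) auto
  then show "0 \<le> frac \<beta> n z" "frac \<beta> n z \<le> 1" by (auto simp: frac_def divide_le_eq)
qed

lemma frac_False: "n > 0 \<Longrightarrow> frac False n z = 1 - frac True n z"
proof -
  assume n: "n > 0"
  have "real (n_like True n z) + real (n_like False n z) = real n"
    using n_like_add[of n z] by (metis of_nat_add)
  then show ?thesis using n by (simp add: frac_def field_simps)
qed

lemma frac_integrable: "integrable (joint n) (\<lambda>z. frac \<beta> n z * frac \<beta>' n z)" "integrable (joint n) (frac \<beta> n)"
  using frac_bounds by (auto intro!: measure_pmf.integrable_const_bound[of _ 1] AE_I2 mult_le_one simp: abs_mult)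

definition moment :: "bool \<Rightarrow> bool \<Rightarrow> nat \<Rightarrow> real" where
  "moment \<beta> \<beta>' n = measure_pmf.expectation (joint n) (\<lambda>z. frac \<beta> n z * frac \<beta>' n z)"

lemma second_moment_eq: "second_moment \<beta> \<beta>' n = ennreal (moment \<beta> \<beta>' n)"
proof -
  have "second_moment \<beta> \<beta>' n = (\<integral>\<^sup>+z. of_nat (n_like \<beta> n z) * of_nat (n_like \<beta>' n z) * ennreal (1 / real n ^ 2) \<partial>joint n)"
    unfolding second_moment_def by (simp add: nn_integral_multc)
  also have "\<dots> = (\<integral>\<^sup>+z. ennreal (frac \<beta> n z * frac \<beta>' n z) \<partial>joint n)"
    by (intro nn_integral_cong)
      (simp add: frac_def ennreal_of_nat_eq_real_of_nat power2_eq_square flip: ennreal_mult')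
  also have "\<dots> = ennreal (moment \<beta> \<beta>' n)"
    unfolding moment_def using frac_bounds by (intro nn_integral_eq_integral frac_integrable) auto
  finally show ?thesis .
qed

lemma eventually_moment_ge:
  assumes "\<epsilon> > 0"
  shows "eventually (\<lambda>n. moment \<beta> \<beta>' n > like_prob \<beta> * like_prob \<beta>' - \<epsilon>) sequentially"
proof (cases "like_prob \<beta> * like_prob \<beta>' - \<epsilon> < 0")
  case True
  have "moment \<beta> \<beta>' n \<ge> 0" for n
    unfolding moment_def using frac_bounds by (intro Bochner_Integration.integral_nonneg) auto
  then have "moment \<beta> \<beta>' n > like_prob \<beta> * like_prob \<beta>' - \<epsilon>" for n
    using True by (rule less_le_trans[rotated])
  then show ?thesis by (intro always_eventually allI)
next
  case False
  have "ennreal (like_prob \<beta> * like_prob \<beta>' - \<epsilon>) < ennreal (like_prob \<beta> * like_prob \<beta>')"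
    using False assms by (intro ennreal_lessI) auto
  also have "\<dots> \<le> liminf (second_moment \<beta> \<beta>')" by (rule second_moment_liminf)
  finally have "eventually (\<lambda>n. ennreal (like_prob \<beta> * like_prob \<beta>' - \<epsilon>) < second_moment \<beta> \<beta>' n) sequentially"
    by (rule less_LiminfD)
  then show ?thesis
    unfolding second_moment_eq by (rule eventually_mono) (use False in \<open>simp add: ennreal_less_iff\<close>)
qed

text \<open>The moments, with the mixed one taken twice, add up to \<open>1\<close>, as do the
  products that bound them from below. So the lower bounds also act as upper bounds, and the mean
  and the second moment of \<open>frac True\<close> are linear in these moments.\<close>

lemma variance_tendsto_0:
  "(\<lambda>n. measure_pmf.expectation (joint n) (\<lambda>z. (frac True n z - like_prob True)\<^sup>2)) \<longlonglongrightarrow> 0"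
proof (rule LIMSEQ_I)
  fix \<epsilon> :: real assume \<epsilon>: "\<epsilon> > 0"
  let ?p = "like_prob True"
  have p: "0 \<le> ?p" "?p \<le> 1" "like_prob False = 1 - ?p"
    using like_prob_add by (auto simp: like_prob_def) (smt (verit) measure_nonneg)
  \<comment> \<open>With \<open>e = \<epsilon>/7\<close>, the moment bounds give a mean above
    \<open>?p - 2 * e\<close> and a second moment below \<open>?p * ?p + 3 * e\<close>; the mean
    square deviation from \<open>?p\<close> is then below
    \<open>3 * e + 4 * ?p * e \<le> 7 * e\<close>.\<close>
  have \<epsilon>7: "\<epsilon>/7 > 0" using \<epsilon> by simp
  have "eventually (\<lambda>n. norm (measure_pmf.expectation (joint n) (\<lambda>z. (frac True n z - ?p)\<^sup>2) - 0) < \<epsilon>) sequentially"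
    using eventually_moment_ge[OF \<epsilon>7, of True True] eventually_moment_ge[OF \<epsilon>7, of True False]
      eventually_moment_ge[OF \<epsilon>7, of False False] eventually_gt_at_top[of 0]
  proof (eventually_elim)
    case (elim n)
    then have n: "n > 0" and a: "moment True True n > ?p * ?p - \<epsilon>/7" and b: "moment True False n > ?p * (1 - ?p) - \<epsilon>/7"
      and c: "moment False False n > (1 - ?p) * (1 - ?p) - \<epsilon>/7"
      using \<epsilon> p by auto
    let ?E = "measure_pmf.expectation (joint n)"
    define m where "m = ?E (frac True n)"
    have ff: "frac False n z = 1 - frac True n z" for z using frac_False n by simp
    have i: "integrable (joint n) (\<lambda>z. frac True n z * frac True n z)" "integrable (joint n) (frac True n)"
      by (rule frac_integrable)+
    have b': "moment True False n = m - moment True True n"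
    proof -
      have "moment True False n = ?E (\<lambda>z. frac True n z - frac True n z * frac True n z)"
        unfolding moment_def ff by (intro Bochner_Integration.integral_cong) (auto simp: algebra_simps)
      then show ?thesis unfolding m_def moment_def using i by simp
    qed
    have c': "moment False False n = 1 - 2 * m + moment True True n"
    proof -
      have "moment False False n = ?E (\<lambda>z. 1 - 2 * frac True n z + frac True n z * frac True n z)"
        unfolding moment_def ff by (intro Bochner_Integration.integral_cong) (auto simp: algebra_simps)
      then show ?thesis unfolding m_def moment_def using i by simp
    qed
    have v: "?E (\<lambda>z. (frac True n z - ?p)\<^sup>2) = moment True True n - 2 * ?p * m + ?p * ?p"
    proof -
      have "?E (\<lambda>z. (frac True n z - ?p)\<^sup>2) = ?E (\<lambda>z. frac True n z * frac True n z - 2 * ?p * frac True n z + ?p * ?p)"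
        by (intro Bochner_Integration.integral_cong) (auto simp: algebra_simps power2_eq_square)
      then show ?thesis unfolding m_def moment_def using i by simp
    qed
    have m1: "m > ?p - 2 * (\<epsilon>/7)" using a b b' by (simp add: algebra_simps)
    have "moment True True n < ?p * ?p + 3 * (\<epsilon>/7)" using b c b' c' by (simp add: algebra_simps)
    moreover have "?p * m \<ge> ?p * (?p - 2 * (\<epsilon>/7))" using m1 p by (intro mult_left_mono) auto
    moreover have "?p * (2 * (\<epsilon>/7)) \<le> 2 * (\<epsilon>/7)" using p \<epsilon> by (intro mult_left_le_one_le) auto
    ultimately have "?E (\<lambda>z. (frac True n z - ?p)\<^sup>2) < \<epsilon>"
      unfolding v by (simp add: algebra_simps)
    moreover have "?E (\<lambda>z. (frac True n z - ?p)\<^sup>2) \<ge> 0" by simp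
    ultimately show ?case by simp
  qed
  then show "\<exists>no. \<forall>n\<ge>no. norm (measure_pmf.expectation (joint n) (\<lambda>z. (frac True n z - ?p)\<^sup>2) - 0) < \<epsilon>"
    by (simp add: eventually_sequentially)
qed

text \<open>Chebyshev's inequality, centred at the limit instead of the mean.\<close>

lemma prob_deviation_tendsto_0:
  assumes \<epsilon>: "\<epsilon> > 0"
  shows "(\<lambda>n. measure_pmf.prob (joint n) {z. \<bar>frac True n z - like_prob True\<bar> > \<epsilon>}) \<longlonglongrightarrow> 0"
proof -
  let ?V = "\<lambda>n. measure_pmf.expectation (joint n) (\<lambda>z. (frac True n z - like_prob True)\<^sup>2)"
  show ?thesis
  proof (rule tendsto_sandwich[where f = "\<lambda>_. 0" and h = "\<lambda>n. ?V n / \<epsilon>\<^sup>2"])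
  show "(\<lambda>n. ?V n / \<epsilon>\<^sup>2) \<longlonglongrightarrow> 0"
    using tendsto_divide[OF variance_tendsto_0 tendsto_const[of "\<epsilon>\<^sup>2"]] \<epsilon> by simp
  show "eventually (\<lambda>n. measure_pmf.prob (joint n) {z. \<bar>frac True n z - like_prob True\<bar> > \<epsilon>} \<le> ?V n / \<epsilon>\<^sup>2) sequentially"
  proof (intro always_eventually allI)
    fix n
    have i: "integrable (joint n) (\<lambda>z. (frac True n z - like_prob True)\<^sup>2)"
    proof -
      have "(frac True n z - like_prob True)\<^sup>2 =
          frac True n z * frac True n z - 2 * like_prob True * frac True n z + like_prob True * like_prob True" for z
        by (simp add: power2_eq_square algebra_simps)
      then show ?thesis
        by (simp only:) (intro Bochner_Integration.integrable_add Bochner_Integration.integrable_diff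
          frac_integrable integrable_mult_right measure_pmf.integrable_const)
    qed
    have "measure_pmf.prob (joint n) {z. \<bar>frac True n z - like_prob True\<bar> > \<epsilon>} =
        measure_pmf.expectation (joint n) (indicator {z. \<bar>frac True n z - like_prob True\<bar> > \<epsilon>})"
      by simp
    also have "\<dots> \<le> measure_pmf.expectation (joint n) (\<lambda>z. (frac True n z - like_prob True)\<^sup>2 / \<epsilon>\<^sup>2)"
    proof (rule integral_mono)
      show "integrable (joint n) (indicator {z. \<bar>frac True n z - like_prob True\<bar> > \<epsilon>} :: _ \<Rightarrow> real)"
        by (intro measure_pmf.integrable_const_bound[of _ 1]) (auto simp: indicator_def)
      show "integrable (joint n) (\<lambda>z. (frac True n z - like_prob True)\<^sup>2 / \<epsilon>\<^sup>2)"
        using i by simp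
      fix z
      show "indicator {z. \<bar>frac True n z - like_prob True\<bar> > \<epsilon>} z \<le> (frac True n z - like_prob True)\<^sup>2 / \<epsilon>\<^sup>2"
      proof (cases "\<bar>frac True n z - like_prob True\<bar> > \<epsilon>")
        case True
        then have "\<epsilon>\<^sup>2 \<le> \<bar>frac True n z - like_prob True\<bar>\<^sup>2" using \<epsilon> by (intro power_mono) auto
        then show ?thesis using True \<epsilon> by (simp add: le_divide_eq)
      qed simp
    qed
    also have "\<dots> = ?V n / \<epsilon>\<^sup>2" by simp
    finally show "measure_pmf.prob (joint n) {z. \<bar>frac True n z - like_prob True\<bar> > \<epsilon>} \<le> ?V n / \<epsilon>\<^sup>2" .
  qed
  qed auto
qed

end

lemma pa_marked_graph_eq:
  assumes "n \<ge> 2"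
  shows "pa_marked_graph md M \<delta> G0 n = map_pmf (\<lambda>z. marked_graph n (edges_of G0 (fst z) (Suc n) 0 (snd z))) (joint n)"
proof -
  \<comment> \<open>\<open>joint\<close> is defined inside the locale of patterns; the trivial
    structure of depth \<open>0\<close> provides an instance of that locale.\<close>
  define t :: "(node \<Rightarrow> nat) \<times> (node \<Rightarrow> nat)" where "t = ((\<lambda>_. 0), (\<lambda>_. 0))"
  obtain J where J: "J \<in> pe 0 t" using parent_edges_nonempty by blast
  interpret S: struct_pat M \<delta> Q F md G0 0 "fst t" "snd t" J
    using J by (rule struct_patI)
  show ?thesis
    unfolding pa_marked_graph_def pa_law_def S.pat.joint_def
    by (simp add: map_bind_pmf pmf.map_comp comp_def flip: map_hist[OF assms])
qed

theorem marked_local_conv_prob_rppt: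
  "marked_local_conv_prob (pa_marked_graph md M \<delta> G0) P (rppt \<kappa> F)"
  unfolding marked_local_conv_prob_def
proof (intro allI impI)
  fix r \<epsilon> :: real and h :: "nat rooted"
  assume r: "r > 0" and "marked_rooted_graph h \<and> continuity_point P (rppt \<kappa> F) r h" and \<epsilon>: "\<epsilon> > 0"
  then have h: "snd h \<in> verts (fst h)" by (auto simp: marked_rooted_graph_def split_beta)
  show "(\<lambda>n. measure_pmf.prob (pa_marked_graph md M \<delta> G0 n)
           {G. \<epsilon> < \<bar>(\<Sum>v\<in>{1..n}. of_bool (looks_like r (G, v) h)) / real n
                 - measure P {w \<in> space P. looks_like r (rppt \<kappa> F w) h}\<bar>}) \<longlonglongrightarrow> 0"
  proof (rule Lim_transform_eventually[OF prob_deviation_tendsto_0[OF r h \<epsilon>]])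
    show "eventually (\<lambda>n. measure_pmf.prob (joint n) {z. \<epsilon> < \<bar>frac r h True n z - like_prob r h True\<bar>} =
       measure_pmf.prob (pa_marked_graph md M \<delta> G0 n)
           {G. \<epsilon> < \<bar>(\<Sum>v\<in>{1..n}. of_bool (looks_like r (G, v) h)) / real n
                 - measure P {w \<in> space P. looks_like r (rppt \<kappa> F w) h}\<bar>}) sequentially"
      using eventually_ge_at_top[of 2]
    proof eventually_elim
      case (elim n)
      have "(\<Sum>v\<in>{1..n}. of_bool (looks_like r (marked_graph n (edges_of G0 (fst z) (Suc n) 0 (snd z)), v) h)) = real (n_like r h True n z)" for z
        unfolding n_like_def[OF r h] by (simp add: sum_of_bool_eq Int_def)
      then show ?case
        unfolding pa_marked_graph_eq[OF elim] frac_def[OF r h] like_prob_def[OF r h]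
        by (simp add: vimage_def)
    qed
  qed
qed

end

theorem mainTheorem1:
  fixes M :: "nat pmf" and \<delta> p :: real and md :: pa_model and G0 :: edges
    and Q :: "'v measure" and F :: "'v \<Rightarrow> real \<Rightarrow> real \<Rightarrow> real set"
  assumes "\<forall>k\<in>set_pmf M. k \<ge> 1"
    and "p > 1" and "integrable (measure_pmf M) (\<lambda>k. real k powr p)"
    and "\<delta> > - real (Inf (set_pmf M))"
    and "set_mset G0 \<subseteq> {1, 2} \<times> {1, 2}"
    and "real (deg G0 1) + \<delta> > 0" and "real (deg G0 2) + \<delta> > 0"
    and "younger_family (chi M \<delta>) Q F"
  shows "marked_local_conv_prob (pa_marked_graph md M \<delta> G0)
           (rppt_space M \<delta> Q) (rppt (chi M \<delta>) F)"
proof -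
  \<comment> \<open>As \<open>M\<close> takes values of at least \<open>1\<close> and
    \<open>p > 1\<close>, the moment of order \<open>p\<close> dominates the first moment.\<close>
  have "integrable (measure_pmf M) real"
  proof (rule Bochner_Integration.integrable_bound[OF assms(3)])
    show "AE k in measure_pmf M. norm (real k) \<le> norm (real k powr p)"
    proof (unfold AE_measure_pmf_iff, intro ballI)
      fix k assume "k \<in> set_pmf M"
      then have "k \<ge> 1" using assms(1) by blast
      then have "real k powr 1 \<le> real k powr p" using assms(2) by (intro powr_mono) auto
      then show "norm (real k) \<le> norm (real k powr p)" using \<open>k \<ge> 1\<close> by simp
    qed
  qed simp
  then interpret pa_rppt M \<delta> Q F md G0
    using assms by unfold_locales auto
  show ?thesis by (rule marked_local_conv_prob_rppt)
qed

end
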